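(* Let $A$ be a simple unital C*-algebra which has a quasitrace. Then $A$ has strict comparison (defined using quasitraces) if and only if $A$ has weak strict comparison.
   Context: For positive elements $a,b$ of a C*-algebra $A$, $a \precsim b$ (Cuntz subequivalence) means there is a sequence $(v_n)$ in $A$ with $\|a - v_n b v_n^*\| \to 0$; $a\sim b$ means $a\precsim b$ and $b\precsim a$. Let $M_\infty(A)=\bigcup_n M_n(A)$ (upper left corner embeddings); $\precsim$ on $M_\infty(A)_+$ is computed in $M_n(A)$ for $n$ large enough. $W(A)=M_\infty(A)_+/\sim$ with $\langle a\rangle+\langle b\rangle=\langle a\oplus b\rangle$ and $\langle a\rangle\le\langle b\rangle$ iff $a\precsim b$. Quasitraces are normalized $2$-quasitraces (in the sense of Blackadar-Handelman/Haagerup); the set of them is $\mathrm{QT}(A)$. For $\tau\in\mathrm{QT}(A)$, extended to $M_\infty(A)$, and $a\in M_\infty(A)_+$, $d_\tau(a)=\lim_{n\to\infty}\tau(a^{1/n})$. $A$ has strict comparison if whenever $a,b\in M_\infty(A)_+$ satisfy $d_\tau(a)<d_\tau(b)$ for all $\tau\in\mathrm{QT}(A)$, then $a\precsim b$. A dimension function on $A$ is an additive order preserving function $d\colon W(A)\to[0,\infty]$; write $d(a)=d(\langle a\rangle)$. $A$ has weak strict comparison if whenever $a,b\in M_\infty(A)_+$ are such that $a$ is in the closed two-sided ideal generated by $b$ and $d(a)<d(b)$ for every dimension function $d$ on $A$ with $d(b)=1$, then $a\precsim b$. *)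

theory Defs
  imports "HOL-Analysis.Analysis"
begin

section \<open>Unital C*-algebras\<close>

class scaleC =
  fixes scaleC :: "complex \<Rightarrow> 'a \<Rightarrow> 'a"  (infixr "*\<^sub>C" 75)

class adjoint =
  fixes adj :: "'a \<Rightarrow> 'a"

class complex_star_algebra = ring + scaleC + adjoint +
  assumes scaleC_add_right: "c *\<^sub>C (x + y) = c *\<^sub>C x + c *\<^sub>C y"
    and scaleC_add_left: "(c + d) *\<^sub>C x = c *\<^sub>C x + d *\<^sub>C x"
    and scaleC_scaleC: "c *\<^sub>C d *\<^sub>C x = (c * d) *\<^sub>C x"
    and scaleC_one: "1 *\<^sub>C x = x"
    and mult_scaleC_left: "(c *\<^sub>C x) * y = c *\<^sub>C (x * y)"
    and mult_scaleC_right: "x * (c *\<^sub>C y) = c *\<^sub>C (x * y)"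
    and adj_add: "adj (x + y) = adj x + adj y"
    and adj_scaleC: "adj (c *\<^sub>C x) = cnj c *\<^sub>C adj x"
    and adj_mult: "adj (x * y) = adj y * adj x"
    and adj_adj: "adj (adj x) = x"

class unital_cstar_algebra = complex_star_algebra + real_normed_algebra_1 + banach +
  assumes scaleR_scaleC: "r *\<^sub>R x = complex_of_real r *\<^sub>C x"
    and norm_scaleC: "norm (c *\<^sub>C x) = cmod c * norm x"
    and cstar_identity: "norm (adj x * x) = (norm x)\<^sup>2"

lemma scaleC_zero_right: "c *\<^sub>C (0 :: 'a :: complex_star_algebra) = 0"
  by (metis add_cancel_right_right scaleC_add_right)

lemma adj_zero: "adj (0 :: 'a :: complex_star_algebra) = 0"
  by (metis add_cancel_right_right adj_add)

lemma scaleC_sum: "c *\<^sub>C sum f K = (\<Sum>k\<in>K. c *\<^sub>C f k :: 'a :: complex_star_algebra)"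
  by (induction K rule: infinite_finite_induct) (simp_all add: scaleC_zero_right scaleC_add_right)

lemma adj_sum: "adj (sum f K) = (\<Sum>k\<in>K. adj (f k) :: 'a :: complex_star_algebra)"
  by (induction K rule: infinite_finite_induct) (simp_all add: adj_zero adj_add)

section \<open>The algebra of finitely supported infinite matrices\<close>

text \<open>The union of all \<open>M\<^sub>n(A)\<close> along the upper left corner embeddings; \<open>Mat n\<close> is the copy of
  \<open>M\<^sub>n(A)\<close> inside it. Indices start at 0.\<close>

typedef (overloaded) 'a minf =
  "{f :: nat \<Rightarrow> nat \<Rightarrow> 'a :: zero. \<exists>n. \<forall>i j. n \<le> i \<or> n \<le> j \<longrightarrow> f i j = 0}"
  morphisms entry Abs_minf
  by (rule exI[of _ "\<lambda>_ _. 0"]) simp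

setup_lifting type_definition_minf

definition Mat :: "nat \<Rightarrow> 'a :: zero minf set" where
  "Mat n = {a. \<forall>i j. n \<le> i \<or> n \<le> j \<longrightarrow> entry a i j = 0}"

lemma minf_eqI: "(\<And>i j. entry a i j = entry b i j) \<Longrightarrow> a = b"
  by (metis entry_inject ext)

lemma ex_Mat: "\<exists>n. a \<in> Mat n"
  using entry[of a] by (auto simp: Mat_def)

lemma Mat_mono: "m \<le> n \<Longrightarrow> Mat m \<subseteq> Mat n"
  by (auto simp: Mat_def)

lift_definition corner :: "'a :: zero \<Rightarrow> 'a minf" is
  "\<lambda>x i j. if i = 0 \<and> j = 0 then x else 0"
  by (rule exI[of _ 1]) auto

text \<open>\<open>dsum m a b\<close> is the block diagonal matrix \<open>a \<oplus> b\<close> with \<open>a\<close> regarded as an element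
  of \<open>M\<^sub>m(A)\<close>.\<close>

lift_definition dsum :: "nat \<Rightarrow> 'a :: zero minf \<Rightarrow> 'a minf \<Rightarrow> 'a minf" is
  "\<lambda>m a b i j. if i < m \<and> j < m then a i j
     else if m \<le> i \<and> m \<le> j then b (i - m) (j - m) else 0"
proof -
  fix m :: nat and a b :: "nat \<Rightarrow> nat \<Rightarrow> 'a"
  assume "\<exists>n. \<forall>i j. n \<le> i \<or> n \<le> j \<longrightarrow> b i j = 0"
  then obtain n where "\<forall>i j. n \<le> i \<or> n \<le> j \<longrightarrow> b i j = 0" by blast
  then show "\<exists>n. \<forall>i j. n \<le> i \<or> n \<le> j \<longrightarrow> (if i < m \<and> j < m then a i j
     else if m \<le> i \<and> m \<le> j then b (i - m) (j - m) else 0) = 0"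
    by (intro exI[of _ "m + n"]) auto
qed

instantiation minf :: (complex_star_algebra) complex_star_algebra
begin

lift_definition zero_minf :: "'a minf" is "\<lambda>_ _. 0" by simp

lift_definition plus_minf :: "'a minf \<Rightarrow> 'a minf \<Rightarrow> 'a minf" is "\<lambda>a b i j. a i j + b i j"
  by (metis add.right_neutral nat_le_linear order_trans)

lift_definition minus_minf :: "'a minf \<Rightarrow> 'a minf \<Rightarrow> 'a minf" is "\<lambda>a b i j. a i j - b i j"
  by (metis diff_zero nat_le_linear order_trans)

lift_definition uminus_minf :: "'a minf \<Rightarrow> 'a minf" is "\<lambda>a i j. - a i j"
  by fastforce

lift_definition times_minf :: "'a minf \<Rightarrow> 'a minf \<Rightarrow> 'a minf" is
  "\<lambda>a b i j. \<Sum>k | a i k \<noteq> 0. a i k * b k j"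
proof -
  fix a b :: "nat \<Rightarrow> nat \<Rightarrow> 'a"
  assume "\<exists>n. \<forall>i j. n \<le> i \<or> n \<le> j \<longrightarrow> a i j = 0"
    and "\<exists>n. \<forall>i j. n \<le> i \<or> n \<le> j \<longrightarrow> b i j = 0"
  then obtain m n where "\<forall>i j. m \<le> i \<or> m \<le> j \<longrightarrow> a i j = 0"
    and "\<forall>i j. n \<le> i \<or> n \<le> j \<longrightarrow> b i j = 0" by blast
  then show "\<exists>n. \<forall>i j. n \<le> i \<or> n \<le> j \<longrightarrow> (\<Sum>k | a i k \<noteq> 0. a i k * b k j) = 0"
    by (intro exI[of _ "max m n"]) (auto intro!: sum.neutral)
qed

lift_definition scaleC_minf :: "complex \<Rightarrow> 'a minf \<Rightarrow> 'a minf" is "\<lambda>c a i j. c *\<^sub>C a i j"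
  by (metis scaleC_zero_right)

lift_definition adj_minf :: "'a minf \<Rightarrow> 'a minf" is "\<lambda>a i j. adj (a j i)"
  by (metis adj_zero)

lemma entry_times:
  assumes "a \<in> Mat n"
  shows "entry (a * b) i j = (\<Sum>k<n. entry a i k * entry b k j)"
proof -
  have "{k. entry a i k \<noteq> 0} \<subseteq> {..<n}"
    using assms unfolding Mat_def by (auto simp: not_le[symmetric])
  then show ?thesis
    unfolding times_minf.rep_eq by (intro sum.mono_neutral_left) auto
qed

instance
proof
  fix a b c :: "'a minf" and z w :: complex
  obtain l m n where lmn: "a \<in> Mat l" "b \<in> Mat m" "c \<in> Mat n"
    using ex_Mat by metis
  define N where "N = max l (max m n)"
  have "l \<le> N" "m \<le> N" "n \<le> N"
    by (auto simp: N_def)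
  then have N: "a \<in> Mat N" "b \<in> Mat N" "c \<in> Mat N"
    using lmn Mat_mono by blast+
  have N': "a * b \<in> Mat N" "a + b \<in> Mat N" "z *\<^sub>C a \<in> Mat N" "adj b \<in> Mat N"
    using N by (simp_all add: Mat_def entry_times[OF N(1)] plus_minf.rep_eq scaleC_minf.rep_eq
      adj_minf.rep_eq scaleC_zero_right adj_zero)
  show "a + b + c = a + (b + c)" "a + b = b + a" "0 + a = a" "- a + a = 0" "a - b = a + - b"
    by (transfer; simp add: add_ac)+
  show "a * b * c = a * (b * c)"
  proof (rule minf_eqI)
    fix i j
    have "entry (a * b * c) i j =
        (\<Sum>k<N. \<Sum>l<N. entry a i l * entry b l k * entry c k j)"
      by (simp add: entry_times[OF N'(1)] entry_times[OF N(1)] sum_distrib_right)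
    also have "\<dots> = (\<Sum>l<N. \<Sum>k<N. entry a i l * entry b l k * entry c k j)"
      by (rule sum.swap)
    also have "\<dots> = entry (a * (b * c)) i j"
      by (simp add: entry_times[OF N(1)] entry_times[OF N(2)] sum_distrib_left mult.assoc)
    finally show "entry (a * b * c) i j = entry (a * (b * c)) i j" .
  qed
  show "(a + b) * c = a * c + b * c"
    by (rule minf_eqI) (simp add: entry_times[OF N'(2)] entry_times[OF N(1)] entry_times[OF N(2)]
      plus_minf.rep_eq distrib_right sum.distrib)
  show "a * (b + c) = a * b + a * c"
    by (rule minf_eqI) (simp add: entry_times[OF N(1)] plus_minf.rep_eq distrib_left sum.distrib)
  show "z *\<^sub>C (a + b) = z *\<^sub>C a + z *\<^sub>C b" "(z + w) *\<^sub>C a = z *\<^sub>C a + w *\<^sub>C a"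
    "z *\<^sub>C w *\<^sub>C a = (z * w) *\<^sub>C a" "1 *\<^sub>C a = a"
    by (transfer; simp add: scaleC_add_right scaleC_add_left scaleC_scaleC scaleC_one)+
  show "z *\<^sub>C a * b = z *\<^sub>C (a * b)" "a * z *\<^sub>C b = z *\<^sub>C (a * b)"
    by (rule minf_eqI; simp add: entry_times[OF N'(3)] entry_times[OF N(1)] scaleC_minf.rep_eq
      scaleC_sum mult_scaleC_left mult_scaleC_right)+
  show "adj (a + b) = adj a + adj b" "adj (z *\<^sub>C a) = cnj z *\<^sub>C adj a" "adj (adj a) = a"
    by (transfer; simp add: adj_add adj_scaleC adj_adj)+
  show "adj (a * b) = adj b * adj a"
    by (rule minf_eqI) (simp add: entry_times[OF N'(4)] entry_times[OF N(1)] adj_minf.rep_eq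
      adj_sum adj_mult)
qed

end

text \<open>The C*-norm on \<open>M\<^sub>n(A)\<close>, realised as the operator norm of \<open>M\<^sub>n(A)\<close> acting on the Hilbert
  C*-module \<open>A\<^sup>n\<close>, whose inner product is \<open>\<langle>x, y\<rangle> = \<Sum>i. adj (x i) * y i\<close>. The set over which
  the supremum is taken does not depend on the choice of \<open>n\<close> with \<open>a \<in> Mat n\<close>.\<close>

definition col_norm :: "nat \<Rightarrow> (nat \<Rightarrow> 'a :: unital_cstar_algebra) \<Rightarrow> real" where
  "col_norm n x = sqrt (norm (\<Sum>i<n. adj (x i) * x i))"

definition mat_norm :: "'a :: unital_cstar_algebra minf \<Rightarrow> real" where
  "mat_norm a = Sup {col_norm n (\<lambda>i. \<Sum>j<n. entry a i j * x j) | n x.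
     a \<in> Mat n \<and> col_norm n x \<le> 1}"

section \<open>Subalgebras, ideals and quasitraces\<close>

text \<open>The following notions are relative to a C*-algebra given as a subset \<open>S\<close> of an ambient
  *-algebra, with norm \<open>N\<close>. They are used for \<open>UNIV :: 'a set\<close> with \<open>norm\<close> and for \<open>Mat n\<close>
  with \<open>mat_norm\<close>.\<close>

definition norm_closed_in :: "'b :: complex_star_algebra set \<Rightarrow> ('b \<Rightarrow> real) \<Rightarrow> 'b set \<Rightarrow> bool" where
  "norm_closed_in S N B \<longleftrightarrow>
     (\<forall>x l. (\<forall>k::nat. x k \<in> B) \<and> l \<in> S \<and> (\<lambda>k. N (x k - l)) \<longlonglongrightarrow> 0 \<longrightarrow> l \<in> B)"

definition cstar_subalgebra :: "'b :: complex_star_algebra set \<Rightarrow> ('b \<Rightarrow> real) \<Rightarrow> 'b set \<Rightarrow> bool" where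
  "cstar_subalgebra S N B \<longleftrightarrow> B \<subseteq> S \<and> 0 \<in> B \<and>
     (\<forall>x\<in>B. \<forall>y\<in>B. x + y \<in> B \<and> x * y \<in> B) \<and> (\<forall>c. \<forall>x\<in>B. c *\<^sub>C x \<in> B) \<and>
     (\<forall>x\<in>B. adj x \<in> B) \<and> norm_closed_in S N B"

definition closed_ideal :: "'b :: complex_star_algebra set \<Rightarrow> ('b \<Rightarrow> real) \<Rightarrow> 'b set \<Rightarrow> bool" where
  "closed_ideal S N I \<longleftrightarrow> I \<subseteq> S \<and> 0 \<in> I \<and>
     (\<forall>x\<in>I. \<forall>y\<in>I. x + y \<in> I) \<and> (\<forall>c. \<forall>x\<in>I. c *\<^sub>C x \<in> I) \<and>
     (\<forall>s\<in>S. \<forall>x\<in>I. s * x \<in> I \<and> x * s \<in> I) \<and> norm_closed_in S N I"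

definition closed_ideal_generated :: "'b :: complex_star_algebra set \<Rightarrow> ('b \<Rightarrow> real) \<Rightarrow> 'b \<Rightarrow> 'b set" where
  "closed_ideal_generated S N b = \<Inter> {I. closed_ideal S N I \<and> b \<in> I}"

definition simple_cstar :: "'a :: unital_cstar_algebra itself \<Rightarrow> bool" where
  "simple_cstar _ \<longleftrightarrow> (\<forall>I :: 'a set. closed_ideal UNIV norm I \<longrightarrow> I = {0} \<or> I = UNIV)"

definition quasitrace_on ::
    "'b :: complex_star_algebra set \<Rightarrow> ('b \<Rightarrow> real) \<Rightarrow> ('b \<Rightarrow> complex) \<Rightarrow> bool" where
  "quasitrace_on S N \<tau> \<longleftrightarrow>
     (\<forall>x\<in>S. \<tau> (adj x * x) = \<tau> (x * adj x) \<and> \<tau> (adj x * x) \<in> \<real>\<^sub>\<ge>\<^sub>0) \<and>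
     (\<forall>a\<in>S. \<forall>b\<in>S. adj a = a \<and> adj b = b \<longrightarrow> \<tau> (a + \<i> *\<^sub>C b) = \<tau> a + \<i> * \<tau> b) \<and>
     (\<forall>B. cstar_subalgebra S N B \<and> (\<forall>x\<in>B. \<forall>y\<in>B. x * y = y * x) \<longrightarrow>
        (\<forall>c. \<forall>x\<in>B. \<forall>y\<in>B. \<tau> (c *\<^sub>C x + y) = c * \<tau> x + \<tau> y))"

text \<open>Normalized 2-quasitraces.\<close>

definition QT :: "('a :: unital_cstar_algebra \<Rightarrow> complex) set" where
  "QT = {\<tau>. quasitrace_on UNIV norm \<tau> \<and>
     (\<exists>\<tau>\<^sub>2 :: 'a minf \<Rightarrow> complex. quasitrace_on (Mat 2) mat_norm \<tau>\<^sub>2 \<and> (\<forall>x. \<tau>\<^sub>2 (corner x) = \<tau> x)) \<and>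
     \<tau> 1 = 1}"

text \<open>A 2-quasitrace extends uniquely to a quasitrace on all matrix algebras
  (Blackadar--Handelman).\<close>

definition qt_extension ::
    "('a :: unital_cstar_algebra \<Rightarrow> complex) \<Rightarrow> 'a minf \<Rightarrow> complex" where
  "qt_extension \<tau> = (THE T. (\<forall>n. quasitrace_on (Mat n) mat_norm T) \<and> (\<forall>x. T (corner x) = \<tau> x))"

section \<open>Positive elements and the Cuntz semigroup\<close>

definition minf_pos :: "'a :: unital_cstar_algebra minf set" where
  "minf_pos = {adj x * x | x. True}"

text \<open>Powers without reference to a unit, which \<open>M\<^sub>\<infinity>(A)\<close> lacks: \<open>pow_Suc a n\<close> is the
  \<open>(n + 1)\<close>-st power of \<open>a\<close>.\<close>

primrec pow_Suc :: "'b :: times \<Rightarrow> nat \<Rightarrow> 'b" where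
  "pow_Suc a 0 = a"
| "pow_Suc a (Suc n) = pow_Suc a n * a"

text \<open>\<open>root_Suc n a\<close> is \<open>a\<^sup>1\<^sup>/\<^sup>(\<^sup>n\<^sup>+\<^sup>1\<^sup>)\<close>, the unique positive \<open>(n + 1)\<close>-st root of the
  positive element \<open>a\<close>.\<close>

definition root_Suc :: "nat \<Rightarrow> 'a :: unital_cstar_algebra minf \<Rightarrow> 'a minf" where
  "root_Suc n a = (THE b. b \<in> minf_pos \<and> pow_Suc b n = a)"

definition d_tau :: "('a :: unital_cstar_algebra \<Rightarrow> complex) \<Rightarrow> 'a minf \<Rightarrow> real" where
  "d_tau \<tau> a = lim (\<lambda>n. Re (qt_extension \<tau> (root_Suc n a)))"

definition cuntz_le :: "'a :: unital_cstar_algebra minf \<Rightarrow> 'a minf \<Rightarrow> bool"  (infix "\<lesssim>" 50) where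
  "a \<lesssim> b \<longleftrightarrow> (\<exists>n. a \<in> Mat n \<and> b \<in> Mat n \<and>
     (\<exists>v :: nat \<Rightarrow> 'a minf. (\<forall>k. v k \<in> Mat n) \<and>
        (\<lambda>k. mat_norm (a - v k * b * adj (v k))) \<longlonglongrightarrow> 0))"

definition cuntz_rel :: "('a :: unital_cstar_algebra minf \<times> 'a minf) set" where
  "cuntz_rel = {(a, b). a \<in> minf_pos \<and> b \<in> minf_pos \<and> a \<lesssim> b \<and> b \<lesssim> a}"

definition cuntz_class :: "'a :: unital_cstar_algebra minf \<Rightarrow> 'a minf set" where
  "cuntz_class a = cuntz_rel `` {a}"

definition cuntz_W :: "'a :: unital_cstar_algebra minf set set" where
  "cuntz_W = minf_pos // cuntz_rel"

text \<open>Addition and order of \<open>W(A)\<close>, defined through arbitrary representatives; the union is over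
  a family with only one member.\<close>

definition W_add :: "'a :: unital_cstar_algebra minf set \<Rightarrow> 'a minf set \<Rightarrow> 'a minf set" where
  "W_add X Y = \<Union> {cuntz_class (dsum m a b) | m a b. a \<in> X \<and> b \<in> Y \<and> a \<in> Mat m}"

definition W_le :: "'a :: unital_cstar_algebra minf set \<Rightarrow> 'a minf set \<Rightarrow> bool" where
  "W_le X Y \<longleftrightarrow> (\<exists>a\<in>X. \<exists>b\<in>Y. a \<lesssim> b)"

definition dimension_function :: "('a :: unital_cstar_algebra minf set \<Rightarrow> ennreal) \<Rightarrow> bool" where
  "dimension_function d \<longleftrightarrow>
     (\<forall>X\<in>cuntz_W. \<forall>Y\<in>cuntz_W. d (W_add X Y) = d X + d Y) \<and>
     (\<forall>X\<in>cuntz_W. \<forall>Y\<in>cuntz_W. W_le X Y \<longrightarrow> d X \<le> d Y)"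

section \<open>Comparison properties\<close>

definition strict_comparison :: "'a :: unital_cstar_algebra itself \<Rightarrow> bool" where
  "strict_comparison _ \<longleftrightarrow>
     (\<forall>a\<in>minf_pos. \<forall>b\<in>minf_pos. (\<forall>\<tau> \<in> (QT :: ('a \<Rightarrow> complex) set). d_tau \<tau> a < d_tau \<tau> b) \<longrightarrow> a \<lesssim> b)"

definition weak_strict_comparison :: "'a :: unital_cstar_algebra itself \<Rightarrow> bool" where
  "weak_strict_comparison _ \<longleftrightarrow>
     (\<forall>a\<in>minf_pos. \<forall>b\<in>(minf_pos :: 'a minf set).
        (\<exists>n. a \<in> Mat n \<and> b \<in> Mat n \<and> a \<in> closed_ideal_generated (Mat n) mat_norm b) \<and>
        (\<forall>d. dimension_function d \<and> d (cuntz_class b) = 1 \<longrightarrow>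
           d (cuntz_class a) < d (cuntz_class b)) \<longrightarrow> a \<lesssim> b)"

end

theory Submission
  imports Defs
begin

text \<open>A finite dimension function \<open>D\<close> is turned into a quasitrace by integrating over the spectrum,
  \<open>a \<mapsto> \<integral> D((a - t)\<^sub>+) dt\<close>; its own dimension function is the lower semicontinuous regularisation of
  \<open>D\<close>. Conversely, \<open>d\<^sub>\<tau>\<close> of a 2-quasitrace \<open>\<tau>\<close> is a lower semicontinuous dimension function on the
  corner \<open>A\<close>. It extends to all matrices through a rank function, the infimum of \<open>\<Sum> d\<^sub>\<tau>(w\<^sup>* w)\<close> over all
  decompositions \<open>x = \<Sum> w v\<close> into columns times rows, and no other extension exists, so that
  \<open>\<tau>\<close> has exactly one extension to all \<open>M\<^sub>n(A)\<close>.

  If \<open>A\<close> is simple, a dimension function with \<open>d(b) = 1\<close> is finite, and does not vanish at the unit.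
  Strict comparison implies the weak one because \<open>d\<^sub>\<tau> / d\<^sub>\<tau>(b)\<close> is a dimension function with value 1 at
  \<open>b\<close>. For the converse, let \<open>d\<^sub>\<tau>(a) < d\<^sub>\<tau>(b)\<close> for all \<open>\<tau>\<close>, and \<open>d(b) = 1\<close>. The regularisation of \<open>d\<close> is a
  multiple of some \<open>d\<^sub>\<tau>\<close>, hence \<open>d((a - \<epsilon>)\<^sub>+) < d(b)\<close> for every \<open>\<epsilon> > 0\<close>, and weak
  comparison yields \<open>(a - \<epsilon>)\<^sub>+ \<lesssim> b\<close>.\<close>

section \<open>C*-norms and positivity in complete unital *-subalgebras\<close>

text \<open>The shape of the proof is dictated by \<open>qt_extension\<close> being a definite
  description: it says nothing until a 2-quasitrace is known to have exactly one extension to all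
  matrices. Linearity of an extended quasitrace on commuting elements is hard to reach directly,
  whereas a dimension function has no linearity to preserve. So the dimension function is extended,
  and linearity is regained by integrating it; uniqueness is transferred in the same way, as a
  quasitrace can be recovered from its dimension function.

  Two obstacles remain. A rank defined as an infimum has easy upper bounds, but its superadditivity
  on orthogonal sums is a rank inequality for block triangular matrices. And integration sees D only
  up to small cuts: D((a - \<epsilon>)_+) \<le> d_\<tau>(a) \<le> D(a). This is enough, because a
  \<lesssim> b may be tested on the cuts of a, while b is never cut. The size 2 in the definition of
  quasitraces pays for subadditivity on the corner, where a + b has to be compared with a direct
  sum.\<close>

text \<open>\<open>M\<^sub>\<infinity>(A)\<close> is neither complete nor unital, but each of its elements lies in some complete
  *-subalgebra with a unit. The functional calculus is built in that generality.\<close>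

class cstar_normed_algebra = complex_star_algebra + real_normed_algebra +
  assumes scaleR_eq_scaleC: "r *\<^sub>R x = complex_of_real r *\<^sub>C x"
    and norm_scaleC_eq: "norm (c *\<^sub>C x) = cmod c * norm x"
    and norm_adj_times: "norm (adj x * x) = (norm x)\<^sup>2"

instance unital_cstar_algebra \<subseteq> cstar_normed_algebra
  by intro_classes (rule scaleR_scaleC norm_scaleC cstar_identity)+

lemma adj_uminus: "adj (- x) = - adj (x :: 'a :: complex_star_algebra)"
  by (metis add.right_inverse add_eq_0_iff adj_add adj_zero)

lemma adj_diff: "adj (x - y) = adj x - adj (y :: 'a :: complex_star_algebra)"
  by (simp add: diff_conv_add_uminus adj_add adj_uminus del: add_uminus_conv_diff)

lemma adj_scaleR: "adj (r *\<^sub>R x) = r *\<^sub>R adj (x :: 'a :: cstar_normed_algebra)"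
  by (simp add: scaleR_eq_scaleC adj_scaleC)

lemmas adj_simps = adj_add adj_diff adj_uminus adj_zero adj_scaleR adj_scaleC adj_mult adj_adj

lemma norm_adj: "norm (adj x) = norm (x :: 'a :: cstar_normed_algebra)"
proof -
  have *: "norm x \<le> norm (adj x)" for x :: 'a
  proof (cases "norm x = 0")
    case False
    have "norm x * norm x \<le> norm (adj x) * norm x"
      using norm_adj_times[of x] norm_mult_ineq[of "adj x" x] by (simp add: power2_eq_square)
    then show ?thesis using False by simp
  qed simp
  from *[of x] *[of "adj x"] show ?thesis by (simp add: adj_adj)
qed

lemma bounded_linear_adj: "bounded_linear (adj :: 'a :: cstar_normed_algebra \<Rightarrow> 'a)"
  by (rule bounded_linear_intro[where K = 1]) (simp_all add: adj_simps norm_adj)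

lemmas tendsto_adj = bounded_linear.tendsto[OF bounded_linear_adj]

lemma scaleC_uminus_left: "(- c) *\<^sub>C x = - (c *\<^sub>C (x :: 'a :: cstar_normed_algebra))"
proof -
  have "(- c) *\<^sub>C x = (complex_of_real (- 1) * c) *\<^sub>C x" by simp
  also have "\<dots> = - (c *\<^sub>C x)" by (simp only: scaleC_scaleC[symmetric] scaleR_eq_scaleC[symmetric]) simp
  finally show ?thesis .
qed

lemma scaleC_uminus_right: "c *\<^sub>C (- x) = - (c *\<^sub>C (x :: 'a :: cstar_normed_algebra))"
  by (metis add.right_inverse add_eq_0_iff scaleC_add_right scaleC_zero_right)

lemma scaleC_diff_right: "c *\<^sub>C (x - y) = c *\<^sub>C x - c *\<^sub>C (y :: 'a :: cstar_normed_algebra)"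
  by (simp add: diff_conv_add_uminus scaleC_add_right scaleC_uminus_right del: add_uminus_conv_diff)

lemma adj_add_ii:
  fixes x y :: "'a :: cstar_normed_algebra"
  assumes "adj x = x" "adj y = y"
  shows "adj (x + \<i> *\<^sub>C y) = x - \<i> *\<^sub>C y"
  using assms by (simp add: adj_simps scaleC_uminus_left)

lemma adj_add_ii_mult:
  fixes x y :: "'a :: cstar_normed_algebra"
  assumes "adj x = x" "adj y = y" "y * x = x * y"
  shows "adj (x + \<i> *\<^sub>C y) * (x + \<i> *\<^sub>C y) = x * x + y * y"
  unfolding adj_add_ii[OF assms(1,2)] using assms(3)
  by (simp add: algebra_simps mult_scaleC_left mult_scaleC_right scaleC_scaleC scaleC_uminus_left scaleC_one
      scaleC_diff_right)

lemma norm_selfadj_square: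
  "adj x = x \<Longrightarrow> norm (x * x) = (norm (x :: 'a :: cstar_normed_algebra))\<^sup>2"
  by (metis norm_adj_times)

section \<open>Square roots by a dominated iteration\<close>

primrec sqrt_iter :: "'a :: real_normed_algebra \<Rightarrow> nat \<Rightarrow> 'a" where
  "sqrt_iter x 0 = 0"
| "sqrt_iter x (Suc n) = (1/2) *\<^sub>R (x + sqrt_iter x n * sqrt_iter x n)"

lemma sqrt_iter_commute: "x * z = z * x \<Longrightarrow> sqrt_iter x n * z = z * sqrt_iter x n"
proof (induction n)
  case (Suc n)
  have "sqrt_iter x n * (sqrt_iter x n * z) = z * sqrt_iter x n * sqrt_iter x n"
    using Suc by (metis mult.assoc)
  then show ?case using Suc by (simp add: algebra_simps)
qed simp

lemma sqrt_iter_real: "sqrt_iter (1 :: real) n \<le> sqrt_iter 1 (Suc n)" "0 \<le> sqrt_iter (1 :: real) n"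
    "sqrt_iter (1 :: real) n \<le> 1"
proof (induction n)
  case (Suc n)
  case 1
  have "sqrt_iter (1 :: real) n * sqrt_iter 1 n \<le> sqrt_iter 1 (Suc n) * sqrt_iter 1 (Suc n)"
    by (intro mult_mono Suc order_trans[OF Suc(2) Suc(1)])
  then show ?case by simp
  case 2 show ?case using order_trans[OF Suc(2) Suc(1)] .
  case 3
  have "sqrt_iter (1 :: real) n * sqrt_iter 1 n \<le> 1 * 1"
    by (intro mult_mono Suc) auto
  then show ?case by simp
qed simp_all

lemma sqrt_iter_norm:
  fixes x :: "'a :: real_normed_algebra"
  assumes "norm x \<le> 1"
  shows "norm (sqrt_iter x n) \<le> sqrt_iter 1 n"
proof (induction n)
  case (Suc n)
  have "norm (x + sqrt_iter x n * sqrt_iter x n) \<le> 1 + sqrt_iter 1 n * sqrt_iter 1 n"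
    by (intro order_trans[OF norm_triangle_ineq] add_mono assms order_trans[OF norm_mult_ineq]
        mult_mono Suc) (auto simp: sqrt_iter_real)
  then show ?case by simp
qed simp

text \<open>Majorant argument: the iterates commute, so a difference of squares factors, and every
  increment is bounded by the one of the scalar iteration for x = 1. That iteration is increasing
  and bounded, so convergence holds up to norm 1, where no geometric estimate is available.\<close>

lemma sqrt_iter_step:
  fixes x :: "'a :: real_normed_algebra"
  assumes "norm x \<le> 1"
  shows "norm (sqrt_iter x (Suc n) - sqrt_iter x n) \<le> sqrt_iter 1 (Suc n) - sqrt_iter 1 n"
proof (induction n)
  case (Suc n)
  let ?a = "sqrt_iter x (Suc n)" and ?b = "sqrt_iter x n"
  let ?r = "sqrt_iter (1 :: real) (Suc n)" and ?s = "sqrt_iter (1 :: real) n"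
  have comm: "?a * ?b = ?b * ?a"
    by (intro sqrt_iter_commute sqrt_iter_commute[symmetric] refl)
  have "sqrt_iter x (Suc (Suc n)) - ?a = (1/2) *\<^sub>R (?a * ?a - ?b * ?b)"
    by (simp add: scaleR_diff_right[symmetric])
  also have "?a * ?a - ?b * ?b = (?a - ?b) * (?a + ?b)"
    using comm by (simp add: algebra_simps del: sqrt_iter.simps)
  finally have "norm (sqrt_iter x (Suc (Suc n)) - ?a) \<le> (1/2) * (norm (?a - ?b) * norm (?a + ?b))"
    by (simp add: norm_mult_ineq)
  also have "norm (?a - ?b) * norm (?a + ?b) \<le> (?r - ?s) * (?r + ?s)"
    by (intro mult_mono Suc order_trans[OF norm_triangle_ineq] add_mono sqrt_iter_norm assms)
      (auto simp: sqrt_iter_real(1) simp del: sqrt_iter.simps)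
  also have "(1/2) * ((?r - ?s) * (?r + ?s)) = sqrt_iter 1 (Suc (Suc n)) - ?r"
    by (simp add: algebra_simps)
  finally show ?case by simp
qed (use assms in simp)

lemma sqrt_iter_Cauchy:
  fixes x :: "'a :: real_normed_algebra"
  assumes "norm x \<le> 1"
  shows "Cauchy (sqrt_iter x)"
proof -
  have d: "norm (sqrt_iter x (n + k) - sqrt_iter x n) \<le> sqrt_iter 1 (n + k) - sqrt_iter 1 n" for n k
  proof (induction k)
    case (Suc k)
    show ?case
      using norm_triangle_mono[OF sqrt_iter_step[OF assms, of "n + k"] Suc]
      by (simp del: sqrt_iter.simps)
  qed simp
  have "incseq (sqrt_iter (1 :: real))"
    using sqrt_iter_real(1) incseq_SucI by blast
  then have "convergent (sqrt_iter (1 :: real))"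
    using sqrt_iter_real(3) by (metis incseq_convergent convergentI)
  then have C: "Cauchy (sqrt_iter (1 :: real))" by (rule convergent_Cauchy)
  show ?thesis
  proof (rule CauchyI')
    fix \<epsilon> :: real assume "0 < \<epsilon>"
    with C obtain M where M: "\<And>m n. m \<ge> M \<Longrightarrow> n \<ge> M \<Longrightarrow> norm (sqrt_iter (1 :: real) m - sqrt_iter 1 n) < \<epsilon>"
      using CauchyD by blast
    have "dist (sqrt_iter x m) (sqrt_iter x n) < \<epsilon>" if "m \<ge> M" "m < n" for m n
      using d[of m "n - m"] M[of n m] that by (simp add: norm_minus_commute dist_norm)
    then show "\<exists>M. \<forall>m\<ge>M. \<forall>n>m. dist (sqrt_iter x m) (sqrt_iter x n) < \<epsilon>" by blast
  qed
qed

section \<open>Positivity and norm in a complete subalgebra with unit\<close>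

locale cstar_unit =
  fixes S :: "'b :: cstar_normed_algebra set" and e :: 'b
  assumes add_mem: "x \<in> S \<Longrightarrow> y \<in> S \<Longrightarrow> x + y \<in> S"
    and mult_mem: "x \<in> S \<Longrightarrow> y \<in> S \<Longrightarrow> x * y \<in> S"
    and scaleC_mem: "x \<in> S \<Longrightarrow> c *\<^sub>C x \<in> S"
    and adj_mem: "x \<in> S \<Longrightarrow> adj x \<in> S"
    and unit_mem: "e \<in> S"
    and unit_left: "x \<in> S \<Longrightarrow> e * x = x"
    and unit_right: "x \<in> S \<Longrightarrow> x * e = x"
    and complete_S: "complete S"
begin

lemma scaleR_mem: "x \<in> S \<Longrightarrow> r *\<^sub>R x \<in> S"
  by (simp add: scaleR_eq_scaleC scaleC_mem)

lemma zero_mem: "0 \<in> S"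
  using scaleR_mem[OF unit_mem, of 0] by simp

lemma uminus_mem: "x \<in> S \<Longrightarrow> - x \<in> S"
  using scaleR_mem[of x "-1"] by simp

lemma diff_mem: "x \<in> S \<Longrightarrow> y \<in> S \<Longrightarrow> x - y \<in> S"
  using add_mem[OF _ uminus_mem, of x y] by simp

lemma sum_mem: "(\<And>i. i \<in> I \<Longrightarrow> f i \<in> S) \<Longrightarrow> sum f I \<in> S"
  by (induction I rule: infinite_finite_induct) (auto intro: add_mem zero_mem)

lemmas mem = add_mem mult_mem scaleC_mem adj_mem unit_mem scaleR_mem zero_mem uminus_mem diff_mem sum_mem

lemma lim_mem: "(\<And>n. x n \<in> S) \<Longrightarrow> x \<longlonglongrightarrow> l \<Longrightarrow> l \<in> S"
  using complete_imp_closed[OF complete_S] closed_sequentially by blast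

lemma adj_unit: "adj e = e"
  by (metis adj_adj adj_mem adj_mult unit_left unit_mem)

text \<open>Only an inequality, since S may be {0}; this happens for \<open>Mat 0\<close>.\<close>

lemma norm_unit: "norm e \<le> 1"
proof -
  have "(norm e)\<^sup>2 = norm e"
    using norm_adj_times[of e] adj_unit unit_left[OF unit_mem] by simp
  then have "norm e = 0 \<or> norm e = 1" by (simp add: power2_eq_square)
  then show ?thesis by auto
qed

text \<open>Positivity without spectra: a self-adjoint element has its spectrum in [0, 2t] iff it
  lies within distance t of t e. In this form sums of positive elements are positive by the triangle
  inequality, before anything is known about squares or \<open>adj x * x\<close>.\<close>

definition pos :: "'b \<Rightarrow> bool" where
  "pos a \<longleftrightarrow> a \<in> S \<and> adj a = a \<and> (\<exists>t\<ge>0. norm (t *\<^sub>R e - a) \<le> t)"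

lemma pos_mem: "pos a \<Longrightarrow> a \<in> S" and pos_adj: "pos a \<Longrightarrow> adj a = a"
  by (auto simp: pos_def)

lemma pos_add:
  assumes "pos a" "pos b"
  shows "pos (a + b)"
proof -
  obtain s t where st: "s \<ge> 0" "norm (s *\<^sub>R e - a) \<le> s" "t \<ge> 0" "norm (t *\<^sub>R e - b) \<le> t"
    using assms by (auto simp: pos_def)
  have "norm ((s + t) *\<^sub>R e - (a + b)) \<le> s + t"
    using norm_triangle_mono[OF st(2,4)] by (simp add: algebra_simps)
  then show ?thesis
    using assms st unfolding pos_def by (auto simp: adj_simps mem intro!: exI[of _ "s + t"])
qed

lemma pos_scale:
  assumes "pos a" "r \<ge> 0"
  shows "pos (r *\<^sub>R a)"
proof -
  obtain s where st: "s \<ge> 0" "norm (s *\<^sub>R e - a) \<le> s"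
    using assms by (auto simp: pos_def)
  have "norm ((r * s) *\<^sub>R e - r *\<^sub>R a) = r * norm (s *\<^sub>R e - a)"
    using assms by (simp flip: scaleR_scaleR scaleR_diff_right)
  then have "norm ((r * s) *\<^sub>R e - r *\<^sub>R a) \<le> r * s"
    using st assms by (simp add: mult_left_mono)
  then show ?thesis
    using assms st unfolding pos_def by (auto simp: adj_simps mem intro!: exI[of _ "r * s"])
qed

lemma pos_zero: "pos 0"
  by (auto simp: pos_def zero_mem adj_zero intro!: exI[of _ 0])

lemma pos_sum: "(\<And>i. i \<in> I \<Longrightarrow> pos (f i)) \<Longrightarrow> pos (sum f I)"
  by (induction I rule: infinite_finite_induct) (auto intro: pos_add pos_zero)

lemma pos_unit_diff:
  assumes "x \<in> S" "adj x = x" "norm x \<le> r"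
  shows "pos (r *\<^sub>R e - x)"
proof -
  have "0 \<le> r" using assms(3) norm_ge_zero order_trans by blast
  then show ?thesis
    using assms unfolding pos_def by (auto simp: adj_simps mem adj_unit intro!: exI[of _ r])
qed

lemma pos_unit_add:
  assumes "x \<in> S" "adj x = x" "norm x \<le> r"
  shows "pos (r *\<^sub>R e + x)"
  using pos_unit_diff[of "- x" r] assms by (simp add: adj_simps mem)

text \<open>The limit b of the iteration satisfies 2b = x + b^2, that is (e - b)^2 = e - x, so c = e
  - b. Elements commuting with x commute with all iterates, hence with c; this makes square roots of
  commuting elements commute.\<close>

lemma sqrt_exists:
  assumes x: "x \<in> S" "adj x = x" "norm x \<le> 1"
  obtains c where "pos c" "c * c = e - x" "\<And>z. z \<in> S \<Longrightarrow> x * z = z * x \<Longrightarrow> c * z = z * c"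
proof -
  have mem: "sqrt_iter x n \<in> S" for n by (induction n) (auto intro!: mem x)
  have sa: "adj (sqrt_iter x n) = sqrt_iter x n" for n by (induction n) (auto simp: adj_simps x)
  obtain b where b: "b \<in> S" "sqrt_iter x \<longlonglongrightarrow> b"
    using complete_S sqrt_iter_Cauchy[OF x(3)] mem unfolding complete_def by blast
  have "(\<lambda>n. sqrt_iter x (Suc n)) \<longlonglongrightarrow> (1/2) *\<^sub>R (x + b * b)"
    unfolding sqrt_iter.simps by (intro tendsto_intros b)
  moreover have "(\<lambda>n. sqrt_iter x (Suc n)) \<longlonglongrightarrow> b" using b(2) by (rule LIMSEQ_Suc)
  ultimately have "b = (1/2) *\<^sub>R (x + b * b)" using LIMSEQ_unique by blast
  then have "2 *\<^sub>R b = 2 *\<^sub>R ((1/2) *\<^sub>R (x + b * b))" by (rule arg_cong)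
  then have eq: "b + b = x + b * b" by (simp add: scaleR_2)
  have "(\<lambda>n. adj (sqrt_iter x n)) \<longlonglongrightarrow> adj b" by (intro tendsto_adj b)
  then have sab: "adj b = b" using b(2) sa LIMSEQ_unique by auto
  have "norm (sqrt_iter x n) \<le> 1" for n
    using sqrt_iter_norm[OF x(3), of n] sqrt_iter_real(3)[of n] by linarith
  then have nb: "norm b \<le> 1"
    using tendsto_norm[OF b(2)] by (auto intro: LIMSEQ_le_const2)
  have "(e - b) * (e - b) = e - x"
  proof -
    have "(e - b) * (e - b) = e - (b + b) + b * b"
      by (simp add: algebra_simps unit_left unit_right b unit_mem)
    then show ?thesis by (simp add: eq)
  qed
  moreover have "pos (e - b)" using pos_unit_diff[OF b(1) sab nb] by simp
  moreover have "(e - b) * z = z * (e - b)" if "z \<in> S" "x * z = z * x" for z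
  proof -
    have "(\<lambda>n. sqrt_iter x n * z) \<longlonglongrightarrow> b * z" "(\<lambda>n. z * sqrt_iter x n) \<longlonglongrightarrow> z * b"
      by (intro tendsto_intros b)+
    then have "b * z = z * b" using sqrt_iter_commute[OF that(2)] LIMSEQ_unique by auto
    then show ?thesis by (simp add: algebra_simps unit_left unit_right that)
  qed
  ultimately show ?thesis using that by blast
qed

lemma pos_sqrt:
  assumes "pos a"
  obtains c where "pos c" "c * c = a" "\<And>z. z \<in> S \<Longrightarrow> a * z = z * a \<Longrightarrow> c * z = z * c"
proof -
  obtain t where t: "t \<ge> 0" "norm (t *\<^sub>R e - a) \<le> t" using assms by (auto simp: pos_def)
  have a: "a \<in> S" "adj a = a" using assms by (auto simp: pos_def)
  show ?thesis
  proof (cases "t = 0")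
    case True
    then have "a = 0" using t by simp
    then show ?thesis using that[of 0] by (simp add: pos_zero)
  next
    case False
    then have tp: "t > 0" using t by simp
    define x where "x = e - (1/t) *\<^sub>R a"
    have x: "x \<in> S" "adj x = x" by (auto simp: x_def adj_simps adj_unit a mem)
    have "t *\<^sub>R x = t *\<^sub>R e - a" using tp by (simp add: x_def algebra_simps)
    then have "t * norm x \<le> t * 1" using t by (metis norm_scaleR abs_of_nonneg mult_1_right)
    then have "norm x \<le> 1" using tp by simp
    then obtain c where c: "pos c" "c * c = e - x" "\<And>z. z \<in> S \<Longrightarrow> x * z = z * x \<Longrightarrow> c * z = z * c"
      using sqrt_exists[OF x] by blast
    have "pos (sqrt t *\<^sub>R c)" using c t by (intro pos_scale) auto
    moreover have "(sqrt t *\<^sub>R c) * (sqrt t *\<^sub>R c) = a"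
      using tp by (simp add: c(2) x_def)
    moreover have "(sqrt t *\<^sub>R c) * z = z * (sqrt t *\<^sub>R c)" if z: "z \<in> S" "a * z = z * a" for z
    proof -
      have "x * z = z * x" using z by (simp add: x_def algebra_simps unit_left unit_right)
      then show ?thesis using c(3)[OF z(1)] by simp
    qed
    ultimately show ?thesis using that by blast
  qed
qed

text \<open>After scaling to norm 1, k and c = (e - k^2)^(1/2) are the real and imaginary parts of u
  = k + i c with \<open>adj u * u = e\<close>. So u has norm at most 1, and so has c. As c^2 = e -
  k^2, this is the bound; it makes squares of self-adjoint elements positive.\<close>

lemma square_bound:
  assumes b: "b \<in> S" "adj b = b"
  shows "norm ((norm b)\<^sup>2 *\<^sub>R e - b * b) \<le> (norm b)\<^sup>2"
proof (cases "b = 0")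
  case False
  define k where "k = (1 / norm b) *\<^sub>R b"
  have k: "k \<in> S" "adj k = k" "norm k = 1" using False by (auto simp: k_def mem b adj_simps)
  have x: "k * k \<in> S" "adj (k * k) = k * k" "norm (k * k) \<le> 1"
    using k norm_selfadj_square[of k] by (auto simp: mem adj_simps)
  obtain c where c: "pos c" "c * c = e - k * k" "\<And>z. z \<in> S \<Longrightarrow> k * k * z = z * (k * k) \<Longrightarrow> c * z = z * c"
    using sqrt_exists[OF x] by blast
  have ck: "c * k = k * c" using c(3)[OF k(1)] by (simp add: mult.assoc)
  have cs: "c \<in> S" "adj c = c" using c(1) by (auto simp: pos_def)
  define u where "u = k + \<i> *\<^sub>C c"
  have au: "adj u = k - \<i> *\<^sub>C c" using adj_add_ii[OF k(2) cs(2)] by (simp add: u_def)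
  have "adj u * u = k * k + c * c" using adj_add_ii_mult[OF k(2) cs(2) ck] by (simp add: u_def)
  then have "adj u * u = e" by (simp add: c)
  then have "(norm u)\<^sup>2 \<le> 1\<^sup>2" using norm_adj_times[of u] norm_unit by simp
  then have nu: "norm u \<le> 1" by (rule power2_le_imp_le) simp
  have "u - adj u = (2 * \<i>) *\<^sub>C c"
    unfolding au by (simp add: u_def scaleC_add_left[symmetric])
  then have "2 * norm c = norm (u - adj u)" by (simp add: norm_scaleC_eq norm_mult)
  also have "\<dots> \<le> 1 + 1"
    by (intro order_trans[OF norm_triangle_ineq4] add_mono) (simp_all add: norm_adj nu)
  finally have "norm c \<le> 1" by simp
  then have "norm (c * c) \<le> 1"
    using norm_selfadj_square[OF cs(2)] by (simp add: power_le_one)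
  then have n: "norm (e - k * k) \<le> 1" by (simp add: c)
  have "b = norm b *\<^sub>R k" using False by (simp add: k_def)
  then have "b * b = (norm b)\<^sup>2 *\<^sub>R (k * k)"
    by (metis mult_scaleR_left mult_scaleR_right scaleR_scaleR power2_eq_square)
  then have "(norm b)\<^sup>2 *\<^sub>R e - b * b = (norm b)\<^sup>2 *\<^sub>R (e - k * k)"
    by (simp add: scaleR_diff_right)
  then show ?thesis using n by (simp add: mult_left_le)
qed simp

lemma pos_square: "b \<in> S \<Longrightarrow> adj b = b \<Longrightarrow> pos (b * b)"
  unfolding pos_def using square_bound[of b] by (auto simp: mem adj_simps intro!: exI[of _ "(norm b)\<^sup>2"])

lemma pos_norm_bound:
  assumes "pos a"
  shows "norm (norm a *\<^sub>R e - a) \<le> norm a"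
proof -
  obtain c where c: "pos c" "c * c = a" using pos_sqrt[OF assms] by metis
  then have "c \<in> S" "adj c = c" by (auto simp: pos_def)
  then show ?thesis using square_bound[of c] norm_selfadj_square[of c] c by simp
qed

lemma pos_norm_diff: "pos a \<Longrightarrow> norm a \<le> r \<Longrightarrow> pos (r *\<^sub>R e - a)"
  using pos_unit_diff[of a r] by (auto simp: pos_def)

lemma pos_mult:
  assumes "pos a" "pos b" "a * b = b * a"
  shows "pos (a * b)"
proof -
  obtain c where c: "pos c" "c * c = a" "\<And>z. z \<in> S \<Longrightarrow> a * z = z * a \<Longrightarrow> c * z = z * c"
    using pos_sqrt[OF assms(1)] by metis
  obtain d where d: "pos d" "d * d = b" "\<And>z. z \<in> S \<Longrightarrow> b * z = z * b \<Longrightarrow> d * z = z * d"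
    using pos_sqrt[OF assms(2)] by metis
  have "c * b = b * c" using c(3) assms pos_mem by metis
  then have cd: "c * d = d * c" using d(3) c(1) pos_mem by metis
  have "a * b = (c * d) * (c * d)" unfolding c(2)[symmetric] d(2)[symmetric] using cd by (metis mult.assoc)
  moreover have "pos \<dots>"
    using c(1) d(1) cd by (intro pos_square) (auto simp: pos_def mem adj_simps)
  ultimately show ?thesis by simp
qed

text \<open>The trick of \<open>square_bound\<close> again: the square roots of w/t and e - w/t are
  the real and imaginary parts of an element of norm at most 1.\<close>

lemma norm_le_pos:
  assumes w: "pos w" and tw: "pos (t *\<^sub>R e - w)" and t: "t > 0"
  shows "norm w \<le> t"
proof -
  have "pos ((1/t) *\<^sub>R w)" "pos ((1/t) *\<^sub>R (t *\<^sub>R e - w))" using t w tw by (auto intro: pos_scale)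
  then have p: "pos ((1/t) *\<^sub>R w)" "pos (e - (1/t) *\<^sub>R w)" using t by (simp_all add: scaleR_diff_right)
  obtain c where c: "pos c" "c * c = (1/t) *\<^sub>R w"
    "\<And>z. z \<in> S \<Longrightarrow> ((1/t) *\<^sub>R w) * z = z * ((1/t) *\<^sub>R w) \<Longrightarrow> c * z = z * c"
    using pos_sqrt[OF p(1)] by metis
  obtain d where d: "pos d" "d * d = e - (1/t) *\<^sub>R w"
    "\<And>z. z \<in> S \<Longrightarrow> (e - (1/t) *\<^sub>R w) * z = z * (e - (1/t) *\<^sub>R w) \<Longrightarrow> d * z = z * d"
    using pos_sqrt[OF p(2)] by metis
  have cs: "c \<in> S" "adj c = c" "d \<in> S" "adj d = d" using c d by (auto simp: pos_def)
  have "(e - c * c) * c = c * (e - c * c)" by (simp add: algebra_simps unit_left unit_right cs)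
  then have dc: "d * c = c * d" using d(3)[OF cs(1)] c(2) by simp
  define u where "u = c + \<i> *\<^sub>C d"
  have au: "adj u = c - \<i> *\<^sub>C d" using adj_add_ii[OF cs(2,4)] by (simp add: u_def)
  have "adj u * u = c * c + d * d" using adj_add_ii_mult[OF cs(2,4) dc] by (simp add: u_def)
  then have "adj u * u = e" by (simp add: c d)
  then have "(norm u)\<^sup>2 \<le> 1\<^sup>2" using norm_adj_times[of u] norm_unit by simp
  then have nu: "norm u \<le> 1" by (rule power2_le_imp_le) simp
  have "u + adj u = 2 *\<^sub>R c" unfolding au by (simp add: u_def scaleR_2)
  then have "2 * norm c = norm (u + adj u)" by simp
  also have "\<dots> \<le> 1 + 1"
    by (intro order_trans[OF norm_triangle_ineq] add_mono) (simp_all add: norm_adj nu)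
  finally have "norm c \<le> 1" by simp
  then have "norm (c * c) \<le> 1"
    using norm_selfadj_square[OF cs(2)] by (simp add: power_le_one)
  then show ?thesis using t by (simp add: c field_simps)
qed

text \<open>Reduces to \<open>norm_le_pos\<close> for x^2, because (t - x)(t + x) = t^2 - x^2 is a
  product of commuting positive elements.\<close>

lemma norm_le_iff_pos:
  assumes x: "x \<in> S" "adj x = x" and p: "pos (t *\<^sub>R e - x)" "pos (t *\<^sub>R e + x)" and t: "t > 0"
  shows "norm x \<le> t"
proof -
  have "(t *\<^sub>R e - x) * (t *\<^sub>R e + x) = t\<^sup>2 *\<^sub>R e - x * x" "(t *\<^sub>R e + x) * (t *\<^sub>R e - x) = t\<^sup>2 *\<^sub>R e - x * x"
    by (simp_all add: algebra_simps unit_left unit_right x mem power2_eq_square)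
  then have "pos (t\<^sup>2 *\<^sub>R e - x * x)" using pos_mult[OF p] by simp
  then have "norm (x * x) \<le> t\<^sup>2" using t by (intro norm_le_pos pos_square x) auto
  then have "(norm x)\<^sup>2 \<le> t\<^sup>2" using norm_selfadj_square x by metis
  then show ?thesis using t by (simp add: power2_le_iff_abs_le)
qed

lemma pos_norm_mono:
  assumes "pos a" "pos (b - a)"
  shows "norm a \<le> norm b"
proof (rule field_le_epsilon)
  fix \<epsilon> :: real assume "0 < \<epsilon>"
  have b: "pos b" using pos_add[OF assms] by simp
  have "pos (((norm b + \<epsilon>) *\<^sub>R e - b) + (b - a))"
    by (intro pos_add assms pos_norm_diff b) (use \<open>0 < \<epsilon>\<close> in simp)
  then have "pos ((norm b + \<epsilon>) *\<^sub>R e - a)" by simp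
  then show "norm a \<le> norm b + \<epsilon>"
    using assms \<open>0 < \<epsilon>\<close> by (intro norm_le_pos) (auto simp: add_nonneg_pos)
qed

end

section \<open>Continuous functional calculus\<close>

primrec upow :: "'a :: times \<Rightarrow> 'a \<Rightarrow> nat \<Rightarrow> 'a" where
  "upow e a 0 = e"
| "upow e a (Suc n) = a * upow e a n"

text \<open>\<open>dval a p\<close> is the value at \<open>a\<close> of the polynomial \<open>x p(x)\<close>; no unit is needed for it.\<close>

definition dval :: "'a :: real_algebra \<Rightarrow> real poly \<Rightarrow> 'a" where
  "dval a p = (\<Sum>i\<le>degree p. coeff p i *\<^sub>R pow_Suc a i)"

lemma dval_sum: "degree p \<le> N \<Longrightarrow> dval a p = (\<Sum>i\<le>N. coeff p i *\<^sub>R pow_Suc a i)"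
  unfolding dval_def by (rule sum.mono_neutral_left) (auto simp: coeff_eq_0)

lemma dval_0 [simp]: "dval a 0 = 0"
  by (simp add: dval_def)

lemma dval_add: "dval a (p + q) = dval a p + dval a q"
proof -
  define N where "N = max (degree p) (degree q)"
  have "degree p \<le> N" "degree q \<le> N" "degree (p + q) \<le> N"
    by (auto simp: N_def degree_add_le)
  then show ?thesis
    by (simp add: dval_sum[where N = N] scaleR_add_left sum.distrib)
qed

lemma dval_smult: "dval a (smult c p) = c *\<^sub>R dval a p"
  by (simp add: dval_sum[where N = "degree p"] degree_smult_le scaleR_sum_right)

lemma dval_minus: "dval a (- p) = - dval a p"
  using dval_smult[of a "-1" p] by simp

lemma dval_diff: "dval a (p - q) = dval a p - dval a q"
  using dval_add[of a p "- q"] by (simp add: dval_minus)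

lemma pow_Suc_commute: "a * z = z * b \<Longrightarrow> pow_Suc a n * z = z * pow_Suc (b :: 'a :: semigroup_mult) n"
proof (induction n)
  case (Suc n)
  have "pow_Suc a n * (a * z) = (pow_Suc a n * z) * b" by (simp add: Suc.prems mult.assoc)
  then show ?case using Suc by (simp add: mult.assoc)
qed simp

lemma dval_pCons: "dval a (pCons c p) = c *\<^sub>R a + a * dval a p"
proof -
  have "dval a (pCons c p) = (\<Sum>i\<le>Suc (degree p). coeff (pCons c p) i *\<^sub>R pow_Suc a i)"
    by (rule dval_sum) (simp add: degree_pCons_le)
  also have "\<dots> = c *\<^sub>R a + (\<Sum>i\<le>degree p. coeff p i *\<^sub>R (pow_Suc a i * a))"
    by (simp add: sum.atMost_Suc_shift del: sum.atMost_Suc)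
  finally show ?thesis
    using pow_Suc_commute[of a a a] by (simp add: dval_def sum_distrib_left)
qed

lemma dval_intertwine: "a * z = z * b \<Longrightarrow> dval a p * z = z * dval b p"
  by (simp add: dval_def sum_distrib_left sum_distrib_right pow_Suc_commute)

text \<open>\<open>dval\<close> supplies one factor x by itself, so the product of x p and x q is
  represented by x p q, which is \<open>pCons 0 (p * q)\<close>.\<close>

lemma dval_mult: "dval a p * dval a q = dval a (pCons 0 (p * q))"
proof (induction p)
  case (pCons c p)
  then show ?case
    by (simp add: dval_pCons distrib_right distrib_left mult.assoc dval_add dval_smult)
qed simp

lemma dval_adj: "adj a = a \<Longrightarrow> adj (dval a p) = dval (a :: 'a :: cstar_normed_algebra) p"
proof (induction p)
  case (pCons c p)
  then show ?case
    using dval_intertwine[of a a a p] by (simp add: dval_pCons adj_simps)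
qed (simp add: adj_zero)

lemma dval_scale: "dval (t *\<^sub>R a) p = (\<Sum>i\<le>degree p. (coeff p i * t ^ Suc i) *\<^sub>R pow_Suc a i)"
proof -
  have "pow_Suc (t *\<^sub>R a) i = t ^ Suc i *\<^sub>R pow_Suc a i" for i
    by (induction i) (simp_all add: mult_ac)
  then show ?thesis by (simp add: dval_def)
qed

section \<open>Bernstein polynomials and the norm of a polynomial in a positive element\<close>

context cstar_unit
begin

lemma upow_mem: "a \<in> S \<Longrightarrow> upow e a n \<in> S"
  by (induction n) (auto intro: mem)

lemma upow_pow_Suc: "a \<in> S \<Longrightarrow> upow e a (Suc n) = pow_Suc a n"
proof (induction n)
  case (Suc n)
  then show ?case using pow_Suc_commute[of a a a n] by simp
qed (simp add: unit_right)

lemma upow_commute: "z \<in> S \<Longrightarrow> a * z = z * a \<Longrightarrow> upow e a n * z = z * upow e a n"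
proof (induction n)
  case (Suc n)
  have "a * (upow e a n * z) = (z * a) * upow e a n" using Suc by (simp add: mult.assoc[symmetric] del: mult.assoc)
  then show ?case by (simp add: mult.assoc)
qed (simp add: unit_left unit_right)

lemma dval_mem: "a \<in> S \<Longrightarrow> dval a p \<in> S"
  unfolding dval_def using upow_mem upow_pow_Suc by (intro sum_mem scaleR_mem) metis

lemma pos_upow: "pos a \<Longrightarrow> pos (upow e a n)"
proof (induction n)
  case 0
  show ?case using pos_square[OF unit_mem adj_unit] unit_left[OF unit_mem] by simp
next
  case (Suc n)
  then show ?case
    using upow_commute[of a a n] by (auto intro!: pos_mult simp: pos_mem)
qed

text \<open>Bernstein basis polynomials at a. For 0 \<le> a \<le> e they are positive and sum to e,
  an operator partition of unity: a real combination of them is bounded by its largest coefficient.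
  This replaces spectral theory in the norm estimate \<open>dval_bound\<close>.\<close>

definition bern :: "'b \<Rightarrow> nat \<Rightarrow> nat \<Rightarrow> 'b" where
  "bern a n k = real (n choose k) *\<^sub>R (upow e a k * upow e (e - a) (n - k))"

lemma bern_mult:
  assumes "a \<in> S"
  shows "a * bern a n k = (real (Suc k) / real (Suc n)) *\<^sub>R bern a (Suc n) (Suc k)"
proof -
  have "real (Suc k) * real (Suc n choose Suc k) = real (Suc n) * real (n choose k)"
    using Suc_times_binomial[of k n] by (metis of_nat_mult)
  then have "real (n choose k) = real (Suc k) / real (Suc n) * real (Suc n choose Suc k)"
    by (simp add: field_simps del: binomial_Suc_Suc of_nat_Suc)
  then show ?thesis by (simp add: bern_def mult.assoc del: binomial_Suc_Suc of_nat_Suc)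
qed

lemma bern_mult':
  assumes "a \<in> S" "k \<le> n"
  shows "(e - a) * bern a n k = (real (Suc n - k) / real (Suc n)) *\<^sub>R bern a (Suc n) k"
proof -
  have c: "(e - a) * upow e a k = upow e a k * (e - a)"
    using upow_commute[of "e - a" a k] assms
    by (simp add: mem algebra_simps unit_left unit_right upow_mem)
  have "real (Suc n - k) * real (Suc n choose k) = real (Suc n) * real (n choose k)"
    using binomial_absorb_comp[of "Suc n" k] by (metis of_nat_mult diff_Suc_1)
  then have "real (n choose k) = real (Suc n - k) / real (Suc n) * real (Suc n choose k)"
    by (simp add: field_simps del: binomial_Suc_Suc of_nat_Suc)
  moreover have "(e - a) * (upow e a k * upow e (e - a) (n - k)) = upow e a k * upow e (e - a) (Suc n - k)"
    using assms by (simp add: Suc_diff_le mult.assoc[symmetric] c del: mult.assoc)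
  ultimately show ?thesis by (simp add: bern_def del: binomial_Suc_Suc of_nat_Suc)
qed

lemma bern_mem: "a \<in> S \<Longrightarrow> bern a n k \<in> S"
  by (simp add: bern_def mem upow_mem)

lemma bern_sum:
  assumes a: "a \<in> S"
  shows "(\<Sum>k\<le>n. bern a n k) = e"
proof (induction n)
  case 0
  show ?case by (simp add: bern_def unit_left unit_mem)
next
  case (Suc n)
  have "e = a * (\<Sum>k\<le>n. bern a n k) + (e - a) * (\<Sum>k\<le>n. bern a n k)"
    using a by (simp add: Suc algebra_simps unit_right unit_mem)
  also have "\<dots> = (\<Sum>k\<le>n. (real (Suc k) / real (Suc n)) *\<^sub>R bern a (Suc n) (Suc k))
      + (\<Sum>k\<le>n. (real (Suc n - k) / real (Suc n)) *\<^sub>R bern a (Suc n) k)"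
    by (simp add: sum_distrib_left bern_mult bern_mult' a del: of_nat_Suc)
  also have "(\<Sum>k\<le>n. (real (Suc k) / real (Suc n)) *\<^sub>R bern a (Suc n) (Suc k))
      = (\<Sum>k\<le>Suc n. (real k / real (Suc n)) *\<^sub>R bern a (Suc n) k)"
    by (subst sum.atMost_Suc_shift) simp
  also have "(\<Sum>k\<le>n. (real (Suc n - k) / real (Suc n)) *\<^sub>R bern a (Suc n) k)
      = (\<Sum>k\<le>Suc n. (real (Suc n - k) / real (Suc n)) *\<^sub>R bern a (Suc n) k)"
    by simp
  also have "(\<Sum>k\<le>Suc n. (real k / real (Suc n)) *\<^sub>R bern a (Suc n) k) + \<dots>
      = (\<Sum>k\<le>Suc n. bern a (Suc n) k)"
    unfolding sum.distrib[symmetric]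
    by (rule sum.cong) (simp_all add: scaleR_add_left[symmetric] add_divide_distrib[symmetric] of_nat_diff del: of_nat_Suc sum.atMost_Suc)
  finally show ?case by simp
qed

lemma bern_pos:
  assumes "pos a" "pos (e - a)"
  shows "pos (bern a n k)"
proof -
  have a: "a \<in> S" using assms pos_mem by blast
  have "(e - a) * upow e a k = upow e a k * (e - a)"
    using upow_commute[of "e - a" a k] a
    by (simp add: mem algebra_simps unit_left unit_right upow_mem)
  then have "upow e (e - a) (n - k) * upow e a k = upow e a k * upow e (e - a) (n - k)"
    using upow_commute[of "upow e a k" "e - a" "n - k"] a by (simp add: upow_mem)
  then show ?thesis
    unfolding bern_def using assms by (intro pos_scale pos_mult pos_upow) auto
qed

lemma bern_norm:
  assumes a: "pos a" "pos (e - a)" and d: "\<And>k. k \<le> n \<Longrightarrow> \<bar>d k\<bar> \<le> M"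
  shows "norm (\<Sum>k\<le>n. d k *\<^sub>R bern a n k) \<le> M"
proof (rule field_le_epsilon)
  fix \<epsilon> :: real assume \<epsilon>: "0 < \<epsilon>"
  have M: "0 \<le> M" using d[of 0] by linarith
  have am: "a \<in> S" using a pos_mem by blast
  let ?x = "\<Sum>k\<le>n. d k *\<^sub>R bern a n k"
  have eq: "(M + \<epsilon>) *\<^sub>R e = (\<Sum>k\<le>n. (M + \<epsilon>) *\<^sub>R bern a n k)"
    using bern_sum[OF am, of n] by (simp flip: scaleR_sum_right)
  have "(M + \<epsilon>) *\<^sub>R e - ?x = (\<Sum>k\<le>n. (M + \<epsilon> - d k) *\<^sub>R bern a n k)"
    "(M + \<epsilon>) *\<^sub>R e + ?x = (\<Sum>k\<le>n. (M + \<epsilon> + d k) *\<^sub>R bern a n k)"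
    unfolding eq by (simp_all add: sum_subtractf sum.distrib scaleR_diff_left scaleR_add_left)
  moreover have "pos (\<Sum>k\<le>n. (M + \<epsilon> - d k) *\<^sub>R bern a n k)" "pos (\<Sum>k\<le>n. (M + \<epsilon> + d k) *\<^sub>R bern a n k)"
  proof -
    have "0 \<le> M + \<epsilon> - d k" "0 \<le> M + \<epsilon> + d k" if "k \<le> n" for k
      using d[OF that] \<epsilon> by linarith+
    then show "pos (\<Sum>k\<le>n. (M + \<epsilon> - d k) *\<^sub>R bern a n k)" "pos (\<Sum>k\<le>n. (M + \<epsilon> + d k) *\<^sub>R bern a n k)"
      by (intro pos_sum pos_scale bern_pos a; simp)+
  qed
  moreover have "adj ?x = ?x"
    using bern_pos[OF a] by (simp add: adj_sum adj_simps pos_adj)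
  moreover have "?x \<in> S" by (intro sum_mem scaleR_mem bern_mem am)
  ultimately show "norm ?x \<le> M + \<epsilon>"
    using M \<epsilon> norm_le_iff_pos[of ?x "M + \<epsilon>"] by simp
qed

text \<open>Multiplication by \<open>a\<close> shifts the Bernstein operator for \<open>f\<close> to the one for \<open>x f(x)\<close>, up to
  the modulus of continuity of \<open>f\<close>; so no explicit formula for the moments is needed.\<close>

lemma bern_power_tendsto:
  assumes a: "pos a" "pos (e - a)"
  shows "(\<lambda>n. \<Sum>k\<le>n. (real k / real n) ^ j *\<^sub>R bern a n k) \<longlonglongrightarrow> upow e a j"
proof (induction j)
  case 0
  show ?case using a by (simp add: bern_sum pos_mem)
next
  case (Suc j)
  have am: "a \<in> S" using a pos_mem by blast
  let ?F = "\<lambda>j n. \<Sum>k\<le>n. (real k / real n) ^ j *\<^sub>R bern a n k"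
  have est: "norm (?F (Suc j) (Suc n) - a * ?F j n) \<le> real j / real n" if n: "n \<ge> 1" for n
  proof -
    \<comment> \<open>Multiplication by a sends index k of level n to index k + 1 of level n + 1
      with the factor (k + 1)/(n + 1). The remaining difference of coefficients at index k of level
      n + 1 is d k; index 0 receives nothing, and its own coefficient vanishes.\<close>
    define d where "d k = (if k = 0 then 0 else
       real k / real (Suc n) * ((real k / real (Suc n)) ^ j - (real (k - 1) / real n) ^ j))" for k
    have "a * ?F j n = (\<Sum>k\<le>n. ((real k / real n) ^ j * (real (Suc k) / real (Suc n))) *\<^sub>R bern a (Suc n) (Suc k))"
      by (simp add: sum_distrib_left bern_mult am)
    moreover have "?F (Suc j) (Suc n) = (\<Sum>k\<le>n. ((real (Suc k) / real (Suc n)) ^ Suc j) *\<^sub>R bern a (Suc n) (Suc k))"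
      by (subst sum.atMost_Suc_shift) simp
    ultimately have "?F (Suc j) (Suc n) - a * ?F j n = (\<Sum>k\<le>n. d (Suc k) *\<^sub>R bern a (Suc n) (Suc k))"
      by (simp add: d_def right_diff_distrib mult.commute sum_subtractf scaleR_diff_left del: of_nat_Suc)
    also have "\<dots> = (\<Sum>k\<le>Suc n. d k *\<^sub>R bern a (Suc n) k)"
      by (subst sum.atMost_Suc_shift) (simp add: d_def)
    also have "norm \<dots> \<le> real j / real n"
    proof (rule bern_norm[OF a])
      fix k assume k: "k \<le> Suc n"
      show "\<bar>d k\<bar> \<le> real j / real n"
      proof (cases k)
        case (Suc i)
        then have i: "i \<le> n" using k by simp
        have "real (Suc i) / real (Suc n) - real i / real n = (real n - real i) / (real n * real (Suc n))"
          using n by (simp add: field_simps)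
        moreover have "(real n - real i) / (real n * real (Suc n)) \<le> real (Suc n) / (real n * real (Suc n))"
          by (intro divide_right_mono) auto
        moreover have "real (Suc n) / (real n * real (Suc n)) = 1 / real n" by (simp del: of_nat_Suc)
        moreover have "0 \<le> (real n - real i) / (real n * real (Suc n))" using i by simp
        ultimately have *: "\<bar>real (Suc i) / real (Suc n) - real i / real n\<bar> \<le> 1 / real n"
          by (simp del: of_nat_Suc)
        have "\<bar>(real (Suc i) / real (Suc n)) ^ j - (real i / real n) ^ j\<bar>
            \<le> real j * \<bar>real (Suc i) / real (Suc n) - real i / real n\<bar>"
          using norm_power_diff[of "real (Suc i) / real (Suc n)" "real i / real n" j] i n by simp
        also have "\<dots> \<le> real j * (1 / real n)" by (intro mult_left_mono *) auto
        finally have **: "\<bar>(real (Suc i) / real (Suc n)) ^ j - (real i / real n) ^ j\<bar> \<le> real j / real n" by simp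
        have "\<bar>d k\<bar> = \<bar>real (Suc i) / real (Suc n)\<bar> * \<bar>(real (Suc i) / real (Suc n)) ^ j - (real i / real n) ^ j\<bar>"
          by (simp add: d_def Suc abs_mult del: of_nat_Suc)
        also have "\<dots> \<le> 1 * (real j / real n)"
          using i by (intro mult_mono **) auto
        finally show ?thesis by simp
      qed (simp add: d_def)
    qed
    finally show ?thesis .
  qed
  have "(\<lambda>n. ?F (Suc j) (Suc n) - a * ?F j n) \<longlonglongrightarrow> 0"
  proof (rule Lim_null_comparison)
    show "eventually (\<lambda>n. norm (?F (Suc j) (Suc n) - a * ?F j n) \<le> real j / real n) sequentially"
      using est by (intro eventually_sequentiallyI[of 1])
    show "(\<lambda>n. real j / real n) \<longlonglongrightarrow> 0" by (rule lim_const_over_n)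
  qed
  moreover have "(\<lambda>n. a * ?F j n) \<longlonglongrightarrow> a * upow e a j"
    by (intro tendsto_intros Suc)
  ultimately have "(\<lambda>n. ?F (Suc j) (Suc n)) \<longlonglongrightarrow> a * upow e a j"
    using tendsto_add by fastforce
  then show ?case unfolding upow.simps(2) by (rule LIMSEQ_imp_Suc)
qed

text \<open>After scaling to norm 1, replace each power by its Bernstein operator. The polynomial
  becomes a combination of \<open>bern\<close> whose coefficients are values of x p(x) at grid
  points of [0, norm a]; \<open>bern_norm\<close> bounds it, and the bound survives the
  limit.\<close>

lemma dval_bound:
  assumes a: "pos a" and M: "\<And>x. x \<in> {0..norm a} \<Longrightarrow> \<bar>x * poly p x\<bar> \<le> M"
  shows "norm (dval a p) \<le> M"
proof (cases "a = 0")
  case True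
  have "pow_Suc (0 :: 'b) i = 0" for i by (cases i) auto
  then show ?thesis using M[of 0] True by (simp add: dval_def)
next
  case False
  define t where "t = norm a"
  have t: "t > 0" using False by (simp add: t_def)
  define b where "b = (1/t) *\<^sub>R a"
  have ab: "a = t *\<^sub>R b" using t by (simp add: b_def)
  have b: "pos b" unfolding b_def using a t by (intro pos_scale) auto
  have "norm b = 1" using t by (simp add: b_def t_def)
  then have b': "pos (e - b)" using pos_norm_diff[OF b, of 1] by simp
  have bm: "b \<in> S" using b pos_mem by blast
  let ?F = "\<lambda>n. \<Sum>i\<le>degree p. (coeff p i * t ^ Suc i) *\<^sub>R (\<Sum>k\<le>n. (real k / real n) ^ Suc i *\<^sub>R bern b n k)"
  have "?F \<longlonglongrightarrow> (\<Sum>i\<le>degree p. (coeff p i * t ^ Suc i) *\<^sub>R upow e b (Suc i))"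
    by (intro tendsto_intros bern_power_tendsto b b')
  also have "(\<Sum>i\<le>degree p. (coeff p i * t ^ Suc i) *\<^sub>R upow e b (Suc i)) = dval a p"
    unfolding ab dval_scale upow_pow_Suc[OF bm] ..
  finally have lim: "?F \<longlonglongrightarrow> dval a p" .
  have "norm (?F n) \<le> M" for n
  proof -
    have "?F n = (\<Sum>k\<le>n. (\<Sum>i\<le>degree p. coeff p i * t ^ Suc i * (real k / real n) ^ Suc i) *\<^sub>R bern b n k)"
      by (simp add: scaleR_sum_right scaleR_sum_left del: power_Suc) (rule sum.swap)
    also have "norm \<dots> \<le> M"
    proof (rule bern_norm[OF b b'])
      fix k assume k: "k \<le> n"
      have "(\<Sum>i\<le>degree p. coeff p i * t ^ Suc i * (real k / real n) ^ Suc i)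
          = (t * (real k / real n)) * poly p (t * (real k / real n))" (is "?l = ?y * poly p ?y")
        by (simp add: poly_altdef sum_distrib_left power_mult_distrib mult_ac del: times_divide_eq_right)
      moreover have "?y \<in> {0..norm a}"
        using k t mult_left_mono[of "real k / real n" 1 t]
        by (auto simp: t_def[symmetric] divide_le_eq_1 simp del: times_divide_eq_right)
      ultimately show "\<bar>?l\<bar> \<le> M" using M by metis
    qed
    finally show ?thesis .
  qed
  then show ?thesis
    using tendsto_norm[OF lim] by (auto intro: LIMSEQ_le_const2)
qed

end


section \<open>The calculus for functions vanishing at 0\<close>

definition cpos :: "'a :: cstar_normed_algebra \<Rightarrow> bool" where
  "cpos a \<longleftrightarrow> (\<exists>S e. cstar_unit S e \<and> cstar_unit.pos S e a)"

definition C0 :: "(real \<Rightarrow> real) \<Rightarrow> bool" where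
  "C0 f \<longleftrightarrow> continuous_on {0..} f \<and> f 0 = 0"

text \<open>No subalgebra enters, only \<open>norm a\<close> and polynomials without constant term;
  so one value serves for all \<open>Mat n\<close> containing a. The arbitrary choice of
  approximants is removed by \<open>cf_tendsto\<close>.\<close>

definition cf :: "(real \<Rightarrow> real) \<Rightarrow> 'a :: cstar_normed_algebra \<Rightarrow> 'a" where
  "cf f a = lim (\<lambda>n. dval a (SOME p. \<forall>x\<in>{0..norm a}. \<bar>f x - x * poly p x\<bar> < 1 / real (Suc n)))"

lemma cpos_adj: "cpos a \<Longrightarrow> adj a = a"
  unfolding cpos_def using cstar_unit.pos_adj by blast

lemma cpos_dval_bound:
  "cpos a \<Longrightarrow> (\<And>x. x \<in> {0..norm a} \<Longrightarrow> \<bar>x * poly p x\<bar> \<le> M) \<Longrightarrow> norm (dval a p) \<le> M"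
  unfolding cpos_def using cstar_unit.dval_bound by blast

text \<open>A Weierstrass approximant g need not vanish at 0, but g - g(0) is divisible by x, and
  g(0) is small because f(0) = 0. Hence the two halves of \<epsilon>.\<close>

lemma C0_approx:
  assumes "C0 f" "0 < \<epsilon>"
  shows "\<exists>p. \<forall>x\<in>{0..M}. \<bar>f x - x * poly p x\<bar> < \<epsilon>"
proof (cases "0 \<le> M")
  case True
  have "continuous_on {0..M} f"
    using assms continuous_on_subset[of "{0..}" f "{0..M}"] by (auto simp: C0_def)
  then obtain g where g: "real_polynomial_function g" "\<And>x. x \<in> {0..M} \<Longrightarrow> \<bar>f x - g x\<bar> < \<epsilon> / 2"
    using Stone_Weierstrass_real_polynomial_function[of "{0..M}" f "\<epsilon> / 2"] assms by auto
  obtain c n where c: "g = (\<lambda>x. \<Sum>i\<le>n. c i * x ^ i)"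
    using g(1) by (auto simp: real_polynomial_function_iff_sum)
  have "\<bar>f x - x * poly (\<Sum>i<n. monom (c (Suc i)) i) x\<bar> < \<epsilon>" if "x \<in> {0..M}" for x
  proof -
    have eq: "x * poly (\<Sum>i<n. monom (c (Suc i)) i) x = g x - g 0"
      by (cases n) (simp_all add: c poly_sum poly_monom sum_distrib_left mult_ac lessThan_Suc_atMost
          sum.atMost_Suc_shift power_0_left del: sum.atMost_Suc)
    have "\<bar>g 0\<bar> < \<epsilon> / 2" using g(2)[of 0] assms True by (simp add: C0_def)
    then show ?thesis
      unfolding eq using g(2)[OF that] by linarith
  qed
  then show ?thesis by blast
qed auto

lemma C0_uniform_limit:
  assumes "C0 f"
  obtains p where "uniform_limit {0..M} (\<lambda>n x. x * poly (p n) x) f sequentially"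
proof -
  have "\<forall>n. \<exists>p. \<forall>x\<in>{0..M}. \<bar>f x - x * poly p x\<bar> < 1 / real (Suc n)"
    using C0_approx[OF assms] by simp
  then obtain p where p: "\<And>n x. x \<in> {0..M} \<Longrightarrow> \<bar>f x - x * poly (p n) x\<bar> < 1 / real (Suc n)"
    by metis
  have "uniform_limit {0..M} (\<lambda>n x. x * poly (p n) x) f sequentially"
  proof (rule uniform_limitI)
    fix \<epsilon> :: real assume "0 < \<epsilon>"
    then have "\<forall>\<^sub>F n in sequentially. 1 / real (Suc n) < \<epsilon>"
      using order_tendstoD(2)[OF LIMSEQ_inverse_real_of_nat] by (simp add: inverse_eq_divide)
    then show "\<forall>\<^sub>F n in sequentially. \<forall>x\<in>{0..M}. dist (x * poly (p n) x) (f x) < \<epsilon>"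
      by eventually_elim (use p in \<open>fastforce simp: dist_real_def abs_minus_commute intro: less_trans\<close>)
  qed
  then show ?thesis using that by blast
qed

lemma C0_bounded: "C0 f \<Longrightarrow> bounded (f ` {0..M})"
  using continuous_on_subset[of "{0..}" f "{0..M}"]
  by (auto simp: C0_def intro!: compact_imp_bounded compact_continuous_image)

lemma dval_tendsto_zero:
  assumes a: "cpos a" and p: "uniform_limit {0..norm a} (\<lambda>n x. x * poly (p n) x) (\<lambda>_. 0) sequentially"
  shows "(\<lambda>n. dval a (p n)) \<longlonglongrightarrow> 0"
proof (rule tendstoI)
  fix \<epsilon> :: real assume "0 < \<epsilon>"
  then have "\<forall>\<^sub>F n in sequentially. \<forall>x\<in>{0..norm a}. dist (x * poly (p n) x) 0 < \<epsilon> / 2"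
    using uniform_limitD[OF p, of "\<epsilon>/2"] by simp
  then show "\<forall>\<^sub>F n in sequentially. dist (dval a (p n)) 0 < \<epsilon>"
  proof eventually_elim
    case (elim n)
    then have "norm (dval a (p n)) \<le> \<epsilon> / 2"
      by (intro cpos_dval_bound a) (auto simp: dist_real_def intro: less_imp_le)
    then show ?case using \<open>0 < \<epsilon>\<close> by simp
  qed
qed

text \<open>By the norm bound for polynomials any two uniformly approximating sequences become equal
  at a in the limit, and a complete subalgebra containing a supplies that limit. The rules of the
  calculus follow by choosing convenient approximants.\<close>

lemma cf_tendsto:
  assumes a: "cpos a" and f: "C0 f"
    and p: "uniform_limit {0..norm a} (\<lambda>n x. x * poly (p n) x) f sequentially"
  shows "(\<lambda>n. dval a (p n)) \<longlonglongrightarrow> cf f a"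
proof -
  define q where "q n = (SOME p. \<forall>x\<in>{0..norm a}. \<bar>f x - x * poly p x\<bar> < 1 / real (Suc n))" for n
  have q: "\<bar>f x - x * poly (q n) x\<bar> < 1 / real (Suc n)" if "x \<in> {0..norm a}" for n x
    using someI_ex[OF C0_approx[OF f, of "1 / real (Suc n)" "norm a"]] that by (simp add: q_def)
  obtain S e where S: "cstar_unit S e" "cstar_unit.pos S e a" using a by (auto simp: cpos_def)
  interpret cstar_unit S e by fact
  have am: "a \<in> S" using S pos_mem by blast
  have est: "norm (dval a (q m) - dval a (q n)) \<le> 1 / real (Suc m) + 1 / real (Suc n)" for m n
    unfolding dval_diff[symmetric]
  proof (rule cpos_dval_bound[OF a])
    fix x assume x: "x \<in> {0..norm a}"
    show "\<bar>x * poly (q m - q n) x\<bar> \<le> 1 / real (Suc m) + 1 / real (Suc n)"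
      using q[OF x, of m] q[OF x, of n] by (simp add: right_diff_distrib)
  qed
  have "Cauchy (\<lambda>n. dval a (q n))"
  proof (rule CauchyI')
    fix \<epsilon> :: real assume "0 < \<epsilon>"
    then obtain M where M: "1 / real (Suc M) < \<epsilon> / 2"
      using reals_Archimedean[of "\<epsilon> / 2"] by (auto simp: inverse_eq_divide)
    have "dist (dval a (q m)) (dval a (q n)) < \<epsilon>" if "m \<ge> M" "n > m" for m n
    proof -
      have "1 / real (Suc m) \<le> 1 / real (Suc M)" "1 / real (Suc n) \<le> 1 / real (Suc M)"
        using that by (auto intro!: divide_left_mono)
      then show ?thesis using est[of m n] M by (simp add: dist_norm)
    qed
    then show "\<exists>M. \<forall>m\<ge>M. \<forall>n>m. dist (dval a (q m)) (dval a (q n)) < \<epsilon>" by blast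
  qed
  then obtain l where "(\<lambda>n. dval a (q n)) \<longlonglongrightarrow> l"
    using complete_S dval_mem[OF am] unfolding complete_def by metis
  then have lim: "(\<lambda>n. dval a (q n)) \<longlonglongrightarrow> cf f a"
    unfolding cf_def q_def[symmetric] by (simp add: limI)
  have "uniform_limit {0..norm a} (\<lambda>n x. x * poly (q n) x) f sequentially"
  proof (rule uniform_limitI)
    fix \<epsilon> :: real assume "0 < \<epsilon>"
    then have "\<forall>\<^sub>F n in sequentially. 1 / real (Suc n) < \<epsilon>"
      using order_tendstoD(2)[OF LIMSEQ_inverse_real_of_nat] by (simp add: inverse_eq_divide)
    then show "\<forall>\<^sub>F n in sequentially. \<forall>x\<in>{0..norm a}. dist (x * poly (q n) x) (f x) < \<epsilon>"
      by eventually_elim (use q in \<open>fastforce simp: dist_real_def abs_minus_commute intro: less_trans\<close>)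
  qed
  from uniform_limit_minus[OF p this]
  have "uniform_limit {0..norm a} (\<lambda>n x. x * poly (p n - q n) x) (\<lambda>_. 0) sequentially"
    by (simp add: right_diff_distrib)
  then have "(\<lambda>n. dval a (p n - q n)) \<longlonglongrightarrow> 0" by (rule dval_tendsto_zero[OF a])
  from tendsto_add[OF this lim] show ?thesis by (simp add: dval_diff)
qed

lemma C0_simps: "C0 (\<lambda>x. x)" "C0 f \<Longrightarrow> C0 g \<Longrightarrow> C0 (\<lambda>x. f x + g x)" "C0 f \<Longrightarrow> C0 g \<Longrightarrow> C0 (\<lambda>x. f x - g x)"
  "C0 f \<Longrightarrow> C0 (\<lambda>x. c * f x)" "C0 f \<Longrightarrow> continuous_on {0..} g \<Longrightarrow> C0 (\<lambda>x. f x * g x)"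
  "C0 f \<Longrightarrow> continuous_on {0..} g \<Longrightarrow> C0 (\<lambda>x. g x * f x)" "C0 f \<Longrightarrow> C0 (\<lambda>x. f x * c)"
  by (auto simp: C0_def intro!: continuous_intros)

lemma C0_cont: "C0 f \<Longrightarrow> continuous_on {0..} f"
  by (simp add: C0_def)

lemma C0_comp:
  assumes "C0 f" "C0 g" "\<And>x. x \<ge> 0 \<Longrightarrow> f x \<ge> 0"
  shows "C0 (\<lambda>x. g (f x))"
  using assms continuous_on_compose2[of "{0..}" g "{0..}" f] by (auto simp: C0_def)

lemma cf_cong:
  assumes a: "cpos a" and f: "C0 f" "C0 g" and eq: "\<And>x. 0 \<le> x \<Longrightarrow> x \<le> norm a \<Longrightarrow> f x = g x"
  shows "cf f a = cf g a"
proof -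
  obtain p where p: "uniform_limit {0..norm a} (\<lambda>n x. x * poly (p n) x) f sequentially"
    using C0_uniform_limit[OF f(1)] by blast
  then have "uniform_limit {0..norm a} (\<lambda>n x. x * poly (p n) x) g sequentially"
    by (rule uniform_limit_cong'[THEN iffD1, rotated 2]) (use eq in auto)
  then show ?thesis
    using cf_tendsto[OF a f(1) p] cf_tendsto[OF a f(2)] LIMSEQ_unique by blast
qed

lemma cf_id:
  assumes "cpos a" shows "cf (\<lambda>x. x) a = a"
proof -
  have "(\<lambda>n :: nat. dval a [:1:]) \<longlonglongrightarrow> cf (\<lambda>x. x) a"
    by (rule cf_tendsto[OF assms C0_simps(1)]) (auto intro!: uniform_limitI)
  then show ?thesis by (simp add: dval_pCons LIMSEQ_const_iff)
qed

lemma cf_add: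
  assumes a: "cpos a" and f: "C0 f" "C0 g"
  shows "cf (\<lambda>x. f x + g x) a = cf f a + cf g a"
proof -
  obtain p q where p: "uniform_limit {0..norm a} (\<lambda>n x. x * poly (p n) x) f sequentially"
    and q: "uniform_limit {0..norm a} (\<lambda>n x. x * poly (q n) x) g sequentially"
    using C0_uniform_limit f by metis
  have "uniform_limit {0..norm a} (\<lambda>n x. x * poly (p n + q n) x) (\<lambda>x. f x + g x) sequentially"
    using uniform_limit_add[OF p q] by (simp add: distrib_left)
  from cf_tendsto[OF a C0_simps(2)[OF f] this]
  show ?thesis
    using tendsto_add[OF cf_tendsto[OF a f(1) p] cf_tendsto[OF a f(2) q]] LIMSEQ_unique
    by (simp add: dval_add)
qed

lemma cf_mult:
  assumes a: "cpos a" and f: "C0 f" "C0 g"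
  shows "cf (\<lambda>x. f x * g x) a = cf f a * cf g a"
proof -
  obtain p q where p: "uniform_limit {0..norm a} (\<lambda>n x. x * poly (p n) x) f sequentially"
    and q: "uniform_limit {0..norm a} (\<lambda>n x. x * poly (q n) x) g sequentially"
    using C0_uniform_limit f by metis
  have "uniform_limit {0..norm a} (\<lambda>n x. x * poly (pCons 0 (p n * q n)) x) (\<lambda>x. f x * g x) sequentially"
    using uniform_lim_mult[OF p q C0_bounded[OF f(1)] C0_bounded[OF f(2)]] by (simp add: mult_ac)
  from cf_tendsto[OF a C0_simps(5)[OF f(1) C0_cont[OF f(2)]] this]
  show ?thesis
    using tendsto_mult[OF cf_tendsto[OF a f(1) p] cf_tendsto[OF a f(2) q]] LIMSEQ_unique
    by (simp add: dval_mult)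
qed

lemma cf_scale:
  assumes a: "cpos a" and f: "C0 f"
  shows "cf (\<lambda>x. c * f x) a = c *\<^sub>R cf f a"
proof -
  obtain p where p: "uniform_limit {0..norm a} (\<lambda>n x. x * poly (p n) x) f sequentially"
    using C0_uniform_limit f by metis
  have "uniform_limit {0..norm a} (\<lambda>n x. x * poly (smult c (p n)) x) (\<lambda>x. c * f x) sequentially"
    using bounded_linear.uniform_limit[OF bounded_linear_mult_right[of c] p] by (simp add: mult_ac)
  from cf_tendsto[OF a C0_simps(4)[OF f] this]
  show ?thesis
    using tendsto_scaleR[OF tendsto_const[of c] cf_tendsto[OF a f p]] LIMSEQ_unique
    by (simp add: dval_smult)
qed

lemma cf_diff:
  assumes "cpos a" "C0 f" "C0 g"
  shows "cf (\<lambda>x. f x - g x) a = cf f a - cf g a"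
  using cf_add[OF assms(1) C0_simps(3)[OF assms(2,3)] assms(3)] by (simp add: algebra_simps)

lemma cf_norm:
  assumes a: "cpos a" and f: "C0 f" and M: "\<And>x. 0 \<le> x \<Longrightarrow> x \<le> norm a \<Longrightarrow> \<bar>f x\<bar> \<le> M"
  shows "norm (cf f a) \<le> M"
proof (rule field_le_epsilon)
  fix \<epsilon> :: real assume "0 < \<epsilon>"
  obtain p where p: "uniform_limit {0..norm a} (\<lambda>n x. x * poly (p n) x) f sequentially"
    using C0_uniform_limit f by metis
  have "\<forall>\<^sub>F n in sequentially. norm (dval a (p n)) \<le> M + \<epsilon>"
    using uniform_limitD[OF p \<open>0 < \<epsilon>\<close>]
  proof eventually_elim
    case (elim n)
    show ?case
    proof (rule cpos_dval_bound[OF a])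
      fix x assume x: "x \<in> {0..norm a}"
      then show "\<bar>x * poly (p n) x\<bar> \<le> M + \<epsilon>"
        using bspec[OF elim x] M[of x] unfolding dist_real_def by auto
    qed
  qed
  then show "norm (cf f a) \<le> M + \<epsilon>"
    using tendsto_norm[OF cf_tendsto[OF a f p]] tendsto_upperbound sequentially_bot by blast
qed

text \<open>Two elements are allowed in order to move functions across x: z = x gives
  \<open>cf f (x * adj x) * x = x * cf f (adj x * x)\<close>. With b = 0 it shows that f(a)
  annihilates what a annihilates.\<close>

lemma cf_intertwine:
  assumes ab: "cpos a" "cpos b" and f: "C0 f" and z: "a * z = z * b"
  shows "cf f a * z = z * cf f b"
proof -
  obtain p where p: "uniform_limit {0..max (norm a) (norm b)} (\<lambda>n x. x * poly (p n) x) f sequentially"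
    using C0_uniform_limit f by metis
  have "(\<lambda>n. dval a (p n) * z) \<longlonglongrightarrow> cf f a * z"
    by (intro tendsto_intros cf_tendsto ab f uniform_limit_on_subset[OF p]) auto
  moreover have "(\<lambda>n. z * dval b (p n)) \<longlonglongrightarrow> z * cf f b"
    by (intro tendsto_intros cf_tendsto ab f uniform_limit_on_subset[OF p]) auto
  ultimately show ?thesis using LIMSEQ_unique by (simp add: dval_intertwine[OF z])
qed

lemma cf_adj:
  assumes a: "cpos a" and f: "C0 f"
  shows "adj (cf f a) = cf f a"
proof -
  obtain p where p: "uniform_limit {0..norm a} (\<lambda>n x. x * poly (p n) x) f sequentially"
    using C0_uniform_limit f by metis
  show ?thesis
    using tendsto_adj[OF cf_tendsto[OF a f p]] cf_tendsto[OF a f p] LIMSEQ_unique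
    by (simp add: dval_adj cpos_adj a)
qed

lemma (in cstar_unit) cf_mem:
  assumes a: "cpos a" "a \<in> S" and f: "C0 f"
  shows "cf f a \<in> S"
proof -
  obtain p where p: "uniform_limit {0..norm a} (\<lambda>n x. x * poly (p n) x) f sequentially"
    using C0_uniform_limit f by metis
  show ?thesis
    by (rule lim_mem[OF dval_mem[OF a(2)] cf_tendsto[OF a(1) f p]])
qed

lemma C0_sqrt: "C0 f \<Longrightarrow> C0 (\<lambda>x. sqrt (f x))"
  by (auto simp: C0_def intro!: continuous_intros)

lemma cf_square_sqrt:
  assumes "cpos a" "C0 f" "\<And>x. x \<ge> 0 \<Longrightarrow> f x \<ge> 0"
  shows "cf f a = cf (\<lambda>x. sqrt (f x)) a * cf (\<lambda>x. sqrt (f x)) a"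
proof -
  have "cf f a = cf (\<lambda>x. sqrt (f x) * sqrt (f x)) a"
    by (rule cf_cong[OF assms(1,2) C0_simps(5)[OF C0_sqrt C0_cont[OF C0_sqrt]]])
      (simp_all add: assms)
  also have "\<dots> = cf (\<lambda>x. sqrt (f x)) a * cf (\<lambda>x. sqrt (f x)) a"
    using assms by (intro cf_mult C0_sqrt)
  finally show ?thesis .
qed

lemma (in cstar_unit) pos_cpos: "pos a \<Longrightarrow> cpos a"
  unfolding cpos_def using cstar_unit_axioms by blast

lemma (in cstar_unit) pos_cf:
  assumes "pos a" "C0 f" "\<And>x. x \<ge> 0 \<Longrightarrow> f x \<ge> 0"
  shows "pos (cf f a)"
proof -
  have "cf f a = cf (\<lambda>x. sqrt (f x)) a * cf (\<lambda>x. sqrt (f x)) a"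
    by (rule cf_square_sqrt[OF pos_cpos[OF assms(1)] assms(2)]) (rule assms(3))
  moreover have "pos \<dots>"
    by (intro pos_square cf_mem cf_adj pos_cpos C0_sqrt pos_mem assms)
  ultimately show ?thesis by simp
qed

lemma cpos_cf:
  assumes "cpos a" "C0 f" "\<And>x. x \<ge> 0 \<Longrightarrow> f x \<ge> 0"
  shows "cpos (cf f a)"
  using assms cstar_unit.pos_cf unfolding cpos_def by metis

lemma cf_dval:
  assumes "cpos a" "C0 f"
  shows "dval (cf f a) p = cf (\<lambda>x. f x * poly p (f x)) a"
proof (induction p)
  case 0
  have "cf (\<lambda>x. 0 * x) a = 0" using cf_scale[OF assms(1) C0_simps(1), of 0] by simp
  then show ?case by simp
next
  case (pCons c p)
  have C: "C0 (\<lambda>x. f x * poly p (f x))"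
    using assms(2) by (intro C0_simps continuous_intros) (auto simp: C0_def)
  have "dval (cf f a) (pCons c p) = cf (\<lambda>x. c * f x) a + cf (\<lambda>x. f x * (f x * poly p (f x))) a"
    by (simp add: dval_pCons pCons cf_scale cf_mult assms C)
  also have "\<dots> = cf (\<lambda>x. c * f x + f x * (f x * poly p (f x))) a"
    by (intro cf_add[symmetric] assms C0_simps C0_cont C)
  finally show ?case by (simp add: distrib_left mult_ac)
qed

lemma cf_comp:
  assumes a: "cpos a" and f: "C0 f" "\<And>x. x \<ge> 0 \<Longrightarrow> f x \<ge> 0" and g: "C0 g"
  shows "cf g (cf f a) = cf (\<lambda>x. g (f x)) a"
proof -
  obtain M where M: "\<And>x. 0 \<le> x \<Longrightarrow> x \<le> norm a \<Longrightarrow> \<bar>f x\<bar> \<le> M"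
    using C0_bounded[OF f(1), of "norm a"] by (fastforce simp: bounded_iff)
  have fa: "cpos (cf f a)" by (intro cpos_cf a f)
  have nM: "norm (cf f a) \<le> M" by (intro cf_norm a f M)
  obtain p where p: "uniform_limit {0..M} (\<lambda>n x. x * poly (p n) x) g sequentially"
    using C0_uniform_limit g by metis
  have "(\<lambda>n. dval (cf f a) (p n)) \<longlonglongrightarrow> cf g (cf f a)"
    by (intro cf_tendsto fa g uniform_limit_on_subset[OF p]) (use nM in auto)
  moreover have "(\<lambda>n. dval (cf f a) (p n)) \<longlonglongrightarrow> cf (\<lambda>x. g (f x)) a"
  proof (rule LIMSEQ_I)
    fix \<epsilon> :: real assume "0 < \<epsilon>"
    have gf: "C0 (\<lambda>x. g (f x))" by (rule C0_comp[OF f(1) g f(2)])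
    have C: "C0 (\<lambda>x. f x * poly (p n) (f x))" for n
      using f(1) by (intro C0_simps continuous_intros) (auto simp: C0_def)
    have "\<forall>\<^sub>F n in sequentially. norm (dval (cf f a) (p n) - cf (\<lambda>x. g (f x)) a) \<le> \<epsilon> / 2"
      using uniform_limitD[OF p half_gt_zero[OF \<open>0 < \<epsilon>\<close>]]
    proof eventually_elim
      case (elim n)
      have "dval (cf f a) (p n) - cf (\<lambda>x. g (f x)) a = cf (\<lambda>x. f x * poly (p n) (f x) - g (f x)) a"
        unfolding cf_dval[OF a f(1)] by (rule cf_diff[OF a C gf, symmetric])
      also have "norm \<dots> \<le> \<epsilon> / 2"
      proof (rule cf_norm[OF a])
        fix x assume x: "0 \<le> x" "x \<le> norm a"
        then have "f x \<in> {0..M}" using M[of x] f(2)[of x] by auto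
        then show "\<bar>f x * poly (p n) (f x) - g (f x)\<bar> \<le> \<epsilon> / 2"
          using elim \<open>0 < \<epsilon>\<close> by (auto simp: dist_real_def intro: less_imp_le)
      qed (rule C0_simps(3)[OF C gf])
      finally show ?case .
    qed
    then obtain N where "\<And>n. n \<ge> N \<Longrightarrow> norm (dval (cf f a) (p n) - cf (\<lambda>x. g (f x)) a) \<le> \<epsilon> / 2"
      by (auto simp: eventually_sequentially)
    then show "\<exists>N. \<forall>n\<ge>N. norm (dval (cf f a) (p n) - cf (\<lambda>x. g (f x)) a) < \<epsilon>"
      using \<open>0 < \<epsilon>\<close> by (metis field_sum_of_halves less_add_same_cancel1 half_gt_zero order_le_less_trans)
  qed
  ultimately show ?thesis using LIMSEQ_unique by blast
qed

section \<open>Positivity of \<open>adj x * x\<close>\<close>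

context cstar_unit
begin

text \<open>With \<open>b = x\<^sup>* x\<close> and \<open>m\<close> its negative part, \<open>y = x m\<close> satisfies \<open>y\<^sup>* y = - m\<^sup>3\<close>. If \<open>y\<close>
  had norm 1, then \<open>z = y y\<^sup>*\<close> would be positive of norm 1, while \<open>z(1 + z)\<^sup>2 = y (1 - m\<^sup>3)\<^sup>2 y\<^sup>*\<close> has
  norm at most 1.\<close>

lemma adj_times_neg:
  assumes y: "y \<in> S" "adj y * y = - w" and w: "pos w"
  shows "y = 0"
proof (rule ccontr)
  assume "y \<noteq> 0"
  define k where "k = 1 / norm y"
  have k: "k > 0" using \<open>y \<noteq> 0\<close> by (simp add: k_def)
  define u where "u = k *\<^sub>R y"
  define v where "v = (k * k) *\<^sub>R w"
  have u: "u \<in> S" "norm u = 1" using y k \<open>y \<noteq> 0\<close> by (auto simp: u_def k_def mem)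
  have v: "pos v" using w by (auto simp: v_def intro: pos_scale)
  have vm: "v \<in> S" using v pos_mem by blast
  have uv: "adj u * u = - v" by (simp add: u_def v_def adj_simps y)
  have "norm v = 1" using norm_adj_times[of u] u uv by simp
  then have ev: "norm (e - v) \<le> 1" using pos_norm_bound[OF v] by simp
  define z where "z = u * adj u"
  have zm: "z \<in> S" by (simp add: z_def mem u)
  have nz: "norm z = 1" using norm_adj_times[of "adj u"] u by (simp add: z_def adj_simps norm_adj)
  \<comment> \<open>Up to sign, twice the real and the imaginary part of u. The sum g^2 + h^2 is
    twice \<open>u * adj u + adj u * u\<close>, and \<open>adj u * u = - v\<close>; so z is half a
    sum of squares plus v, hence positive.\<close>
  define g h where "g = u + adj u" and "h = \<i> *\<^sub>C (u - adj u)"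
  have gh: "g \<in> S" "h \<in> S" using u unfolding g_def h_def by (intro mem; simp)+
  have gh': "adj g = g" by (simp add: g_def adj_simps add.commute)
  have "adj h = - (\<i> *\<^sub>C (adj u - u))" by (simp add: h_def adj_simps scaleC_uminus_left)
  also have "\<dots> = h" by (simp add: h_def scaleC_uminus_right[symmetric])
  finally have gh'': "adj h = h" .
  have "h * h = - ((u - adj u) * (u - adj u))"
    by (simp add: h_def mult_scaleC_left mult_scaleC_right scaleC_scaleC scaleC_uminus_left scaleC_one)
  then have "g * g + h * h = 2 *\<^sub>R z + 2 *\<^sub>R (adj u * u)"
    by (simp add: g_def z_def algebra_simps scaleR_2)
  then have "z = (1/2) *\<^sub>R (g * g + h * h) + v"
    by (simp add: uv scaleR_add_right scaleR_diff_right)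
  moreover have "pos \<dots>" by (intro pos_add pos_scale pos_square gh gh' gh'' v) auto
  ultimately have z: "pos z" by simp
  have "(e + z) * u = u * (e - v)"
    by (simp add: algebra_simps unit_left unit_right u z_def mult.assoc uv)
  then have "(e + z) * ((e + z) * z) = u * ((e - v) * (e - v)) * adj u"
    unfolding z_def by (metis mult.assoc)
  also have "norm \<dots> \<le> 1 * (1 * 1) * 1"
    by (intro order_trans[OF norm_mult_ineq] mult_mono) (use u ev in \<open>auto simp: norm_adj\<close>)
  finally have le: "norm ((e + z) * ((e + z) * z)) \<le> 1" by simp
  have zz: "pos (z * z)" by (intro pos_square zm pos_adj z)
  then have zzz: "pos (z * (z * z))" by (intro pos_mult z) (auto simp: mult.assoc)
  \<comment> \<open>The difference z + z^3 is positive, so the norm just bounded by 1 is at least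
    that of 2 z^2, which is 2.\<close>
  have eq: "(e + z) * ((e + z) * z) - 2 *\<^sub>R (z * z) = z + z * (z * z)"
    by (simp add: algebra_simps unit_left unit_right zm mem scaleR_2)
  have "norm (2 *\<^sub>R (z * z)) \<le> norm ((e + z) * ((e + z) * z))"
  proof (rule pos_norm_mono)
    show "pos (2 *\<^sub>R (z * z))" by (intro pos_scale zz) simp
    show "pos ((e + z) * ((e + z) * z) - 2 *\<^sub>R (z * z))" unfolding eq by (intro pos_add z zzz)
  qed
  moreover have "norm (z * z) = 1" using norm_selfadj_square[OF pos_adj[OF z]] nz by simp
  ultimately show False using le by simp
qed

text \<open>The calculus is available for positive elements only, so b is shifted to c = b + M e.
  There max(s - M, 0) yields the positive part, and min(s, M) yields M e minus the negative
  part.\<close>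

lemma pos_part_exists:
  assumes b: "b \<in> S" "adj b = b"
  obtains p m where "pos p" "pos m" "b = p - m" "p * m = 0" "m * p = 0"
    "\<And>z. z \<in> S \<Longrightarrow> b * z = z * b \<Longrightarrow> p * z = z * p"
proof -
  define M where "M = norm b"
  have M: "M \<ge> 0" by (simp add: M_def)
  define c where "c = M *\<^sub>R e + b"
  have c: "pos c" unfolding c_def M_def by (intro pos_unit_add b) simp
  define f g where "f = (\<lambda>s. max (s - M) 0)" and "g = (\<lambda>s. min s M)"
  have f: "C0 f" "f x \<ge> 0" and g: "C0 g" "x \<ge> 0 \<Longrightarrow> g x \<ge> 0" for x
    using M by (auto simp: f_def g_def C0_def intro!: continuous_intros)
  note cp = pos_cpos[OF c]
  define p q where "p = cf f c" and "q = cf g c"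
  have p: "pos p" and q: "pos q"
    unfolding p_def q_def using pos_cf[OF c f] pos_cf[OF c g] by auto
  have "p + q = cf (\<lambda>x. f x + g x) c" using cf_add[OF cp f(1) g(1)] by (simp add: p_def q_def)
  also have "(\<lambda>x. f x + g x) = (\<lambda>x. x)" by (auto simp: f_def g_def)
  finally have pq: "p + q = c" using cf_id[OF cp] by simp
  define m where "m = M *\<^sub>R e - q"
  have "norm q \<le> M"
    unfolding q_def using M by (intro cf_norm cp g) (auto simp: g_def)
  then have m: "pos m" unfolding m_def by (rule pos_norm_diff[OF q])
  have "p * q = cf (\<lambda>x. f x * g x) c" "q * p = cf (\<lambda>x. g x * f x) c"
    using cf_mult[OF cp f(1) g(1)] cf_mult[OF cp g(1) f(1)] by (simp_all add: p_def q_def)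
  moreover have "(\<lambda>x. f x * g x) = (\<lambda>x. M * f x)" "(\<lambda>x. g x * f x) = (\<lambda>x. M * f x)"
    by (auto simp: f_def g_def max_def min_def)
  moreover have "cf (\<lambda>x. M * f x) c = M *\<^sub>R p" unfolding p_def by (intro cf_scale cp f)
  ultimately have "p * q = M *\<^sub>R p" "q * p = M *\<^sub>R p" by simp_all
  then have pm: "p * m = 0" "m * p = 0"
    by (simp_all add: m_def right_diff_distrib left_diff_distrib unit_left unit_right pos_mem[OF p])
  have bpm: "b = p - m" using pq by (simp add: m_def c_def algebra_simps)
  have "p * z = z * p" if "z \<in> S" "b * z = z * b" for z
    unfolding p_def
    by (intro cf_intertwine cp f) (simp add: c_def algebra_simps that unit_left unit_right)
  then show ?thesis using that p m bpm pm by blast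
qed

lemma pos_adj_times:
  assumes x: "x \<in> S"
  shows "pos (adj x * x)"
proof -
  obtain p m where pm: "pos p" "pos m" "adj x * x = p - m" "p * m = 0" "m * p = 0"
    by (rule pos_part_exists[of "adj x * x"]) (use x in \<open>auto simp: mem adj_simps\<close>)
  have ms: "m \<in> S" "adj m = m" using pm pos_mem pos_adj by auto
  have mm: "pos (m * m)" by (intro pos_square ms)
  then have mmm: "pos (m * (m * m))" by (intro pos_mult pm) (auto simp: mult.assoc)
  have "adj (x * m) * (x * m) = m * (adj x * x) * m" by (simp add: adj_simps ms mult.assoc)
  also have "\<dots> = - (m * (m * m))"
    unfolding pm(3) using pm(5) by (simp add: algebra_simps)
  finally have "x * m = 0" by (intro adj_times_neg[OF _ _ mmm] mem x ms)
  then have "m * (m * m) = 0"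
    using \<open>adj (x * m) * (x * m) = m * (adj x * x) * m\<close> \<open>m * (adj x * x) * m = - (m * (m * m))\<close> by simp
  then have "(m * m) * (m * m) = 0" by (metis mult.assoc mult_zero_right)
  then have "norm (m * m) = 0" using norm_selfadj_square[OF pos_adj[OF mm]] by simp
  then have "m = 0" using norm_selfadj_square[OF ms(2)] by simp
  then show ?thesis using pm by simp
qed

lemma pos_iff: "pos a \<longleftrightarrow> (\<exists>x\<in>S. a = adj x * x)"
  using pos_adj_times pos_sqrt[of a] pos_adj pos_mem by metis

lemma pos_conj: "pos a \<Longrightarrow> y \<in> S \<Longrightarrow> pos (adj y * a * y)"
  unfolding pos_iff by (metis adj_mult mult.assoc mult_mem)

end

section \<open>The C*-norm of \<open>M\<^sub>\<infinity>(A)\<close>\<close>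

lemma cstar_unit_UNIV: "cstar_unit (UNIV :: 'a :: unital_cstar_algebra set) 1"
  by standard (simp_all add: complete_UNIV)

section \<open>The Hilbert module \<open>A^n\<close> and its operator norm\<close>

context
  fixes dummy :: "'a :: unital_cstar_algebra itself"
begin

interpretation A: cstar_unit "UNIV :: 'a set" 1
  by (rule cstar_unit_UNIV)

definition cip :: "nat \<Rightarrow> (nat \<Rightarrow> 'a) \<Rightarrow> (nat \<Rightarrow> 'a) \<Rightarrow> 'a" where
  "cip n x y = (\<Sum>i<n. adj (x i) * y i)"

lemma col_norm_cip: "col_norm n x = sqrt (norm (cip n x x))"
  by (simp add: col_norm_def cip_def)

lemma col_norm_nonneg: "0 \<le> col_norm n (x :: nat \<Rightarrow> 'a)"
  by (simp add: col_norm_def)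

lemma col_norm_sq: "(col_norm n x)\<^sup>2 = norm (cip n x x)"
  by (simp add: col_norm_cip)

lemma cip_pos: "A.pos (cip n x x)"
  unfolding cip_def by (intro A.pos_sum A.pos_adj_times) simp

lemma cip_adj: "adj (cip n x y) = cip n y x"
  by (simp add: cip_def adj_sum adj_simps)

lemma norm_le_col_norm:
  assumes "i < n" shows "norm (x i) \<le> col_norm n (x :: nat \<Rightarrow> 'a)"
proof -
  have "cip n x x - adj (x i) * x i = (\<Sum>j\<in>{..<n} - {i}. adj (x j) * x j)"
    using assms by (simp add: cip_def sum.remove[of "{..<n}" i])
  also have "A.pos \<dots>" by (intro A.pos_sum A.pos_adj_times) simp
  finally have "norm (adj (x i) * x i) \<le> norm (cip n x x)"
    by (intro A.pos_norm_mono A.pos_adj_times) simp_all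
  then show ?thesis
    by (simp add: norm_adj_times col_norm_cip real_le_rsqrt)
qed

text \<open>Expand 0 \<le> <z, z> for z = y - x b / s with b = <x, y>. The value <x, x> is not a
  scalar, but it is at most s = norm <x, x>, which suffices to collapse the quadratic term.\<close>

lemma cip_Cauchy_Schwarz: "norm (cip n x y) \<le> col_norm n x * col_norm n y"
proof (cases "col_norm n x = 0")
  case True
  then have "x i = 0" if "i < n" for i using norm_le_col_norm[OF that, of x] by simp
  then have "cip n x y = 0" by (simp add: cip_def adj_zero)
  then show ?thesis by (simp add: col_norm_nonneg)
next
  case False
  define s where "s = norm (cip n x x)"
  have s: "s > 0" using False by (simp add: s_def col_norm_cip)
  define b where "b = cip n x y"
  define z where "z i = y i - (1/s) *\<^sub>R (x i * b)" for i
  have "cip n z z = (\<Sum>i<n. adj (y i) * y i - (1/s) *\<^sub>R (adj (y i) * x i * b)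
      - (1/s) *\<^sub>R (adj b * (adj (x i) * y i)) + (1/s/s) *\<^sub>R (adj b * (adj (x i) * x i) * b))"
    unfolding cip_def z_def by (intro sum.cong) (simp_all add: adj_simps algebra_simps)
  also have "\<dots> = cip n y y - (1/s) *\<^sub>R (cip n y x * b) - (1/s) *\<^sub>R (adj b * cip n x y)
      + (1/s/s) *\<^sub>R (adj b * cip n x x * b)"
    by (simp add: cip_def sum.distrib sum_subtractf sum_distrib_left sum_distrib_right scaleR_sum_right)
  also have "cip n y x = adj b" by (simp add: b_def cip_adj)
  finally have z: "cip n z z = cip n y y - (1/s) *\<^sub>R (adj b * b) - (1/s) *\<^sub>R (adj b * b)
      + (1/s/s) *\<^sub>R (adj b * cip n x x * b)" by (simp add: b_def)
  have "A.pos (s *\<^sub>R 1 - cip n x x)" by (intro A.pos_norm_diff cip_pos) (simp add: s_def)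
  then have "A.pos (adj b * (s *\<^sub>R 1 - cip n x x) * b)" by (rule A.pos_conj) simp
  then have "A.pos ((1/s/s) *\<^sub>R (adj b * (s *\<^sub>R 1 - cip n x x) * b))"
    using s by (intro A.pos_scale) auto
  then have "A.pos (cip n z z + (1/s/s) *\<^sub>R (adj b * (s *\<^sub>R 1 - cip n x x) * b))"
    by (intro A.pos_add cip_pos)
  moreover have "cip n z z + (1/s/s) *\<^sub>R (adj b * (s *\<^sub>R 1 - cip n x x) * b) = cip n y y - (1/s) *\<^sub>R (adj b * b)"
    using s by (simp add: z algebra_simps)
  ultimately have "norm ((1/s) *\<^sub>R (adj b * b)) \<le> norm (cip n y y)"
    using s by (intro A.pos_norm_mono A.pos_scale A.pos_adj_times) auto
  then have "(norm b)\<^sup>2 \<le> s * norm (cip n y y)"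
    using s by (simp add: norm_adj_times field_simps)
  also have "\<dots> = (col_norm n x * col_norm n y)\<^sup>2"
    by (simp add: power_mult_distrib col_norm_sq s_def)
  finally show ?thesis
    unfolding b_def by (rule power2_le_imp_le) (simp add: col_norm_nonneg)
qed

lemma col_norm_triangle: "col_norm n (\<lambda>i. x i + y i) \<le> col_norm n x + col_norm n (y :: nat \<Rightarrow> 'a)"
proof (rule power2_le_imp_le)
  have "cip n (\<lambda>i. x i + y i) (\<lambda>i. x i + y i) = cip n x x + cip n x y + cip n y x + cip n y y"
    by (simp add: cip_def adj_simps algebra_simps sum.distrib)
  then have "(col_norm n (\<lambda>i. x i + y i))\<^sup>2 \<le> norm (cip n x x) + norm (cip n x y) + norm (cip n y x) + norm (cip n y y)"
    by (simp only: col_norm_sq) (intro order_trans[OF norm_triangle_ineq] add_mono order_refl)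
  also have "\<dots> \<le> (col_norm n x + col_norm n y)\<^sup>2"
    using cip_Cauchy_Schwarz[of n x y] cip_Cauchy_Schwarz[of n y x]
    by (simp add: power2_sum col_norm_sq algebra_simps)
  finally show "(col_norm n (\<lambda>i. x i + y i))\<^sup>2 \<le> (col_norm n x + col_norm n y)\<^sup>2" .
qed (simp add: col_norm_nonneg)

lemma col_norm_scaleC: "col_norm n (\<lambda>i. c *\<^sub>C x i) = cmod c * col_norm n (x :: nat \<Rightarrow> 'a)"
proof -
  have "cip n (\<lambda>i. c *\<^sub>C x i) (\<lambda>i. c *\<^sub>C x i) = (cnj c * c) *\<^sub>C cip n x x"
    by (simp add: cip_def scaleC_sum adj_simps mult_scaleC_left mult_scaleC_right scaleC_scaleC mult.commute)
  then show ?thesis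
    by (simp add: col_norm_cip norm_scaleC_eq norm_mult real_sqrt_mult)
qed

lemma col_norm_le_sum: "col_norm n x \<le> (\<Sum>i<n. norm (x i :: 'a))"
proof -
  have "norm (cip n x x) \<le> (\<Sum>i<n. (norm (x i))\<^sup>2)"
    unfolding cip_def by (rule order_trans[OF norm_sum]) (simp add: norm_adj_times)
  then have "col_norm n x \<le> L2_set (\<lambda>i. norm (x i)) {..<n}"
    by (simp add: col_norm_cip L2_set_def)
  also have "\<dots> \<le> (\<Sum>i<n. norm (x i))" by (rule L2_set_le_sum) simp
  finally show ?thesis .
qed

lemma col_norm_mono:
  assumes "m \<le> n" shows "col_norm m x \<le> col_norm n (x :: nat \<Rightarrow> 'a)"
proof -
  have "{..<n} = {..<m} \<union> {m..<n}" using assms by auto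
  then have "cip n x x - cip m x x = (\<Sum>j\<in>{m..<n}. adj (x j) * x j)"
    by (simp add: cip_def sum.union_disjoint ivl_disj_int)
  also have "A.pos \<dots>" by (intro A.pos_sum A.pos_adj_times) simp
  finally have "norm (cip m x x) \<le> norm (cip n x x)" by (intro A.pos_norm_mono cip_pos) 
  then show ?thesis by (simp add: col_norm_cip)
qed

definition mv :: "'a minf \<Rightarrow> nat \<Rightarrow> (nat \<Rightarrow> 'a) \<Rightarrow> nat \<Rightarrow> 'a" where
  "mv a n x i = (\<Sum>j<n. entry a i j * x j)"

lemma mat_norm_mv: "mat_norm a = Sup {col_norm n (mv a n x) | n x. a \<in> Mat n \<and> col_norm n x \<le> 1}"
  by (simp add: mat_norm_def mv_def[abs_def])

lemma col_norm_mv_crude: "col_norm n (mv a n x) \<le> (\<Sum>i<n. \<Sum>j<n. norm (entry a i j)) * col_norm n x"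
proof -
  have "col_norm n (mv a n x) \<le> (\<Sum>i<n. norm (mv a n x i))" by (rule col_norm_le_sum)
  also have "\<dots> \<le> (\<Sum>i<n. \<Sum>j<n. norm (entry a i j) * col_norm n x)"
    unfolding mv_def
    by (intro sum_mono order_trans[OF norm_sum] order_trans[OF norm_mult_ineq] mult_left_mono
        norm_le_col_norm) auto
  finally show ?thesis by (simp add: sum_distrib_right)
qed

lemma Mat_min: "a \<in> Mat m \<Longrightarrow> a \<in> Mat n \<Longrightarrow> a \<in> Mat (min m n)"
  by (auto simp: Mat_def min_le_iff_disj)

lemma mv_restrict:
  assumes "a \<in> Mat m" "m \<le> n"
  shows "col_norm n (mv a n x) = col_norm m (mv a m x)"
proof -
  have 1: "mv a n x i = mv a m x i" for i
    unfolding mv_def by (rule sum.mono_neutral_right) (use assms in \<open>auto simp: Mat_def\<close>)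
  have 2: "mv a m x i = 0" if "i \<ge> m" for i
    using assms that by (auto simp: mv_def Mat_def)
  have "cip n (mv a n x) (mv a n x) = cip m (mv a m x) (mv a m x)"
    unfolding cip_def 1 by (rule sum.mono_neutral_right) (use assms 2 in auto)
  then show ?thesis by (simp add: col_norm_cip)
qed

text \<open>The supremum in \<open>mat_norm\<close> runs over all n with a in \<open>Mat n\<close>.
  A bound for one size holds for every other one: restrict the column to the common size and pad it
  with zeros.\<close>

lemma mat_norm_upper:
  assumes a: "a \<in> Mat n" and C: "\<And>x. col_norm n x \<le> 1 \<Longrightarrow> col_norm n (mv a n x) \<le> C"
  shows "col_norm m x \<le> 1 \<Longrightarrow> a \<in> Mat m \<Longrightarrow> col_norm m (mv a m x) \<le> C"
proof -
  assume x: "col_norm m x \<le> 1" and am: "a \<in> Mat m"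
  define k where "k = min m n"
  have k: "a \<in> Mat k" "k \<le> m" "k \<le> n" using Mat_min[OF am a] by (auto simp: k_def)
  define y where "y i = (if i < k then x i else 0)" for i
  have "cip n y y = cip k x x"
    unfolding cip_def by (rule sum.mono_neutral_cong_right) (use k in \<open>auto simp: y_def\<close>)
  then have "col_norm n y = col_norm k x" by (simp add: col_norm_cip)
  also have "\<dots> \<le> 1" using col_norm_mono[OF k(2), of x] x by simp
  finally have "col_norm n (mv a n y) \<le> C" by (rule C)
  moreover have "mv a k x = mv a k y" by (auto simp: mv_def y_def intro!: sum.cong)
  ultimately show ?thesis using mv_restrict[OF k(1,2)] mv_restrict[OF k(1,3)] by metis
qed

lemma mat_norm_le:
  assumes "a \<in> Mat n" "\<And>x. col_norm n x \<le> 1 \<Longrightarrow> col_norm n (mv a n x) \<le> C"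
  shows "mat_norm a \<le> C"
  unfolding mat_norm_mv
proof (rule cSup_least)
  have "col_norm n (\<lambda>_. 0 :: 'a) \<le> 1" by (simp add: col_norm_def)
  then show "{col_norm n (mv a n x) |n x. a \<in> Mat n \<and> col_norm n x \<le> 1} \<noteq> {}"
    using assms(1) by blast
qed (use mat_norm_upper[OF assms] in blast)

lemma mat_norm_bound1:
  assumes a: "a \<in> Mat n" and x: "col_norm n x \<le> 1"
  shows "col_norm n (mv a n x) \<le> mat_norm a"
  unfolding mat_norm_mv
proof (rule cSup_upper)
  define C where "C = (\<Sum>i<n. \<Sum>j<n. norm (entry a i j))"
  have C: "col_norm n (mv a n x) \<le> C" if "col_norm n x \<le> 1" for x
    using col_norm_mv_crude[of n a x] that mult_left_mono[of "col_norm n x" 1 C]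
    by (auto simp: C_def sum_nonneg)
  show "bdd_above {col_norm n (mv a n x) |n x. a \<in> Mat n \<and> col_norm n x \<le> 1}"
    using mat_norm_upper[OF a C] by (auto simp: bdd_above_def)
qed (use assms in blast)

lemma mat_norm_nonneg: "0 \<le> mat_norm (a :: 'a minf)"
proof -
  obtain n where "a \<in> Mat n" using ex_Mat by blast
  from mat_norm_bound1[OF this, of "\<lambda>_. 0"] show ?thesis
    by (simp add: col_norm_def mv_def adj_zero)
qed

lemma mv_scale: "mv a n (\<lambda>i. c *\<^sub>C x i) = (\<lambda>i. c *\<^sub>C mv a n x i)"
  by (simp add: mv_def scaleC_sum mult_scaleC_right fun_eq_iff)

lemma mat_norm_bound:
  assumes a: "a \<in> Mat n"
  shows "col_norm n (mv a n x) \<le> mat_norm a * col_norm n x"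
proof (cases "col_norm n x = 0")
  case True
  then show ?thesis using col_norm_mv_crude[of n a x] by simp
next
  case False
  then have s: "col_norm n x > 0" using col_norm_nonneg[of n x] by linarith
  let ?c = "complex_of_real (1 / col_norm n x)"
  have "col_norm n (\<lambda>i. ?c *\<^sub>C x i) = 1" using s by (simp add: col_norm_scaleC norm_divide)
  then have "col_norm n (mv a n (\<lambda>i. ?c *\<^sub>C x i)) \<le> mat_norm a"
    by (intro mat_norm_bound1 a) simp
  then show ?thesis using s by (simp add: mv_scale col_norm_scaleC norm_divide field_simps)
qed

lemma mat_norm_crude: "a \<in> Mat n \<Longrightarrow> mat_norm a \<le> (\<Sum>i<n. \<Sum>j<n. norm (entry a i j :: 'a))"
proof (rule mat_norm_le)
  fix x :: "nat \<Rightarrow> 'a" assume "col_norm n x \<le> 1"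
  then show "col_norm n (mv a n x) \<le> (\<Sum>i<n. \<Sum>j<n. norm (entry a i j))"
    using col_norm_mv_crude[of n a x] mult_left_mono[of "col_norm n x" 1 "\<Sum>i<n. \<Sum>j<n. norm (entry a i j)"]
    by (auto simp: sum_nonneg)
qed

lemma entry_le_mat_norm: "norm (entry a i j) \<le> mat_norm (a :: 'a minf)"
proof -
  obtain n where n: "a \<in> Mat n" using ex_Mat by blast
  show ?thesis
  proof (cases "i < n \<and> j < n")
    case True
    define x where "x k = (if k = j then 1 else 0 :: 'a)" for k
    have "cip n x x = (\<Sum>k<n. if k = j then adj 1 * 1 else 0)"
      unfolding cip_def by (intro sum.cong) (auto simp: x_def adj_zero)
    then have "col_norm n x = 1"
      using True A.adj_unit by (simp add: col_norm_cip)
    moreover have "mv a n x = (\<lambda>i. entry a i j)"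
      using True by (simp add: mv_def x_def fun_eq_iff if_distrib[of "\<lambda>z. _ * z"] cong: if_cong)
    ultimately have "col_norm n (\<lambda>i. entry a i j) \<le> mat_norm a"
      using mat_norm_bound1[OF n, of x] by simp
    then show ?thesis using norm_le_col_norm[of i n "\<lambda>i. entry a i j"] True by linarith
  next
    case False
    then have "entry a i j = 0" using n by (auto simp: Mat_def)
    then show ?thesis by (simp add: mat_norm_nonneg)
  qed
qed

lemma mv_times: "a \<in> Mat n \<Longrightarrow> mv (a * b) n x = mv a n (mv b n x)"
  by (simp add: mv_def entry_times sum_distrib_left sum_distrib_right mult.assoc fun_eq_iff)
    (auto intro: sum.swap)

lemma mv_adj: "cip n (mv a n x) y = cip n x (mv (adj a) n y)"
  by (simp add: cip_def mv_def adj_minf.rep_eq adj_sum sum_distrib_left sum_distrib_right adj_simps mult.assoc)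
    (auto intro: sum.swap)

lemma Mat_closed:
  assumes "a \<in> Mat n" "b \<in> Mat n"
  shows "a + b \<in> Mat n" "a * b \<in> Mat n" "c *\<^sub>C a \<in> Mat n" "adj a \<in> Mat n" "- a \<in> Mat n" "a - b \<in> Mat n"
    "(0 :: 'a minf) \<in> Mat n"
  using assms by (auto simp: Mat_def plus_minf.rep_eq entry_times[OF assms(1)] scaleC_minf.rep_eq
      scaleC_zero_right adj_minf.rep_eq adj_zero uminus_minf.rep_eq minus_minf.rep_eq zero_minf.rep_eq)

lemma ex_Mat2: "\<exists>n. (a :: 'a minf) \<in> Mat n \<and> (b :: 'a minf) \<in> Mat n"
proof -
  obtain m n where "a \<in> Mat m" "b \<in> Mat n" using ex_Mat by blast
  then have "a \<in> Mat (max m n)" "b \<in> Mat (max m n)" using Mat_mono by (metis max.cobounded1 max.cobounded2 subsetD)+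
  then show ?thesis by blast
qed

lemma mat_norm_triangle: "mat_norm (a + b) \<le> mat_norm a + mat_norm (b :: 'a minf)"
proof -
  obtain n where n: "a \<in> Mat n" "b \<in> Mat n" using ex_Mat2 by blast
  show ?thesis
  proof (rule mat_norm_le[OF Mat_closed(1)[OF n]])
    fix x :: "nat \<Rightarrow> 'a" assume x: "col_norm n x \<le> 1"
    have "mv (a + b) n x = (\<lambda>i. mv a n x i + mv b n x i)"
      by (simp add: mv_def plus_minf.rep_eq distrib_right sum.distrib fun_eq_iff)
    then have "col_norm n (mv (a + b) n x) \<le> col_norm n (mv a n x) + col_norm n (mv b n x)"
      by (simp add: col_norm_triangle)
    also have "\<dots> \<le> mat_norm a + mat_norm b" by (intro add_mono mat_norm_bound1 n x)
    finally show "col_norm n (mv (a + b) n x) \<le> mat_norm a + mat_norm b" .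
  qed
qed

lemma mat_norm_times: "mat_norm (a * b) \<le> mat_norm a * mat_norm (b :: 'a minf)"
proof -
  obtain n where n: "a \<in> Mat n" "b \<in> Mat n" using ex_Mat2 by blast
  show ?thesis
  proof (rule mat_norm_le[OF Mat_closed(2)[OF n]])
    fix x :: "nat \<Rightarrow> 'a" assume x: "col_norm n x \<le> 1"
    have "col_norm n (mv (a * b) n x) \<le> mat_norm a * col_norm n (mv b n x)"
      unfolding mv_times[OF n(1)] by (rule mat_norm_bound[OF n(1)])
    also have "\<dots> \<le> mat_norm a * mat_norm b"
      by (intro mult_left_mono mat_norm_bound1 n x mat_norm_nonneg)
    finally show "col_norm n (mv (a * b) n x) \<le> mat_norm a * mat_norm b" .
  qed
qed

lemma mat_norm_scaleC_le: "mat_norm (c *\<^sub>C a) \<le> cmod c * mat_norm (a :: 'a minf)"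
proof -
  obtain n where n: "a \<in> Mat n" using ex_Mat by blast
  show ?thesis
  proof (rule mat_norm_le[OF Mat_closed(3)[OF n n]])
    fix x :: "nat \<Rightarrow> 'a" assume x: "col_norm n x \<le> 1"
    have "mv (c *\<^sub>C a) n x = (\<lambda>i. c *\<^sub>C mv a n x i)"
      by (simp add: mv_def scaleC_minf.rep_eq scaleC_sum mult_scaleC_left fun_eq_iff)
    then show "col_norm n (mv (c *\<^sub>C a) n x) \<le> cmod c * mat_norm a"
      using mat_norm_bound1[OF n x] by (simp add: col_norm_scaleC mult_left_mono)
  qed
qed

lemma mat_norm_scaleC: "mat_norm (c *\<^sub>C a) = cmod c * mat_norm (a :: 'a minf)"
proof (cases "c = 0")
  case True
  have "0 *\<^sub>C a = 0"
    by (metis add_cancel_right_right add.right_neutral scaleC_add_left)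
  then show ?thesis using True mat_norm_scaleC_le[of 0 a] mat_norm_nonneg[of "0 *\<^sub>C a"] by simp
next
  case False
  have "mat_norm a = mat_norm ((1/c) *\<^sub>C (c *\<^sub>C a))"
    using False by (simp add: scaleC_scaleC scaleC_one)
  also have "\<dots> \<le> cmod (1/c) * mat_norm (c *\<^sub>C a)" by (rule mat_norm_scaleC_le)
  finally show ?thesis
    using False mat_norm_scaleC_le[of c a] by (simp add: norm_divide field_simps)
qed

text \<open>One inequality is Cauchy-Schwarz for x and \<open>adj a * a\<close> applied to x. It
  also forces a and \<open>adj a\<close> to have the same norm, which gives the other one.\<close>

lemma mat_norm_adj_times: "mat_norm (adj a * a) = (mat_norm (a :: 'a minf))\<^sup>2"
proof -
  have le: "(mat_norm a)\<^sup>2 \<le> mat_norm (adj a * a)" for a :: "'a minf"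
  proof -
    obtain n where n: "a \<in> Mat n" using ex_Mat by blast
    have "mat_norm a \<le> sqrt (mat_norm (adj a * a))"
    proof (rule mat_norm_le[OF n])
      fix x :: "nat \<Rightarrow> 'a" assume x: "col_norm n x \<le> 1"
      have "(col_norm n (mv a n x))\<^sup>2 = norm (cip n x (mv (adj a * a) n x))"
        using n by (simp add: col_norm_sq mv_adj mv_times Mat_closed)
      also have "\<dots> \<le> col_norm n x * col_norm n (mv (adj a * a) n x)"
        by (rule cip_Cauchy_Schwarz)
      also have "\<dots> \<le> 1 * mat_norm (adj a * a)"
        using n x by (intro mult_mono mat_norm_bound1 Mat_closed col_norm_nonneg) auto
      finally show "col_norm n (mv a n x) \<le> sqrt (mat_norm (adj a * a))"
        by (simp add: real_le_rsqrt)
    qed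
    then have "(mat_norm a)\<^sup>2 \<le> (sqrt (mat_norm (adj a * a)))\<^sup>2"
      by (intro power_mono mat_norm_nonneg)
    then show ?thesis by (simp add: mat_norm_nonneg)
  qed
  have adj: "mat_norm a \<le> mat_norm (adj a)" for a :: "'a minf"
  proof (cases "mat_norm a = 0")
    case False
    have "mat_norm a * mat_norm a \<le> mat_norm (adj a) * mat_norm a"
      using le[of a] mat_norm_times[of "adj a" a] by (simp add: power2_eq_square)
    then show ?thesis using False mat_norm_nonneg[of a] by simp
  qed (simp add: mat_norm_nonneg)
  have "mat_norm (adj a) = mat_norm a" using adj[of a] adj[of "adj a"] by (simp add: adj_adj)
  then show ?thesis using le[of a] mat_norm_times[of "adj a" a] by (simp add: power2_eq_square)
qed

lemma mat_norm_eq_0: "mat_norm a = 0 \<longleftrightarrow> a = (0 :: 'a minf)"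
proof
  assume "mat_norm a = 0"
  then have "entry a i j = 0" for i j using entry_le_mat_norm[of a i j] by simp
  then show "a = 0" by (intro minf_eqI) (simp add: zero_minf.rep_eq)
next
  assume "a = 0"
  then show "mat_norm a = 0"
    using mat_norm_crude[of a 0] mat_norm_nonneg[of a] by (simp add: Mat_def zero_minf.rep_eq)
qed

end

instantiation minf :: (unital_cstar_algebra) cstar_normed_algebra
begin

definition scaleR_minf :: "real \<Rightarrow> 'a minf \<Rightarrow> 'a minf" where
  "scaleR_minf r a = complex_of_real r *\<^sub>C a"

definition norm_minf :: "'a minf \<Rightarrow> real" where "norm_minf = mat_norm"

definition dist_minf :: "'a minf \<Rightarrow> 'a minf \<Rightarrow> real" where "dist_minf a b = norm (a - b)"

definition sgn_minf :: "'a minf \<Rightarrow> 'a minf" where "sgn_minf a = inverse (norm a) *\<^sub>R a"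

definition uniformity_minf :: "('a minf \<times> 'a minf) filter" where
  "uniformity_minf = (INF \<epsilon>\<in>{0 <..}. principal {(x, y). dist x y < \<epsilon>})"

definition open_minf :: "'a minf set \<Rightarrow> bool" where
  "open_minf U \<longleftrightarrow> (\<forall>x\<in>U. eventually (\<lambda>(x', y). x' = x \<longrightarrow> y \<in> U) uniformity)"

instance
  by intro_classes
    (simp_all add: scaleR_minf_def norm_minf_def dist_minf_def sgn_minf_def uniformity_minf_def open_minf_def
      scaleC_add_right scaleC_add_left scaleC_scaleC scaleC_one mult_scaleC_left mult_scaleC_right
      mat_norm_triangle mat_norm_times mat_norm_scaleC mat_norm_adj_times mat_norm_eq_0)

end

no_notation lepoll (infixl \<open>\<lesssim>\<close> 50)

lemma norm_mult3: "norm (a * b * c) \<le> norm a * norm b * norm (c :: 'a :: real_normed_algebra)"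
  by (rule order_trans[OF norm_mult_ineq mult_right_mono[OF norm_mult_ineq norm_ge_zero]])

lemma norm_null_comparison:
  assumes "\<And>n. norm (f n :: 'a :: real_normed_vector) \<le> g n" "g \<longlonglongrightarrow> 0"
  shows "f \<longlonglongrightarrow> 0"
  by (rule Lim_null_comparison[OF _ assms(2)]) (simp add: assms(1))

section \<open>Order and functional calculus in \<open>M\<^sub>\<infinity>(A)\<close>\<close>

lift_definition unitm :: "nat \<Rightarrow> 'a :: zero_neq_one minf" is
  "\<lambda>n i j. if i = j \<and> i < n then 1 else 0"
proof -
  fix n :: nat
  show "\<exists>m. \<forall>i j. m \<le> i \<or> m \<le> j \<longrightarrow> (if i = j \<and> i < n then 1 else 0 :: 'a) = 0"
    by (intro exI[of _ n]) auto
qed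

lemma unitm_Mat: "unitm n \<in> Mat n"
  by (simp add: Mat_def unitm.rep_eq)

lemma unitm_left: "a \<in> Mat n \<Longrightarrow> unitm n * a = (a :: 'a :: unital_cstar_algebra minf)"
proof (rule minf_eqI)
  fix i j assume a: "a \<in> Mat n"
  have "entry (unitm n * a) i j = (\<Sum>k<n. if i = k then entry a k j else 0)"
    unfolding entry_times[OF unitm_Mat] by (intro sum.cong) (auto simp: unitm.rep_eq)
  then show "entry (unitm n * a) i j = entry a i j" using a by (auto simp: Mat_def)
qed

lemma unitm_right: "a \<in> Mat n \<Longrightarrow> a * unitm n = (a :: 'a :: unital_cstar_algebra minf)"
proof (rule minf_eqI)
  fix i j assume a: "a \<in> Mat n"
  have "entry (a * unitm n) i j = (\<Sum>k<n. if k = j then entry a i k else 0)"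
    unfolding entry_times[OF a] by (intro sum.cong) (auto simp: unitm.rep_eq)
  then show "entry (a * unitm n) i j = entry a i j" using a by (auto simp: Mat_def)
qed

text \<open>The norm lies between the norm of each entry and the sum of all of them, so completeness
  passes from A entry by entry.\<close>

lemma complete_Mat: "complete (Mat n :: 'a :: unital_cstar_algebra minf set)"
  unfolding complete_def
proof (intro allI impI)
  fix x :: "nat \<Rightarrow> 'a minf" assume x: "(\<forall>k. x k \<in> Mat n) \<and> Cauchy x"
  have "Cauchy (\<lambda>k. entry (x k) i j)" for i j
  proof (rule CauchyI)
    fix \<epsilon> :: real assume "0 < \<epsilon>"
    then obtain M where M: "\<And>p q. p \<ge> M \<Longrightarrow> q \<ge> M \<Longrightarrow> norm (x p - x q) < \<epsilon>"
      using x CauchyD by blast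
    have "norm (entry (x p) i j - entry (x q) i j) \<le> norm (x p - x q)" for p q
      using entry_le_mat_norm[of "x p - x q" i j] by (simp add: minus_minf.rep_eq norm_minf_def)
    then show "\<exists>M. \<forall>p\<ge>M. \<forall>q\<ge>M. norm (entry (x p) i j - entry (x q) i j) < \<epsilon>"
      using M le_less_trans by blast
  qed
  then have "\<exists>l. (\<lambda>k. entry (x k) i j) \<longlonglongrightarrow> l" for i j
    by (metis Cauchy_convergent convergentD)
  then obtain L where L: "\<And>i j. (\<lambda>k. entry (x k) i j) \<longlonglongrightarrow> L i j" by metis
  have z: "L i j = 0" if "n \<le> i \<or> n \<le> j" for i j
  proof -
    have "(\<lambda>k. entry (x k) i j) = (\<lambda>k. 0)" using x that by (auto simp: Mat_def)
    then show ?thesis using L[of i j] by (simp add: LIMSEQ_const_iff)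
  qed
  define l where "l = Abs_minf L"
  have el: "entry l i j = L i j" for i j
    unfolding l_def using z by (subst Abs_minf_inverse) auto
  then have lM: "l \<in> Mat n" using z by (simp add: Mat_def)
  have "(\<lambda>k. \<Sum>i<n. \<Sum>j<n. norm (entry (x k) i j - L i j)) \<longlonglongrightarrow> (\<Sum>i<n. \<Sum>j<n. 0)"
    by (intro tendsto_sum tendsto_norm_zero) (use L LIM_zero in blast)
  moreover have "norm (x k - l) \<le> (\<Sum>i<n. \<Sum>j<n. norm (entry (x k) i j - L i j))" for k
    using mat_norm_crude[of "x k - l" n] x lM
    by (simp add: Mat_closed norm_minf_def minus_minf.rep_eq el)
  ultimately have "(\<lambda>k. x k - l) \<longlonglongrightarrow> 0"
    by (intro norm_null_comparison[of "\<lambda>k. x k - l"]) simp_all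
  then show "\<exists>l\<in>Mat n. x \<longlonglongrightarrow> l" using lM LIM_zero_cancel by blast
qed

lemma cstar_unit_Mat: "cstar_unit (Mat n :: 'a :: unital_cstar_algebra minf set) (unitm n)"
  by (rule cstar_unit.intro)
    (assumption | rule Mat_closed unitm_Mat unitm_left unitm_right complete_Mat)+

abbreviation mpos :: "nat \<Rightarrow> 'a :: unital_cstar_algebra minf \<Rightarrow> bool" where
  "mpos n \<equiv> cstar_unit.pos (Mat n) (unitm n)"

lemmas M_adj_mem = cstar_unit.adj_mem[OF cstar_unit_Mat]
lemmas M_adj_unit = cstar_unit.adj_unit[OF cstar_unit_Mat]
lemmas M_cf_mem = cstar_unit.cf_mem[OF cstar_unit_Mat]
lemmas M_mult_mem = cstar_unit.mult_mem[OF cstar_unit_Mat]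
lemmas M_norm_unit = cstar_unit.norm_unit[OF cstar_unit_Mat]
lemmas M_pos_add = cstar_unit.pos_add[OF cstar_unit_Mat]
lemmas M_pos_adj_times = cstar_unit.pos_adj_times[OF cstar_unit_Mat]
lemmas M_pos_cf = cstar_unit.pos_cf[OF cstar_unit_Mat]
lemmas M_pos_cpos = cstar_unit.pos_cpos[OF cstar_unit_Mat]
lemmas M_pos_def = cstar_unit.pos_def[OF cstar_unit_Mat]
lemmas M_pos_iff = cstar_unit.pos_iff[OF cstar_unit_Mat]
lemmas M_pos_mem = cstar_unit.pos_mem[OF cstar_unit_Mat]
lemmas M_pos_mult = cstar_unit.pos_mult[OF cstar_unit_Mat]
lemmas M_pos_norm_mono = cstar_unit.pos_norm_mono[OF cstar_unit_Mat]
lemmas M_pos_unit_diff = cstar_unit.pos_unit_diff[OF cstar_unit_Mat]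

lemma Mat_sub: "a \<in> Mat m \<Longrightarrow> m \<le> n \<Longrightarrow> a \<in> Mat n"
  using Mat_mono by blast

lemma ex_Mat3: "\<exists>n. (a :: 'a :: unital_cstar_algebra minf) \<in> Mat n \<and> (b :: 'a minf) \<in> Mat n \<and> (c :: 'a minf) \<in> Mat n"
proof -
  obtain l m n where "a \<in> Mat l" "b \<in> Mat m" "c \<in> Mat n" using ex_Mat by metis
  then have "a \<in> Mat (max l (max m n))" "b \<in> Mat (max l (max m n))" "c \<in> Mat (max l (max m n))"
    by (auto intro: Mat_sub)
  then show ?thesis by blast
qed

text \<open>The witness x in \<open>minf_pos\<close> may live in a larger matrix algebra. Then the
  estimate that defines \<open>pos\<close> there is compressed by \<open>unitm n\<close>, which
  fixes a and cuts the larger unit down to the smaller one.\<close>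

lemma minf_pos_iff: "a \<in> Mat n \<Longrightarrow> a \<in> minf_pos \<longleftrightarrow> mpos n (a :: 'a :: unital_cstar_algebra minf)"
proof
  assume a: "a \<in> Mat n" and "a \<in> minf_pos"
  then obtain x where x: "a = adj x * x" by (auto simp: minf_pos_def)
  obtain N where N: "x \<in> Mat N" "a \<in> Mat N" using ex_Mat2 by blast
  have "mpos N a" using M_pos_adj_times[OF N(1)] x by simp
  then obtain t where t: "t \<ge> 0" "norm (t *\<^sub>R unitm N - a) \<le> t" "adj a = a" by (auto simp: M_pos_def)
  show "mpos n a"
  proof (cases "N \<le> n")
    case True
    then have "x \<in> Mat n" using N Mat_sub by blast
    then show ?thesis using M_pos_adj_times x by simp
  next
    case False
    then have "unitm n \<in> (Mat N :: 'a minf set)" using unitm_Mat Mat_sub by (metis nat_le_linear)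
    then have "unitm n * (t *\<^sub>R unitm N - a) * unitm n = t *\<^sub>R unitm n - a"
      using a by (simp add: right_diff_distrib left_diff_distrib unitm_left unitm_right unitm_Mat)
    then have "norm (t *\<^sub>R unitm n - a) \<le> norm (unitm n :: 'a minf) * norm (t *\<^sub>R unitm N - a) * norm (unitm n :: 'a minf)"
      using norm_mult3 by metis
    also have "\<dots> \<le> 1 * t * 1" by (intro mult_mono M_norm_unit t mult_nonneg_nonneg) auto
    finally show ?thesis using a t by (auto simp: M_pos_def)
  qed
next
  assume "mpos n a"
  then show "a \<in> minf_pos" by (auto simp: M_pos_iff minf_pos_def)
qed

lemma psd_adj: "a \<in> minf_pos \<Longrightarrow> adj a = a"
  by (auto simp: minf_pos_def adj_simps)

lemma psd_cpos: "a \<in> minf_pos \<Longrightarrow> cpos a"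
  using ex_Mat[of a] minf_pos_iff M_pos_cpos by blast

lemma psd_square: "adj x * x \<in> minf_pos" "x * adj x \<in> minf_pos"
  by (auto simp: minf_pos_def) (metis adj_adj)

lemma psd_square': "adj x = x \<Longrightarrow> x * x \<in> minf_pos"
  using psd_square(1)[of x] by simp

lemma psd_0 [simp]: "0 \<in> minf_pos"
  using psd_square(1)[of 0] by simp

lemma psd_add: "a \<in> minf_pos \<Longrightarrow> b \<in> minf_pos \<Longrightarrow> a + b \<in> minf_pos"
proof -
  obtain n where n: "a \<in> Mat n" "b \<in> Mat n" using ex_Mat2 by blast
  then show "a \<in> minf_pos \<Longrightarrow> b \<in> minf_pos \<Longrightarrow> a + b \<in> minf_pos"
    using M_pos_add Mat_closed(1)[OF n] by (simp add: minf_pos_iff[where n = n])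
qed

lemma psd_sum: "(\<And>i. i \<in> I \<Longrightarrow> f i \<in> minf_pos) \<Longrightarrow> sum f I \<in> minf_pos"
  by (induction I rule: infinite_finite_induct) (auto intro: psd_add)

lemma psd_scale:
  assumes a: "a \<in> minf_pos" "0 \<le> r"
  shows "r *\<^sub>R a \<in> minf_pos"
proof -
  obtain x where x: "a = adj x * x" using a(1) by (auto simp: minf_pos_def)
  have "r *\<^sub>R a = adj (sqrt r *\<^sub>R x) * (sqrt r *\<^sub>R x)" using a by (simp add: x adj_simps)
  then show ?thesis by (simp only: psd_square)
qed

lemma psd_conj: "a \<in> minf_pos \<Longrightarrow> adj y * a * y \<in> minf_pos" "a \<in> minf_pos \<Longrightarrow> y * a * adj y \<in> minf_pos"
proof -
  have "adj y * a * y \<in> minf_pos" if p: "a \<in> minf_pos" for y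
  proof -
    obtain x where x: "a = adj x * x" using p by (auto simp: minf_pos_def)
    have "adj y * a * y = adj (x * y) * (x * y)" by (simp add: x adj_simps mult.assoc)
    then show ?thesis by (simp only: psd_square)
  qed
  from this[of y] this[of "adj y"] show "a \<in> minf_pos \<Longrightarrow> adj y * a * y \<in> minf_pos"
    "a \<in> minf_pos \<Longrightarrow> y * a * adj y \<in> minf_pos" by (simp_all add: adj_simps)
qed

lemma psd_norm_mono:
  assumes "a \<in> minf_pos" "b - a \<in> minf_pos"
  shows "norm a \<le> norm b"
proof -
  obtain n where n: "a \<in> Mat n" "b \<in> Mat n" using ex_Mat2 by blast
  then show ?thesis
    using assms Mat_closed(6)[OF n(2,1)] by (intro M_pos_norm_mono[of n]) (simp_all add: minf_pos_iff)
qed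

lemma psd_unit_diff:
  assumes "a \<in> Mat n" "adj a = a" "norm a \<le> r"
  shows "r *\<^sub>R unitm n - a \<in> minf_pos"
  using M_pos_unit_diff[OF assms] M_pos_mem minf_pos_iff by blast

lemma psd_mult:
  assumes "a \<in> minf_pos" "b \<in> minf_pos" "a * b = b * a"
  shows "a * b \<in> minf_pos"
proof -
  obtain n where n: "a \<in> Mat n" "b \<in> Mat n" using ex_Mat2 by blast
  then have "mpos n a" "mpos n b" using assms minf_pos_iff by blast+
  then have "mpos n (a * b)" using assms M_pos_mult by blast
  then show ?thesis using minf_pos_iff M_pos_mem by blast
qed

lemma psd_cf: "a \<in> minf_pos \<Longrightarrow> C0 f \<Longrightarrow> (\<And>x. x \<ge> 0 \<Longrightarrow> f x \<ge> 0) \<Longrightarrow> cf f a \<in> minf_pos"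
proof -
  assume a: "a \<in> minf_pos" and f: "C0 f" "\<And>x. x \<ge> 0 \<Longrightarrow> f x \<ge> 0"
  obtain n where n: "a \<in> Mat n" using ex_Mat by blast
  then have "mpos n a" using a minf_pos_iff by blast
  then have "mpos n (cf f a)" by (rule M_pos_cf) (rule f, rule f)
  then show ?thesis using M_pos_mem minf_pos_iff by blast
qed

lemma psd_cf_diff:
  assumes a: "a \<in> minf_pos" and fg: "C0 f" "C0 g" and le: "\<And>x. 0 \<le> x \<Longrightarrow> x \<le> norm a \<Longrightarrow> f x \<le> g x"
  shows "cf g a - cf f a \<in> minf_pos"
proof -
  \<comment> \<open>The inequality is known on [0, norm a] only; truncation makes the difference
    nonnegative everywhere.\<close>
  let ?h = "\<lambda>x. max 0 (g x - f x)"
  have h: "C0 ?h" using fg by (auto simp: C0_def intro!: continuous_intros)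
  have "cf g a - cf f a = cf (\<lambda>x. g x - f x) a" using cf_diff[OF psd_cpos[OF a] fg(2,1)] by simp
  also have "\<dots> = cf ?h a" by (intro cf_cong psd_cpos a h C0_simps fg) (use le in auto)
  finally show ?thesis using psd_cf[OF a h] by simp
qed

lemma cf_Mat: "a \<in> minf_pos \<Longrightarrow> a \<in> Mat n \<Longrightarrow> C0 f \<Longrightarrow> cf f a \<in> Mat n"
  by (intro M_cf_mem psd_cpos)

lemma cf_sqrt:
  assumes "a \<in> minf_pos"
  shows "cf sqrt a \<in> minf_pos" "cf sqrt a * cf sqrt a = a"
proof -
  have C: "C0 sqrt" using C0_sqrt[OF C0_simps(1)] by simp
  then show "cf sqrt a \<in> minf_pos" by (intro psd_cf assms) auto
  show "cf sqrt a * cf sqrt a = a"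
    using cf_square_sqrt[OF psd_cpos[OF assms] C0_simps(1)] cf_id[OF psd_cpos[OF assms]] by simp
qed

lemma cf_times_adj_intertwine: "C0 f \<Longrightarrow> cf f (x * adj x) * x = x * cf f (adj x * (x :: 'a :: unital_cstar_algebra minf))"
  by (intro cf_intertwine psd_cpos psd_square) (auto simp: mult.assoc)

text \<open>\<open>rsq d\<close> is a bounded substitute for the inverse square root, accurate away from zero.\<close>

definition rsq :: "real \<Rightarrow> real \<Rightarrow> real" where
  "rsq d s = sqrt s / (s + d)"

lemma C0_rsq: "d > 0 \<Longrightarrow> C0 (rsq d)"
  unfolding C0_def rsq_def[abs_def] by (auto intro!: continuous_intros)

lemma rsq_est1:
  assumes "0 \<le> s" "0 < d" shows "\<bar>sqrt s - s * rsq d s\<bar> \<le> sqrt d"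
proof -
  have "sqrt s * d \<le> sqrt d * (s + d)"
  proof -
    have "2 * (sqrt s * sqrt d) \<le> s + d"
      using arith_geo_mean_sqrt[of s d] assms by (simp add: real_sqrt_mult)
    moreover have "0 \<le> sqrt s * sqrt d" using assms by simp
    ultimately have "sqrt s * sqrt d \<le> s + d" by linarith
    then have "sqrt d * (sqrt s * sqrt d) \<le> sqrt d * (s + d)" using assms by (intro mult_left_mono) auto
    moreover have "sqrt d * (sqrt s * sqrt d) = sqrt s * d" using assms by (simp add: mult.left_commute)
    ultimately show ?thesis by simp
  qed
  moreover have "sqrt s - s * rsq d s = sqrt s * d / (s + d)"
    using assms by (simp add: rsq_def field_simps)
  ultimately show ?thesis using assms by (simp add: abs_mult divide_le_eq)
qed

lemma rsq_est2:
  assumes "0 \<le> s" "0 < d"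
  shows "0 \<le> s * (rsq d s * rsq d s)" "s * (rsq d s * rsq d s) \<le> 1"
    "s * (1 - s * (rsq d s * rsq d s)) \<le> 2 * d"
proof -
  have e: "s * (rsq d s * rsq d s) = (s / (s + d)) * (s / (s + d))"
    using assms by (simp add: rsq_def)
  have r: "0 \<le> s / (s + d)" "s / (s + d) \<le> 1" using assms by auto
  show "0 \<le> s * (rsq d s * rsq d s)" "s * (rsq d s * rsq d s) \<le> 1"
    unfolding e using r mult_mono[OF r(2) r(2)] by (auto simp del: times_divide_times_eq)
  have sq: "1 - q * q = (1 - q) * (1 + q)" for q :: real by (simp add: algebra_simps)
  have "1 - s / (s + d) = d / (s + d)" using assms by (simp add: field_simps)
  then have "1 - s * (rsq d s * rsq d s) = d / (s + d) * (1 + s / (s + d))"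
    unfolding e using sq[of "s / (s + d)"] by simp
  then have "s * (1 - s * (rsq d s * rsq d s)) = (s / (s + d)) * (1 + s / (s + d)) * d" by simp
  also have "\<dots> \<le> 1 * (1 + 1) * d" using r assms by (intro mult_mono add_mono) auto
  finally show "s * (1 - s * (rsq d s * rsq d s)) \<le> 2 * d" by simp
qed

section \<open>Cuntz comparison\<close>

lemma cuntz_leD:
  assumes "a \<lesssim> b" "0 < \<epsilon>"
  shows "\<exists>v. norm (a - v * b * adj v) < \<epsilon>"
proof -
  obtain v :: "nat \<Rightarrow> 'a minf" where "(\<lambda>k. mat_norm (a - v k * b * adj (v k))) \<longlonglongrightarrow> 0"
    using assms by (auto simp: cuntz_le_def)
  then have "\<forall>\<^sub>F k in sequentially. mat_norm (a - v k * b * adj (v k)) < \<epsilon>"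
    using assms order_tendstoD(2) by blast
  then show ?thesis unfolding norm_minf_def using eventually_happens trivial_limit_sequentially by blast
qed

text \<open>The conjugators need not lie in the matrix algebra of a and b: compressing them by
  \<open>unitm n\<close> changes neither a nor b and does not increase the error.\<close>

lemma cuntz_leI:
  assumes "\<And>\<epsilon>. 0 < \<epsilon> \<Longrightarrow> \<exists>v. norm (a - v * b * adj v) < \<epsilon>"
  shows "a \<lesssim> b"
proof -
  obtain n where n: "a \<in> Mat n" "b \<in> Mat n" using ex_Mat2 by blast
  have "\<forall>k. \<exists>v. norm (a - v * b * adj v) < 1 / real (Suc k)" using assms by simp
  then obtain v where v: "\<And>k. norm (a - v k * b * adj (v k)) < 1 / real (Suc k)" by metis
  let ?e = "unitm n :: 'a minf"
  define w where "w k = ?e * v k * ?e" for k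
  have wM: "w k \<in> Mat n" for k
  proof -
    obtain N where "v k \<in> Mat N" "?e \<in> Mat N" using ex_Mat2 by blast
    then show ?thesis
      by (auto simp: w_def Mat_def entry_times unitm.rep_eq if_distrib[of "\<lambda>z. z * _"] if_distrib[of "\<lambda>z. _ * z"]
          entry_times[OF M_mult_mem, of ?e N "v k" ?e] cong: if_cong intro!: sum.neutral)
  qed
  have "norm (a - w k * b * adj (w k)) \<le> 1 / real (Suc k)" for k
  proof -
    have "?e * (a - v k * b * adj (v k)) * ?e = ?e * a * ?e - ?e * v k * b * (adj (v k) * ?e)"
      by (simp add: right_diff_distrib left_diff_distrib mult.assoc)
    also have "\<dots> = a - ?e * v k * (?e * b * ?e) * (adj (v k) * ?e)"
      using n by (simp add: unitm_left unitm_right)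
    also have "\<dots> = a - w k * b * adj (w k)"
      by (simp add: w_def adj_simps M_adj_unit mult.assoc)
    finally have "a - w k * b * adj (w k) = ?e * (a - v k * b * adj (v k)) * ?e" by simp
    also have "norm \<dots> \<le> norm ?e * norm (a - v k * b * adj (v k)) * norm ?e"
      by (rule norm_mult3)
    also have "\<dots> \<le> 1 * (1 / real (Suc k)) * 1"
      using v[of k] by (intro mult_mono M_norm_unit mult_nonneg_nonneg) auto
    finally show ?thesis by simp
  qed
  then have "\<And>k. norm (norm (a - w k * b * adj (w k))) \<le> inverse (real (Suc k))"
    by (simp add: inverse_eq_divide)
  then have "(\<lambda>k. norm (a - w k * b * adj (w k))) \<longlonglongrightarrow> 0"
    using LIMSEQ_inverse_real_of_nat by (rule norm_null_comparison)
  then show ?thesis unfolding cuntz_le_def norm_minf_def using n wM by blast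
qed

lemma cuntz_conj: "v * b * adj v \<lesssim> b"
  by (rule cuntz_leI) (metis diff_self norm_zero)

lemma cuntz_refl: "a \<lesssim> a"
proof -
  obtain n where "a \<in> Mat n" using ex_Mat by blast
  then have "unitm n * a * adj (unitm n) = a" by (simp add: M_adj_unit unitm_left unitm_right)
  then show ?thesis using cuntz_conj by metis
qed

lemma cuntz_trans [trans]:
  assumes "a \<lesssim> b" "b \<lesssim> c" shows "a \<lesssim> c"
proof (rule cuntz_leI)
  fix \<epsilon> :: real assume "0 < \<epsilon>"
  then obtain v where v: "norm (a - v * b * adj v) < \<epsilon> / 2" using cuntz_leD[OF assms(1)] half_gt_zero by blast
  define K where "K = (norm v)\<^sup>2 + 1"
  define r where "r = \<epsilon> / 2 / K"
  have k: "K > 0" by (simp add: K_def add_nonneg_pos)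
  then have "r > 0" using \<open>0 < \<epsilon>\<close> by (simp add: r_def)
  then obtain w where w: "norm (b - w * c * adj w) < r" using cuntz_leD[OF assms(2)] by blast
  have "a - (v * w) * c * adj (v * w) = (a - v * b * adj v) + v * (b - w * c * adj w) * adj v"
    by (simp add: algebra_simps adj_simps)
  also have "norm \<dots> \<le> norm (a - v * b * adj v) + norm v * norm (b - w * c * adj w) * norm (adj v)"
    by (intro order_trans[OF norm_triangle_ineq] add_left_mono norm_mult3)
  also have "norm v * norm (b - w * c * adj w) * norm (adj v) = (norm v)\<^sup>2 * norm (b - w * c * adj w)"
    by (simp add: norm_adj power2_eq_square)
  also have "\<dots> \<le> K * r" using w by (intro mult_mono) (auto simp: K_def)
  also have "\<dots> = \<epsilon> / 2" using k by (simp add: r_def)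
  finally show "\<exists>u. norm (a - u * c * adj u) < \<epsilon>" using v by (intro exI[of _ "v * w"]) simp
qed

lemma cuntz_scale: "0 \<le> r \<Longrightarrow> r *\<^sub>R a \<lesssim> a"
proof -
  assume r: "0 \<le> r"
  obtain n where "a \<in> Mat n" using ex_Mat by blast
  then have "(sqrt r *\<^sub>R unitm n) * a * adj (sqrt r *\<^sub>R unitm n) = r *\<^sub>R a"
    using r by (simp add: M_adj_unit unitm_left unitm_right adj_simps)
  then show ?thesis using cuntz_conj by metis
qed

text \<open>If \<open>m2 \<le> y\<close> then \<open>w = m2\<^sup>1\<^sup>/\<^sup>2 (rsq d y)\<close> nearly conjugates \<open>y\<close> into \<open>m2\<close>.\<close>

lemma rsq_conj_est:
  assumes m2: "m2 \<in> minf_pos" "y - m2 \<in> minf_pos" and d: "0 < d"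
  defines "m \<equiv> cf sqrt m2" and "w \<equiv> cf sqrt m2 * cf (rsq d) y"
  shows "norm (m2 - w * y * adj w) \<le> sqrt (2 * d) * norm m"
proof -
  have y: "y \<in> minf_pos" using psd_add[OF m2] by simp
  note cp = psd_cpos[OF y]
  define g where "g = (\<lambda>s. s * (rsq d s * rsq d s))"
  have C: "C0 (rsq d)" by (rule C0_rsq[OF d])
  have g: "C0 g" unfolding g_def by (intro C0_simps C0_cont C)
  define G where "G = cf g y"
  have Ga: "adj G = G" unfolding G_def by (intro cf_adj cp g)
  have m: "adj m = m" "m * m = m2" using cf_sqrt[OF m2(1)] psd_adj by (auto simp: m_def)
  have aw: "adj w = cf (rsq d) y * m" unfolding w_def by (simp add: adj_simps cf_adj cp C m m_def[symmetric])
  have "cf (rsq d) y * y * cf (rsq d) y = G"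
  proof -
    have "cf (rsq d) y * y * cf (rsq d) y = cf (\<lambda>s. rsq d s * s * rsq d s) y"
      using cf_mult[OF cp C0_simps(5)[OF C C0_cont[OF C0_simps(1)]] C] cf_mult[OF cp C C0_simps(1)] cf_id[OF cp]
      by simp
    also have "(\<lambda>s. rsq d s * s * rsq d s) = g" by (auto simp: g_def)
    finally show ?thesis by (simp add: G_def)
  qed
  moreover have "w * y * adj w = m * (cf (rsq d) y * y * cf (rsq d) y) * m"
    unfolding aw by (simp add: w_def m_def mult.assoc)
  ultimately have wyw: "w * y * adj w = m * G * m" by simp
  \<comment> \<open>X is m (1 - G) with G close to the support of y. As m^2 = m2 \<le> y,
    \<open>adj X * X\<close> is at most (1 - G) y (1 - G), a function of y bounded by 2 d.\<close>
  define X where "X = m - m * G"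
  have aX: "adj X = m - G * m" by (simp add: X_def adj_simps m Ga)
  have XX: "adj X * X = m2 - G * m2 - m2 * G + G * m2 * G"
    unfolding aX by (simp add: X_def algebra_simps m(2)[symmetric])
  have "y - G * y - y * G + G * y * G - adj X * X = (y - m2) - G * (y - m2) - (y - m2) * G + G * (y - m2) * G"
    unfolding XX by (simp add: algebra_simps)
  also have "\<dots> \<in> minf_pos"
  proof -
    obtain n where n: "y - m2 \<in> Mat n" "G \<in> Mat n" using ex_Mat2 by blast
    have 1: "(unitm n - G) * (y - m2) = (y - m2) - G * (y - m2)"
      using n by (simp add: left_diff_distrib[of "unitm n"] unitm_left)
    have 2: "z * (unitm n - G) = z - z * G" if "z \<in> Mat n" for z
      using that by (simp add: right_diff_distrib unitm_right)
    have "adj (unitm n - G) * (y - m2) * (unitm n - G) = ((y - m2) - G * (y - m2)) * (unitm n - G)"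
      by (simp only: adj_diff M_adj_unit Ga 1)
    also have "\<dots> = (y - m2) - G * (y - m2) - ((y - m2) - G * (y - m2)) * G"
      by (rule 2) (intro Mat_closed n)
    finally have "(y - m2) - G * (y - m2) - (y - m2) * G + G * (y - m2) * G
        = adj (unitm n - G) * (y - m2) * (unitm n - G)"
      by (simp add: left_diff_distrib[of "y - m2" "G * (y - m2)"])
    then show ?thesis using psd_conj(1)[OF m2(2)] by simp
  qed
  finally have "norm (adj X * X) \<le> norm (y - G * y - y * G + G * y * G)"
    by (intro psd_norm_mono psd_square)
  also have "y - G * y - y * G + G * y * G = cf (\<lambda>s. s - g s * s - s * g s + g s * s * g s) y"
  proof -
    have c: "C0 (\<lambda>s. g s * s)" "C0 (\<lambda>s. s * g s)" "C0 (\<lambda>s. g s * s * g s)"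
      by (intro C0_simps C0_cont g)+
    have "G * y = cf (\<lambda>s. g s * s) y" "y * G = cf (\<lambda>s. s * g s) y" "G * y * G = cf (\<lambda>s. g s * s * g s) y"
      unfolding G_def by (simp_all add: cf_mult[OF cp c(1) g] cf_mult[OF cp g C0_simps(1)]
        cf_mult[OF cp C0_simps(1) g] cf_id[OF cp])
    moreover have "cf (\<lambda>s. s - g s * s - s * g s + g s * s * g s) y
        = y - cf (\<lambda>s. g s * s) y - cf (\<lambda>s. s * g s) y + cf (\<lambda>s. g s * s * g s) y"
      using cf_add[OF cp C0_simps(3)[OF C0_simps(3)[OF C0_simps(1) c(1)] c(2)] c(3)]
        cf_diff[OF cp C0_simps(3)[OF C0_simps(1) c(1)] c(2)] cf_diff[OF cp C0_simps(1) c(1)]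
      by (simp add: cf_id[OF cp])
    ultimately show ?thesis by simp
  qed
  also have "norm \<dots> \<le> 2 * d"
  proof (rule cf_norm[OF cp])
    show "C0 (\<lambda>s. s - g s * s - s * g s + g s * s * g s)" by (intro C0_simps C0_cont g)
    fix s :: real assume s: "0 \<le> s"
    have "s - g s * s - s * g s + g s * s * g s = (s * (1 - g s)) * (1 - g s)" by (simp add: algebra_simps)
    moreover have "0 \<le> g s" "g s \<le> 1" "s * (1 - g s) \<le> 2 * d" using rsq_est2[OF s d] by (auto simp: g_def)
    moreover have "(s * (1 - g s)) * (1 - g s) \<le> (2 * d) * 1"
      using mult_mono[of "s * (1 - g s)" "2 * d" "1 - g s" 1] calculation d by simp
    ultimately show "\<bar>s - g s * s - s * g s + g s * s * g s\<bar> \<le> 2 * d" using s by simp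
  qed
  finally have "(norm X)\<^sup>2 \<le> 2 * d" by (simp add: norm_adj_times)
  then have X: "norm X \<le> sqrt (2 * d)" by (simp add: real_le_rsqrt)
  have "m2 - w * y * adj w = X * m" by (simp add: wyw X_def left_diff_distrib m)
  then have "norm (m2 - w * y * adj w) \<le> norm X * norm m" by (simp add: norm_mult_ineq)
  also have "\<dots> \<le> sqrt (2 * d) * norm m" by (intro mult_right_mono X) simp
  finally show ?thesis .
qed

lemma rsq_conj_tendsto:
  assumes "m2 \<in> minf_pos" "y - m2 \<in> minf_pos"
  defines "w \<equiv> \<lambda>n. cf sqrt m2 * cf (rsq (1 / real (Suc n))) y"
  shows "(\<lambda>n. w n * y * adj (w n)) \<longlonglongrightarrow> m2"
proof -
  have "(\<lambda>n. sqrt (2 * (1 / real (Suc n))) * norm (cf sqrt m2)) \<longlonglongrightarrow> sqrt (2 * 0) * norm (cf sqrt m2)"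
    using LIMSEQ_inverse_real_of_nat by (intro tendsto_intros) (simp add: inverse_eq_divide)
  then have "(\<lambda>n. sqrt (2 * (1 / real (Suc n))) * norm (cf sqrt m2)) \<longlonglongrightarrow> 0" by simp
  moreover have "norm (m2 - w n * y * adj (w n)) \<le> sqrt (2 * (1 / real (Suc n))) * norm (cf sqrt m2)" for n
    unfolding w_def by (rule rsq_conj_est[OF assms(1,2)]) simp
  ultimately have "(\<lambda>n. m2 - w n * y * adj (w n)) \<longlonglongrightarrow> 0"
    by (intro norm_null_comparison[of "\<lambda>n. m2 - w n * y * adj (w n)"])
  from tendsto_diff[OF tendsto_const[of m2] this] show ?thesis by simp
qed

lemma le_cuntz:
  assumes "a \<in> minf_pos" "b - a \<in> minf_pos"
  shows "a \<lesssim> b"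
proof (rule cuntz_leI)
  fix \<epsilon> :: real assume \<epsilon>: "0 < \<epsilon>"
  define w where "w n = cf sqrt a * cf (rsq (1 / real (Suc n))) b" for n
  have "(\<lambda>n. w n * b * adj (w n)) \<longlonglongrightarrow> a" unfolding w_def by (rule rsq_conj_tendsto[OF assms])
  then obtain n where "norm (w n * b * adj (w n) - a) < \<epsilon>" using LIMSEQ_D[OF _ \<epsilon>] by blast
  then show "\<exists>v. norm (a - v * b * adj v) < \<epsilon>" by (metis norm_minus_commute)
qed

text \<open>x is the limit of the products of the square root of m2, the regularised inverse square
  root of \<open>z * adj z\<close>, and z. Each of them ends in z, so x keeps every right unit of z;
  this is how \<open>cuntz_factor\<close> controls where x is supported.\<close>

lemma le_factor:
  assumes m2: "m2 \<in> minf_pos" "z * adj z - m2 \<in> minf_pos"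
  obtains x where "x * adj x = m2" "\<And>k. z * k = z \<Longrightarrow> x * k = x"
proof -
  define w where "w n = cf sqrt m2 * cf (rsq (1 / real (Suc n))) (z * adj z)" for n
  have lim: "(\<lambda>n. w n * (z * adj z) * adj (w n)) \<longlonglongrightarrow> m2"
    unfolding w_def by (rule rsq_conj_tendsto[OF m2])
  define t where "t = adj z * z"
  have t: "cpos t" and zz: "cpos (z * adj z)" unfolding t_def by (intro psd_cpos psd_square)+
  have est: "norm (w n * z - w k * z) \<le> sqrt (1 / real (Suc n)) + sqrt (1 / real (Suc k))" for n k
  proof -
    define r where "r = (\<lambda>s. rsq (1 / real (Suc n)) s - rsq (1 / real (Suc k)) s)"
    have r: "C0 r" unfolding r_def by (intro C0_simps C0_rsq) auto
    define D where "D = cf r (z * adj z)"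
    have Da: "adj D = D" unfolding D_def by (intro cf_adj zz r)
    define m where "m = cf sqrt m2"
    have m: "adj m = m" "m * m = m2" using cf_sqrt[OF m2(1)] psd_adj by (auto simp: m_def)
    have D: "D = cf (rsq (1 / real (Suc n))) (z * adj z) - cf (rsq (1 / real (Suc k))) (z * adj z)"
      unfolding D_def r_def by (intro cf_diff zz C0_rsq) auto
    have wz: "w n * z - w k * z = m * (D * z)"
      unfolding D by (simp add: w_def m_def left_diff_distrib right_diff_distrib mult.assoc del: of_nat_Suc)
    \<comment> \<open>The bound of m2 by \<open>z * adj z\<close> allows replacing m by
      \<open>adj z\<close>, and \<open>adj z * D * z\<close> is the function s r(s) of
      \<open>adj z * z\<close>, to which \<open>rsq_est1\<close> applies.\<close>
    have "(norm (m * (D * z)))\<^sup>2 = norm (adj (D * z) * m2 * (D * z))"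
      unfolding norm_adj_times[symmetric] by (simp add: adj_simps m(1) mult.assoc m(2)[symmetric])
    also have "\<dots> \<le> norm (adj (D * z) * (z * adj z) * (D * z))"
    proof (intro psd_norm_mono psd_conj m2)
      have "adj (D * z) * (z * adj z) * (D * z) - adj (D * z) * m2 * (D * z) = adj (D * z) * (z * adj z - m2) * (D * z)"
        by (simp add: algebra_simps)
      then show "adj (D * z) * (z * adj z) * (D * z) - adj (D * z) * m2 * (D * z) \<in> minf_pos"
        using psd_conj(1)[OF m2(2)] by simp
    qed
    also have "adj (D * z) * (z * adj z) * (D * z) = adj (adj z * D * z) * (adj z * D * z)"
      by (simp add: adj_simps Da mult.assoc)
    also have "norm \<dots> = (norm (adj z * D * z))\<^sup>2" by (rule norm_adj_times)
    finally have "norm (m * (D * z)) \<le> norm (adj z * D * z)" by (rule power2_le_imp_le) simp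
    also have "adj z * D * z = cf (\<lambda>s. s * r s) t"
      using cf_times_adj_intertwine[OF r, of z] cf_mult[OF t C0_simps(1) r] cf_id[OF t]
      by (simp add: D_def t_def mult.assoc)
    also have "norm \<dots> \<le> sqrt (1 / real (Suc n)) + sqrt (1 / real (Suc k))"
    proof (rule cf_norm[OF t])
      show "C0 (\<lambda>s. s * r s)" by (intro C0_simps C0_cont r)
      fix s :: real assume s: "0 \<le> s"
      have "s * r s = s * rsq (1 / real (Suc n)) s - s * rsq (1 / real (Suc k)) s"
        by (simp add: r_def right_diff_distrib)
      then show "\<bar>s * r s\<bar> \<le> sqrt (1 / real (Suc n)) + sqrt (1 / real (Suc k))"
        using rsq_est1[OF s, of "1 / real (Suc n)"] rsq_est1[OF s, of "1 / real (Suc k)"] by simp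
    qed
    finally show ?thesis by (simp add: wz)
  qed
  have "Cauchy (\<lambda>n. w n * z)"
  proof (rule CauchyI')
    fix \<epsilon> :: real assume \<epsilon>: "0 < \<epsilon>"
    have "(\<lambda>n. sqrt (1 / real (Suc n))) \<longlonglongrightarrow> sqrt 0"
      using LIMSEQ_inverse_real_of_nat by (intro tendsto_intros) (simp add: inverse_eq_divide)
    then obtain N where N: "sqrt (1 / real (Suc n)) < \<epsilon> / 2" if "n \<ge> N" for n
      using order_tendstoD(2)[of _ "sqrt 0" sequentially "\<epsilon> / 2"] \<epsilon> by (auto simp: eventually_sequentially)
    show "\<exists>M. \<forall>m\<ge>M. \<forall>n>m. dist (w m * z) (w n * z) < \<epsilon>"
    proof (intro exI allI impI)
      fix m n assume "N \<le> m" "m < n"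
      then show "dist (w m * z) (w n * z) < \<epsilon>"
        using N[of m] N[of n] est[of m n] by (simp add: dist_norm)
    qed
  qed
  moreover obtain n where n: "m2 \<in> Mat n" "z \<in> Mat n" using ex_Mat2 by blast
  moreover have "w k * z \<in> Mat n" for k
    unfolding w_def using n
    by (intro M_mult_mem cf_Mat m2 C0_rsq psd_square M_adj_mem) (auto intro: C0_sqrt[OF C0_simps(1)])
  ultimately obtain x where x: "(\<lambda>n. w n * z) \<longlonglongrightarrow> x"
    using complete_Mat[of n] unfolding complete_def by metis
  have "(\<lambda>n. (w n * z) * adj (w n * z)) \<longlonglongrightarrow> x * adj x"
    by (intro tendsto_mult tendsto_adj x)
  then have "x * adj x = m2"
    using lim LIMSEQ_unique by (auto simp: adj_simps mult.assoc)
  moreover have "x * k = x" if "z * k = z" for k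
  proof -
    have "(\<lambda>n. w n * z * k) \<longlonglongrightarrow> x * k" by (intro tendsto_intros x)
    then show ?thesis using x LIMSEQ_unique that by (auto simp: mult.assoc)
  qed
  ultimately show ?thesis using that by blast
qed

lemma unitm_compress: "unitm n * v * unitm n \<in> (Mat n :: 'a :: unital_cstar_algebra minf set)"
proof -
  obtain N where N: "v \<in> Mat N" "(unitm n :: 'a minf) \<in> Mat N" using ex_Mat2 by blast
  have "entry (unitm n * v * unitm n) i j = 0" if "n \<le> i" for i j
    unfolding mult.assoc entry_times[OF unitm_Mat] by (rule sum.neutral) (use that in \<open>auto simp: unitm.rep_eq\<close>)
  moreover have "entry (unitm n * v * unitm n) i j = 0" if "n \<le> j" for i j
    unfolding entry_times[OF Mat_closed(2)[OF N(2,1)]]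
    by (rule sum.neutral) (use that in \<open>auto simp: unitm.rep_eq\<close>)
  ultimately show ?thesis by (auto simp: Mat_def)
qed

lemma Mat_hereditary:
  assumes "x \<in> Mat n" "y \<in> Mat n"
  shows "x * z * y \<in> (Mat n :: 'a :: unital_cstar_algebra minf set)"
proof -
  have "unitm n * (x * z * y) * unitm n = (unitm n * x) * z * (y * unitm n)" by (simp only: mult.assoc)
  then show ?thesis
    using unitm_compress[of n "x * z * y"] assms by (simp add: unitm_left unitm_right)
qed

lemma cf_zero: "C0 f \<Longrightarrow> cf f (0 :: 'a :: unital_cstar_algebra minf) = 0"
  using cf_norm[of "0 :: 'a minf" f 0] psd_cpos[OF psd_0] by (auto simp: C0_def)

lemma cf_mult_zero:
  assumes "a \<in> minf_pos" "C0 f" "a * z = 0" shows "cf f a * z = 0"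
  using cf_intertwine[OF psd_cpos[OF assms(1)] psd_cpos[OF psd_0] assms(2), of z] assms
  by (simp add: cf_zero)

lemma orth_sym: "a \<in> minf_pos \<Longrightarrow> b \<in> minf_pos \<Longrightarrow> a * b = 0 \<Longrightarrow> b * a = 0"
  by (metis adj_mult adj_zero psd_adj)

lemma cf_add_orth:
  assumes ab: "a \<in> minf_pos" "b \<in> minf_pos" "a * b = 0" and f: "C0 f"
  shows "cf f (a + b) = cf f a + cf f b"
proof -
  have ba: "b * a = 0" by (rule orth_sym[OF ab])
  have z: "pow_Suc a i * b = 0" "pow_Suc b i * a = 0" for i
    using pow_Suc_commute[of a b 0 i] pow_Suc_commute[of b a 0 i] ab ba by (induction i) (auto simp: mult.assoc)
  have "pow_Suc (a + b) i = pow_Suc a i + pow_Suc b i" for i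
    by (induction i) (simp_all add: distrib_left distrib_right z)
  then have dv: "dval (a + b) p = dval a p + dval b p" for p
    by (simp add: dval_def scaleR_add_right sum.distrib)
  define M where "M = max (norm (a + b)) (max (norm a) (norm b))"
  obtain p where p: "uniform_limit {0..M} (\<lambda>n x. x * poly (p n) x) f sequentially"
    using C0_uniform_limit f by metis
  have lim: "(\<lambda>n. dval c (p n)) \<longlonglongrightarrow> cf f c" if "c \<in> minf_pos" "norm c \<le> M" for c
    by (intro cf_tendsto psd_cpos that f uniform_limit_on_subset[OF p]) (use that in auto)
  have "(\<lambda>n. dval (a + b) (p n)) \<longlonglongrightarrow> cf f (a + b)" "(\<lambda>n. dval a (p n)) \<longlonglongrightarrow> cf f a"
    "(\<lambda>n. dval b (p n)) \<longlonglongrightarrow> cf f b"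
    by (auto intro!: lim ab psd_add simp: M_def)
  from this(1) tendsto_add[OF this(2,3)] show ?thesis
    unfolding dv using LIMSEQ_unique by blast
qed

section \<open>Cut-offs and perturbation of Cuntz comparison\<close>

definition excess :: "real \<Rightarrow> real \<Rightarrow> real" where "excess \<epsilon> s = max 0 (s - \<epsilon>)"

text \<open>A continuous substitute for the spectral projection of (\<delta>, \<infinity>): it
  vanishes up to \<delta> and is 1 from 2 \<delta> on, so it acts as a unit on functions supported
  above 2 \<delta>.\<close>

definition ramp :: "real \<Rightarrow> real \<Rightarrow> real" where "ramp \<delta> s = min 1 (max 0 (s / \<delta> - 1))"

lemma C0_cut: "0 \<le> \<epsilon> \<Longrightarrow> C0 (excess \<epsilon>)"
  by (auto simp: C0_def excess_def[abs_def] intro!: continuous_intros)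

lemma C0_ramp: "0 < \<delta> \<Longrightarrow> C0 (ramp \<delta>)"
  by (auto simp: C0_def ramp_def[abs_def] intro!: continuous_intros)

lemma cut_nonneg: "0 \<le> excess \<epsilon> s" and ramp_nonneg: "0 \<le> ramp \<delta> s" and ramp_le_1: "ramp \<delta> s \<le> 1"
  by (auto simp: excess_def ramp_def)

lemma ramp_eq_0: "0 < \<delta> \<Longrightarrow> s \<le> \<delta> \<Longrightarrow> ramp \<delta> s = 0"
  by (simp add: ramp_def max_def field_simps)

lemma ramp_eq_1: "0 < \<delta> \<Longrightarrow> 2 * \<delta> \<le> s \<Longrightarrow> ramp \<delta> s = 1"
  by (simp add: ramp_def max_def min_def field_simps)

lemma psd_cut: "a \<in> minf_pos \<Longrightarrow> 0 \<le> \<epsilon> \<Longrightarrow> cf (excess \<epsilon>) a \<in> minf_pos"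
  by (intro psd_cf C0_cut cut_nonneg)

lemma psd_ramp: "a \<in> minf_pos \<Longrightarrow> 0 < \<delta> \<Longrightarrow> cf (ramp \<delta>) a \<in> minf_pos"
  by (intro psd_cf C0_ramp ramp_nonneg)

lemma norm_ramp: "a \<in> minf_pos \<Longrightarrow> 0 < \<delta> \<Longrightarrow> norm (cf (ramp \<delta>) a) \<le> 1"
  by (intro cf_norm psd_cpos C0_ramp) (use ramp_nonneg[of \<delta>] ramp_le_1[of \<delta>] in auto)

lemma norm_cut:
  assumes "a \<in> minf_pos" "0 \<le> \<epsilon>" shows "norm (a - cf (excess \<epsilon>) a) \<le> \<epsilon>"
proof -
  note cp = psd_cpos[OF assms(1)]
  have "a - cf (excess \<epsilon>) a = cf (\<lambda>x. x - excess \<epsilon> x) a"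
    using cf_diff[OF cp C0_simps(1) C0_cut[OF assms(2)]] cf_id[OF cp] by simp
  also have "norm \<dots> \<le> \<epsilon>"
    using assms by (intro cf_norm cp C0_simps C0_cut) (auto simp: excess_def)
  finally show ?thesis .
qed

lemma cut_cut:
  assumes "a \<in> minf_pos" "0 \<le> \<epsilon>" "0 \<le> \<delta>"
  shows "cf (excess \<epsilon>) (cf (excess \<delta>) a) = cf (excess (\<epsilon> + \<delta>)) a"
proof -
  have "(\<lambda>x. excess \<epsilon> (excess \<delta> x)) = excess (\<epsilon> + \<delta>)" using assms by (auto simp: excess_def)
  then show ?thesis
    using cf_comp[OF psd_cpos[OF assms(1)] C0_cut[OF assms(3)] cut_nonneg C0_cut[OF assms(2)]] by simp
qed

lemma cuntz_cf:
  assumes a: "a \<in> minf_pos" and f: "C0 f" "\<And>x. 0 \<le> x \<Longrightarrow> 0 \<le> f x" and g: "C0 g"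
    and le: "\<And>x. 0 \<le> x \<Longrightarrow> x \<le> norm a \<Longrightarrow> f x \<le> C * g x" and C: "0 \<le> C"
  shows "cf f a \<lesssim> cf g a"
proof -
  have "cf (\<lambda>x. C * g x) a - cf f a \<in> minf_pos"
    by (rule psd_cf_diff[OF a f(1) C0_simps(4)[OF g] le])
  then have "cf f a \<lesssim> C *\<^sub>R cf g a"
    using le_cuntz[OF psd_cf[OF a f]] cf_scale[OF psd_cpos[OF a] g] by simp
  then show ?thesis using cuntz_scale[OF C] cuntz_trans by blast
qed

lemma cuntz_cut:
  assumes "a \<in> minf_pos" "0 \<le> \<epsilon>" shows "cf (excess \<epsilon>) a \<lesssim> a"
proof -
  have "cf (excess \<epsilon>) a \<lesssim> cf (\<lambda>x. x) a"
    by (rule cuntz_cf[where C = 1]) (use assms in \<open>auto simp: C0_cut excess_def C0_simps\<close>)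
  then show ?thesis using cf_id[OF psd_cpos[OF assms(1)]] by simp
qed

lemma cuntz_ramp: "a \<in> minf_pos \<Longrightarrow> 0 < \<delta> \<Longrightarrow> cf (ramp \<delta>) a \<lesssim> cf (excess \<delta>) a"
  by (rule cuntz_cf[where C = "1 / \<delta>"])
    (auto simp: C0_cut C0_ramp ramp_nonneg excess_def ramp_def field_simps min_def max_def)

lemma cuntz_cut_ramp:
  assumes "a \<in> minf_pos" "0 < \<delta>" shows "cf (excess (2 * \<delta>)) a \<lesssim> cf (ramp \<delta>) a"
proof (rule cuntz_cf[where C = "norm a"])
  fix x assume x: "0 \<le> x" "x \<le> norm a"
  show "excess (2 * \<delta>) x \<le> norm a * ramp \<delta> x"
  proof (cases "2 * \<delta> \<le> x")
    case True
    then show ?thesis using x assms by (simp add: ramp_eq_1 excess_def)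
  qed (use ramp_nonneg[of \<delta> x] in \<open>simp add: excess_def\<close>)
qed (use assms in \<open>auto simp: C0_cut C0_ramp cut_nonneg\<close>)

lemma cuntz_from_cut:
  assumes a: "a \<in> minf_pos" and le: "\<And>\<epsilon>. 0 < \<epsilon> \<Longrightarrow> cf (excess \<epsilon>) a \<lesssim> b"
  shows "a \<lesssim> b"
proof (rule cuntz_leI)
  fix \<epsilon> :: real assume \<epsilon>: "0 < \<epsilon>"
  then obtain v where v: "norm (cf (excess (\<epsilon>/2)) a - v * b * adj v) < \<epsilon> / 2"
    using cuntz_leD[OF le, of "\<epsilon>/2" "\<epsilon>/2"] by auto
  have "norm (a - v * b * adj v) \<le> norm (a - cf (excess (\<epsilon>/2)) a) + norm (cf (excess (\<epsilon>/2)) a - v * b * adj v)"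
    using norm_triangle_ineq[of "a - cf (excess (\<epsilon>/2)) a" "cf (excess (\<epsilon>/2)) a - v * b * adj v"] by simp
  then show "\<exists>v. norm (a - v * b * adj v) < \<epsilon>"
    using v norm_cut[OF a, of "\<epsilon>/2"] \<epsilon> by (intro exI[of _ v]) linarith
qed

text \<open>Take F = \<phi>(a) with \<phi>(s)^2 (s - \<epsilon>0) = (s - \<epsilon>)_+. Then (a -
  \<epsilon>)_+ = F (a - \<epsilon>0) F, and a - \<epsilon>0 \<le> y in the unital algebra.\<close>

lemma cut_le_conj:
  assumes a: "a \<in> minf_pos" and y: "adj y = y" and n: "norm (a - y) \<le> \<epsilon>0" "0 \<le> \<epsilon>0" "\<epsilon>0 < \<epsilon>"
  obtains F where "adj F = F" "\<And>m. a \<in> Mat m \<Longrightarrow> F \<in> Mat m" "F * y * F - cf (excess \<epsilon>) a \<in> minf_pos"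
proof -
  \<comment> \<open>The maximum keeps the denominator away from 0; where it differs from s -
    \<epsilon>0 the numerator vanishes.\<close>
  define \<phi> where "\<phi> = (\<lambda>s. sqrt (max 0 (s - \<epsilon>) / max (s - \<epsilon>0) (\<epsilon> - \<epsilon>0)))"
  have \<phi>: "C0 \<phi>" using n by (auto simp: C0_def \<phi>_def intro!: continuous_intros)
  note cp = psd_cpos[OF a]
  define F where "F = cf \<phi> a"
  have F: "adj F = F" unfolding F_def by (intro cf_adj cp \<phi>)
  obtain m where m: "a \<in> Mat m" "y \<in> Mat m" using ex_Mat2 by blast
  have Fm: "F \<in> Mat k" if "a \<in> Mat k" for k unfolding F_def by (intro cf_Mat a that \<phi>)
  have "\<phi> s * s * \<phi> s - \<epsilon>0 * (\<phi> s * \<phi> s) = excess \<epsilon> s" for s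
  proof -
    have "\<phi> s * \<phi> s = max 0 (s - \<epsilon>) / max (s - \<epsilon>0) (\<epsilon> - \<epsilon>0)" using n by (simp add: \<phi>_def)
    then have "\<phi> s * s * \<phi> s - \<epsilon>0 * (\<phi> s * \<phi> s) = (s - \<epsilon>0) * (max 0 (s - \<epsilon>) / max (s - \<epsilon>0) (\<epsilon> - \<epsilon>0))"
      by (metis left_diff_distrib mult.assoc mult.commute)
    also have "\<dots> = excess \<epsilon> s"
      using n by (cases "s \<le> \<epsilon>") (auto simp: excess_def max_def)
    finally show ?thesis .
  qed
  then have "cf (excess \<epsilon>) a = cf (\<lambda>s. \<phi> s * s * \<phi> s - \<epsilon>0 * (\<phi> s * \<phi> s)) a" by simp
  also have "\<dots> = F * a * F - \<epsilon>0 *\<^sub>R (F * F)"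
  proof -
    have c: "C0 (\<lambda>s. \<phi> s * s)" "C0 (\<lambda>s. \<phi> s * s * \<phi> s)" "C0 (\<lambda>s. \<phi> s * \<phi> s)"
      by (intro C0_simps C0_cont \<phi>)+
    then show ?thesis
      using cf_diff[OF cp c(2) C0_simps(4)[OF c(3), of \<epsilon>0]] cf_mult[OF cp c(1) \<phi>]
        cf_mult[OF cp \<phi> C0_simps(1)] cf_mult[OF cp \<phi> \<phi>] cf_scale[OF cp c(3), of \<epsilon>0]
      by (simp add: F_def cf_id[OF cp])
  qed
  finally have c: "cf (excess \<epsilon>) a = F * a * F - \<epsilon>0 *\<^sub>R (F * F)" .
  have "\<epsilon>0 *\<^sub>R unitm m - (a - y) \<in> minf_pos"
    using m n psd_adj[OF a] y by (intro psd_unit_diff Mat_closed) (auto simp: adj_diff)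
  then have "adj F * (\<epsilon>0 *\<^sub>R unitm m - (a - y)) * F \<in> minf_pos" by (rule psd_conj)
  moreover have "adj F * (\<epsilon>0 *\<^sub>R unitm m - (a - y)) * F = F * y * F - cf (excess \<epsilon>) a"
    unfolding c F by (simp add: right_diff_distrib left_diff_distrib unitm_right[OF Fm[OF m(1)]])
  ultimately show ?thesis using that F Fm by simp
qed

lemma cut_cuntz_near:
  assumes "a \<in> minf_pos" "b \<in> minf_pos" "norm (a - b) < \<epsilon>"
  shows "cf (excess \<epsilon>) a \<lesssim> b"
proof -
  obtain F where F: "adj F = F" "F * b * F - cf (excess \<epsilon>) a \<in> minf_pos"
    using cut_le_conj[OF assms(1) psd_adj[OF assms(2)] order_refl norm_ge_zero assms(3)] by metis
  have "0 \<le> \<epsilon>" using assms(3) norm_ge_zero[of "a - b"] by linarith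
  then have "cf (excess \<epsilon>) a \<lesssim> F * b * adj F"
    using F by (intro le_cuntz psd_cut assms) auto
  then show ?thesis using cuntz_conj cuntz_trans by blast
qed

text \<open>The Kirchberg--Rordam form of Cuntz comparison.\<close>

lemma cuntz_factor:
  assumes a: "a \<in> minf_pos" and b: "b \<in> minf_pos" and ab: "a \<lesssim> b" and \<epsilon>: "0 < \<epsilon>"
  obtains x \<gamma> where "0 < \<gamma>" "cf (excess \<epsilon>) a = x * adj x" "x * cf (ramp \<gamma>) b = x"
    "\<And>n. a \<in> Mat n \<Longrightarrow> b \<in> Mat n \<Longrightarrow> x \<in> Mat n"
proof -
  obtain v where v: "norm (a - v * b * adj v) < \<epsilon> / 4" using cuntz_leD[OF ab] \<epsilon> by (metis zero_less_divide_iff zero_less_numeral)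
  define K where "K = (norm v)\<^sup>2 + 1"
  have K: "K > 0" by (simp add: K_def add_nonneg_pos)
  \<comment> \<open>Chosen so that cutting b by \<gamma> costs at most \<epsilon>/4. Together with
    the error of v this stays within \<epsilon>/2, strictly below the cut at \<epsilon>.\<close>
  define \<gamma> where "\<gamma> = \<epsilon> / 4 / K"
  have \<gamma>: "\<gamma> > 0" using \<epsilon> K by (simp add: \<gamma>_def)
  define b' where "b' = cf (excess \<gamma>) b"
  have b': "b' \<in> minf_pos" unfolding b'_def using \<gamma> by (intro psd_cut b) simp
  have "norm (v * (b - b') * adj v) \<le> norm v * norm (b - b') * norm (adj v)" by (rule norm_mult3)
  also have "\<dots> = (norm v)\<^sup>2 * norm (b - b')" by (simp add: norm_adj power2_eq_square)
  also have "\<dots> \<le> K * \<gamma>"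
    using norm_cut[OF b, of \<gamma>] \<gamma> unfolding b'_def by (intro mult_mono) (auto simp: K_def)
  also have "\<dots> = \<epsilon> / 4" using K by (simp add: \<gamma>_def)
  finally have "norm (v * (b - b') * adj v) \<le> \<epsilon> / 4" .
  moreover have eq: "a - v * b' * adj v = (a - v * b * adj v) + v * (b - b') * adj v"
    by (simp add: algebra_simps)
  have "norm (a - v * b' * adj v) \<le> norm (a - v * b * adj v) + norm (v * (b - b') * adj v)"
    unfolding eq by (rule norm_triangle_ineq)
  ultimately have "norm (a - v * b' * adj v) \<le> norm (a - v * b * adj v) + \<epsilon> / 4" by linarith
  then have n: "norm (a - v * b' * adj v) \<le> \<epsilon> / 2" using v by simp
  have sa: "adj (v * b' * adj v) = v * b' * adj v" by (intro psd_adj psd_conj b')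
  obtain F where F: "adj F = F" "F * (v * b' * adj v) * F - cf (excess \<epsilon>) a \<in> minf_pos"
    by (rule cut_le_conj[OF a sa n]) (use \<epsilon> in auto)
  \<comment> \<open>z ends in the square root of (b - \<gamma>)_+, so
    \<open>cf (ramp (\<gamma>/2)) b\<close> is a right unit of z, and \<open>le_factor\<close>
    passes this on to x.\<close>
  define z where "z = F * v * cf sqrt b'"
  have "adj (cf sqrt b') = cf sqrt b'" using cf_sqrt[OF b'] psd_adj by blast
  then have "z * adj z = F * v * (cf sqrt b' * cf sqrt b') * adj v * F"
    by (simp add: z_def adj_simps F mult.assoc)
  then have "z * adj z - cf (excess \<epsilon>) a \<in> minf_pos" using F cf_sqrt[OF b'] by (simp add: mult.assoc)
  then obtain x where x: "x * adj x = cf (excess \<epsilon>) a" "\<And>k. z * k = z \<Longrightarrow> x * k = x"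
    using le_factor[OF psd_cut[OF a]] \<epsilon> by (metis less_imp_le)
  note cpb = psd_cpos[OF b]
  have s: "C0 sqrt" using C0_sqrt[OF C0_simps(1)] by simp
  have sc: "C0 (\<lambda>s. sqrt (excess \<gamma> s))" using \<gamma> by (intro C0_sqrt C0_cut) simp
  have r: "C0 (ramp (\<gamma>/2))" using \<gamma> by (intro C0_ramp) simp
  have "cf sqrt b' * cf (ramp (\<gamma>/2)) b = cf (\<lambda>s. sqrt (excess \<gamma> s) * ramp (\<gamma>/2) s) b"
    unfolding b'_def cf_mult[OF cpb sc r]
    using \<gamma> by (subst cf_comp[OF cpb]) (auto intro!: C0_cut cut_nonneg s)
  also have "\<dots> = cf (\<lambda>s. sqrt (excess \<gamma> s)) b"
  proof (rule cf_cong[OF cpb C0_simps(5)[OF sc C0_cont[OF r]] sc])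
    fix s :: real assume "0 \<le> s"
    show "sqrt (excess \<gamma> s) * ramp (\<gamma>/2) s = sqrt (excess \<gamma> s)"
      using ramp_eq_1[of "\<gamma>/2" s] \<gamma> by (cases "s \<le> \<gamma>") (auto simp: excess_def)
  qed
  also have "\<dots> = cf sqrt b'"
    unfolding b'_def using \<gamma> by (subst cf_comp[OF cpb]) (auto intro!: C0_cut cut_nonneg s)
  finally have "z * cf (ramp (\<gamma>/2)) b = z" by (simp add: z_def mult.assoc)
  then have xr: "x * cf (ramp (\<gamma>/2)) b = x" by (rule x(2))
  have "x \<in> Mat n" if n: "a \<in> Mat n" "b \<in> Mat n" for n
  proof -
    have c: "cf (excess \<epsilon>) a \<in> Mat n" using n \<epsilon> by (intro cf_Mat a C0_cut) auto
    obtain N where N: "x \<in> Mat N" "unitm n \<in> (Mat N :: 'a minf set)" using ex_Mat2 by blast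
    \<comment> \<open>As \<open>x * adj x\<close> lies in \<open>Mat n\<close>,
      \<open>?u * adj ?u\<close> vanishes, which settles the left side of x. The right side follows
      from the ramp of b.\<close>
    let ?u = "unitm n * x - x"
    have "?u * adj ?u = unitm n * (x * adj x) * unitm n - unitm n * (x * adj x) - (x * adj x) * unitm n + x * adj x"
      by (simp add: adj_simps M_adj_unit algebra_simps)
    also have "\<dots> = 0" unfolding x(1) by (simp add: unitm_left[OF c] unitm_right[OF c])
    finally have "adj (adj ?u) * adj ?u = 0" by (simp add: adj_adj)
    then have "norm (adj ?u) = 0" using norm_adj_times[of "adj ?u"] by simp
    then have "unitm n * x = x" by (simp add: norm_adj)
    moreover have "x * unitm n = x"
    proof -
      have "cf (ramp (\<gamma>/2)) b * unitm n = cf (ramp (\<gamma>/2)) b"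
        by (intro unitm_right cf_Mat b n r)
      then show ?thesis using xr by (metis mult.assoc)
    qed
    ultimately show ?thesis using unitm_compress[of n x] by simp
  qed
  then show ?thesis using that[of "\<gamma>/2" x] \<gamma> x(1) xr by simp
qed

text \<open>Conjugating \<open>adj x * x\<close> by R x gives R t^2 R with t =
  \<open>x * adj x\<close>, and this tends to t when R is the regularised inverse square root of
  t.\<close>

lemma cuntz_mult_adj: "x * adj x \<lesssim> adj x * x"
proof (rule cuntz_leI)
  fix \<epsilon> :: real assume \<epsilon>: "0 < \<epsilon>"
  define d where "d = \<epsilon> / 3"
  have d: "d > 0" using \<epsilon> by (simp add: d_def)
  have C: "C0 (rsq d)" by (rule C0_rsq[OF d])
  define t where "t = x * adj x"
  have t: "t \<in> minf_pos" "cpos t" unfolding t_def by (intro psd_cpos psd_square)+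
  define R where "R = cf (rsq d) t"
  have R: "adj R = R" unfolding R_def by (intro cf_adj t C)
  have c: "C0 (\<lambda>s. rsq d s * s)" "C0 (\<lambda>s. rsq d s * s * s)" "C0 (\<lambda>s. rsq d s * s * s * rsq d s)"
    by (intro C0_simps C0_cont C)+
  have "R * t * t * R = cf (\<lambda>s. rsq d s * s * s * rsq d s) t"
    unfolding R_def by (simp add: cf_mult[OF t(2) c(2) C] cf_mult[OF t(2) c(1) C0_simps(1)]
      cf_mult[OF t(2) C C0_simps(1)] cf_id[OF t(2)])
  then have "t - R * t * t * R = cf (\<lambda>s. s - rsq d s * s * s * rsq d s) t"
    using cf_diff[OF t(2) C0_simps(1) c(3)] cf_id[OF t(2)] by simp
  also have "norm \<dots> \<le> 2 * d"
  proof (rule cf_norm[OF t(2) C0_simps(3)[OF C0_simps(1) c(3)]])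
    fix s :: real assume s: "0 \<le> s"
    have "s - rsq d s * s * s * rsq d s = s * (1 - s * (rsq d s * rsq d s))" by (simp add: algebra_simps)
    then show "\<bar>s - rsq d s * s * s * rsq d s\<bar> \<le> 2 * d"
      using rsq_est2[OF s d] s by simp
  qed
  finally have "norm (t - R * t * t * R) < \<epsilon>" using \<epsilon> by (simp add: d_def)
  moreover have "(R * x) * (adj x * x) * adj (R * x) = R * t * t * R"
    by (simp add: t_def adj_simps R mult.assoc)
  ultimately show "\<exists>v. norm (x * adj x - v * (adj x * x) * adj v) < \<epsilon>"
    unfolding t_def by metis
qed

lemma cuntz_adj_mult: "adj x * x \<lesssim> x * adj x"
  using cuntz_mult_adj[of "adj x"] by (simp add: adj_adj)

lemma cuntz_compress:
  assumes "X \<in> minf_pos" shows "adj w * X * w \<lesssim> adj w * w"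
proof -
  obtain n where n: "X \<in> Mat n" "w \<in> Mat n" using ex_Mat2 by blast
  have "adj w * (norm X *\<^sub>R unitm n - X) * w \<in> minf_pos"
    by (intro psd_conj psd_unit_diff n psd_adj assms) simp
  then have "norm X *\<^sub>R (adj w * w) - adj w * X * w \<in> minf_pos"
    using n by (simp add: right_diff_distrib left_diff_distrib mult.assoc unitm_left)
  then have "adj w * X * w \<lesssim> norm X *\<^sub>R (adj w * w)" by (intro le_cuntz psd_conj assms)
  then show ?thesis using cuntz_scale[OF norm_ge_zero] cuntz_trans by blast
qed

text \<open>Makes the dimension of \<open>adj x * x\<close> subadditive in x. The missing term of
  the parallelogram identity is positive, being of the same form.\<close>

lemma parallelogram_cuntz:
  "adj (x + y) * (x + y) \<lesssim> adj x * x + adj y * y"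
proof -
  have "2 *\<^sub>R (adj x * x + adj y * y) - adj (x + y) * (x + y) = adj (x - y) * (x - y)"
    by (simp add: adj_simps algebra_simps scaleR_2)
  also have "\<dots> \<in> minf_pos" by (rule psd_square)
  finally have "adj (x + y) * (x + y) \<lesssim> 2 *\<^sub>R (adj x * x + adj y * y)"
    by (intro le_cuntz psd_square)
  then show ?thesis using cuntz_scale[of 2] cuntz_trans by force
qed

lemmas Mat_intros = cstar_unit.add_mem[OF cstar_unit_Mat] cstar_unit.mult_mem[OF cstar_unit_Mat]
  cstar_unit.scaleC_mem[OF cstar_unit_Mat] cstar_unit.scaleR_mem[OF cstar_unit_Mat]
  cstar_unit.adj_mem[OF cstar_unit_Mat] cstar_unit.diff_mem[OF cstar_unit_Mat]
  cstar_unit.zero_mem[OF cstar_unit_Mat]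

section \<open>Direct sums\<close>

lift_definition shiftm :: "nat \<Rightarrow> nat \<Rightarrow> 'a :: zero_neq_one minf" is
  "\<lambda>m k i j. if i = j + m \<and> j < k then 1 else 0"
proof -
  fix m k :: nat
  show "\<exists>n. \<forall>i j. n \<le> i \<or> n \<le> j \<longrightarrow> (if i = j + m \<and> j < k then 1 else 0 :: 'a) = 0"
    by (intro exI[of _ "m + k"]) auto
qed

lemma shiftm_Mat: "shiftm m k \<in> Mat (m + k)"
  by (auto simp: Mat_def shiftm.rep_eq)

lemma adj_one: "adj (1 :: 'a :: unital_cstar_algebra) = 1"
  using cstar_unit.adj_unit[OF cstar_unit_UNIV] .

lemma entry_shiftm_times:
  "entry (shiftm m k * b) i j = (if m \<le> i \<and> i < m + k then entry b (i - m) j else (0 :: 'a :: unital_cstar_algebra))"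
proof -
  have "entry (shiftm m k * b) i j = (\<Sum>l<m+k. if l = i - m then (if m \<le> i \<and> i < m + k then entry b l j else 0) else 0)"
    unfolding entry_times[OF shiftm_Mat] by (intro sum.cong) (auto simp: shiftm.rep_eq)
  then show ?thesis by auto
qed

lemma adj_shiftm_shiftm: "adj (shiftm m k) * shiftm m k = (unitm k :: 'a :: unital_cstar_algebra minf)"
proof (rule minf_eqI)
  fix i j
  have "entry (adj (shiftm m k) * shiftm m k) i j
      = (\<Sum>l<m+k. if l = i + m then (if i = j \<and> i < k then 1 else 0) else (0 :: 'a))"
    unfolding entry_times[OF Mat_closed(4)[OF shiftm_Mat shiftm_Mat]] adj_minf.rep_eq
    by (intro sum.cong) (auto simp: shiftm.rep_eq adj_zero adj_one)
  then show "entry (adj (shiftm m k) * shiftm m k) i j = entry (unitm k :: 'a minf) i j"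
    by (auto simp: unitm.rep_eq)
qed

lemma unitm_shiftm: "unitm m * shiftm m k = (0 :: 'a :: unital_cstar_algebra minf)"
  by (rule minf_eqI) (auto simp: entry_times[OF unitm_Mat] unitm.rep_eq shiftm.rep_eq zero_minf.rep_eq
    intro!: sum.neutral)

lemma shiftm_orth:
  assumes "a \<in> Mat m"
  shows "a * shiftm m k = (0 :: 'a :: unital_cstar_algebra minf)" "adj (shiftm m k) * a = (0 :: 'a minf)"
proof -
  have z: "a * shiftm m k = 0" if "a \<in> Mat m" for a :: "'a minf"
    using unitm_right[OF that] unitm_shiftm[of m k] by (metis mult.assoc mult_zero_right)
  show "a * shiftm m k = 0" by (rule z[OF assms])
  have "adj (adj a * shiftm m k) = 0" using z[OF Mat_closed(4)[OF assms assms]] by (simp add: adj_zero)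
  then show "adj (shiftm m k) * a = 0" by (simp add: adj_simps)
qed

text \<open>Rewrites the direct sum as a sum of two orthogonal elements, the second one Cuntz
  equivalent to b. From here on additivity is used in the form D(a + b) = D(a) + D(b) for a b =
  0.\<close>

lemma dsum_shiftm:
  assumes "a \<in> Mat m" "b \<in> Mat k"
  shows "dsum m a b = a + shiftm m k * b * adj (shiftm m k :: 'a :: unital_cstar_algebra minf)"
proof (rule minf_eqI)
  fix i j
  have "shiftm m k * b * adj (shiftm m k) = shiftm m k * adj (shiftm m k * adj b)"
    by (simp add: adj_simps mult.assoc)
  then have "entry (shiftm m k * b * adj (shiftm m k)) i j
      = (if m \<le> i \<and> i < m + k \<and> m \<le> j \<and> j < m + k then entry b (i - m) (j - m) else 0)"
    by (simp add: entry_shiftm_times adj_minf.rep_eq adj_zero adj_adj)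
  moreover have "entry b (i - m) (j - m) = 0" if "m + k \<le> i \<or> m + k \<le> j"
    using assms(2) that by (auto simp: Mat_def)
  moreover have "entry a i j = 0" if "m \<le> i \<or> m \<le> j" using assms(1) that by (auto simp: Mat_def)
  ultimately show "entry (dsum m a b) i j = entry (a + shiftm m k * b * adj (shiftm m k)) i j"
    by (auto simp: dsum.rep_eq plus_minf.rep_eq)
qed

text \<open>v is the row (1, 1): conjugating the diagonal matrix with entries a and b by it gives a
  + b.\<close>

lemma add_cuntz_dsum:
  assumes "a \<in> Mat m" "b \<in> Mat k"
  shows "a + b \<lesssim> a + shiftm m k * b * adj (shiftm m k :: 'a :: unital_cstar_algebra minf)"
proof -
  let ?w = "shiftm m k :: 'a minf" and ?e = "unitm m :: 'a minf"
  have ew: "adj ?w * ?e = 0" using shiftm_orth(2)[OF unitm_Mat] .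
  have wa: "adj ?w * a = 0" using shiftm_orth(2)[OF assms(1)] .
  have aw: "a * ?w = 0" using shiftm_orth(1)[OF assms(1)] .
  define v where "v = ?e + adj ?w"
  have av: "adj v = ?e + ?w" by (simp add: v_def adj_simps M_adj_unit)
  have "v * a = a" using unitm_left[OF assms(1)] wa by (simp add: v_def distrib_right)
  moreover have "a * adj v = a" using unitm_right[OF assms(1)] aw by (simp add: av distrib_left)
  moreover have "v * ?w = unitm k" by (simp add: v_def distrib_right unitm_shiftm adj_shiftm_shiftm)
  moreover have "adj ?w * adj v = unitm k"
    using ew by (simp add: av distrib_left adj_shiftm_shiftm)
  ultimately have "v * (a + ?w * b * adj ?w) * adj v = a + unitm k * b * unitm k"
    by (simp add: distrib_left distrib_right) (metis mult.assoc)
  then show ?thesis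
    using cuntz_conj[of v "a + ?w * b * adj ?w"] assms(2) by (simp add: unitm_left unitm_right)
qed

lemma shiftm_cuntz:
  fixes b :: "'a :: unital_cstar_algebra minf"
  assumes "b \<in> Mat k"
  shows "shiftm m k * b * adj (shiftm m k) \<lesssim> b" "b \<lesssim> shiftm m k * b * adj (shiftm m k)"
proof -
  let ?w = "shiftm m k :: 'a minf"
  show "?w * b * adj ?w \<lesssim> b" by (rule cuntz_conj)
  have "adj ?w * (?w * b * adj ?w) * adj (adj ?w) = (adj ?w * ?w) * b * (adj ?w * ?w)"
    by (simp add: adj_adj mult.assoc)
  also have "\<dots> = b" using assms by (simp add: adj_shiftm_shiftm unitm_left unitm_right)
  finally show "b \<lesssim> ?w * b * adj ?w" using cuntz_conj by metis
qed

lemma psd_unitm: "unitm m \<in> minf_pos"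
  using psd_square'[of "unitm m"] unitm_left[OF unitm_Mat] M_adj_unit by metis

section \<open>Dimension functions on positive matrices\<close>

text \<open>Subadditivity is an axiom because a single \<open>Mat n\<close> may lack the room for
  the orthogonal copy that proves it (\<open>dimfun_UNIV_I\<close>). The value type covers both real
  and extended real dimension functions.\<close>

locale dimfun =
  fixes S :: "'a :: unital_cstar_algebra minf set" and D :: "'a minf \<Rightarrow> 'c :: ordered_comm_monoid_add"
  assumes S_Mat: "S = UNIV \<or> (\<exists>n. S = Mat n)"
    and D_nonneg: "a \<in> S \<Longrightarrow> a \<in> minf_pos \<Longrightarrow> 0 \<le> D a"
    and D_mono: "a \<in> S \<Longrightarrow> b \<in> S \<Longrightarrow> a \<in> minf_pos \<Longrightarrow> b \<in> minf_pos \<Longrightarrow> a \<lesssim> b \<Longrightarrow> D a \<le> D b"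
    and D_orth: "a \<in> S \<Longrightarrow> b \<in> S \<Longrightarrow> a \<in> minf_pos \<Longrightarrow> b \<in> minf_pos \<Longrightarrow> a * b = 0 \<Longrightarrow> D (a + b) = D a + D b"
    and D_add: "a \<in> S \<Longrightarrow> b \<in> S \<Longrightarrow> a \<in> minf_pos \<Longrightarrow> b \<in> minf_pos \<Longrightarrow> D (a + b) \<le> D a + D b"
begin

lemma S_closed:
  "x \<in> S \<Longrightarrow> y \<in> S \<Longrightarrow> x + y \<in> S" "x \<in> S \<Longrightarrow> y \<in> S \<Longrightarrow> x - y \<in> S"
  "x \<in> S \<Longrightarrow> y \<in> S \<Longrightarrow> x * y \<in> S" "x \<in> S \<Longrightarrow> adj x \<in> S" "x \<in> S \<Longrightarrow> r *\<^sub>R x \<in> S"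
  "x \<in> S \<Longrightarrow> y \<in> S \<Longrightarrow> x * z * y \<in> S" "0 \<in> S"
  using S_Mat by (auto intro: Mat_intros Mat_hereditary)

lemma S_cf: "a \<in> S \<Longrightarrow> a \<in> minf_pos \<Longrightarrow> C0 f \<Longrightarrow> cf f a \<in> S"
  using S_Mat cf_Mat by auto

lemma D_eq: "a \<in> S \<Longrightarrow> b \<in> S \<Longrightarrow> a \<in> minf_pos \<Longrightarrow> b \<in> minf_pos \<Longrightarrow> a \<lesssim> b \<Longrightarrow> b \<lesssim> a \<Longrightarrow> D a = D b"
  by (intro antisym D_mono)

lemma D_trace: "adj x * x \<in> S \<Longrightarrow> x * adj x \<in> S \<Longrightarrow> D (adj x * x) = D (x * adj x)"
  by (intro D_eq psd_square cuntz_adj_mult cuntz_mult_adj)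

lemma D_gram_add:
  assumes "adj x * x \<in> S" "adj y * y \<in> S" "adj (x + y) * (x + y) \<in> S"
  shows "D (adj (x + y) * (x + y)) \<le> D (adj x * x) + D (adj y * y)"
  by (rule order_trans[OF D_mono[OF _ _ _ _ parallelogram_cuntz] D_add])
    (intro assms psd_square psd_add S_closed)+

end

lemma dimfun_UNIV_I:
  fixes D :: "'a :: unital_cstar_algebra minf \<Rightarrow> 'c :: ordered_comm_monoid_add"
  assumes "\<And>a. a \<in> minf_pos \<Longrightarrow> 0 \<le> D a"
    and mono: "\<And>a b. a \<in> minf_pos \<Longrightarrow> b \<in> minf_pos \<Longrightarrow> a \<lesssim> b \<Longrightarrow> D a \<le> D b"
    and orth: "\<And>a b. a \<in> minf_pos \<Longrightarrow> b \<in> minf_pos \<Longrightarrow> a * b = 0 \<Longrightarrow> D (a + b) = D a + D b"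
  shows "dimfun UNIV D"
proof
  fix a b :: "'a minf" assume ab: "a \<in> minf_pos" "b \<in> minf_pos"
  obtain n where n: "a \<in> Mat n" "b \<in> Mat n" using ex_Mat2 by blast
  let ?c = "shiftm n n * b * adj (shiftm n n)"
  have c: "?c \<in> minf_pos" by (intro psd_conj ab)
  have "D (a + b) \<le> D (a + ?c)"
    by (intro mono psd_add ab c add_cuntz_dsum n)
  also have "\<dots> = D a + D ?c"
    by (intro orth ab c) (simp add: mult.assoc[symmetric] shiftm_orth[OF n(1)])
  also have "\<dots> \<le> D a + D b" by (intro add_left_mono mono c ab shiftm_cuntz n)
  finally show "D (a + b) \<le> D a + D b" .
qed (use assms in auto)

locale lsc_dimfun = dimfun S D for S :: "'a :: unital_cstar_algebra minf set" and D :: "'a minf \<Rightarrow> real" +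
  assumes D_lsc: "a \<in> S \<Longrightarrow> a \<in> minf_pos \<Longrightarrow> (\<And>\<epsilon>. 0 < \<epsilon> \<Longrightarrow> D (cf (excess \<epsilon>) a) \<le> c) \<Longrightarrow> D a \<le> c"
begin

lemma D_ramp_approx:
  assumes a: "a \<in> S" "a \<in> minf_pos" and \<eta>: "0 < \<eta>"
  obtains \<delta> where "0 < \<delta>" "D a - \<eta> < D (cf (ramp \<delta>) a)"
proof -
  obtain \<epsilon> where \<epsilon>: "0 < \<epsilon>" "D a - \<eta> < D (cf (excess \<epsilon>) a)"
    using D_lsc[OF a, of "D a - \<eta>"] \<eta> by (meson diff_less_eq less_add_same_cancel1 not_le)
  have "D (cf (excess \<epsilon>) a) \<le> D (cf (ramp (\<epsilon>/2)) a)"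
    using cuntz_cut_ramp[OF a(2), of "\<epsilon>/2"] \<epsilon>
    by (intro D_mono S_cf psd_cut psd_ramp a C0_cut C0_ramp) auto
  then show ?thesis using that[of "\<epsilon>/2"] \<epsilon> by simp
qed

end

text \<open>Take y = x h with h evaluated at \<open>adj x * x\<close> and h(s)^2 s = f(s); h is
  continuous because f vanishes near 0. So the trace property extends from \<open>adj x * x\<close>
  to functions of it.\<close>

lemma cf_trace_factor:
  fixes x :: "'a :: unital_cstar_algebra minf"
  assumes f: "C0 f" "\<And>s. 0 \<le> s \<Longrightarrow> 0 \<le> f s" and \<delta>: "0 < \<delta>" "\<And>s. 0 \<le> s \<Longrightarrow> s \<le> \<delta> \<Longrightarrow> f s = 0"
  obtains y where "adj y * y = cf f (adj x * x)" "y * adj y = cf f (x * adj x)" "\<And>n. x \<in> Mat n \<Longrightarrow> y \<in> Mat n"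
proof -
  define h where "h = (\<lambda>s. sqrt (f s / max s \<delta>))"
  have h: "C0 h" using f(1) \<delta> by (auto simp: C0_def h_def intro!: continuous_intros)
  have hs: "h s * s * h s = f s" "h s * h s * s = f s" if "0 \<le> s" for s
  proof -
    have "h s * h s = f s / max s \<delta>" using f(2)[OF that] \<delta>(1) by (simp add: h_def)
    then show "h s * h s * s = f s" using \<delta> that by (cases "s \<le> \<delta>") (auto simp: max_def)
    then show "h s * s * h s = f s" by (simp add: mult_ac)
  qed
  let ?t = "adj x * x" and ?u = "x * adj x"
  have t: "cpos ?t" "cpos ?u" by (intro psd_cpos psd_square)+
  define y where "y = x * cf h ?t"
  have hm: "C0 (\<lambda>s. h s * s)" "C0 (\<lambda>s. h s * h s)" by (intro C0_simps C0_cont h)+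
  have ay: "adj y = cf h ?t * adj x" by (simp add: y_def adj_simps cf_adj[OF t(1) h])
  have "adj y * y = cf h ?t * ?t * cf h ?t" unfolding ay by (simp add: y_def mult.assoc)
  also have "\<dots> = cf (\<lambda>s. h s * s * h s) ?t"
    by (simp add: cf_mult[OF t(1) hm(1) h] cf_mult[OF t(1) h C0_simps(1)] cf_id[OF t(1)])
  also have "\<dots> = cf f ?t" by (intro cf_cong t f C0_simps C0_cont h) (simp add: hs)
  finally have 1: "adj y * y = cf f ?t" .
  have "y * adj y = x * cf (\<lambda>s. h s * h s) ?t * adj x"
    unfolding ay by (simp add: y_def mult.assoc cf_mult[OF t(1) h h])
  also have "\<dots> = cf (\<lambda>s. h s * h s) ?u * ?u"
    by (simp add: cf_times_adj_intertwine[OF hm(2), symmetric] mult.assoc)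
  also have "\<dots> = cf (\<lambda>s. h s * h s * s) ?u"
    by (simp add: cf_mult[OF t(2) hm(2) C0_simps(1)] cf_id[OF t(2)])
  also have "\<dots> = cf f ?u" by (intro cf_cong t f C0_simps C0_cont h) (simp add: hs)
  finally have 2: "y * adj y = cf f ?u" .
  have "y \<in> Mat n" if "x \<in> Mat n" for n unfolding y_def
    by (intro Mat_intros cf_Mat psd_square h that)
  then show ?thesis using that 1 2 by blast
qed

section \<open>Quasitraces and their dimension functions\<close>

locale quasitr =
  fixes n :: nat and T :: "'a :: unital_cstar_algebra minf \<Rightarrow> complex"
  assumes qt: "quasitrace_on (Mat n) mat_norm T"
begin

lemma T_trace: "x \<in> Mat n \<Longrightarrow> T (adj x * x) = T (x * adj x)"
  using qt by (auto simp: quasitrace_on_def)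

text \<open>Commuting self-adjoint elements lie in the commutative subalgebra given by their double commutant.\<close>

lemma T_linear:
  assumes a: "a \<in> Mat n" "adj a = a" and b: "b \<in> Mat n" "adj b = b" and ab: "a * b = b * a"
  shows "T (c *\<^sub>C a + b) = c * T a + T b"
proof -
  define C where "C = {x \<in> Mat n. x * a = a * x \<and> x * b = b * x}"
  define B where "B = {x \<in> Mat n. \<forall>y\<in>C. x * y = y * x}"
  have CB: "C \<subseteq> Mat n" "B \<subseteq> Mat n" by (auto simp: C_def B_def)
  have abC: "a \<in> C" "b \<in> C" and abB: "a \<in> B" "b \<in> B"
    using a b ab by (auto simp: C_def B_def)
  then have BC: "B \<subseteq> C" by (auto simp: C_def B_def)
  have comm: "x * y = y * x" if "x \<in> B" "y \<in> B" for x y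
    using that BC by (auto simp: B_def)
  have adjC: "adj y \<in> C" if "y \<in> C" for y
  proof -
    have "adj (a * y) = adj (y * a)" "adj (b * y) = adj (y * b)" using that by (auto simp: C_def)
    then have "adj y * a = a * adj y" "adj y * b = b * adj y" by (simp_all add: adj_simps a b)
    moreover have "adj y \<in> Mat n" using that Mat_closed(4) by (auto simp: C_def)
    ultimately show ?thesis by (simp add: C_def)
  qed
  have "cstar_subalgebra (Mat n) mat_norm B"
    unfolding cstar_subalgebra_def
  proof (intro conjI ballI allI)
    show "B \<subseteq> Mat n" by (rule CB)
    show "0 \<in> B" using Mat_closed(7)[OF a(1) a(1)] by (simp add: B_def)
    fix x assume x: "x \<in> B"
    show "c *\<^sub>C x \<in> B" for c
      using x Mat_closed(3)[of x n x c] by (simp add: B_def mult_scaleC_left mult_scaleC_right)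
    show "adj x \<in> B"
    proof -
      have "adj x * y = y * adj x" if y: "y \<in> C" for y
      proof -
        have "adj (adj y * x) = adj (x * adj y)" using x adjC[OF y] by (simp add: B_def)
        then show ?thesis by (simp add: adj_simps)
      qed
      moreover have "adj x \<in> Mat n" using x Mat_closed(4)[of x n x] by (simp add: B_def)
      ultimately show ?thesis by (simp add: B_def)
    qed
    fix y assume y: "y \<in> B"
    show "x + y \<in> B"
      using x y Mat_closed(1)[of x n y] by (simp add: B_def distrib_left distrib_right)
    have "x * y * z = z * (x * y)" if "z \<in> C" for z
    proof -
      have "x * y * z = x * (z * y)" using y that by (simp add: B_def mult.assoc)
      also have "\<dots> = z * x * y" using x that by (simp add: B_def mult.assoc[symmetric])
      finally show ?thesis by (simp add: mult.assoc)
    qed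
    then show "x * y \<in> B" using x y Mat_closed(2)[of x n y] by (simp add: B_def)
  next
    show "norm_closed_in (Mat n) mat_norm B"
      unfolding norm_closed_in_def
    proof (intro allI impI)
      fix x :: "nat \<Rightarrow> 'a minf" and l
      assume H: "(\<forall>k. x k \<in> B) \<and> l \<in> Mat n \<and> (\<lambda>k. mat_norm (x k - l)) \<longlonglongrightarrow> 0"
      then have "(\<lambda>k. x k - l) \<longlonglongrightarrow> 0"
        using tendsto_norm_zero_cancel[of "\<lambda>k. x k - l"] by (simp add: norm_minf_def)
      then have lim: "x \<longlonglongrightarrow> l" by (rule LIM_zero_cancel)
      have "l * y = y * l" if y: "y \<in> C" for y
      proof -
        have "(\<lambda>k. x k * y) \<longlonglongrightarrow> l * y" "(\<lambda>k. y * x k) \<longlonglongrightarrow> y * l" by (intro tendsto_intros lim)+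
        moreover have "(\<lambda>k. x k * y) = (\<lambda>k. y * x k)" using H y by (auto simp: B_def)
        ultimately show ?thesis using LIMSEQ_unique by metis
      qed
      then show "l \<in> B" using H by (simp add: B_def)
    qed
  qed
  then show ?thesis
    using qt comm abB unfolding quasitrace_on_def by blast
qed

lemma T_0: "T 0 = 0"
  using T_linear[of 0 0 1] by (simp add: Mat_intros adj_zero scaleC_zero_right)

lemma T_add: "a \<in> Mat n \<Longrightarrow> b \<in> Mat n \<Longrightarrow> adj a = a \<Longrightarrow> adj b = b \<Longrightarrow> a * b = b * a \<Longrightarrow> T (a + b) = T a + T b"
  using T_linear[of a b 1] by (simp add: scaleC_one)

lemma T_scaleR: "a \<in> Mat n \<Longrightarrow> adj a = a \<Longrightarrow> T (r *\<^sub>R a) = of_real r * T a"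
  using T_linear[of a 0 "of_real r"] by (simp add: Mat_intros adj_zero T_0 scaleR_eq_scaleC)

lemma T_psd: "a \<in> Mat n \<Longrightarrow> a \<in> minf_pos \<Longrightarrow> T a \<in> \<real>\<^sub>\<ge>\<^sub>0"
proof -
  assume a: "a \<in> Mat n" "a \<in> minf_pos"
  have "cf sqrt a \<in> Mat n" using C0_sqrt[OF C0_simps(1)] by (intro cf_Mat a) simp
  then have "T (adj (cf sqrt a) * cf sqrt a) \<in> \<real>\<^sub>\<ge>\<^sub>0" using qt by (auto simp: quasitrace_on_def)
  then show ?thesis using cf_sqrt[OF a(2)] psd_adj by metis
qed

definition tr :: "'a minf \<Rightarrow> real" where "tr a = Re (T a)"

lemma T_tr: "a \<in> Mat n \<Longrightarrow> a \<in> minf_pos \<Longrightarrow> T a = of_real (tr a)"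
  using T_psd[of a] by (auto simp: tr_def nonneg_Reals_def)

lemma tr_nonneg: "a \<in> Mat n \<Longrightarrow> a \<in> minf_pos \<Longrightarrow> 0 \<le> tr a"
  using T_psd[of a] by (auto simp: tr_def nonneg_Reals_def)

lemma tr_add: "a \<in> Mat n \<Longrightarrow> b \<in> Mat n \<Longrightarrow> adj a = a \<Longrightarrow> adj b = b \<Longrightarrow> a * b = b * a \<Longrightarrow> tr (a + b) = tr a + tr b"
  by (simp add: tr_def T_add)

lemma tr_scaleR: "a \<in> Mat n \<Longrightarrow> adj a = a \<Longrightarrow> tr (r *\<^sub>R a) = r * tr a"
  by (simp add: tr_def T_scaleR)

lemma tr_mono:
  assumes "a \<in> Mat n" "b \<in> Mat n" "adj a = a" "b - a \<in> minf_pos" "a * b = b * a"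
  shows "tr a \<le> tr b"
proof -
  have "tr b = tr (a + (b - a))" by simp
  also have "\<dots> = tr a + tr (b - a)"
    using assms psd_adj[OF assms(4)] by (intro tr_add Mat_intros) (auto simp: algebra_simps)
  finally show ?thesis using tr_nonneg[of "b - a"] assms Mat_closed(6) by auto
qed

lemma tr_cf_mono:
  assumes a: "a \<in> Mat n" "a \<in> minf_pos" and fg: "C0 f" "C0 g" "\<And>x. 0 \<le> x \<Longrightarrow> x \<le> norm a \<Longrightarrow> f x \<le> g x"
  shows "tr (cf f a) \<le> tr (cf g a)"
proof (rule tr_mono)
  note cp = psd_cpos[OF a(2)]
  show "cf g a - cf f a \<in> minf_pos" by (rule psd_cf_diff[OF a(2) fg])
  show "cf f a * cf g a = cf g a * cf f a"
    by (simp add: cf_mult[OF cp fg(1,2), symmetric] cf_mult[OF cp fg(2,1), symmetric] mult.commute)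
qed (intro cf_Mat cf_adj psd_cpos a fg)+

lemma tr_cf_trace:
  assumes x: "x \<in> Mat n" and f: "C0 f" "\<And>s. 0 \<le> s \<Longrightarrow> 0 \<le> f s" and \<delta>: "0 < \<delta>" "\<And>s. 0 \<le> s \<Longrightarrow> s \<le> \<delta> \<Longrightarrow> f s = 0"
  shows "tr (cf f (adj x * x)) = tr (cf f (x * adj x))"
proof -
  obtain y where y: "adj y * y = cf f (adj x * x)" "y * adj y = cf f (x * adj x)" "y \<in> Mat n"
    using cf_trace_factor[OF f \<delta>, of x] x by metis
  from T_trace[OF y(3)] show ?thesis by (simp add: tr_def y)
qed

text \<open>This is d_\<tau>, written with functions that vanish near 0, as
  \<open>cf_trace_factor\<close> demands and roots do not. The agreement with the limit over roots
  is \<open>tr_root_LIMSEQ\<close>.\<close>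

definition dim :: "'a minf \<Rightarrow> real" where
  "dim a = (SUP k. tr (cf (ramp (1 / real (Suc k))) a))"

text \<open>A quasitrace is known to be monotone only between commuting elements. Here c g = c makes
  them commute, and g - c = g (1 - c) is positive.\<close>

lemma tr_le_unit:
  assumes "c \<in> Mat n" "c \<in> minf_pos" "norm c \<le> 1" "g \<in> Mat n" "g \<in> minf_pos" "c * g = c"
  shows "tr c \<le> tr g"
proof (rule tr_mono[OF assms(1,4) psd_adj[OF assms(2)]])
  have gc: "g * c = c" using assms psd_adj by (metis adj_mult)
  then show "c * g = g * c" using assms by simp
  have "unitm n - c \<in> minf_pos" using psd_unit_diff[of c n 1] assms psd_adj by auto
  moreover have "g * (unitm n - c) = g - c" "(unitm n - c) * g = g - c"
    using assms gc by (simp_all add: right_diff_distrib left_diff_distrib unitm_left unitm_right)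
  ultimately show "g - c \<in> minf_pos" using psd_mult[OF assms(5), of "unitm n - c"] by simp
qed

lemma tr_ramp_bound:
  assumes a: "a \<in> Mat n" "a \<in> minf_pos" and \<delta>: "0 < \<delta>"
  shows "tr (cf (ramp \<delta>) a) \<le> tr (unitm n)"
  using cf_Mat[OF a(2,1) C0_ramp[OF \<delta>]]
  by (intro tr_le_unit psd_ramp norm_ramp a \<delta> unitm_Mat psd_unitm unitm_right)

lemma bdd_dim: "a \<in> Mat n \<Longrightarrow> a \<in> minf_pos \<Longrightarrow> bdd_above (range (\<lambda>k. tr (cf (ramp (1 / real (Suc k))) a)))"
  using tr_ramp_bound[of a] by (intro bdd_aboveI[of _ "tr (unitm n)"]) auto

lemma dim_upper:
  assumes a: "a \<in> Mat n" "a \<in> minf_pos" and f: "C0 f" "\<And>s. 0 \<le> s \<Longrightarrow> f s \<le> 1"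
    and \<delta>: "0 < \<delta>" "\<And>s. 0 \<le> s \<Longrightarrow> s \<le> \<delta> \<Longrightarrow> f s \<le> 0"
  shows "tr (cf f a) \<le> dim a"
proof -
  obtain k where k: "1 / real (Suc k) < \<delta> / 2"
    using reals_Archimedean[of "\<delta> / 2"] \<delta> by (auto simp: inverse_eq_divide)
  have "tr (cf f a) \<le> tr (cf (ramp (1 / real (Suc k))) a)"
  proof (rule tr_cf_mono[OF a f(1) C0_ramp])
    fix s :: real assume s: "0 \<le> s"
    show "f s \<le> ramp (1 / real (Suc k)) s"
    proof (cases "s \<le> \<delta>")
      case True
      then show ?thesis using \<delta>(2)[OF s True] ramp_nonneg[of "1 / real (Suc k)" s] by linarith
    next
      case False
      then show ?thesis using f(2)[OF s] ramp_eq_1[of "1 / real (Suc k)" s] k by simp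
    qed
  qed simp
  also have "\<dots> \<le> dim a" unfolding dim_def by (rule cSUP_upper[OF _ bdd_dim[OF a]]) simp
  finally show ?thesis .
qed

lemma dim_least: "(\<And>\<delta>. 0 < \<delta> \<Longrightarrow> tr (cf (ramp \<delta>) a) \<le> c) \<Longrightarrow> dim a \<le> c"
  unfolding dim_def by (rule cSUP_least) auto

lemma dim_ramp: "a \<in> Mat n \<Longrightarrow> a \<in> minf_pos \<Longrightarrow> 0 < \<delta> \<Longrightarrow> tr (cf (ramp \<delta>) a) \<le> dim a"
  by (rule dim_upper[where \<delta> = \<delta>]) (auto simp: C0_ramp ramp_le_1 ramp_eq_0)

lemma dim_nonneg: "a \<in> Mat n \<Longrightarrow> a \<in> minf_pos \<Longrightarrow> 0 \<le> dim a"
  using dim_ramp[of a 1] tr_nonneg[of "cf (ramp 1) a"] cf_Mat[OF _ _ C0_ramp, of a n 1] psd_ramp[of a 1] by simp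

text \<open>The function \<open>s \<mapsto> ramp \<delta> (s + \<delta>/2)\<close> undoes a cut-off by \<open>\<delta>/2\<close>.\<close>

lemma ramp_cut:
  assumes "a \<in> minf_pos" "0 < \<delta>"
  defines "f \<equiv> \<lambda>s. ramp \<delta> (s + \<delta> / 2)"
  shows "C0 f" "cf (ramp \<delta>) a = cf f (cf (excess (\<delta>/2)) a)" "\<And>s. 0 \<le> s \<Longrightarrow> s \<le> \<delta> / 2 \<Longrightarrow> f s = 0"
    "\<And>s. 0 \<le> f s" "\<And>s. f s \<le> 1"
proof -
  show f0: "f s = 0" if "0 \<le> s" "s \<le> \<delta> / 2" for s
    unfolding f_def using that assms by (intro ramp_eq_0) auto
  have "continuous_on {0..} f"
    unfolding f_def ramp_def[abs_def] using assms by (intro continuous_intros) auto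
  then show C: "C0 f" using f0[of 0] assms by (simp add: C0_def)
  show "\<And>s. 0 \<le> f s" "\<And>s. f s \<le> 1" by (simp_all add: f_def ramp_nonneg ramp_le_1)
  have "cf f (cf (excess (\<delta>/2)) a) = cf (\<lambda>s. f (excess (\<delta>/2) s)) a"
    using assms by (intro cf_comp psd_cpos C0_cut cut_nonneg C) auto
  also have "\<dots> = cf (ramp \<delta>) a"
  proof (rule cf_cong[OF psd_cpos[OF assms(1)]])
    show "C0 (\<lambda>s. f (excess (\<delta>/2) s))" using assms by (intro C0_comp[OF C0_cut C] cut_nonneg) simp
    show "C0 (ramp \<delta>)" using assms by (simp add: C0_ramp)
    fix s :: real assume "0 \<le> s"
    then show "f (excess (\<delta>/2) s) = ramp \<delta> s"
      using assms by (cases "s \<le> \<delta> / 2") (auto simp: f_def excess_def ramp_eq_0)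
  qed
  finally show "cf (ramp \<delta>) a = cf f (cf (excess (\<delta>/2)) a)" by simp
qed

text \<open>The difficulty is that a and b need not commute. Factor a cut of a as
  \<open>x * adj x\<close> with x supported on b; the trace property leads to
  \<open>adj x * x\<close>, and a ramp of b is a unit for it, hence commutes with it.\<close>

lemma dim_mono:
  assumes a: "a \<in> Mat n" "a \<in> minf_pos" and b: "b \<in> Mat n" "b \<in> minf_pos" and ab: "a \<lesssim> b"
  shows "dim a \<le> dim b"
proof (rule dim_least)
  fix \<delta> :: real assume \<delta>: "0 < \<delta>"
  obtain x \<gamma> where x: "0 < \<gamma>" "cf (excess (\<delta>/2)) a = x * adj x" "x * cf (ramp \<gamma>) b = x" "x \<in> Mat n"
    using cuntz_factor[OF a(2) b(2) ab, of "\<delta>/2"] a b \<delta> by (metis half_gt_zero)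
  define f where "f = (\<lambda>s. ramp \<delta> (s + \<delta> / 2))"
  have f: "C0 f" "cf (ramp \<delta>) a = cf f (cf (excess (\<delta>/2)) a)" "\<And>s. 0 \<le> s \<Longrightarrow> s \<le> \<delta> / 2 \<Longrightarrow> f s = 0"
    "\<And>s. 0 \<le> f s" "\<And>s. f s \<le> 1"
    using ramp_cut[OF a(2) \<delta>] by (simp_all add: f_def)
  let ?t = "adj x * x"
  have t: "?t \<in> Mat n" "?t \<in> minf_pos" using x by (auto intro: psd_square Mat_intros)
  have "?t * cf (ramp \<gamma>) b = ?t" using x(3) by (simp add: mult.assoc)
  then have "adj (?t * cf (ramp \<gamma>) b) = adj ?t" by simp
  then have "cf (ramp \<gamma>) b * ?t = ?t"
    using psd_adj[OF psd_ramp[OF b(2) x(1)]] by (simp add: adj_simps)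
  then have kt: "?t * cf (ramp \<gamma>) b = cf (ramp \<gamma>) b * ?t" using \<open>?t * cf (ramp \<gamma>) b = ?t\<close> by simp
  \<comment> \<open>Dividing f by s exhibits \<open>adj x * x\<close> as a factor of its image under
    f, which thereby inherits the right unit. Below \<delta>/2, where the denominator is not s, f
    vanishes.\<close>
  define h where "h = (\<lambda>s. f s / max s (\<delta>/2))"
  have h: "C0 h" using f(1) \<delta> by (auto simp: C0_def h_def intro!: continuous_intros)
  have "cf f ?t = cf (\<lambda>s. h s * s) ?t"
  proof (rule cf_cong[OF psd_cpos[OF t(2)] f(1) C0_simps(5)[OF h C0_cont[OF C0_simps(1)]]])
    fix s :: real assume s: "0 \<le> s"
    show "f s = h s * s" using f(3)[OF s] s \<delta> by (cases "s \<le> \<delta> / 2") (auto simp: h_def)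
  qed
  also have "\<dots> = cf h ?t * ?t"
    by (simp add: cf_mult[OF psd_cpos[OF t(2)] h C0_simps(1)] cf_id[OF psd_cpos[OF t(2)]])
  finally have ck: "cf f ?t * cf (ramp \<gamma>) b = cf f ?t"
    using \<open>?t * cf (ramp \<gamma>) b = ?t\<close> by (simp add: mult.assoc)
  have "tr (cf (ramp \<delta>) a) = tr (cf f (x * adj x))" by (simp add: f(2) x(2))
  also have "\<dots> = tr (cf f ?t)"
    using \<delta> by (intro tr_cf_trace[symmetric, where \<delta> = "\<delta>/2"] x f) auto
  also have "\<dots> \<le> tr (cf (ramp \<gamma>) b)"
  proof (rule tr_le_unit)
    show "norm (cf f ?t) \<le> 1" using f(4,5) by (intro cf_norm psd_cpos t f) auto
  qed (use ck in \<open>auto intro!: cf_Mat psd_cf t b f C0_ramp x ramp_nonneg\<close>)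
  also have "\<dots> \<le> dim b" by (intro dim_ramp b x)
  finally show "tr (cf (ramp \<delta>) a) \<le> dim b" .
qed

lemma dim_LIMSEQ:
  assumes a: "a \<in> Mat n" "a \<in> minf_pos"
  shows "(\<lambda>k. tr (cf (ramp (1 / real (Suc k))) a)) \<longlonglongrightarrow> dim a"
  unfolding dim_def
proof (rule LIMSEQ_incseq_SUP[OF bdd_dim[OF a]])
  show "incseq (\<lambda>k. tr (cf (ramp (1 / real (Suc k))) a))"
  proof (rule incseq_SucI, rule tr_cf_mono[OF a C0_ramp C0_ramp])
    fix k s assume "(0::real) \<le> s"
    then have "s * real (Suc k) \<le> s * real (Suc (Suc k))" by (intro mult_left_mono) auto
    then show "ramp (1 / real (Suc k)) s \<le> ramp (1 / real (Suc (Suc k))) s"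
      by (simp add: ramp_def)
  qed auto
qed

lemma dim_orth:
  assumes a: "a \<in> Mat n" "a \<in> minf_pos" and b: "b \<in> Mat n" "b \<in> minf_pos" and ab: "a * b = 0"
  shows "dim (a + b) = dim a + dim b"
proof -
  have "tr (cf (ramp (1 / real (Suc k))) (a + b)) = tr (cf (ramp (1 / real (Suc k))) a) + tr (cf (ramp (1 / real (Suc k))) b)" for k
  proof -
    let ?r = "ramp (1 / real (Suc k))"
    have r: "C0 ?r" by (intro C0_ramp) simp
    have ba: "b * a = 0" by (rule orth_sym[OF a(2) b(2) ab])
    have "b * cf ?r a = 0"
      using cf_mult_zero[OF a(2) r ab] psd_adj[OF b(2)] cf_adj[OF psd_cpos[OF a(2)] r] by (metis adj_mult adj_zero)
    then have 1: "cf ?r b * cf ?r a = 0" by (rule cf_mult_zero[OF b(2) r])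
    have "a * cf ?r b = 0"
      using cf_mult_zero[OF b(2) r ba] psd_adj[OF a(2)] cf_adj[OF psd_cpos[OF b(2)] r] by (metis adj_mult adj_zero)
    then have 2: "cf ?r a * cf ?r b = 0" by (rule cf_mult_zero[OF a(2) r])
    show ?thesis
      unfolding cf_add_orth[OF a(2) b(2) ab r]
      by (intro tr_add cf_Mat cf_adj psd_cpos a b r) (simp only: 1 2)
  qed
  then show ?thesis
    using dim_LIMSEQ[OF Mat_closed(1)[OF a(1) b(1)] psd_add[OF a(2) b(2)]]
      tendsto_add[OF dim_LIMSEQ[OF a] dim_LIMSEQ[OF b]] LIMSEQ_unique by simp
qed

lemma dim_lsc:
  assumes a: "a \<in> Mat n" "a \<in> minf_pos" and c: "\<And>\<epsilon>. 0 < \<epsilon> \<Longrightarrow> dim (cf (excess \<epsilon>) a) \<le> c"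
  shows "dim a \<le> c"
proof (rule dim_least)
  fix \<delta> :: real assume \<delta>: "0 < \<delta>"
  define f where "f = (\<lambda>s. ramp \<delta> (s + \<delta> / 2))"
  have f: "C0 f" "cf (ramp \<delta>) a = cf f (cf (excess (\<delta>/2)) a)" "\<And>s. 0 \<le> s \<Longrightarrow> s \<le> \<delta> / 2 \<Longrightarrow> f s = 0"
    "\<And>s. 0 \<le> f s" "\<And>s. f s \<le> 1"
    using ramp_cut[OF a(2) \<delta>] by (simp_all add: f_def)
  have "tr (cf (ramp \<delta>) a) \<le> dim (cf (excess (\<delta>/2)) a)"
    unfolding f(2)
    by (rule dim_upper[where \<delta> = "\<delta>/2"]) (use \<delta> f in \<open>auto intro!: cf_Mat a C0_cut psd_cut\<close>)
  also have "\<dots> \<le> c" using \<delta> by (intro c) simp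
  finally show "tr (cf (ramp \<delta>) a) \<le> c" .
qed

text \<open>Subadditivity on \<open>Mat m\<close> compares a + b with a plus a copy of b shifted by
  m, and this copy must fit into \<open>Mat n\<close>. For m = 1 it is the reason for working with
  quasitraces on 2 by 2 matrices.\<close>

lemma lsc_dimfun_dim:
  assumes "2 * m \<le> n"
  shows "lsc_dimfun (Mat m) dim"
proof
  have mn: "a \<in> Mat n" if "a \<in> Mat m" for a :: "'a minf" using that assms Mat_sub[of a m n] by simp
  show "Mat m = UNIV \<or> (\<exists>n. Mat m = (Mat n :: 'a minf set))" by blast
  fix a :: "'a minf" assume a: "a \<in> Mat m" "a \<in> minf_pos"
  show "0 \<le> dim a" by (intro dim_nonneg mn a)
  show "dim a \<le> c" if "\<And>\<epsilon>. 0 < \<epsilon> \<Longrightarrow> dim (cf (excess \<epsilon>) a) \<le> c" for c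
    by (rule dim_lsc[OF mn[OF a(1)] a(2) that])
  fix b :: "'a minf" assume b: "b \<in> Mat m" "b \<in> minf_pos"
  show "dim a \<le> dim b" if "a \<lesssim> b" by (intro dim_mono mn a b that)
  show "dim (a + b) = dim a + dim b" if "a * b = 0" by (intro dim_orth mn a b that)
  let ?c = "shiftm m m * b * adj (shiftm m m)"
  have c: "?c \<in> minf_pos" by (intro psd_conj b)
  have w: "shiftm m m \<in> (Mat n :: 'a minf set)" using Mat_sub[OF shiftm_Mat[of m m], of n] assms by simp
  have cn: "?c \<in> Mat n" by (intro Mat_intros w mn[OF b(1)])
  have "dim (a + b) \<le> dim (a + ?c)"
    by (intro dim_mono psd_add cn Mat_intros mn[OF a(1)] mn[OF b(1)] a b c add_cuntz_dsum)
  also have "\<dots> = dim a + dim ?c"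
    by (intro dim_orth cn mn[OF a(1)] a c) (simp add: mult.assoc[symmetric] shiftm_orth[OF a(1)])
  also have "\<dots> \<le> dim a + dim b" by (intro add_left_mono dim_mono cn mn[OF b(1)] c b shiftm_cuntz)
  finally show "dim (a + b) \<le> dim a + dim b" .
qed

end

section \<open>The quasitrace of a dimension function\<close>

lemma cuntz_square: "c \<in> minf_pos \<Longrightarrow> c \<lesssim> c * c"
proof (rule cuntz_from_cut)
  fix \<epsilon> :: real assume \<epsilon>: "0 < \<epsilon>" and c: "c \<in> minf_pos"
  note cp = psd_cpos[OF c]
  have "cf (excess \<epsilon>) c \<lesssim> cf (\<lambda>s. s * s) c"
  proof (rule cuntz_cf[OF c, where C = "1 / \<epsilon>"])
    fix s :: real
    show "excess \<epsilon> s \<le> 1 / \<epsilon> * (s * s)"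
    proof (cases "\<epsilon> \<le> s")
      case True
      then have "s * \<epsilon> \<le> s * s" using \<epsilon> by (intro mult_left_mono) auto
      then have "s \<le> 1 / \<epsilon> * (s * s)" using \<epsilon> by (simp add: pos_le_divide_eq)
      then show ?thesis using \<epsilon> True by (simp add: excess_def)
    qed (use \<epsilon> in \<open>simp add: excess_def\<close>)
  qed (use \<epsilon> in \<open>auto simp: C0_cut cut_nonneg intro!: C0_simps C0_cont\<close>)
  then show "cf (excess \<epsilon>) c \<lesssim> c * c"
    using cf_mult[OF cp C0_simps(1) C0_simps(1)] cf_id[OF cp] by simp
qed

text \<open>Conjugate a \<le> t + Y by F, the square root of (a - t)_+. Since F (a - t) F is the
  square of (a - t)_+, that square is at most F Y F, and a positive element is Cuntz below its
  square.\<close>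

lemma excess_cuntz:
  assumes a: "a \<in> minf_pos" "a \<in> Mat m" and Y: "Y \<in> minf_pos" "Y \<in> Mat m"
    and t: "0 \<le> t" and le: "t *\<^sub>R unitm m + Y - a \<in> minf_pos"
  shows "cf (excess t) a \<lesssim> Y"
proof -
  define f where "f = (\<lambda>s. sqrt (excess t s))"
  have f: "C0 f" unfolding f_def by (intro C0_sqrt C0_cut t)
  note cp = psd_cpos[OF a(1)]
  define F where "F = cf f a"
  have F: "adj F = F" "F \<in> Mat m" unfolding F_def by (intro cf_adj cp f cf_Mat a)+
  have c: "C0 (\<lambda>s. f s * s)" "C0 (\<lambda>s. f s * s * f s)" "C0 (\<lambda>s. f s * f s)"
    by (intro C0_simps C0_cont f)+
  have ff: "f s * f s = excess t s" for s by (simp add: f_def cut_nonneg)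
  have "excess t s * excess t s = f s * s * f s - t * (f s * f s)" for s
  proof -
    have "f s * s * f s - t * (f s * f s) = (s - t) * (f s * f s)" by (simp add: algebra_simps)
    then show ?thesis by (cases "s \<le> t") (simp_all add: ff, simp_all add: excess_def)
  qed
  then have "cf (\<lambda>s. excess t s * excess t s) a = cf (\<lambda>s. f s * s * f s - t * (f s * f s)) a" by simp
  also have "\<dots> = F * a * F - t *\<^sub>R (F * F)"
    using cf_diff[OF cp c(2) C0_simps(4)[OF c(3), of t]] cf_mult[OF cp c(1) f]
      cf_mult[OF cp f C0_simps(1)] cf_mult[OF cp f f] cf_scale[OF cp c(3), of t]
    by (simp add: F_def cf_id[OF cp])
  finally have e: "cf (excess t) a * cf (excess t) a = F * a * F - t *\<^sub>R (F * F)"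
    using cf_mult[OF cp C0_cut[OF t] C0_cut[OF t]] by simp
  have "adj F * (t *\<^sub>R unitm m + Y - a) * F \<in> minf_pos" by (rule psd_conj[OF le])
  moreover have "adj F * (t *\<^sub>R unitm m + Y - a) * F = F * Y * adj F - cf (excess t) a * cf (excess t) a"
    unfolding e F by (simp add: right_diff_distrib left_diff_distrib distrib_left distrib_right unitm_right[OF F(2)])
  ultimately have "cf (excess t) a * cf (excess t) a \<lesssim> F * Y * adj F"
    by (intro le_cuntz psd_square' cf_adj cp C0_cut t) simp
  then show ?thesis
    using cuntz_square[OF psd_cut[OF a(1) t]] cuntz_conj cuntz_trans by blast
qed

lemma excess_le:
  assumes "a \<in> minf_pos" "a \<in> Mat m" "0 \<le> t"
  shows "t *\<^sub>R unitm m + cf (excess t) a - a \<in> minf_pos"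
proof -
  have "t *\<^sub>R unitm m - (a - cf (excess t) a) \<in> minf_pos"
    using norm_cut[OF assms(1,3)] cf_Mat[OF assms(1,2) C0_cut[OF assms(3)]] assms psd_adj[OF assms(1)]
      psd_adj[OF psd_cut[OF assms(1,3)]]
    by (intro psd_unit_diff Mat_intros) (auto simp: adj_diff)
  then show ?thesis by (simp add: algebra_simps)
qed

locale fin_dimfun = dimfun UNIV D for D :: "'a :: unital_cstar_algebra minf \<Rightarrow> real"
begin

lemmas mono = D_mono[OF UNIV_I UNIV_I] and orth = D_orth[OF UNIV_I UNIV_I]
  and subadd = D_add[OF UNIV_I UNIV_I] and nonneg = D_nonneg[OF UNIV_I]

lemma D_0: "D 0 = 0"
  using orth[of 0 0] by simp

definition F :: "'a minf \<Rightarrow> real \<Rightarrow> real" where "F a t = D (cf (excess t) a)"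

lemma F_nonneg: "a \<in> minf_pos \<Longrightarrow> 0 \<le> t \<Longrightarrow> 0 \<le> F a t"
  unfolding F_def by (intro nonneg psd_cut)

lemma F_antimono:
  assumes "a \<in> minf_pos" "0 \<le> s" "s \<le> t" shows "F a t \<le> F a s"
proof -
  have "cf (excess (t - s)) (cf (excess s) a) \<lesssim> cf (excess s) a"
    using assms by (intro cuntz_cut psd_cut) auto
  then show ?thesis
    unfolding F_def using assms cut_cut[of a "t - s" s] by (intro mono psd_cut) auto
qed

lemma F_le: "a \<in> minf_pos \<Longrightarrow> 0 \<le> t \<Longrightarrow> F a t \<le> D a"
  unfolding F_def by (intro mono psd_cut cuntz_cut)

lemma F_zero:
  assumes "a \<in> minf_pos" "norm a \<le> t" shows "F a t = 0"
proof -
  have t: "0 \<le> t" using assms(2) norm_ge_zero order_trans by blast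
  have "norm (cf (excess t) a) \<le> 0"
    by (intro cf_norm psd_cpos assms C0_cut t) (use assms in \<open>auto simp: excess_def\<close>)
  then show ?thesis by (simp add: F_def D_0)
qed

lemma F_integrable:
  assumes "a \<in> minf_pos" shows "F a integrable_on {0..M}"
proof -
  have "mono_on {0..M} (\<lambda>t. - F a t)"
    using F_antimono[OF assms] by (auto simp: mono_on_def)
  then have "(\<lambda>t. - F a t) integrable_on {0..M}" by (rule integrable_on_mono_on)
  then show ?thesis using integrable_neg_iff by blast
qed

definition tD :: "'a minf \<Rightarrow> real" where "tD a = integral {0..norm a} (F a)"

lemma tD_bound:
  assumes a: "a \<in> minf_pos" "norm a \<le> M" shows "tD a = integral {0..M} (F a)"
proof -
  have "integral {0..norm a} (F a) + integral {norm a..M} (F a) = integral {0..M} (F a)"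
    using assms by (intro Henstock_Kurzweil_Integration.integral_combine F_integrable) auto
  moreover have "integral {norm a..M} (F a) = integral {norm a..M} (\<lambda>_. 0)"
    by (intro integral_cong F_zero a) auto
  ultimately show ?thesis by (simp add: tD_def)
qed

lemma tD_nonneg: "a \<in> minf_pos \<Longrightarrow> 0 \<le> tD a"
  unfolding tD_def by (intro integral_nonneg F_integrable F_nonneg) auto

lemma tD_le: "a \<in> minf_pos \<Longrightarrow> tD a \<le> norm a * D a"
proof -
  assume a: "a \<in> minf_pos"
  have "tD a \<le> integral {0..norm a} (\<lambda>_. D a)"
    unfolding tD_def by (intro integral_le F_integrable a F_le) auto
  then show ?thesis by simp
qed

text \<open>For each t, a \<le> t + (y - t)_+ + z, so D((a - t)_+) \<le> D((y - t)_+) + D(z), and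
  only t \<le> norm a contributes. Thus z is measured by D(z) whatever its norm, which allows
  remainders of small dimension to be discarded.\<close>

lemma tD_add_le:
  assumes a: "a \<in> minf_pos" and y: "y \<in> minf_pos" and z: "z \<in> minf_pos" and le: "y + z - a \<in> minf_pos"
  shows "tD a \<le> tD y + norm a * D z"
proof -
  define M where "M = max (norm a) (norm y)"
  obtain m where m: "a \<in> Mat m" "y \<in> Mat m" "z \<in> Mat m" using ex_Mat3 by blast
  have F: "F a t \<le> F y t + (if t \<le> norm a then D z else 0)" if t: "0 \<le> t" for t
  proof (cases "t \<le> norm a")
    case True
    have "t *\<^sub>R unitm m + (cf (excess t) y + z) - a = (t *\<^sub>R unitm m + cf (excess t) y - y) + (y + z - a)" by simp
    also have "\<dots> \<in> minf_pos" by (intro psd_add le excess_le y m t)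
    finally have "cf (excess t) a \<lesssim> cf (excess t) y + z"
      by (intro excess_cuntz[OF a m(1)] psd_add psd_cut y z t Mat_intros cf_Mat m C0_cut)
    then have "F a t \<le> D (cf (excess t) y + z)"
      unfolding F_def by (intro mono psd_cut psd_add a y z t)
    also have "\<dots> \<le> F y t + D z" unfolding F_def by (intro subadd psd_cut y z t)
    finally show ?thesis using True by simp
  next
    case False
    then show ?thesis using F_zero[OF a, of t] F_nonneg[OF y t] by simp
  qed
  have i: "(\<lambda>t. if t \<le> norm a then D z else 0) integrable_on {0..M}"
  proof -
    have "mono_on {0..M} (\<lambda>t. - (if t \<le> norm a then D z else 0))"
      using nonneg[OF z] by (auto simp: mono_on_def)
    then have "(\<lambda>t. - (if t \<le> norm a then D z else 0)) integrable_on {0..M}" by (rule integrable_on_mono_on)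
    then show ?thesis using integrable_neg_iff by blast
  qed
  have "tD a = integral {0..M} (F a)" by (intro tD_bound a) (simp add: M_def)
  also have "\<dots> \<le> integral {0..M} (\<lambda>t. F y t + (if t \<le> norm a then D z else 0))"
    by (intro integral_le F_integrable a integrable_add y i) (use F in auto)
  also have "\<dots> = integral {0..M} (F y) + integral {0..M} (\<lambda>t. if t \<le> norm a then D z else 0)"
    by (intro integral_add F_integrable y i)
  also have "integral {0..M} (F y) = tD y" by (intro tD_bound[symmetric] y) (simp add: M_def)
  also have "integral {0..M} (\<lambda>t. if t \<le> norm a then D z else 0)
      = integral {0..norm a} (\<lambda>t. if t \<le> norm a then D z else 0) + integral {norm a..M} (\<lambda>t. if t \<le> norm a then D z else 0)"
    by (intro Henstock_Kurzweil_Integration.integral_combine[symmetric] i) (auto simp: M_def)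
  \<comment> \<open>The integrands agree except at the single point norm a.\<close>
  also have "integral {norm a..M} (\<lambda>t. if t \<le> norm a then D z else 0) = integral {norm a..M} (\<lambda>_. 0)"
    by (rule integral_spike[of "{norm a}"]) auto
  also have "integral {0..norm a} (\<lambda>t. if t \<le> norm a then D z else 0) = integral {0..norm a} (\<lambda>_. D z)"
    by (rule integral_cong) auto
  finally show ?thesis by simp
qed

lemma tD_mono: "a \<in> minf_pos \<Longrightarrow> b - a \<in> minf_pos \<Longrightarrow> tD a \<le> tD b"
  using tD_add_le[of a b 0] psd_add[of a "b - a"] by (simp add: D_0)

lemma tD_orth:
  assumes a: "a \<in> minf_pos" and b: "b \<in> minf_pos" and ab: "a * b = 0"
  shows "tD (a + b) = tD a + tD b"
proof -
  define M where "M = max (norm (a + b)) (max (norm a) (norm b))"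
  have "F (a + b) t = F a t + F b t" if t: "0 \<le> t" for t
  proof -
    note r = C0_cut[OF t]
    have "b * cf (excess t) a = 0"
      using cf_mult_zero[OF a r ab] psd_adj[OF b] cf_adj[OF psd_cpos[OF a] r] by (metis adj_mult adj_zero)
    then have "cf (excess t) b * cf (excess t) a = 0" by (rule cf_mult_zero[OF b r])
    then have "cf (excess t) a * cf (excess t) b = 0" using orth_sym psd_cut a b t by blast
    then show ?thesis
      unfolding F_def cf_add_orth[OF a b ab r] by (intro orth psd_cut a b t)
  qed
  then have "integral {0..M} (F (a + b)) = integral {0..M} (\<lambda>t. F a t + F b t)"
    by (intro integral_cong) auto
  also have "\<dots> = integral {0..M} (F a) + integral {0..M} (F b)"
    by (intro integral_add F_integrable a b)
  finally show ?thesis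
    by (subst (1 2 3) tD_bound[where M = M]) (auto simp: M_def intro: a b psd_add)
qed

lemma tD_0: "tD 0 = 0"
  using tD_orth[of 0 0] by simp

lemma tD_sum:
  assumes "finite I" "\<And>i. i \<in> I \<Longrightarrow> f i \<in> minf_pos" "\<And>i j. i \<in> I \<Longrightarrow> j \<in> I \<Longrightarrow> i \<noteq> j \<Longrightarrow> f i * f j = 0"
  shows "tD (sum f I) = (\<Sum>i\<in>I. tD (f i))"
  using assms
proof (induction I)
  case (insert i I)
  have "f i * sum f I = 0" unfolding sum_distrib_left using insert by (intro sum.neutral) auto
  then have "tD (f i + sum f I) = tD (f i) + tD (sum f I)"
    using insert by (intro tD_orth psd_sum) auto
  then show ?case using insert by simp
qed (simp add: tD_0)

lemma tD_scale:
  assumes a: "a \<in> minf_pos" and r: "0 \<le> r" shows "tD (r *\<^sub>R a) = r * tD a"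
proof (cases "r = 0")
  case False
  then have r: "0 < r" using r by simp
  note cp = psd_cpos[OF a]
  have Fr: "F (r *\<^sub>R a) (r * t) = F a t" if t: "0 \<le> t" for t
  proof -
    have "cf (\<lambda>s. r * s) a = r *\<^sub>R a" using cf_scale[OF cp C0_simps(1)] cf_id[OF cp] by simp
    then have "cf (excess (r * t)) (r *\<^sub>R a) = cf (\<lambda>s. excess (r * t) (r * s)) a"
      using cf_comp[OF cp C0_simps(4)[OF C0_simps(1)] _ C0_cut, of r "r * t"] r t by simp
    also have "(\<lambda>s. excess (r * t) (r * s)) = (\<lambda>s. r * excess t s)"
      using r by (auto simp: excess_def right_diff_distrib max_mult_distrib_left fun_eq_iff max_def)
    also have "cf (\<lambda>s. r * excess t s) a = r *\<^sub>R cf (excess t) a" by (rule cf_scale[OF cp C0_cut[OF t]])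
    finally have e: "cf (excess (r * t)) (r *\<^sub>R a) = r *\<^sub>R cf (excess t) a" .
    have "r *\<^sub>R cf (excess t) a \<lesssim> cf (excess t) a" using r by (intro cuntz_scale) simp
    moreover have "(1/r) *\<^sub>R (r *\<^sub>R cf (excess t) a) \<lesssim> r *\<^sub>R cf (excess t) a" using r by (intro cuntz_scale) simp
    ultimately show ?thesis
      unfolding F_def e using r by (intro D_eq psd_scale psd_cut a t) auto
  qed
  have "((\<lambda>t. F (r *\<^sub>R a) (r * t)) has_integral (1 / \<bar>r\<bar>) *\<^sub>R tD (r *\<^sub>R a)) ((\<lambda>x. x / r) ` {0..norm (r *\<^sub>R a)})"
    unfolding tD_def
    using has_integral_stretch_real[OF integrable_integral[OF F_integrable[OF psd_scale[OF a less_imp_le[OF r]]]], of r "norm (r *\<^sub>R a)"] r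
    by simp
  moreover have "(\<lambda>x. x / r) ` {0..norm (r *\<^sub>R a)} = {0..norm a}"
    using r image_divide_atLeastAtMost[of r 0 "norm (r *\<^sub>R a)"] by simp
  ultimately have "integral {0..norm a} (\<lambda>t. F (r *\<^sub>R a) (r * t)) = (1 / r) * tD (r *\<^sub>R a)"
    using r by (simp add: integral_unique)
  moreover have "integral {0..norm a} (\<lambda>t. F (r *\<^sub>R a) (r * t)) = tD a"
    unfolding tD_def by (intro integral_cong Fr) auto
  ultimately show ?thesis using r by (simp add: field_simps)
qed (simp add: tD_0)

lemma tD_approx:
  assumes y: "y \<in> minf_pos" and z: "z \<in> minf_pos" and x: "x = y + z"
  shows "\<bar>tD x - tD y\<bar> \<le> norm x * D z"
proof -
  have xp: "x \<in> minf_pos" using psd_add[OF y z] x by simp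
  have "tD x \<le> tD y + norm x * D z" by (intro tD_add_le xp y z) (simp add: x)
  moreover have "tD y \<le> tD x" by (intro tD_mono y) (simp add: x z)
  ultimately show ?thesis using nonneg[OF z] by (simp add: abs_le_iff)
qed

end

text \<open>The calculus in \<open>Mat n\<close> including its unit, for functions that do not
  vanish at 0. The spectral partitions of unity below need it, since their first member is 1 at
  0.\<close>

definition cfe :: "nat \<Rightarrow> (real \<Rightarrow> real) \<Rightarrow> 'a :: unital_cstar_algebra minf \<Rightarrow> 'a minf" where
  "cfe n f a = f 0 *\<^sub>R unitm n + cf (\<lambda>s. f s - f 0) a"

context
  fixes n :: nat and a :: "'a :: unital_cstar_algebra minf"
  assumes a: "a \<in> Mat n" "a \<in> minf_pos"
begin

private lemma cp: "cpos a" by (rule psd_cpos[OF a(2)])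

private lemma C: "continuous_on {0..} f \<Longrightarrow> C0 (\<lambda>s. f s - f 0)"
  by (auto simp: C0_def intro!: continuous_intros)

lemma cfe_Mat: "continuous_on {0..} f \<Longrightarrow> cfe n f a \<in> Mat n"
  unfolding cfe_def by (intro Mat_intros cf_Mat a C unitm_Mat)

lemma cfe_adj: "continuous_on {0..} f \<Longrightarrow> adj (cfe n f a) = cfe n f a"
  unfolding cfe_def by (simp add: adj_simps M_adj_unit cf_adj[OF cp C])

lemma cfe_cf: "C0 f \<Longrightarrow> cfe n f a = cf f a"
  by (simp add: cfe_def C0_def)

lemma cfe_const: "cfe n (\<lambda>_. c) a = c *\<^sub>R unitm n"
  using cf_scale[OF cp C0_simps(1), of 0] by (simp add: cfe_def)

lemma cfe_id: "cfe n (\<lambda>s. s) a = a"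
  by (simp add: cfe_cf C0_simps cf_id[OF cp])

lemma cfe_cong:
  assumes "continuous_on {0..} f" "continuous_on {0..} g" "\<And>s. 0 \<le> s \<Longrightarrow> s \<le> norm a \<Longrightarrow> f s = g s"
  shows "cfe n f a = cfe n g a"
proof -
  have "cf (\<lambda>s. f s - f 0) a = cf (\<lambda>s. g s - g 0) a"
    by (intro cf_cong cp C assms) (use assms(3)[of 0] assms(3) in auto)
  then show ?thesis using assms(3)[of 0] by (simp add: cfe_def)
qed

lemma cfe_add:
  assumes "continuous_on {0..} f" "continuous_on {0..} g"
  shows "cfe n (\<lambda>s. f s + g s) a = cfe n f a + cfe n g a"
proof -
  have "cf (\<lambda>s. (f s - f 0) + (g s - g 0)) a = cf (\<lambda>s. f s - f 0) a + cf (\<lambda>s. g s - g 0) a"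
    by (intro cf_add cp C assms)
  moreover have "(\<lambda>s. (f s - f 0) + (g s - g 0)) = (\<lambda>s. f s + g s - (f 0 + g 0))" by auto
  ultimately show ?thesis by (simp add: cfe_def scaleR_add_left)
qed

lemma cfe_scale:
  assumes "continuous_on {0..} f"
  shows "cfe n (\<lambda>s. c * f s) a = c *\<^sub>R cfe n f a"
proof -
  have "cf (\<lambda>s. c * (f s - f 0)) a = c *\<^sub>R cf (\<lambda>s. f s - f 0) a"
    by (intro cf_scale cp C assms)
  then show ?thesis by (simp add: cfe_def scaleR_add_right right_diff_distrib)
qed

lemma cfe_diff:
  assumes "continuous_on {0..} f" "continuous_on {0..} g"
  shows "cfe n (\<lambda>s. f s - g s) a = cfe n f a - cfe n g a"
  using cfe_add[of f "\<lambda>s. -1 * g s"] cfe_scale[of g "-1"] assms by (simp add: continuous_intros)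

lemma cfe_mult:
  assumes f: "continuous_on {0..} f" and g: "continuous_on {0..} g"
  shows "cfe n (\<lambda>s. f s * g s) a = cfe n f a * cfe n g a"
proof -
  let ?f = "\<lambda>s. f s - f 0" and ?g = "\<lambda>s. g s - g 0"
  have c: "C0 (\<lambda>s. f 0 * ?g s)" "C0 (\<lambda>s. g 0 * ?f s)" "C0 (\<lambda>s. ?f s * ?g s)"
    by (intro C0_simps C f g continuous_intros)+
  have m: "cf ?f a \<in> Mat n" "cf ?g a \<in> Mat n" by (intro cf_Mat a C f g)+
  have "cf (\<lambda>s. (f 0 * ?g s + g 0 * ?f s) + ?f s * ?g s) a
      = f 0 *\<^sub>R cf ?g a + g 0 *\<^sub>R cf ?f a + cf ?f a * cf ?g a"
    using cf_add[OF cp C0_simps(2)[OF c(1,2)] c(3)] cf_add[OF cp c(1,2)] cf_mult[OF cp C[OF f] C[OF g]]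
      cf_scale[OF cp C[OF f], of "g 0"] cf_scale[OF cp C[OF g], of "f 0"] by simp
  moreover have "(\<lambda>s. (f 0 * ?g s + g 0 * ?f s) + ?f s * ?g s) = (\<lambda>s. f s * g s - f 0 * g 0)"
    by (auto simp: algebra_simps)
  ultimately have "cfe n (\<lambda>s. f s * g s) a = (f 0 * g 0) *\<^sub>R unitm n
      + (f 0 *\<^sub>R cf ?g a + g 0 *\<^sub>R cf ?f a + cf ?f a * cf ?g a)"
    by (simp add: cfe_def)
  also have "\<dots> = cfe n f a * cfe n g a"
    by (simp add: cfe_def distrib_left distrib_right unitm_left[OF m(2)] unitm_right[OF m(1)]
      unitm_left[OF unitm_Mat] mult.commute scaleR_add_right)
  finally show ?thesis .
qed

lemma cfe_sum:
  assumes "finite I" "\<And>i. i \<in> I \<Longrightarrow> continuous_on {0..} (f i)"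
  shows "cfe n (\<lambda>s. \<Sum>i\<in>I. f i s) a = (\<Sum>i\<in>I. cfe n (f i) a)"
  using assms
proof (induction I)
  case empty
  show ?case using cfe_const[of 0] by simp
next
  case (insert i I)
  then show ?case by (simp add: cfe_add continuous_intros)
qed

lemma cfe_psd:
  assumes f: "continuous_on {0..} f" "\<And>s. 0 \<le> s \<Longrightarrow> s \<le> norm a \<Longrightarrow> 0 \<le> f s"
  shows "cfe n f a \<in> minf_pos"
proof -
  let ?h = "\<lambda>s. sqrt (max 0 (f s))"
  have h: "continuous_on {0..} ?h" using f by (intro continuous_intros)
  have "cfe n f a = cfe n (\<lambda>s. ?h s * ?h s) a"
    by (intro cfe_cong f continuous_on_mult h) (simp add: f(2))
  also have "\<dots> = cfe n ?h a * cfe n ?h a" by (intro cfe_mult h)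
  finally show ?thesis using psd_square'[OF cfe_adj[OF h]] by simp
qed

lemma cfe_commute:
  assumes "continuous_on {0..} f" "z \<in> Mat n" "a * z = z * a"
  shows "cfe n f a * z = z * cfe n f a"
  using cf_intertwine[OF cp cp C[OF assms(1)] assms(3)] assms(2)
  by (simp add: cfe_def distrib_left distrib_right unitm_left unitm_right)

end

section \<open>Spectral partitions and additivity on commuting elements\<close>

definition step :: "real \<Rightarrow> real \<Rightarrow> real \<Rightarrow> real" where
  "step v \<gamma> s = min 1 (max 0 ((s - v) / \<gamma>))"

lemma step_cont: "\<gamma> > 0 \<Longrightarrow> continuous_on A (step v \<gamma>)"
  unfolding step_def[abs_def] by (intro continuous_intros) auto

lemma step_simps: "\<gamma> > 0 \<Longrightarrow> s \<le> v \<Longrightarrow> step v \<gamma> s = 0" "\<gamma> > 0 \<Longrightarrow> v + \<gamma> \<le> s \<Longrightarrow> step v \<gamma> s = 1"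
  "0 \<le> step v \<gamma> s" "step v \<gamma> s \<le> 1"
  by (auto simp: step_def max_def min_def field_simps)

context fin_dimfun
begin

lemma D_sum_le:
  assumes "finite I" "\<And>i. i \<in> I \<Longrightarrow> f i \<in> minf_pos"
  shows "D (sum f I) \<le> (\<Sum>i\<in>I. D (f i))"
  using assms
proof (induction I)
  case (insert i I)
  then have "D (f i + sum f I) \<le> D (f i) + D (sum f I)" by (intro subadd psd_sum) auto
  then show ?case using insert by simp
qed (simp add: D_0)

text \<open>The monotone function t \<mapsto> D((a - t)_+) has a continuity point u in the given
  interval. The bump around u is orthogonal to (a - u - \<gamma>)_+, and their sum is Cuntz below (a
  - u + \<gamma>)_+; so the dimension of the bump is at most the drop of the function from u -
  \<gamma> to u + \<gamma>.\<close>

lemma small_gap: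
  assumes a: "a \<in> minf_pos" and lr: "0 \<le> l" "l < r" and \<epsilon>: "0 < \<epsilon>"
  obtains u \<gamma> where "0 < \<gamma>" "l \<le> u - \<gamma>" "u + \<gamma> \<le> r"
    "D (cf (\<lambda>s. step (u - \<gamma>) \<gamma> s - step u \<gamma> s) a) \<le> \<epsilon>"
proof -
  \<comment> \<open>Negated and extended constantly to negative t, so that it is increasing on the
    whole line.\<close>
  define \<phi> where "\<phi> t = - F a (max 0 t)" for t
  have "mono \<phi>" unfolding \<phi>_def by (rule monoI) (auto intro!: F_antimono a)
  then have "countable {t. \<not> isCont \<phi> t}" by (rule mono_ctble_discont)
  then have "\<not> {l<..<r} \<subseteq> {t. \<not> isCont \<phi> t}"
    using uncountable_open_interval[of l r] lr countable_subset by blast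
  then obtain u where u: "l < u" "u < r" "isCont \<phi> u" by auto
  then obtain \<delta> where \<delta>: "\<delta> > 0" "\<And>t. \<bar>t - u\<bar> < \<delta> \<Longrightarrow> \<bar>\<phi> t - \<phi> u\<bar> < \<epsilon> / 2"
    using \<epsilon> unfolding continuous_at_eps_delta dist_real_def by (metis half_gt_zero)
  define \<gamma> where "\<gamma> = min (\<delta> / 2) (min (u - l) (r - u))"
  have \<gamma>: "0 < \<gamma>" "l \<le> u - \<gamma>" "u + \<gamma> \<le> r" "\<gamma> < \<delta>" using u \<delta> by (auto simp: \<gamma>_def)
  define G where "G = (\<lambda>s. step (u - \<gamma>) \<gamma> s - step u \<gamma> s)"
  have G0: "0 \<le> G s" for s
  proof (cases "u \<le> s")
    case True
    then show ?thesis using \<gamma> by (simp add: G_def step_simps)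
  next
    case False
    then show ?thesis using \<gamma> by (simp add: G_def step_simps)
  qed
  have "G 0 = 0" using \<gamma> lr by (simp add: G_def step_simps)
  then have G: "C0 G"
    using \<gamma> by (auto simp: C0_def G_def intro!: continuous_intros step_cont)
  let ?e = "excess (u + \<gamma>)"
  have e: "C0 ?e" using \<gamma> lr by (intro C0_cut) linarith
  have ue: "0 \<le> u - \<gamma>" using \<gamma> lr by linarith
  have GE: "G s * ?e s = 0" for s using \<gamma> by (cases "s \<le> u + \<gamma>") (auto simp: G_def excess_def step_simps)
  have "cf G a * cf ?e a = cf (\<lambda>s. G s * ?e s) a" by (rule cf_mult[OF psd_cpos[OF a] G e, symmetric])
  also have "\<dots> = 0" using cf_scale[OF psd_cpos[OF a] G, of 0] by (simp add: GE)
  finally have "D (cf G a) + D (cf ?e a) = D (cf G a + cf ?e a)"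
    by (intro orth[symmetric] psd_cf a G e G0 cut_nonneg)
  also have "\<dots> = D (cf (\<lambda>s. G s + ?e s) a)" by (simp add: cf_add[OF psd_cpos[OF a] G e])
  also have "\<dots> \<le> D (cf (excess (u - \<gamma>)) a)"
  proof (intro mono psd_cf a C0_simps G e C0_cut ue add_nonneg_nonneg G0 cut_nonneg)
    show "cf (\<lambda>s. G s + ?e s) a \<lesssim> cf (excess (u - \<gamma>)) a"
    proof (rule cuntz_cf[OF a C0_simps(2)[OF G e], where C = "1 / \<gamma> + 1"])
      fix s
      have "step (u - \<gamma>) \<gamma> s \<le> 1 / \<gamma> * excess (u - \<gamma>) s"
      proof (cases "u - \<gamma> \<le> s")
        case True
        then have "excess (u - \<gamma>) s = s - (u - \<gamma>)" "0 \<le> (s - (u - \<gamma>)) / \<gamma>" using \<gamma> by (auto simp: excess_def)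
        then show ?thesis by (simp add: step_def)
      next
        case False
        then show ?thesis using \<gamma> by (simp add: step_simps cut_nonneg)
      qed
      then have "G s \<le> 1 / \<gamma> * excess (u - \<gamma>) s" using step_simps(3)[of u \<gamma> s] by (simp add: G_def)
      moreover have "?e s \<le> excess (u - \<gamma>) s" using \<gamma> by (simp add: excess_def)
      ultimately show "G s + ?e s \<le> (1 / \<gamma> + 1) * excess (u - \<gamma>) s" by (simp add: distrib_right)
    qed (use \<gamma> ue in \<open>auto intro!: C0_cut add_nonneg_nonneg G0 cut_nonneg\<close>)
  qed
  finally have "D (cf G a) \<le> \<phi> (u + \<gamma>) - \<phi> (u - \<gamma>)"
    using \<gamma> lr by (simp add: \<phi>_def F_def)
  also have "\<dots> \<le> \<epsilon>"
  proof -
    have "\<bar>\<phi> (u + \<gamma>) - \<phi> u\<bar> < \<epsilon> / 2" "\<bar>\<phi> (u - \<gamma>) - \<phi> u\<bar> < \<epsilon> / 2"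
      by (rule \<delta>(2), use \<gamma> in simp)+
    then show ?thesis by linarith
  qed
  finally show ?thesis using that[of \<gamma> u] \<gamma> by (simp add: G_def)
qed

text \<open>P i is a piece of a spectral partition, and t i is the value of a on it up to 2 l. P i
  commutes with whatever commutes with a, so that grids of commuting elements can be multiplied. The
  sum may fall short of the unit by dimension \<epsilon>, as orthogonal continuous bumps leave
  gaps.\<close>

definition is_grid :: "nat \<Rightarrow> 'a minf \<Rightarrow> real \<Rightarrow> real \<Rightarrow> nat \<Rightarrow> (nat \<Rightarrow> 'a minf) \<Rightarrow> (nat \<Rightarrow> real) \<Rightarrow> bool" where
  "is_grid n a \<epsilon> l K P t \<longleftrightarrow>
    (\<forall>i. P i \<in> Mat n) \<and> (\<forall>i. P i \<in> minf_pos) \<and> (\<forall>i. \<forall>z\<in>Mat n. a * z = z * a \<longrightarrow> P i * z = z * P i) \<and>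
    (\<forall>i j. i \<noteq> j \<longrightarrow> P i * P j = 0) \<and> (\<forall>i. 0 \<le> t i) \<and>
    (\<forall>i. a * P i - t i *\<^sub>R P i \<in> minf_pos) \<and> (\<forall>i. (t i + 2 * l) *\<^sub>R P i - a * P i \<in> minf_pos) \<and>
    unitm n - (\<Sum>i\<le>K. P i) \<in> minf_pos \<and> D (unitm n - (\<Sum>i\<le>K. P i)) \<le> \<epsilon>"

text \<open>A positive element decomposes, up to a remainder of small dimension, into pairwise orthogonal
  pieces on which it is nearly scalar.\<close>

lemma grid:
  assumes a: "a \<in> Mat n" "a \<in> minf_pos" and \<epsilon>: "0 < \<epsilon>" and l: "0 < l"
  shows "\<exists>K P t. is_grid n a \<epsilon> l K P t"
proof -
  obtain K :: nat where K: "norm a \<le> real K * l"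
    using reals_Archimedean3[OF l] by (metis less_imp_le)
  \<comment> \<open>K gaps occur below norm a, and each of them may take \<epsilon>/(K + 1).\<close>
  define \<epsilon>' where "\<epsilon>' = \<epsilon> / real (Suc K)"
  have \<epsilon>': "0 < \<epsilon>'" using \<epsilon> by (simp add: \<epsilon>'_def)
  define W where "W k u \<gamma> \<longleftrightarrow> 0 < \<gamma> \<and> real k * l \<le> u - \<gamma> \<and> u + \<gamma> \<le> real (Suc k) * l \<and>
    D (cf (\<lambda>s. step (u - \<gamma>) \<gamma> s - step u \<gamma> s) a) \<le> \<epsilon>'" for k u \<gamma>
  have "\<exists>u \<gamma>. W k u \<gamma>" for k
    by (rule small_gap[OF a(2) _ _ \<epsilon>', of "real k * l" "real (Suc k) * l"]) (use l in \<open>auto simp: W_def\<close>)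
  then obtain u \<gamma> where "\<And>k. W k (u k) (\<gamma> k)" by metis
  then have g: "\<And>k. 0 < \<gamma> k" and lo: "\<And>k. real k * l \<le> u k - \<gamma> k"
    and hi: "\<And>k. u k + \<gamma> k \<le> real (Suc k) * l"
    and small: "\<And>k. D (cf (\<lambda>s. step (u k - \<gamma> k) (\<gamma> k) s - step (u k) (\<gamma> k) s) a) \<le> \<epsilon>'"
    by (auto simp: W_def)
  \<comment> \<open>\<open>up i\<close> rises just above u (i - 1) and \<open>dn i\<close> just
    below u i, so p i ends where p (i + 1) begins. What is left out around u i is the bump G i of
    \<open>small_gap\<close>; piece 0 has no left flank.\<close>
  define up where "up i s = (if i = 0 then 1 else step (u (i - 1)) (\<gamma> (i - 1)) s)" for i s
  define dn where "dn i = step (u i - \<gamma> i) (\<gamma> i)" for i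
  define p where "p i s = up i s - dn i s" for i s
  define G where "G k s = dn k s - step (u k) (\<gamma> k) s" for k s
  have lk: "real k * l \<ge> 0" for k using l by simp
  have ord: "u i + \<gamma> i \<le> u j - \<gamma> j" if "i < j" for i j
  proof -
    have "real (Suc i) * l \<le> real j * l" using that l by (intro mult_right_mono) auto
    then show ?thesis using hi[of i] lo[of j] by linarith
  qed
  have up1: "up i s = 1" if "u i - \<gamma> i \<le> s" for i s
    using that ord[of "i - 1" i] g[of "i - 1"] by (auto simp: up_def intro!: step_simps)
  have cu: "continuous_on {0..} (up i)" for i
    using step_cont[OF g] by (cases i) (simp_all add: up_def[abs_def])
  have cd: "continuous_on {0..} (dn i)" for i unfolding dn_def by (rule step_cont[OF g])
  have cpi: "continuous_on {0..} (p i)" for i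
    unfolding p_def[abs_def] by (intro continuous_intros cu cd)
  have cs: "continuous_on {0..} (\<lambda>s. s * p i s)" "continuous_on {0..} (\<lambda>s. c * p i s)" for i c
    by (intro continuous_intros cpi)+
  have p0: "0 \<le> p i s" for i s
  proof (cases "u i - \<gamma> i \<le> s")
    case True
    then show ?thesis using up1 by (simp add: p_def dn_def step_simps)
  next
    case False
    then show ?thesis using g by (simp add: p_def dn_def step_simps up_def)
  qed
  have p_hi: "p i s = 0" if "u i \<le> s" for i s
    using up1[of i s] g[of i] that by (simp add: p_def dn_def step_simps)
  have p_lo: "p i s = 0" if "i \<noteq> 0" "s \<le> u (i - 1)" for i s
  proof -
    have "s \<le> u i - \<gamma> i" using ord[of "i - 1" i] g[of "i - 1"] that by simp
    then show ?thesis using that g by (simp add: p_def up_def dn_def step_simps)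
  qed
  have pp: "p i s * p j s = 0" if "i < j" for i j s
  proof (cases "u i \<le> s")
    case False
    have "u i \<le> u (j - 1)"
    proof (cases "i = j - 1")
      case ne: False
      then have "i < j - 1" using that by linarith
      then show ?thesis using ord[of i "j - 1"] g[of i] g[of "j - 1"] by linarith
    qed simp
    then have "p j s = 0" using False that by (intro p_lo) auto
    then show ?thesis by simp
  qed (simp add: p_hi)
  \<comment> \<open>Piece i lives between u (i - 1) \<ge> (i - 1) l and u i \<le> (i + 1) l, whence
    the width 2 l in \<open>is_grid\<close>. Truncated subtraction gives t 0 = 0.\<close>
  define t where "t i = real (i - 1) * l" for i
  have t_lo: "t i * p i s \<le> s * p i s" if "0 \<le> s" for i s
  proof (cases "p i s = 0")
    case False
    have "t i \<le> s"
    proof (cases "i = 0")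
      case ne: False
      then have "u (i - 1) < s" using p_lo[of i s] False by force
      then show ?thesis using lo[of "i - 1"] g[of "i - 1"] by (simp only: t_def)
    qed (use that in \<open>simp add: t_def\<close>)
    then show ?thesis using p0 by (intro mult_right_mono)
  qed simp
  have t_hi: "s * p i s \<le> (t i + 2 * l) * p i s" for i s
  proof (cases "p i s = 0")
    case False
    then have "s \<le> real (Suc i) * l" using p_hi[of i s] hi[of i] g[of i] by force
    also have "\<dots> \<le> t i + 2 * l" using l by (cases i) (auto simp: t_def algebra_simps)
    finally show ?thesis using p0 by (intro mult_right_mono)
  qed simp
  have sum: "(\<Sum>i\<le>m. p i s) = 1 - (\<Sum>k<m. G k s) - dn m s" for m s
    by (induction m) (auto simp: p_def up_def G_def)
  define P where "P i = cfe n (p i) a" for i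
  have aP: "a * P i = cfe n (\<lambda>s. s * p i s) a" for i
    unfolding P_def using cfe_mult[OF a continuous_on_id cpi[of i]] cfe_id[OF a] by simp
  have cG: "continuous_on {0..} (G k)" for k
    unfolding G_def[abs_def] by (intro continuous_intros cd step_cont g)
  have CG: "C0 (G k)" for k
  proof -
    have "0 \<le> u k - \<gamma> k" "0 \<le> u k" using lo[of k] lk[of k] g[of k] by linarith+
    then show ?thesis using cG[of k] g[of k] by (simp add: C0_def G_def dn_def step_simps)
  qed
  have G0: "0 \<le> G k s" for k s
  proof (cases "u k \<le> s")
    case True
    then show ?thesis using g by (simp add: G_def dn_def step_simps)
  next
    case False
    then show ?thesis using g by (simp add: G_def dn_def step_simps)
  qed
  have "unitm n - (\<Sum>i\<le>K. P i) = cfe n (\<lambda>_. 1) a - cfe n (\<lambda>s. \<Sum>i\<le>K. p i s) a"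
    using cfe_sum[OF a, of "{..K}" p] cpi cfe_const[OF a, of 1] by (simp add: P_def)
  also have "\<dots> = cfe n (\<lambda>s. 1 - (\<Sum>i\<le>K. p i s)) a"
    by (intro cfe_diff[OF a, symmetric] continuous_intros cpi)
  also have "\<dots> = cfe n (\<lambda>s. \<Sum>k<K. G k s) a"
  proof (intro cfe_cong[OF a] continuous_intros cpi cG)
    fix s assume s: "0 \<le> s" "s \<le> norm a"
    then have "dn K s = 0" using lo[of K] K g by (simp add: dn_def step_simps)
    then show "1 - (\<Sum>i\<le>K. p i s) = (\<Sum>k<K. G k s)" by (simp add: sum)
  qed
  also have "\<dots> = (\<Sum>k<K. cfe n (G k) a)" by (intro cfe_sum[OF a] cG) simp
  also have "\<dots> = (\<Sum>k<K. cf (G k) a)" by (simp add: cfe_cf[OF a] CG)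
  finally have rem: "unitm n - (\<Sum>i\<le>K. P i) = (\<Sum>k<K. cf (G k) a)" .
  have psdG: "cf (G k) a \<in> minf_pos" for k by (intro psd_cf a CG G0)
  show ?thesis
  proof (rule exI[of _ K], rule exI[of _ P], rule exI[of _ t], unfold is_grid_def, intro conjI allI ballI impI)
    show "P i \<in> Mat n" "P i \<in> minf_pos" for i
      unfolding P_def by (intro cfe_Mat[OF a] cfe_psd[OF a] cpi p0)+
    show "P i * z = z * P i" if "z \<in> Mat n" "a * z = z * a" for i z
      unfolding P_def by (intro cfe_commute[OF a] cpi that)
    show "P i * P j = 0" if "i \<noteq> j" for i j
    proof -
      have "P i * P j = cfe n (\<lambda>s. p i s * p j s) a" unfolding P_def by (intro cfe_mult[OF a, symmetric] cpi)
      also have "(\<lambda>s. p i s * p j s) = (\<lambda>_. 0)"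
        using pp[of i j] pp[of j i] that by (cases "i < j") (auto simp: mult.commute fun_eq_iff)
      also have "cfe n (\<lambda>_. 0) a = 0" using cfe_const[OF a, of 0] by simp
      finally show ?thesis .
    qed
    show "0 \<le> t i" for i using l by (simp add: t_def)
    show "a * P i - t i *\<^sub>R P i \<in> minf_pos" for i
    proof -
      have "a * P i - t i *\<^sub>R P i = cfe n (\<lambda>s. s * p i s - t i * p i s) a"
        unfolding aP unfolding P_def cfe_scale[OF a cpi, symmetric] by (intro cfe_diff[OF a, symmetric] cs)
      then show ?thesis using t_lo by (auto intro!: cfe_psd[OF a] continuous_intros cpi)
    qed
    show "(t i + 2 * l) *\<^sub>R P i - a * P i \<in> minf_pos" for i
    proof -
      have "(t i + 2 * l) *\<^sub>R P i - a * P i = cfe n (\<lambda>s. (t i + 2 * l) * p i s - s * p i s) a"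
        unfolding aP unfolding P_def cfe_scale[OF a cpi, symmetric] by (intro cfe_diff[OF a, symmetric] cs)
      then show ?thesis using t_hi by (auto intro!: cfe_psd[OF a] continuous_intros cpi)
    qed
    show "unitm n - (\<Sum>i\<le>K. P i) \<in> minf_pos" unfolding rem by (intro psd_sum psdG)
    have "D (\<Sum>k<K. cf (G k) a) \<le> (\<Sum>k<K. D (cf (G k) a))" by (intro D_sum_le psdG) simp
    also have "\<dots> \<le> (\<Sum>k<K. \<epsilon>')"
      using small by (intro sum_mono) (simp add: G_def[abs_def] dn_def)
    also have "\<dots> \<le> \<epsilon>" using \<epsilon> by (simp add: \<epsilon>'_def field_simps)
    finally show "D (unitm n - (\<Sum>i\<le>K. P i)) \<le> \<epsilon>" unfolding rem .
  qed
qed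

text \<open>A Riemann sum for \<open>tD x\<close>. What lies outside the pieces has dimension at
  most \<epsilon> and is discarded by \<open>tD_approx\<close>; on each piece x lies between c and c
  + w, and the pieces have total mass at most D of the unit.\<close>

lemma pieces_approx:
  assumes x: "x \<in> Mat n" "x \<in> minf_pos" and I: "finite I"
    and r: "\<And>i. i \<in> I \<Longrightarrow> r i \<in> Mat n" "\<And>i. i \<in> I \<Longrightarrow> r i \<in> minf_pos" "\<And>i. i \<in> I \<Longrightarrow> x * r i = r i * x"
    and o: "\<And>i j. i \<in> I \<Longrightarrow> j \<in> I \<Longrightarrow> i \<noteq> j \<Longrightarrow> r i * r j = 0"
    and c: "\<And>i. i \<in> I \<Longrightarrow> 0 \<le> c i" "\<And>i. i \<in> I \<Longrightarrow> x * r i - c i *\<^sub>R r i \<in> minf_pos"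
      "\<And>i. i \<in> I \<Longrightarrow> (c i + w) *\<^sub>R r i - x * r i \<in> minf_pos"
    and w: "0 \<le> w"
    and R: "unitm n - sum r I \<in> minf_pos" "D (unitm n - sum r I) \<le> \<epsilon>"
  shows "\<bar>tD x - (\<Sum>i\<in>I. c i * tD (r i))\<bar> \<le> norm x * \<epsilon> + w * D (unitm n)"
proof -
  let ?e = "unitm n :: 'a minf"
  let ?R = "sum r I"
  have Rm: "?R \<in> Mat n" by (intro cstar_unit.sum_mem[OF cstar_unit_Mat] r)
  have Rp: "?R \<in> minf_pos" by (intro psd_sum r)
  have xR: "x * ?R = ?R * x" unfolding sum_distrib_left sum_distrib_right by (intro sum.cong r) simp
  have xe: "x * (?e - ?R) = (?e - ?R) * x"
    using x xR by (simp add: right_diff_distrib left_diff_distrib unitm_left unitm_right)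
  have z: "x * (?e - ?R) \<in> minf_pos" by (intro psd_mult x R xe)
  have xr: "x * r i \<in> minf_pos" if "i \<in> I" for i by (intro psd_mult x r that)
  have y: "(\<Sum>i\<in>I. x * r i) \<in> minf_pos" by (intro psd_sum xr)
  have "norm x *\<^sub>R (?e - ?R) - x * (?e - ?R) = (norm x *\<^sub>R ?e - x) * (?e - ?R)"
    using Rm x by (simp add: left_diff_distrib right_diff_distrib unitm_left unitm_right scaleR_diff_right
      unitm_left[OF unitm_Mat])
  also have "\<dots> \<in> minf_pos"
    using Rm x xR by (intro psd_mult psd_unit_diff psd_adj R)
      (auto simp: left_diff_distrib right_diff_distrib scaleR_diff_right unitm_left unitm_right unitm_Mat)
  finally have "x * (?e - ?R) \<lesssim> norm x *\<^sub>R (?e - ?R)" by (intro le_cuntz z)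
  then have "x * (?e - ?R) \<lesssim> ?e - ?R" using cuntz_scale[OF norm_ge_zero] cuntz_trans by blast
  then have "D (x * (?e - ?R)) \<le> \<epsilon>" using R mono[OF z R(1)] by linarith
  moreover have "x = (\<Sum>i\<in>I. x * r i) + x * (?e - ?R)"
    using x by (simp add: right_diff_distrib unitm_right sum_distrib_left)
  then have "\<bar>tD x - tD (\<Sum>i\<in>I. x * r i)\<bar> \<le> norm x * D (x * (?e - ?R))"
    by (rule tD_approx[OF y z])
  ultimately have 1: "\<bar>tD x - tD (\<Sum>i\<in>I. x * r i)\<bar> \<le> norm x * \<epsilon>"
    using mult_left_mono[of "D (x * (?e - ?R))" \<epsilon> "norm x"] by simp
  have 2: "tD (\<Sum>i\<in>I. x * r i) = (\<Sum>i\<in>I. tD (x * r i))"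
  proof (rule tD_sum[OF I xr])
    fix i j assume ij: "i \<in> I" "j \<in> I" "i \<noteq> j"
    have "x * r i * (x * r j) = x * x * (r i * r j)" using r(3)[OF ij(1)] by (metis mult.assoc)
    then show "x * r i * (x * r j) = 0" using o[OF ij] by simp
  qed
  have "\<bar>tD (x * r i) - c i * tD (r i)\<bar> \<le> w * tD (r i)" if i: "i \<in> I" for i
  proof -
    have "c i * tD (r i) \<le> tD (x * r i)"
      using tD_mono[OF psd_scale[OF r(2)[OF i] c(1)[OF i]] c(2)[OF i]] tD_scale r(2)[OF i] c(1)[OF i] by simp
    moreover have "tD (x * r i) \<le> (c i + w) * tD (r i)"
      using tD_mono[OF xr[OF i] c(3)[OF i]] tD_scale[of "r i" "c i + w"] r(2)[OF i] c(1)[OF i] w by simp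
    ultimately show ?thesis by (simp add: abs_le_iff algebra_simps)
  qed
  then have "(\<Sum>i\<in>I. \<bar>tD (x * r i) - c i * tD (r i)\<bar>) \<le> (\<Sum>i\<in>I. w * tD (r i))" by (intro sum_mono)
  also have "\<dots> = w * tD ?R"
    unfolding sum_distrib_left[symmetric] by (subst tD_sum[OF I r(2) o]) auto
  also have "\<dots> \<le> w * D ?e"
  proof (intro mult_left_mono w)
    have "?e \<in> minf_pos" using psd_add[OF Rp R(1)] by simp
    then have "tD ?R \<le> norm ?e * D ?e" using tD_mono[OF Rp R(1)] tD_le[of ?e] by linarith
    also have "\<dots> \<le> 1 * D ?e" using nonneg[OF \<open>?e \<in> minf_pos\<close>] by (intro mult_right_mono M_norm_unit)
    finally show "tD ?R \<le> D ?e" by simp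
  qed
  finally have "\<bar>(\<Sum>i\<in>I. tD (x * r i)) - (\<Sum>i\<in>I. c i * tD (r i))\<bar> \<le> w * D ?e"
    unfolding sum_subtractf[symmetric] by (rule order_trans[OF sum_abs])
  then show ?thesis using 1 2 by linarith
qed

text \<open>The products P i Q j of two grids are orthogonal pieces on which a, b and a + b are
  nearly scalar simultaneously, and Riemann sums over the same pieces add up.\<close>

lemma tD_add:
  assumes a: "a \<in> minf_pos" and b: "b \<in> minf_pos" and ab: "a * b = b * a"
  shows "tD (a + b) = tD a + tD b"
proof -
  obtain n where n: "a \<in> Mat n" "b \<in> Mat n" using ex_Mat2 by blast
  let ?e = "unitm n :: 'a minf"
  \<comment> \<open>The error factors of the three Riemann sums: the remainder 2 \<epsilon> of the
    product grid gives the factors 2 at the norms, the widths 2 \<epsilon>, 2 \<epsilon> and 4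
    \<epsilon> give the 8, and the 1 makes B positive.\<close>
  define B where "B = 2 * norm (a + b) + 2 * norm a + 2 * norm b + 8 * D ?e + 1"
  have ep: "?e \<in> minf_pos"
    using psd_square'[of ?e] unitm_left[OF unitm_Mat] M_adj_unit by metis
  have B: "B > 0" using nonneg[OF ep] by (simp add: B_def add_nonneg_pos)
  have *: "\<bar>tD (a + b) - (tD a + tD b)\<bar> \<le> \<eta>" if \<eta>: "0 < \<eta>" for \<eta>
  proof -
    define \<epsilon> where "\<epsilon> = \<eta> / B"
    have \<epsilon>: "0 < \<epsilon>" using \<eta> B by (simp add: \<epsilon>_def)
    obtain K P t where "is_grid n a \<epsilon> \<epsilon> K P t" using grid[OF n(1) a \<epsilon> \<epsilon>] by blast
    then have P: "\<And>i. P i \<in> Mat n" "\<And>i. P i \<in> minf_pos"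
      "\<And>i z. z \<in> Mat n \<Longrightarrow> a * z = z * a \<Longrightarrow> P i * z = z * P i"
      "\<And>i j. i \<noteq> j \<Longrightarrow> P i * P j = 0" "\<And>i. 0 \<le> t i"
      "\<And>i. a * P i - t i *\<^sub>R P i \<in> minf_pos" "\<And>i. (t i + 2 * \<epsilon>) *\<^sub>R P i - a * P i \<in> minf_pos"
      "?e - (\<Sum>i\<le>K. P i) \<in> minf_pos" "D (?e - (\<Sum>i\<le>K. P i)) \<le> \<epsilon>"
      unfolding is_grid_def by blast+
    obtain L Q s where "is_grid n b \<epsilon> \<epsilon> L Q s" using grid[OF n(2) b \<epsilon> \<epsilon>] by blast
    then have Q: "\<And>i. Q i \<in> Mat n" "\<And>i. Q i \<in> minf_pos"
      "\<And>i z. z \<in> Mat n \<Longrightarrow> b * z = z * b \<Longrightarrow> Q i * z = z * Q i"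
      "\<And>i j. i \<noteq> j \<Longrightarrow> Q i * Q j = 0" "\<And>i. 0 \<le> s i"
      "\<And>i. b * Q i - s i *\<^sub>R Q i \<in> minf_pos" "\<And>i. (s i + 2 * \<epsilon>) *\<^sub>R Q i - b * Q i \<in> minf_pos"
      "?e - (\<Sum>i\<le>L. Q i) \<in> minf_pos" "D (?e - (\<Sum>i\<le>L. Q i)) \<le> \<epsilon>"
      unfolding is_grid_def by blast+
    have Pa: "P i * a = a * P i" for i using P(3)[OF n(1)] by simp
    have Pb: "P i * b = b * P i" for i using P(3)[OF n(2)] ab by simp
    have Qb: "Q j * b = b * Q j" for j using Q(3)[OF n(2)] by simp
    have Qa: "Q j * a = a * Q j" for j using Q(3)[OF n(1)] ab by simp
    have QP: "Q j * P i = P i * Q j" for i j using Q(3)[OF P(1)] Pb by simp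
    define I where "I = {..K} \<times> {..L}"
    define r where "r = (\<lambda>(i, j). P i * Q j)"
    define p where "p = (\<Sum>i\<le>K. P i)"
    define q where "q = (\<Sum>j\<le>L. Q j)"
    have rsum: "sum r I = p * q"
      unfolding I_def r_def p_def q_def by (simp add: sum_product sum.cartesian_product)
    have pm: "p \<in> Mat n" "q \<in> Mat n" "p \<in> minf_pos" "q \<in> minf_pos"
      unfolding p_def q_def by (intro cstar_unit.sum_mem[OF cstar_unit_Mat] psd_sum P Q)+
    have qp: "q * p = p * q"
      unfolding p_def q_def sum_product by (subst sum.swap) (simp add: QP)
    have pq: "p * (?e - q) \<in> minf_pos" "(?e - p) * (?e - q) \<in> minf_pos"
    proof -
      have "p * (?e - q) = (?e - q) * p" "(?e - p) * (?e - q) = (?e - q) * (?e - p)"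
        using pm qp by (simp_all add: left_diff_distrib right_diff_distrib unitm_left unitm_right unitm_left[OF unitm_Mat])
      then show "p * (?e - q) \<in> minf_pos" "(?e - p) * (?e - q) \<in> minf_pos"
        using P(8) Q(8) pm by (auto intro: psd_mult simp: p_def[symmetric] q_def[symmetric])
    qed
    have e1: "?e - sum r I = (?e - p) + p * (?e - q)"
      using pm by (simp add: rsum right_diff_distrib unitm_right)
    have R1: "?e - sum r I \<in> minf_pos"
      unfolding e1 using P(8) by (intro psd_add pq) (simp add: p_def)
    have "(?e - q) - p * (?e - q) = (?e - p) * (?e - q)"
      using pm by (simp add: left_diff_distrib right_diff_distrib unitm_left unitm_Mat)
    then have "D (p * (?e - q)) \<le> D (?e - q)"
      using Q(8) pq by (intro mono le_cuntz) (auto simp: q_def)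
    then have R2: "D (?e - sum r I) \<le> 2 * \<epsilon>"
      using subadd[of "?e - p" "p * (?e - q)"] pq P(8,9) Q(9) by (simp add: e1 p_def q_def)
    have rm: "r i \<in> Mat n" "r i \<in> minf_pos" if "i \<in> I" for i
      unfolding r_def by (auto split: prod.split intro!: Mat_intros P(1,2) Q(1,2) psd_mult simp: QP)
    have comm: "c * (P k * Q m) = P k * Q m * c" if "P k * c = c * P k" "Q m * c = c * Q m" for c k m
      using that by (metis mult.assoc)
    have ra: "a * r i = r i * a" for i
      unfolding r_def by (cases i) (simp only: prod.case comm[OF Pa Qa])
    have rb: "b * r i = r i * b" for i
      unfolding r_def by (cases i) (simp only: prod.case comm[OF Pb Qb])
    have rr: "r i * r j = 0" if "i \<noteq> j" for i j
    proof -
      obtain i1 i2 j1 j2 where ij: "i = (i1, i2)" "j = (j1, j2)" by (cases i, cases j) auto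
      have "r i * r j = P i1 * (Q i2 * P j1) * Q j2" by (simp add: r_def ij mult.assoc)
      also have "\<dots> = (P i1 * P j1) * (Q i2 * Q j2)" by (simp add: QP mult.assoc)
      also have "\<dots> = 0" using that P(4)[of i1 j1] Q(4)[of i2 j2] ij by auto
      finally show ?thesis .
    qed
    define S1 where "S1 = (\<Sum>i\<in>I. t (fst i) * tD (r i))"
    define S2 where "S2 = (\<Sum>i\<in>I. s (snd i) * tD (r i))"
    have ca: "a * P k * Q m = Q m * (a * P k)" for k m using Qa QP by (metis mult.assoc)
    have cb: "P k * (b * Q m) = b * Q m * P k" for k m using Pb QP by (metis mult.assoc)
    have bP: "b * (P k * z) = P k * (b * z)" for k z using Pb by (metis mult.assoc)
    have alo: "a * r i - t (fst i) *\<^sub>R r i \<in> minf_pos" for i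
    proof -
      have "a * r i - t (fst i) *\<^sub>R r i = (a * P (fst i) - t (fst i) *\<^sub>R P (fst i)) * Q (snd i)"
        by (auto simp: r_def left_diff_distrib mult.assoc split: prod.split)
      moreover have "\<dots> \<in> minf_pos"
        by (rule psd_mult[OF P(6) Q(2)]) (simp add: left_diff_distrib right_diff_distrib ca QP)
      ultimately show ?thesis by simp
    qed
    have ahi: "(t (fst i) + 2 * \<epsilon>) *\<^sub>R r i - a * r i \<in> minf_pos" for i
    proof -
      have "(t (fst i) + 2 * \<epsilon>) *\<^sub>R r i - a * r i = ((t (fst i) + 2 * \<epsilon>) *\<^sub>R P (fst i) - a * P (fst i)) * Q (snd i)"
        by (auto simp: r_def left_diff_distrib mult.assoc split: prod.split)
      moreover have "\<dots> \<in> minf_pos"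
        by (rule psd_mult[OF P(7) Q(2)]) (simp add: left_diff_distrib right_diff_distrib ca QP)
      ultimately show ?thesis by simp
    qed
    have blo: "b * r i - s (snd i) *\<^sub>R r i \<in> minf_pos" for i
    proof -
      have "b * r i - s (snd i) *\<^sub>R r i = P (fst i) * (b * Q (snd i) - s (snd i) *\<^sub>R Q (snd i))"
        by (auto simp: r_def right_diff_distrib bP split: prod.split)
      moreover have "\<dots> \<in> minf_pos"
        by (rule psd_mult[OF P(2) Q(6)]) (simp add: left_diff_distrib right_diff_distrib cb QP)
      ultimately show ?thesis by simp
    qed
    have bhi: "(s (snd i) + 2 * \<epsilon>) *\<^sub>R r i - b * r i \<in> minf_pos" for i
    proof -
      have "(s (snd i) + 2 * \<epsilon>) *\<^sub>R r i - b * r i = P (fst i) * ((s (snd i) + 2 * \<epsilon>) *\<^sub>R Q (snd i) - b * Q (snd i))"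
        by (auto simp: r_def right_diff_distrib bP split: prod.split)
      moreover have "\<dots> \<in> minf_pos"
        by (rule psd_mult[OF P(2) Q(7)]) (simp add: left_diff_distrib right_diff_distrib cb QP)
      ultimately show ?thesis by simp
    qed
    have I: "finite I" by (simp add: I_def)
    have "\<bar>tD a - S1\<bar> \<le> norm a * (2 * \<epsilon>) + (2 * \<epsilon>) * D ?e"
      unfolding S1_def using \<epsilon> by (intro pieces_approx n a I rm ra rr P alo ahi R1 R2) auto
    moreover have "\<bar>tD b - S2\<bar> \<le> norm b * (2 * \<epsilon>) + (2 * \<epsilon>) * D ?e"
      unfolding S2_def using \<epsilon> by (intro pieces_approx n b I rm rb rr Q blo bhi R1 R2) auto
    moreover have "\<bar>tD (a + b) - (\<Sum>i\<in>I. (t (fst i) + s (snd i)) * tD (r i))\<bar> \<le> norm (a + b) * (2 * \<epsilon>) + (4 * \<epsilon>) * D ?e"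
    proof (rule pieces_approx[OF _ _ I rm])
      show "a + b \<in> Mat n" "a + b \<in> minf_pos" by (intro Mat_intros n psd_add a b)+
      show "(a + b) * r i = r i * (a + b)" for i
        using ra[of i] rb[of i] by (simp add: distrib_left distrib_right)
      show "0 \<le> t (fst i) + s (snd i)" for i using P(5) Q(5) by (intro add_nonneg_nonneg)
      show "(a + b) * r i - (t (fst i) + s (snd i)) *\<^sub>R r i \<in> minf_pos" for i
        using psd_add[OF alo[of i] blo[of i]] by (simp add: algebra_simps)
      show "(t (fst i) + s (snd i) + 4 * \<epsilon>) *\<^sub>R r i - (a + b) * r i \<in> minf_pos" for i
      proof -
        have "(4 * \<epsilon>) *\<^sub>R r i = (2 * \<epsilon>) *\<^sub>R r i + (2 * \<epsilon>) *\<^sub>R r i"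
          by (simp add: scaleR_add_left[symmetric])
        then show ?thesis using psd_add[OF ahi[of i] bhi[of i]] by (simp add: algebra_simps)
      qed
    qed (use \<epsilon> R1 R2 rr in auto)
    moreover have "(\<Sum>i\<in>I. (t (fst i) + s (snd i)) * tD (r i)) = S1 + S2"
      by (simp add: S1_def S2_def distrib_right sum.distrib)
    moreover have "B * \<epsilon> = \<eta>" using B by (simp add: \<epsilon>_def)
    then have "norm (a + b) * (2 * \<epsilon>) + (4 * \<epsilon>) * D ?e + (norm a * (2 * \<epsilon>) + (2 * \<epsilon>) * D ?e)
        + (norm b * (2 * \<epsilon>) + (2 * \<epsilon>) * D ?e) + \<epsilon> = \<eta>"
      by (simp add: B_def algebra_simps)
    ultimately show ?thesis using \<epsilon> by linarith
  qed
  have "\<bar>tD (a + b) - (tD a + tD b)\<bar> \<le> 0" by (rule field_le_epsilon) (simp add: *)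
  then show ?thesis by simp
qed

end

section \<open>From positive elements to all matrices\<close>

lemma cf_sqrt_square: 
  assumes "c \<in> minf_pos" shows "cf sqrt (c * c) = c"
proof -
  note cp = psd_cpos[OF assms]
  have C: "C0 (\<lambda>s :: real. s * s)" by (intro C0_simps C0_cont)
  have s: "C0 sqrt" using C0_sqrt[OF C0_simps(1)] by simp
  have "cf sqrt (c * c) = cf sqrt (cf (\<lambda>s. s * s) c)"
    by (simp add: cf_mult[OF cp C0_simps(1) C0_simps(1)] cf_id[OF cp])
  also have "\<dots> = cf (\<lambda>s. sqrt (s * s)) c" by (intro cf_comp cp C s) simp
  also have "\<dots> = cf (\<lambda>s. s) c" by (intro cf_cong cp C0_sqrt C C0_simps) simp
  finally show ?thesis by (simp add: cf_id[OF cp])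
qed

text \<open>The formula (|h| + h)/2 with |h| the square root of h^2, since the calculus does not
  apply to h itself. The negative part is \<open>pos_part (- h)\<close>.\<close>

definition pos_part :: "'a :: unital_cstar_algebra minf \<Rightarrow> 'a minf" where
  "pos_part h = (1/2) *\<^sub>R (cf sqrt (h * h) + h)"

lemma pos_part_props:
  fixes h :: "'a :: unital_cstar_algebra minf"
  assumes h: "h \<in> Mat n" "adj h = h"
  shows "pos_part h \<in> minf_pos" "pos_part (- h) \<in> minf_pos" "h = pos_part h - pos_part (- h)"
    "pos_part h * pos_part (- h) = 0" "pos_part h \<in> Mat n" "pos_part (- h) \<in> Mat n"
    "\<And>z. z \<in> Mat n \<Longrightarrow> h * z = z * h \<Longrightarrow> pos_part h * z = z * pos_part h"
    "\<And>z. z \<in> Mat n \<Longrightarrow> h * z = z * h \<Longrightarrow> pos_part (- h) * z = z * pos_part (- h)"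
proof -
  obtain p m where pm: "mpos n p" "mpos n m" "h = p - m" "p * m = 0" "m * p = 0"
    "\<And>z. z \<in> Mat n \<Longrightarrow> h * z = z * h \<Longrightarrow> p * z = z * p"
    using cstar_unit.pos_part_exists[OF cstar_unit_Mat h] by metis
  have M: "p \<in> Mat n" "m \<in> Mat n" using pm M_pos_mem by blast+
  then have P: "p \<in> minf_pos" "m \<in> minf_pos" using pm minf_pos_iff by blast+
  have "h * h = (p + m) * (p + m)" unfolding pm(3) by (simp add: algebra_simps pm)
  then have s: "cf sqrt (h * h) = p + m" using cf_sqrt_square[OF psd_add[OF P]] by simp
  have two: "(1/2) *\<^sub>R (z + z) = z" for z :: "'a minf" by (simp add: scaleR_2[symmetric])
  have p: "pos_part h = p"
    unfolding pos_part_def s using two[of p] by (simp add: pm(3))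
  have m: "pos_part (- h) = m"
    unfolding pos_part_def minus_mult_minus s using two[of m] by (simp add: pm(3))
  have "m * z = z * m" if "z \<in> Mat n" "h * z = z * h" for z
  proof -
    have "m = p - h" by (simp add: pm(3))
    then show ?thesis using pm(6)[OF that] that by (simp add: left_diff_distrib right_diff_distrib)
  qed
  then show "pos_part h \<in> minf_pos" "pos_part (- h) \<in> minf_pos" "h = pos_part h - pos_part (- h)"
    "pos_part h * pos_part (- h) = 0" "pos_part h \<in> Mat n" "pos_part (- h) \<in> Mat n"
    "\<And>z. z \<in> Mat n \<Longrightarrow> h * z = z * h \<Longrightarrow> pos_part h * z = z * pos_part h"
    "\<And>z. z \<in> Mat n \<Longrightarrow> h * z = z * h \<Longrightarrow> pos_part (- h) * z = z * pos_part (- h)"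
    unfolding p m using P M pm by auto
qed

definition re :: "'a :: unital_cstar_algebra minf \<Rightarrow> 'a minf" where
  "re x = (1/2) *\<^sub>R (x + adj x)"

definition im :: "'a :: unital_cstar_algebra minf \<Rightarrow> 'a minf" where
  "im x = (1/2) *\<^sub>R ((- \<i>) *\<^sub>C (x - adj x))"

lemma re_adj: "adj (re x) = re x"
  by (simp add: re_def adj_simps add.commute)

lemma im_adj: "adj (im x) = im x"
  by (simp add: im_def adj_simps scaleC_diff_right scaleC_uminus_left)

lemma re_im: "x = re x + \<i> *\<^sub>C im x"
proof -
  have "\<i> *\<^sub>C im x = (1/2) *\<^sub>R (x - adj x)"
    by (simp add: im_def scaleR_eq_scaleC scaleC_scaleC)
  then show ?thesis
    by (simp add: re_def scaleR_diff_right scaleR_add_right scaleR_add_left[symmetric])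
qed

lemma re_Mat: "x \<in> Mat n \<Longrightarrow> re x \<in> Mat n" and im_Mat: "x \<in> Mat n \<Longrightarrow> im x \<in> Mat n"
  unfolding re_def im_def by (intro Mat_intros; assumption)+

lemma re_lin: "re (c *\<^sub>C x + y) = Re c *\<^sub>R re x - Im c *\<^sub>R im x + re y"
proof -
  have c: "c *\<^sub>C z = Re c *\<^sub>R z + Im c *\<^sub>R (\<i> *\<^sub>C z)" for c and z :: "'a minf"
    by (subst (1) complex_eq[of c]) (simp add: scaleR_eq_scaleC scaleC_scaleC scaleC_add_left mult.commute)
  have "Im c *\<^sub>R im x = (1/2) *\<^sub>R (Im c *\<^sub>R (- (\<i> *\<^sub>C (x - adj x))))"
    by (simp add: im_def scaleC_uminus_left mult.commute)
  moreover have "r *\<^sub>R - (\<i> *\<^sub>C z) = - (r *\<^sub>R (\<i> *\<^sub>C z))" for r and z :: "'a minf" by simp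
  ultimately show ?thesis
    unfolding re_def
    by (simp add: adj_simps c[of c x] c[of "cnj c" "adj x"] scaleR_add_right scaleC_diff_right
      scaleR_diff_right scaleC_uminus_left algebra_simps)
qed

lemma im_eq_re: "im x = re ((- \<i>) *\<^sub>C x)"
  by (simp add: im_def re_def adj_simps scaleC_diff_right scaleC_uminus_left)

lemma re_im_sa:
  assumes "adj a = a" "adj b = b"
  shows "re (a + \<i> *\<^sub>C b) = a" "im (a + \<i> *\<^sub>C b) = b"
proof -
  have "adj (a + \<i> *\<^sub>C b) = a - \<i> *\<^sub>C b" by (rule adj_add_ii[OF assms])
  moreover have "(- \<i>) *\<^sub>C (\<i> *\<^sub>C b + \<i> *\<^sub>C b) = 2 *\<^sub>R b"
    by (simp add: scaleC_add_right scaleC_scaleC scaleC_one scaleR_2)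
  ultimately show "re (a + \<i> *\<^sub>C b) = a" "im (a + \<i> *\<^sub>C b) = b"
    by (simp_all add: re_def im_def scaleR_2[symmetric])
qed

context fin_dimfun
begin

definition tS :: "'a minf \<Rightarrow> real" where "tS h = tD (pos_part h) - tD (pos_part (- h))"

text \<open>The value is the same for every decomposition of h into commuting positive elements: the
  identity h_+ + v = h_- + u may be measured on both sides, because h_+ commutes with v and h_- with
  u.\<close>

lemma tS_diff:
  assumes u: "u \<in> minf_pos" and v: "v \<in> minf_pos" and uv: "u * v = v * u"
  shows "tS (u - v) = tD u - tD v"
proof -
  obtain n where n: "u \<in> Mat n" "v \<in> Mat n" using ex_Mat2 by blast
  define h where "h = u - v"
  have h: "h \<in> Mat n" "adj h = h" using n u v by (auto simp: h_def adj_diff psd_adj intro: Mat_intros)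
  note pp = pos_part_props[OF h]
  have "h * u = u * h" "h * v = v * h" using uv by (simp_all add: h_def algebra_simps)
  then have c: "pos_part h * v = v * pos_part h" "pos_part (- h) * u = u * pos_part (- h)"
    using pp(7)[OF n(2)] pp(8)[OF n(1)] by auto
  have "pos_part h + v = pos_part (- h) + u" using pp(3) by (simp add: h_def algebra_simps)
  then have "tD (pos_part h) + tD v = tD (pos_part (- h)) + tD u"
    using tD_add[OF pp(1) v c(1)] tD_add[OF pp(2) u c(2)] by simp
  then show ?thesis by (simp add: tS_def h_def)
qed

lemma tS_psd: "a \<in> minf_pos \<Longrightarrow> tS a = tD a"
  using tS_diff[of a 0] by (simp add: tD_0)

lemma tS_add:
  assumes n: "h \<in> Mat n" "k \<in> Mat n" and sa: "adj h = h" "adj k = k" and hk: "h * k = k * h"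
  shows "tS (h + k) = tS h + tS k"
proof -
  note H = pos_part_props[OF n(1) sa(1)] and K = pos_part_props[OF n(2) sa(2)]
  define p q r s where d: "p = pos_part h" "q = pos_part (- h)" "r = pos_part k" "s = pos_part (- k)"
  have hk': "h * r = r * h" "h * s = s * h"
    using K(7)[OF n(1)] K(8)[OF n(1)] hk by (simp_all add: d)
  have c: "p * r = r * p" "p * s = s * p" "q * r = r * q" "q * s = s * q"
    using H(7)[of r] H(7)[of s] H(8)[of r] H(8)[of s] hk' K(5,6) by (simp_all add: d)
  have P: "p \<in> minf_pos" "q \<in> minf_pos" "r \<in> minf_pos" "s \<in> minf_pos" using H K by (simp_all add: d)
  have pq: "p * q = q * p" "r * s = s * r"
    using H(4) K(4) orth_sym[OF H(1,2,4)] orth_sym[OF K(1,2,4)] by (simp_all add: d)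
  have "h + k = (p - q) + (r - s)" using H(3) K(3) by (simp add: d)
  then have "h + k = (p + r) - (q + s)" by simp
  then have "tS (h + k) = tD (p + r) - tD (q + s)"
    by (simp only:) (intro tS_diff psd_add P, simp add: algebra_simps c pq)
  also have "\<dots> = (tD p + tD r) - (tD q + tD s)" using tD_add P c by simp
  finally show ?thesis by (simp add: tS_def d)
qed

lemma tS_uminus: "tS (- h) = - tS h"
  by (simp add: tS_def)

lemma tS_scale:
  assumes h: "h \<in> Mat n" "adj h = h" shows "tS (r *\<^sub>R h) = r * tS h"
proof -
  note H = pos_part_props[OF h]
  have nonneg: "tS (r *\<^sub>R h) = r * tS h" if r: "0 \<le> r" for r
  proof -
    have c: "pos_part h * pos_part (- h) = pos_part (- h) * pos_part h"
      using H(4) orth_sym[OF H(1,2,4)] by simp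
    have "r *\<^sub>R h = r *\<^sub>R pos_part h - r *\<^sub>R pos_part (- h)" using H(3) by (metis scaleR_diff_right)
    then have "tS (r *\<^sub>R h) = tD (r *\<^sub>R pos_part h) - tD (r *\<^sub>R pos_part (- h))"
      by (simp only:) (intro tS_diff psd_scale H r, simp add: c)
    then show ?thesis using tD_scale H r by (simp add: tS_def right_diff_distrib)
  qed
  show ?thesis
  proof (cases "0 \<le> r")
    case False
    have "tS (r *\<^sub>R h) = tS (- ((- r) *\<^sub>R h))" by simp
    then show ?thesis using nonneg[of "- r"] False unfolding tS_uminus by simp
  qed (rule nonneg)
qed

definition TD :: "'a minf \<Rightarrow> complex" where
  "TD x = of_real (tS (re x)) + \<i> * of_real (tS (im x))"

lemma TD_psd: "a \<in> minf_pos \<Longrightarrow> TD a = of_real (tD a)"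
proof -
  assume a: "a \<in> minf_pos"
  have "re a = a" "im a = 0"
    using psd_adj[OF a] by (simp_all add: re_def im_def scaleR_2[symmetric] scaleC_zero_right)
  then show ?thesis using tS_psd[OF a] tS_psd[OF psd_0] by (simp add: TD_def tD_0)
qed

lemma tD_trace: "tD (adj x * x) = tD (x * adj x)"
proof -
  define M where "M = max (norm (adj x * x)) (norm (x * adj x))"
  have F: "F (adj x * x) t = F (x * adj x) t" if t: "0 \<le> t" for t
  proof (cases "t = 0")
    case True
    have "cf (excess 0) a = a" if "a \<in> minf_pos" for a :: "'a minf"
      using cf_cong[OF psd_cpos[OF that] C0_cut C0_simps(1), of 0] cf_id[OF psd_cpos[OF that]]
      by (simp add: excess_def)
    from this[OF psd_square(1)] this[OF psd_square(2)] show ?thesis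
      using D_trace[of x] by (simp add: F_def True)
  next
    case False
    then have t: "0 < t" using t by simp
    obtain y where "adj y * y = cf (excess t) (adj x * x)" "y * adj y = cf (excess t) (x * adj x)"
      using cf_trace_factor[of "excess t" t x] t by (auto simp: C0_cut cut_nonneg excess_def)
    then show ?thesis using D_trace[of y] by (simp add: F_def)
  qed
  have "integral {0..M} (F (adj x * x)) = integral {0..M} (F (x * adj x))"
    by (intro integral_cong F) auto
  then show ?thesis
    using tD_bound[OF psd_square(1), of x M] tD_bound[OF psd_square(2), of x M] by (simp add: M_def)
qed

lemma quasitrace_TD: "quasitrace_on (Mat n) mat_norm TD"
  unfolding quasitrace_on_def
proof (intro conjI ballI allI impI)
  fix x :: "'a minf" assume "x \<in> Mat n"
  show "TD (adj x * x) = TD (x * adj x)"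
    using tD_trace[of x] by (simp add: TD_psd psd_square)
  show "TD (adj x * x) \<in> \<real>\<^sub>\<ge>\<^sub>0"
    using tD_nonneg[OF psd_square(1)] by (simp add: TD_psd psd_square)
next
  fix a b :: "'a minf" assume "adj a = a \<and> adj b = b"
  then have ab: "adj a = a" "adj b = b" by auto
  have sa: "TD a = of_real (tS a)" if "adj a = a" for a :: "'a minf"
    using re_im_sa[OF that adj_zero] tS_psd[OF psd_0] by (simp add: TD_def scaleC_zero_right tD_0)
  show "TD (a + \<i> *\<^sub>C b) = TD a + \<i> * TD b"
    unfolding sa[OF ab(1)] sa[OF ab(2)] by (simp add: TD_def re_im_sa[OF ab])
next
  fix B :: "'a minf set" and c :: complex and x y :: "'a minf"
  assume B: "cstar_subalgebra (Mat n) mat_norm B \<and> (\<forall>x\<in>B. \<forall>y\<in>B. x * y = y * x)"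
    and x: "x \<in> B" and y: "y \<in> B"
  have BM: "B \<subseteq> Mat n" and Badj: "\<And>z. z \<in> B \<Longrightarrow> adj z \<in> B" and Badd: "\<And>z w. z \<in> B \<Longrightarrow> w \<in> B \<Longrightarrow> z + w \<in> B"
    and Bsc: "\<And>z c. z \<in> B \<Longrightarrow> c *\<^sub>C z \<in> B" and comm: "\<And>z w. z \<in> B \<Longrightarrow> w \<in> B \<Longrightarrow> z * w = w * z"
    using B unfolding cstar_subalgebra_def by auto
  have reB: "re z \<in> B" if "z \<in> B" for z
    unfolding re_def scaleR_eq_scaleC by (intro Bsc Badd Badj that)
  have imB: "im z \<in> B" if "z \<in> B" for z unfolding im_eq_re by (intro reB Bsc that)
  have scB: "r *\<^sub>R z \<in> B" if "z \<in> B" for r z unfolding scaleR_eq_scaleC by (rule Bsc[OF that])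
  have add: "tS (z + w) = tS z + tS w" if "z \<in> B" "w \<in> B" "adj z = z" "adj w = w" for z w
    using tS_add[of z n w] that BM comm by auto
  have re: "tS (re (c *\<^sub>C x + y)) = Re c * tS (re x) - Im c * tS (im x) + tS (re y)"
    if "x \<in> B" "y \<in> B" for c x y
  proof -
    have B: "Re c *\<^sub>R re x \<in> B" "(- Im c) *\<^sub>R im x \<in> B" "re y \<in> B"
      by (rule scB[OF reB[OF that(1)]], rule scB[OF imB[OF that(1)]], rule reB[OF that(2)])
    have sa: "adj (Re c *\<^sub>R re x) = Re c *\<^sub>R re x" "adj ((- Im c) *\<^sub>R im x) = (- Im c) *\<^sub>R im x"
      by (simp_all add: adj_simps re_adj im_adj)
    have sa': "adj (Re c *\<^sub>R re x + (- Im c) *\<^sub>R im x) = Re c *\<^sub>R re x + (- Im c) *\<^sub>R im x"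
      unfolding adj_add sa ..
    have "re (c *\<^sub>C x + y) = (Re c *\<^sub>R re x + (- Im c) *\<^sub>R im x) + re y" by (simp add: re_lin)
    then have "tS (re (c *\<^sub>C x + y)) = tS (Re c *\<^sub>R re x) + tS ((- Im c) *\<^sub>R im x) + tS (re y)"
      using add[OF Badd[OF B(1,2)] B(3) sa' re_adj] add[OF B(1,2) sa] by simp
    also have "tS (Re c *\<^sub>R re x) = Re c * tS (re x)"
      using that BM by (intro tS_scale[of _ n] re_Mat re_adj) auto
    also have "tS ((- Im c) *\<^sub>R im x) = - Im c * tS (im x)"
      using that BM by (intro tS_scale[of _ n] im_Mat im_adj) auto
    finally show ?thesis by simp
  qed
  have im2: "im (c *\<^sub>C x + y) = re ((- \<i> * c) *\<^sub>C x + (- \<i>) *\<^sub>C y)"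
    by (simp add: im_eq_re scaleC_add_right scaleC_scaleC)
  have "tS (im (c *\<^sub>C x + y)) = Im c * tS (re x) + Re c * tS (im x) + tS (im y)"
    unfolding im2 re[OF x Bsc[OF y]] by (simp add: im_eq_re)
  then show "TD (c *\<^sub>C x + y) = c * TD x + TD y"
    using re[OF x y] by (simp add: TD_def complex_eq_iff)
qed

lemma quasitr_TD: "quasitr n TD"
  by standard (rule quasitrace_TD)

lemma dim_TD_le:
  assumes a: "a \<in> Mat n" "a \<in> minf_pos"
  shows "quasitr.dim TD a \<le> D a"
proof (rule quasitr.dim_least[OF quasitr_TD])
  fix \<delta> :: real assume \<delta>: "0 < \<delta>"
  have r: "cf (ramp \<delta>) a \<in> minf_pos" by (intro psd_ramp a \<delta>)
  have "quasitr.tr TD (cf (ramp \<delta>) a) = tD (cf (ramp \<delta>) a)"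
    using r by (simp add: quasitr.tr_def[OF quasitr_TD] TD_psd)
  also have "\<dots> \<le> norm (cf (ramp \<delta>) a) * D (cf (ramp \<delta>) a)" by (rule tD_le[OF r])
  also have "\<dots> \<le> 1 * D (cf (ramp \<delta>) a)" by (intro mult_right_mono norm_ramp nonneg r a \<delta>)
  also have "\<dots> \<le> D a"
    using cuntz_trans[OF cuntz_ramp[OF a(2) \<delta>] cuntz_cut[OF a(2)]] \<delta> by (simp add: mono r a)
  finally show "quasitr.tr TD (cf (ramp \<delta>) a) \<le> D a" .
qed

text \<open>For c = \<open>cf (ramp \<delta>) a\<close> with 2 \<delta> = \<epsilon>, the cut (c -
  t)_+ dominates (a - \<epsilon>)_+ for every t < 1; integrate over [0, 1]. With
  \<open>dim_TD_le\<close> this shows that the dimension function of \<open>TD\<close> is D up to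
  arbitrarily small cuts.\<close>

lemma dim_TD_ge:
  assumes a: "a \<in> Mat n" "a \<in> minf_pos" and \<epsilon>: "0 < \<epsilon>"
  shows "D (cf (excess \<epsilon>) a) \<le> quasitr.dim TD a"
proof -
  define \<delta> where "\<delta> = \<epsilon> / 2"
  have \<delta>: "0 < \<delta>" "\<epsilon> = 2 * \<delta>" using \<epsilon> by (auto simp: \<delta>_def)
  define c where "c = cf (ramp \<delta>) a"
  have c: "c \<in> minf_pos" unfolding c_def by (intro psd_ramp a \<delta>)
  let ?d = "D (cf (excess \<epsilon>) a)"
  have F: "?d \<le> F c t" if t: "0 \<le> t" "t < 1" for t
  proof -
    have "cf (excess \<epsilon>) a \<lesssim> cf (\<lambda>s. excess t (ramp \<delta> s)) a"
    proof (rule cuntz_cf[OF a(2), where C = "norm a / (1 - t)"])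
      fix s :: real assume s: "0 \<le> s" "s \<le> norm a"
      show "excess \<epsilon> s \<le> norm a / (1 - t) * excess t (ramp \<delta> s)"
      proof (cases "2 * \<delta> \<le> s")
        case True
        then have "excess t (ramp \<delta> s) = 1 - t" using t \<delta> by (simp add: ramp_eq_1 excess_def)
        then show ?thesis using s t \<epsilon> True \<delta> by (simp add: excess_def)
      next
        case False
        then show ?thesis using t \<delta> by (simp add: excess_def)
      qed
    qed (use t \<epsilon> \<delta> in \<open>auto intro!: C0_cut cut_nonneg C0_comp[OF C0_ramp C0_cut] ramp_nonneg\<close>)
    also have "cf (\<lambda>s. excess t (ramp \<delta> s)) a = cf (excess t) c"
      unfolding c_def by (rule cf_comp[OF psd_cpos[OF a(2)] C0_ramp[OF \<delta>(1)] ramp_nonneg C0_cut[OF t(1)], symmetric])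
    finally have "cf (excess \<epsilon>) a \<lesssim> cf (excess t) c" .
    then show ?thesis unfolding F_def using \<epsilon> t by (intro mono psd_cut a c) auto
  qed
  have "norm c \<le> 1" unfolding c_def by (intro norm_ramp a \<delta>)
  then have tc: "tD c = integral {0..1} (F c)" by (intro tD_bound c)
  have "integral {0..1} (\<lambda>t :: real. if t = 1 then 0 else ?d) = integral {0..1} (\<lambda>t :: real. ?d)"
    by (rule integral_spike[of "{1}"]) auto
  then have "?d = integral {0..1} (\<lambda>t :: real. if t = 1 then 0 else ?d)" by simp
  also have "\<dots> \<le> tD c"
    unfolding tc
  proof (rule integral_le)
    show "(\<lambda>t :: real. if t = 1 then 0 else ?d) integrable_on {0..1}"
      by (rule integrable_spike[of "\<lambda>t :: real. ?d" _ "{1}"]) (auto intro: integrable_const_ivl)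
    fix t :: real assume "t \<in> {0..1}"
    then show "(if t = 1 then 0 else ?d) \<le> F c t" using F[of t] F_nonneg[OF c, of t] by auto
  qed (rule F_integrable[OF c])
  also have "\<dots> = quasitr.tr TD c" using c by (simp add: quasitr.tr_def[OF quasitr_TD] TD_psd)
  also have "\<dots> \<le> quasitr.dim TD a"
    unfolding c_def by (rule quasitr.dim_ramp[OF quasitr_TD a \<delta>(1)])
  finally show ?thesis .
qed

end

section \<open>Recovering a quasitrace from its dimension function\<close>

context quasitr
begin

lemma tr_cf_sum:
  assumes a: "a \<in> Mat n" "a \<in> minf_pos" and "finite I" "\<And>i. i \<in> I \<Longrightarrow> C0 (f i)"
  shows "C0 (\<lambda>s. \<Sum>i\<in>I. f i s) \<and> tr (cf (\<lambda>s. \<Sum>i\<in>I. f i s) a) = (\<Sum>i\<in>I. tr (cf (f i) a))"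
  using assms(3,4)
proof (induction I)
  case empty
  have "cf (\<lambda>s. 0) a = 0" using cf_scale[OF psd_cpos[OF a(2)] C0_simps(1), of 0] by simp
  then show ?case by (simp add: C0_def tr_def T_0)
next
  case (insert i I)
  note cp = psd_cpos[OF a(2)]
  have I: "C0 (\<lambda>s. \<Sum>i\<in>I. f i s)" and fi: "C0 (f i)" using insert by auto
  have "cf (f i) a * cf (\<lambda>s. \<Sum>i\<in>I. f i s) a = cf (\<lambda>s. \<Sum>i\<in>I. f i s) a * cf (f i) a"
    by (simp add: cf_mult[OF cp fi I, symmetric] cf_mult[OF cp I fi, symmetric] mult.commute)
  then have "tr (cf (f i) a + cf (\<lambda>s. \<Sum>i\<in>I. f i s) a) = tr (cf (f i) a) + tr (cf (\<lambda>s. \<Sum>i\<in>I. f i s) a)"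
    by (intro tr_add cf_Mat a cf_adj cp I fi)
  then show ?case using insert I fi C0_simps(2)[OF fi I] by (simp add: cf_add[OF cp fi I])
qed

text \<open>On the spectrum m s is a sum of slices min(1, (m s - k)_+), and the trace of a slice is
  compared with the dimensions of neighbouring cuts. Up to the factor m the sums are Riemann sums of
  d((a - t)_+), and the two bounds differ by an amount independent of m.\<close>

lemma tr_sandwich:
  assumes a: "a \<in> Mat n" "a \<in> minf_pos" and m: "0 < m" and K: "norm a * m \<le> real K"
  defines "d \<equiv> \<lambda>k. dim (cf (excess (real k / m)) a)"
  shows "(\<Sum>k<K. d (Suc k)) \<le> m * tr a"
    "m * tr a \<le> tr (unitm n) + d 0 + (\<Sum>k<K. d (Suc k))"
proof -
  define g where "g k s = min 1 (max 0 (m * s - real k))" for k s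
  have g: "C0 (g k)" for k
    by (auto simp: C0_def g_def[abs_def] intro!: continuous_intros)
  note cp = psd_cpos[OF a(2)]
  have sum: "(\<Sum>k<K. g k s) = min (m * s) (real K)" if "0 \<le> s" for s
  proof (induction K)
    case 0
    then show ?case using mult_nonneg_nonneg[of m s] that m by simp
  next
    case (Suc K)
    then show ?case by (auto simp: g_def min_def max_def)
  qed
  have "cf (\<lambda>s. \<Sum>k<K. g k s) a = cf (\<lambda>s. m * s) a"
  proof (rule cf_cong[OF cp])
    show "C0 (\<lambda>s. \<Sum>k<K. g k s)" using tr_cf_sum[OF a, of "{..<K}" g] g by auto
    fix s assume s: "0 \<le> s" "s \<le> norm a"
    then have "m * s \<le> m * norm a" using m by (intro mult_left_mono) auto
    then have "m * s \<le> real K" using K by (simp add: mult.commute)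
    then show "(\<Sum>k<K. g k s) = m * s" using sum[OF s(1)] by simp
  qed (intro C0_simps)
  also have "\<dots> = m *\<^sub>R a" using cf_scale[OF cp C0_simps(1)] cf_id[OF cp] by simp
  finally have "tr (m *\<^sub>R a) = (\<Sum>k<K. tr (cf (g k) a))"
    using tr_cf_sum[OF a, of "{..<K}" g] g by auto
  then have eq: "m * tr a = (\<Sum>k<K. tr (cf (g k) a))"
    using tr_scaleR[OF a(1) psd_adj[OF a(2)]] by simp
  have ex: "C0 (excess (real k / m))" "cf (excess (real k / m)) a \<in> Mat n" "cf (excess (real k / m)) a \<in> minf_pos" for k
    using m by (auto intro!: C0_cut cf_Mat a psd_cut)
  have "d (Suc k) \<le> tr (cf (g k) a)" for k
    unfolding d_def
  proof (rule dim_least)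
    fix \<delta> :: real assume \<delta>: "0 < \<delta>"
    have "cf (ramp \<delta>) (cf (excess (real (Suc k) / m)) a) = cf (\<lambda>s. ramp \<delta> (excess (real (Suc k) / m) s)) a"
      by (rule cf_comp[OF cp ex(1) cut_nonneg C0_ramp[OF \<delta>]])
    also have "tr \<dots> \<le> tr (cf (g k) a)"
    proof (rule tr_cf_mono[OF a C0_comp[OF ex(1) C0_ramp[OF \<delta>] cut_nonneg] g])
      fix s :: real
      show "ramp \<delta> (excess (real (Suc k) / m) s) \<le> g k s"
      proof (cases "s \<le> real (Suc k) / m")
        case True
        then show ?thesis using \<delta> by (simp add: excess_def ramp_eq_0 g_def)
      next
        case False
        then have "real (Suc k) \<le> m * s" using m by (simp add: field_simps)
        then have "g k s = 1" by (simp add: g_def)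
        then show ?thesis by (simp add: ramp_le_1)
      qed
    qed
    finally show "tr (cf (ramp \<delta>) (cf (excess (real (Suc k) / m)) a)) \<le> tr (cf (g k) a)" .
  qed
  then show "(\<Sum>k<K. d (Suc k)) \<le> m * tr a" unfolding eq by (intro sum_mono)
  \<comment> \<open>The index is shifted because \<open>dim_upper\<close> wants a function vanishing
    near 0: slice k + 1 starts at distance 1/m above the cut at k/m. The remaining slice 0 is
    bounded by the trace of the unit.\<close>
  have up: "tr (cf (g (Suc k)) a) \<le> d k" for k
  proof -
    define f where "f = (\<lambda>x. min 1 (max 0 (m * x - 1)))"
    have f: "C0 f" by (auto simp: C0_def f_def intro!: continuous_intros)
    have "cf (g (Suc k)) a = cf (\<lambda>s. f (excess (real k / m) s)) a"
    proof (rule cf_cong[OF cp g C0_comp[OF ex(1) f cut_nonneg]])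
      fix s :: real
      show "g (Suc k) s = f (excess (real k / m) s)"
      proof (cases "s \<le> real k / m")
        case True
        then have "m * s \<le> real k" using m by (simp add: field_simps)
        then show ?thesis using True by (simp add: g_def f_def excess_def)
      next
        case False
        then show ?thesis using m by (simp add: g_def f_def excess_def algebra_simps)
      qed
    qed
    also have "\<dots> = cf f (cf (excess (real k / m)) a)"
      by (rule cf_comp[OF cp ex(1) cut_nonneg f, symmetric])
    also have "tr \<dots> \<le> d k"
      unfolding d_def
    proof (rule dim_upper[OF ex(2,3) f, where \<delta> = "1 / m"])
      fix s assume "s \<le> 1 / m"
      then have "m * s \<le> 1" using m by (simp add: field_simps)
      then show "f s \<le> 0" by (simp add: f_def)
    qed (use m in \<open>auto simp: f_def\<close>)
    finally show ?thesis .
  qed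
  have gp: "cf (g k) a \<in> minf_pos" "cf (g k) a \<in> Mat n" for k
    by (intro psd_cf cf_Mat a g; simp add: g_def)+
  have "norm (cf (g 0) a) \<le> 1" by (intro cf_norm cp g) (simp add: g_def)
  then have g0: "tr (cf (g 0) a) \<le> tr (unitm n)"
    by (intro tr_le_unit gp unitm_Mat psd_unitm unitm_right)
  have d0: "0 \<le> d k" for k unfolding d_def by (intro dim_nonneg ex)
  have tr0: "0 \<le> tr (unitm n)" by (intro tr_nonneg unitm_Mat psd_unitm)
  show "m * tr a \<le> tr (unitm n) + d 0 + (\<Sum>k<K. d (Suc k))"
  proof (cases K)
    case 0
    then have "m * tr a = 0" using eq by simp
    then show ?thesis using d0[of 0] tr0 unfolding 0 by (simp only: lessThan_0 sum.empty)
  next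
    case (Suc L)
    have "m * tr a = tr (cf (g 0) a) + (\<Sum>k<L. tr (cf (g (Suc k)) a))"
      unfolding eq Suc by (simp add: sum.lessThan_Suc_shift del: sum.lessThan_Suc)
    also have "\<dots> \<le> tr (unitm n) + (\<Sum>k<L. d k)" by (intro add_mono g0 sum_mono up)
    also have "(\<Sum>k<L. d k) \<le> (\<Sum>k<Suc L. d k)" using d0 by simp
    also have "(\<Sum>k<Suc L. d k) = d 0 + (\<Sum>k<L. d (Suc k))"
      by (simp add: sum.lessThan_Suc_shift del: sum.lessThan_Suc)
    also have "(\<Sum>k<L. d (Suc k)) \<le> (\<Sum>k<K. d (Suc k))" using d0 by (simp add: Suc)
    finally show ?thesis by simp
  qed
qed

end

text \<open>With equal dimension functions \<open>tr_sandwich\<close> bounds m times the difference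
  of the two traces uniformly in m. So uniqueness of quasitraces becomes uniqueness of dimension
  functions.\<close>

lemma quasitr_determined:
  assumes T: "quasitr n T" and T': "quasitr n T'"
    and eq: "\<And>a. a \<in> Mat n \<Longrightarrow> a \<in> minf_pos \<Longrightarrow> quasitr.dim T a = quasitr.dim T' a"
    and x: "x \<in> Mat n"
  shows "T x = T' x"
proof -
  interpret A: quasitr n T by (rule T)
  interpret B: quasitr n T' by (rule T')
  have psd: "T a = T' a" if a: "a \<in> Mat n" "a \<in> minf_pos" for a
  proof -
    define C where "C = A.tr (unitm n) + B.tr (unitm n) + A.dim (cf (excess 0) a)"
    have d0: "0 \<le> A.dim (cf (excess 0) a)" by (intro A.dim_nonneg cf_Mat a psd_cut C0_cut) auto
    have u: "0 \<le> A.tr (unitm n)" "0 \<le> B.tr (unitm n)"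
      by (intro A.tr_nonneg B.tr_nonneg unitm_Mat psd_unitm)+
    have C: "0 \<le> C" using d0 u by (simp add: C_def)
    have b: "real (Suc m) * \<bar>A.tr a - B.tr a\<bar> \<le> C" for m
    proof -
      obtain K :: nat where K: "norm a * real (Suc m) \<le> real K" using real_arch_simple by blast
      have e: "B.dim (cf (excess (real k / real (Suc m))) a) = A.dim (cf (excess (real k / real (Suc m))) a)" for k
        by (intro eq[symmetric] cf_Mat a C0_cut psd_cut) auto
      have "real (Suc m) * (A.tr a - B.tr a) \<le> C" "real (Suc m) * (B.tr a - A.tr a) \<le> C"
        using A.tr_sandwich[OF a _ K] B.tr_sandwich[OF a _ K] u unfolding e C_def
        by (simp_all add: right_diff_distrib)
      then show ?thesis by (auto simp: abs_if)
    qed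
    have "\<bar>A.tr a - B.tr a\<bar> \<le> 0"
    proof (rule ccontr)
      assume "\<not> \<bar>A.tr a - B.tr a\<bar> \<le> 0"
      then have p: "0 < \<bar>A.tr a - B.tr a\<bar>" by simp
      obtain m :: nat where "C < real m * \<bar>A.tr a - B.tr a\<bar>" using reals_Archimedean3[OF p] by blast
      also have "\<dots> \<le> real (Suc m) * \<bar>A.tr a - B.tr a\<bar>" by (intro mult_right_mono) auto
      finally show False using b[of m] by simp
    qed
    then show ?thesis using A.T_tr[OF a] B.T_tr[OF a] by simp
  qed
  have sa: "T h = T' h" if h: "h \<in> Mat n" "adj h = h" for h
  proof -
    note H = pos_part_props[OF h]
    have hm: "h * pos_part (- h) = pos_part (- h) * h" using H(8)[OF h(1)] by simp
    have "h + pos_part (- h) = pos_part h" using H(3) by (simp add: algebra_simps)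
    then have "T (pos_part h) = T h + T (pos_part (- h))" "T' (pos_part h) = T' h + T' (pos_part (- h))"
      using A.T_add[OF h(1) H(6) h(2) psd_adj[OF H(2)] hm] B.T_add[OF h(1) H(6) h(2) psd_adj[OF H(2)] hm] by simp_all
    then show ?thesis using psd H by simp
  qed
  have "T x = T (re x) + \<i> * T (im x)" "T' x = T' (re x) + \<i> * T' (im x)"
    using A.qt B.qt re_Mat[OF x] im_Mat[OF x] re_adj im_adj re_im[of x] unfolding quasitrace_on_def by metis+
  then show ?thesis using sa[OF re_Mat[OF x] re_adj] sa[OF im_Mat[OF x] im_adj] by simp
qed

section \<open>Extending a quasitrace from the corner to all matrices\<close>

declare One_nat_def [simp del]

lemma shiftm_unitm: "shiftm m k * unitm k = (shiftm m k :: 'a :: unital_cstar_algebra minf)"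
  by (rule minf_eqI) (auto simp: entry_shiftm_times shiftm.rep_eq unitm.rep_eq)

lemma unitm_Suc: "unitm (Suc n) = unitm n + shiftm n 1 * adj (shiftm n 1 :: 'a :: unital_cstar_algebra minf)"
  by (rule minf_eqI)
    (auto simp: plus_minf.rep_eq entry_shiftm_times adj_minf.rep_eq shiftm.rep_eq unitm.rep_eq adj_zero adj_one)

lemma unitm_0: "unitm 0 = (0 :: 'a :: unital_cstar_algebra minf)"
  by (rule minf_eqI) (simp add: unitm.rep_eq zero_minf.rep_eq)

lemma C0_mult: "C0 f \<Longrightarrow> C0 g \<Longrightarrow> C0 (\<lambda>x. f x * g x)"
  by (intro C0_simps(5) C0_cont)

locale corner_dimfun = lsc_dimfun "Mat 1" N for N :: "'a :: unital_cstar_algebra minf \<Rightarrow> real"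
begin

text \<open>\<open>w * unitm 1 = w\<close> says that \<open>w\<close> is a column, i.e. supported in the column with index 0.\<close>

inductive rk :: "'a minf \<Rightarrow> real \<Rightarrow> bool" where
  rk_0: "rk 0 0"
| rk_step: "rk x r \<Longrightarrow> w * unitm 1 = w \<Longrightarrow> N (adj w * w) \<le> t \<Longrightarrow> rk (x + w * v) (r + t)"

text \<open>For A the complex numbers and N equal to 1 at nonzero elements this is the ordinary
  rank, the least number of terms in a decomposition into columns times rows.\<close>

definition \<rho> :: "'a minf \<Rightarrow> real" where "\<rho> x = Inf {r. rk x r}"

lemma col_Mat: "(w :: 'a minf) * unitm 1 = w \<Longrightarrow> adj w * w \<in> Mat 1"
  using unitm_compress[of 1 "adj w * w"] by (metis adj_mult mult.assoc M_adj_unit)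

lemma N_col_nonneg: "w * unitm 1 = w \<Longrightarrow> 0 \<le> N (adj w * w)"
  by (intro D_nonneg col_Mat psd_square)

lemma N_col_left: "w * unitm 1 = w \<Longrightarrow> N (adj (u * w) * (u * w)) \<le> N (adj w * w)"
proof (intro D_mono psd_square)
  assume w: "w * unitm 1 = w"
  show "adj w * w \<in> Mat 1" by (rule col_Mat[OF w])
  show "adj (u * w) * (u * w) \<in> Mat 1" by (rule col_Mat) (simp add: mult.assoc w)
  have "adj (u * w) * (u * w) = adj w * (adj u * u) * w" by (simp add: adj_mult mult.assoc)
  also have "\<dots> \<lesssim> adj w * w" by (rule cuntz_compress[OF psd_square(1)])
  finally show "adj (u * w) * (u * w) \<lesssim> adj w * w" .
qed

lemma rk_nonneg: "rk x r \<Longrightarrow> 0 \<le> r"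
  by (induction rule: rk.induct) (use N_col_nonneg in \<open>auto intro: order_trans add_nonneg_nonneg\<close>)

lemma rk_add: "rk y t \<Longrightarrow> rk x r \<Longrightarrow> rk (x + y) (r + t)"
proof (induction rule: rk.induct)
  case (rk_step y t w t' v)
  then show ?case using rk.rk_step[of "x + y" "r + t" w t' v] by (simp add: add.assoc)
qed simp

lemma rk_mult: "rk x r \<Longrightarrow> rk (u * x * v) r"
proof (induction rule: rk.induct)
  case (rk_step x r w t v')
  have "rk (u * x * v + (u * w) * (v' * v)) (r + t)"
    using rk_step N_col_left[of w u] by (intro rk.rk_step) (auto simp: mult.assoc)
  then show ?case by (simp add: distrib_left distrib_right mult.assoc)
qed (simp add: rk_0)

lemma rk_col: "w * unitm 1 = w \<Longrightarrow> rk (w * v) (N (adj w * w))"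
  using rk_step[OF rk_0, of w "N (adj w * w)" v] by simp

lemma ex_rk: "\<exists>r. rk x r"
proof -
  obtain n where n: "x \<in> Mat n" using ex_Mat by blast
  have "\<exists>r. rk (x * unitm n) r" for n
  proof (induction n)
    case 0
    then show ?case using rk_0 by (auto simp: unitm_0)
  next
    case (Suc n)
    have "shiftm n 1 * unitm 1 = (shiftm n 1 :: 'a minf)" by (rule shiftm_unitm)
    then have "rk ((x * shiftm n 1) * adj (shiftm n 1)) (N (adj (x * shiftm n 1) * (x * shiftm n 1)))"
      by (intro rk_col) (simp add: mult.assoc)
    moreover obtain r where "rk (x * unitm n) r" using Suc by blast
    ultimately show ?case unfolding unitm_Suc distrib_left mult.assoc by (blast intro: rk_add)
  qed
  then show ?thesis using unitm_right[OF n] by metis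
qed

lemma rho_le: "rk x r \<Longrightarrow> \<rho> x \<le> r"
  unfolding \<rho>_def by (rule cInf_lower) (auto intro!: bdd_belowI[of _ 0] rk_nonneg)

lemma rho_greatest: "(\<And>r. rk x r \<Longrightarrow> c \<le> r) \<Longrightarrow> c \<le> \<rho> x"
  unfolding \<rho>_def by (rule cInf_greatest) (use ex_rk in auto)

lemma rho_approx: "0 < \<epsilon> \<Longrightarrow> \<exists>r. rk x r \<and> r < \<rho> x + \<epsilon>"
  using rho_greatest[of x "\<rho> x + \<epsilon>"] by (force simp: not_less)

lemma rho_nonneg: "0 \<le> \<rho> x"
  by (rule rho_greatest) (rule rk_nonneg)

lemma rho_add: "\<rho> (x + y) \<le> \<rho> x + \<rho> y"
proof (rule field_le_epsilon)
  fix \<epsilon> :: real assume "0 < \<epsilon>"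
  then obtain r t where "rk x r" "r < \<rho> x + \<epsilon> / 2" "rk y t" "t < \<rho> y + \<epsilon> / 2"
    using rho_approx[of "\<epsilon> / 2"] by (meson half_gt_zero)
  then show "\<rho> (x + y) \<le> \<rho> x + \<rho> y + \<epsilon>" using rho_le[OF rk_add[of y t x r]] by simp
qed

lemma rho_mult: "\<rho> (u * x * v) \<le> \<rho> x"
  by (rule rho_greatest) (intro rho_le rk_mult)

lemma rho_left: "\<rho> (u * x) \<le> \<rho> x"
proof -
  obtain n where "x \<in> Mat n" using ex_Mat by blast
  then show ?thesis using rho_mult[of u x "unitm n"] by (simp add: mult.assoc unitm_right)
qed

lemma rho_right: "\<rho> (x * v) \<le> \<rho> x"
proof -
  obtain n where "x \<in> Mat n" using ex_Mat by blast
  then show ?thesis using rho_mult[of "unitm n" x v] by (simp add: unitm_left)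
qed

lemma rho_col: "w * unitm 1 = w \<Longrightarrow> \<rho> (w * v) \<le> N (adj w * w)"
  by (intro rho_le rk_col)

text \<open>The one easy lower bound: the first column of x has its Gram element in the corner,
  where N is available, and a summand w v raises its value by at most that of w. It yields \<rho> =
  N on the corner.\<close>

lemma rk_lower: "rk x r \<Longrightarrow> N (adj (x * unitm 1) * (x * unitm 1)) \<le> r"
proof (induction rule: rk.induct)
  case rk_0
  have "N 0 = 0" using D_orth[of 0 0] by (simp add: S_closed)
  then show ?case by (simp add: adj_zero)
next
  case (rk_step x r w t v)
  have u: "unitm 1 * unitm 1 = (unitm 1 :: 'a minf)" by (intro unitm_left unitm_Mat)
  have M: "adj (x * unitm 1) * (x * unitm 1) \<in> Mat 1" for x :: "'a minf"
    by (rule col_Mat) (simp add: mult.assoc u)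
  let ?v = "v * unitm 1"
  have "N (adj (x * unitm 1 + w * ?v) * (x * unitm 1 + w * ?v))
      \<le> N (adj (x * unitm 1) * (x * unitm 1)) + N (adj (w * ?v) * (w * ?v))"
    using M[of "x + w * v"] M[of "w * v"] by (intro D_gram_add M) (simp_all add: mult.assoc distrib_right)
  also have "N (adj (w * ?v) * (w * ?v)) \<le> N (adj w * w)"
  proof (intro D_mono psd_square col_Mat rk_step)
    show "w * ?v * unitm 1 = w * ?v" by (simp add: mult.assoc u)
    have "adj (w * ?v) * (w * ?v) = adj ?v * (adj w * w) * adj (adj ?v)" by (simp add: adj_mult adj_adj mult.assoc)
    then show "adj (w * ?v) * (w * ?v) \<lesssim> adj w * w" using cuntz_conj by metis
  qed
  finally show ?case using rk_step by (simp add: distrib_right mult.assoc)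
qed

lemma rho_corner:
  assumes c: "c \<in> Mat 1" "c \<in> minf_pos" shows "\<rho> c = N c"
proof -
  have "cf sqrt c * c * adj (cf sqrt c) = c * c"
    using cf_sqrt[OF c(2)] by (metis mult.assoc psd_adj)
  then have cc: "c * c \<lesssim> c" using cuntz_conj by metis
  have e: "N (adj c * c) = N c"
    unfolding psd_adj[OF c(2)]
    by (intro D_eq cc cuntz_square psd_square' psd_adj Mat_intros c)
  show ?thesis
  proof (rule antisym)
    show "\<rho> c \<le> N c" using rho_col[of c "unitm 1"] c(1) e by (simp add: unitm_right)
    show "N c \<le> \<rho> c" using rk_lower[of c] c(1) e by (intro rho_greatest) (simp add: unitm_right)
  qed
qed


text \<open>One elimination step. H is an approximate inverse of a = \<open>adj p * p\<close>, and q
  = H a an approximate support projection. Up to \<epsilon> the dimension of w is at least that of p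
  plus that of w - w q, the part of w that s does not see, while p - p q is negligible.\<close>

lemma pivot:
  fixes w s :: "'a minf"
  assumes w: "w * unitm 1 = w" and \<epsilon>: "0 < \<epsilon>"
  defines "p \<equiv> s * w"
  shows "\<exists>H. N (adj (w - w * (H * (adj p * p))) * (w - w * (H * (adj p * p)))) + N (adj p * p) \<le> N (adj w * w) + \<epsilon> \<and>
    N (adj (p - p * (H * (adj p * p))) * (p - p * (H * (adj p * p)))) \<le> \<epsilon> \<and> H \<in> Mat 1"
proof -
  define a where "a = adj p * p"
  have p: "p * unitm 1 = p" by (simp add: p_def mult.assoc w)
  have a: "a \<in> Mat 1" "a \<in> minf_pos" unfolding a_def by (intro col_Mat p psd_square)+
  note cp = psd_cpos[OF a(2)]
  \<comment> \<open>q', taken at level 2 \<delta>, carries the dimension of a up to \<epsilon>; q,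
    taken at level \<delta>, is a unit for q', so that w - w q annihilates q'.\<close>
  obtain \<delta>0 where \<delta>0: "0 < \<delta>0" "N a - \<epsilon> < N (cf (ramp \<delta>0) a)" using D_ramp_approx[OF a \<epsilon>] by blast
  define \<delta> where "\<delta> = \<delta>0 / 2"
  have \<delta>: "0 < \<delta>" using \<delta>0 by (simp add: \<delta>_def)
  define q' where "q' = cf (ramp (2 * \<delta>)) a"
  have q': "N a - \<epsilon> < N q'" using \<delta>0 by (simp add: q'_def \<delta>_def)
  define h f where "h = (\<lambda>s. ramp \<delta> s / max s \<delta>)" and "f = (\<lambda>s. ramp (2 * \<delta>) s / max s \<delta>)"
  have h: "C0 h" and f: "C0 f"
    using C0_ramp[of \<delta>] C0_ramp[of "2 * \<delta>"] \<delta>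
    by (auto simp: C0_def h_def f_def intro!: continuous_intros)
  note k = C0_ramp[OF \<delta>] and k2 = C0_ramp[of "2 * \<delta>"]
  have k2: "C0 (ramp (2 * \<delta>))" using \<delta> by (intro C0_ramp) simp
  have hs: "h s * s = ramp \<delta> s" "s * f s = ramp (2 * \<delta>) s" if "0 \<le> s" for s
    using \<delta> that by (auto simp: h_def f_def max_def ramp_eq_0)
  have kk: "ramp \<delta> s * ramp (2 * \<delta>) s = ramp (2 * \<delta>) s" for s
    using \<delta> by (cases "2 * \<delta> \<le> s") (simp_all add: ramp_eq_0 ramp_eq_1)
  define H q where "H = cf h a" and "q = cf (ramp \<delta>) a"
  have "H * a = cf (\<lambda>s. h s * s) a" by (simp add: H_def cf_mult[OF cp h C0_simps(1)] cf_id[OF cp])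
  also have "\<dots> = q" unfolding q_def by (rule cf_cong[OF cp C0_mult[OF h C0_simps(1)] k hs(1)])
  finally have q: "H * a = q" .
  have qa: "adj q = q" unfolding q_def by (intro cf_adj cp k)
  have qq': "q * q' = q'"
    unfolding q_def q'_def cf_mult[OF cp k k2, symmetric] kk ..
  have q'M: "q' \<in> Mat 1" "q' \<in> minf_pos" unfolding q'_def using \<delta> by (auto intro!: cf_Mat psd_ramp a k2)
  define t where "t = adj (p - p * q) * (p - p * q)"
  define m where "m = (\<lambda>s. s - s * ramp \<delta> s)"
  have m: "C0 m" unfolding m_def using k by (auto simp: C0_def intro!: continuous_intros)
  have km: "C0 (\<lambda>s. ramp \<delta> s * m s)" by (rule C0_mult[OF k m])
  have mkm: "C0 (\<lambda>s. m s - ramp \<delta> s * m s)" using m km by (auto simp: C0_def intro!: continuous_intros)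
  have cfm: "cf m a = a - a * q"
    unfolding m_def q_def
    by (simp add: cf_diff[OF cp C0_simps(1) C0_mult[OF C0_simps(1) k]] cf_mult[OF cp C0_simps(1) k] cf_id[OF cp])
  have "t = (a - a * q) - q * (a - a * q)"
    by (simp add: t_def a_def adj_simps qa algebra_simps)
  then have t: "t = cf (\<lambda>s. m s - ramp \<delta> s * m s) a"
    unfolding cf_diff[OF cp m km] cf_mult[OF cp k m] cfm q_def .
  have "t * q' = cf (\<lambda>s. (m s - ramp \<delta> s * m s) * ramp (2 * \<delta>) s) a"
    unfolding t q'_def by (rule cf_mult[OF cp mkm k2, symmetric])
  also have "\<dots> = cf (\<lambda>s. 0) a"
  proof (rule cf_cong[OF cp C0_mult[OF mkm k2]])
    fix s :: real
    show "(m s - ramp \<delta> s * m s) * ramp (2 * \<delta>) s = 0"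
    proof -
      have "(m s - ramp \<delta> s * m s) * ramp (2 * \<delta>) s = m s * (ramp (2 * \<delta>) s - ramp \<delta> s * ramp (2 * \<delta>) s)"
        by (simp add: left_diff_distrib right_diff_distrib mult.assoc mult.left_commute)
      then show ?thesis by (simp add: kk)
    qed
  qed (simp add: C0_def)
  also have "\<dots> = 0" using cf_scale[OF cp C0_simps(1), of 0] by simp
  finally have tq: "t * q' = 0" .
  have pq: "(p - p * q) * unitm 1 = p - p * q"
  proof -
    have "q * unitm 1 = q" unfolding q_def by (intro unitm_right cf_Mat a k)
    then show ?thesis by (simp add: left_diff_distrib mult.assoc p)
  qed
  have tM: "t \<in> Mat 1" "t \<in> minf_pos" unfolding t_def by (intro col_Mat pq psd_square)+
  \<comment> \<open>t is orthogonal to q', and t + q' is Cuntz below a. Since q' has almost the full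
    dimension of a, little is left for t.\<close>
  have "N t + N q' = N (t + q')" by (rule D_orth[OF tM(1) q'M(1) tM(2) q'M(2) tq, symmetric])
  also have "t + q' \<lesssim> a"
  proof -
    have "t + q' = cf (\<lambda>s. (m s - ramp \<delta> s * m s) + ramp (2 * \<delta>) s) a"
      unfolding t q'_def by (rule cf_add[OF cp mkm k2, symmetric])
    also have "\<dots> \<lesssim> cf (\<lambda>s. s) a"
    proof (rule cuntz_cf[OF a(2) C0_simps(2)[OF mkm k2] _ C0_simps(1), where C = "1 + 1 / (2 * \<delta>)"])
      fix s :: real assume s: "0 \<le> s"
      have e: "m s - ramp \<delta> s * m s = s * (1 - ramp \<delta> s)\<^sup>2"
        by (simp add: m_def power2_eq_square algebra_simps)
      show "0 \<le> (m s - ramp \<delta> s * m s) + ramp (2 * \<delta>) s"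
        unfolding e using s by (intro add_nonneg_nonneg mult_nonneg_nonneg ramp_nonneg) auto
      have "(1 - ramp \<delta> s)\<^sup>2 \<le> 1"
        using ramp_le_1[of \<delta> s] ramp_nonneg[of \<delta> s] by (intro power_le_one) auto
      then have 1: "s * (1 - ramp \<delta> s)\<^sup>2 \<le> s * 1" using s by (rule mult_left_mono)
      have 2: "ramp (2 * \<delta>) s \<le> 1 / (2 * \<delta>) * s" using divide_nonneg_pos[of s "2 * \<delta>"] s \<delta> by (auto simp: ramp_def min_def max_def)
      show "(m s - ramp \<delta> s * m s) + ramp (2 * \<delta>) s \<le> (1 + 1 / (2 * \<delta>)) * s"
        unfolding e distrib_right using 1 2 by simp
    qed (use \<delta> in simp)
    finally show ?thesis by (simp add: cf_id[OF cp])
  qed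
  then have "N (t + q') \<le> N a"
    by (intro D_mono S_closed psd_add tM q'M a)
  finally have N2: "N t \<le> \<epsilon>" using q' by simp
  define y where "y = w - w * q"
  have y: "y * unitm 1 = y"
  proof -
    have "q * unitm 1 = q" unfolding q_def by (intro unitm_right cf_Mat a k)
    then show ?thesis by (simp add: y_def left_diff_distrib mult.assoc w)
  qed
  have "y * q' = 0" by (simp add: y_def left_diff_distrib mult.assoc qq')
  then have yq: "adj y * y * q' = 0" by (simp add: mult.assoc)
  obtain n where n: "w \<in> Mat n" using ex_Mat by blast
  \<comment> \<open>Z and X are made so that \<open>adj w * X * w\<close> equals
    \<open>adj y * y + q'\<close>: the first term of X uses Z w = w q, the second recovers q' from s
    w = p. Then \<open>cuntz_compress\<close> bounds the sum by \<open>adj w * w\<close>.\<close>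
  define Z where "Z = w * H * adj p * s"
  define X where "X = adj (unitm n - Z) * (unitm n - Z) + adj s * cf f (p * adj p) * s"
  have f0: "0 \<le> f s" if "0 \<le> s" for s using \<delta> by (simp add: f_def ramp_nonneg)
  have X: "X \<in> minf_pos" unfolding X_def by (intro psd_add psd_square psd_conj psd_cf f f0)
  have "(unitm n - Z) * w = y"
    by (simp add: y_def Z_def left_diff_distrib unitm_left[OF n] mult.assoc q[symmetric] a_def p_def)
  then have 1: "adj w * (adj (unitm n - Z) * (unitm n - Z)) * w = adj y * y"
    by (metis adj_mult mult.assoc)
  have "adj w * (adj s * cf f (p * adj p) * s) * w = adj p * (cf f (p * adj p) * p)"
    by (simp add: p_def adj_mult mult.assoc)
  also have "\<dots> = a * cf f a" by (simp add: cf_times_adj_intertwine[OF f] a_def mult.assoc)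
  also have "\<dots> = cf (\<lambda>s. s * f s) a" by (simp add: cf_mult[OF cp C0_simps(1) f] cf_id[OF cp])
  also have "\<dots> = q'" unfolding q'_def by (rule cf_cong[OF cp C0_mult[OF C0_simps(1) f] k2 hs(2)])
  finally have "adj w * X * w = adj y * y + q'" using 1 by (simp add: X_def distrib_left distrib_right)
  then have "adj y * y + q' \<lesssim> adj w * w" using cuntz_compress[OF X, of w] by simp
  then have "N (adj y * y + q') \<le> N (adj w * w)"
    by (intro D_mono S_closed(1) col_Mat y w psd_add psd_square q'M)
  moreover have "N (adj y * y + q') = N (adj y * y) + N q'"
    by (intro D_orth col_Mat y psd_square q'M yq)
  ultimately have N1: "N (adj y * y) + N a \<le> N (adj w * w) + \<epsilon>" using q' by simp
  have "H \<in> Mat 1" unfolding H_def by (rule cf_Mat[OF a(2,1) h])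
  then show ?thesis
    using N1 N2 unfolding y_def t_def a_def[symmetric]
    by (intro exI[of _ H]) (simp add: q)
qed


text \<open>Rank superadditivity for block triangular matrices \<open>(x, *; e, c)\<close>, proved by eliminating one column
  after the other as in Gaussian elimination; \<open>e\<close> only has to be small.\<close>

lemma rho_triangular:
  fixes L :: "('a minf \<times> 'a minf \<times> 'a minf \<times> 'a minf \<times> 'a minf) list"
  assumes "\<forall>(w, s, u, v, r) \<in> set L. w * unitm 1 = w"
  shows "\<rho> (\<Sum>(w, s, u, v, r)\<leftarrow>L. u * w * v) + \<rho> (\<Sum>(w, s, u, v, r)\<leftarrow>L. s * w * r)
    \<le> (\<Sum>(w, s, u, v, r)\<leftarrow>L. N (adj w * w)) + real (length L) * \<rho> (\<Sum>(w, s, u, v, r)\<leftarrow>L. s * w * v)"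
  using assms
proof (induction "length L" arbitrary: L)
  case 0
  have "\<rho> 0 \<le> 0" by (rule rho_le[OF rk_0])
  then show ?case using 0 by simp
next
  case (Suc l)
  obtain w s u v r L0 where L: "L = (w, s, u, v, r) # L0" using Suc(2) by (cases L) auto
  then have w: "w * unitm 1 = w" and L0: "\<forall>(w, s, u, v, r) \<in> set L0. w * unitm 1 = w" and l: "length L0 = l"
    using Suc by auto
  \<comment> \<open>The w are the columns of the decomposition, u and s stand for its two block
    rows, v and r for its two block columns. X and C are the diagonal blocks, E is the lower left
    one.\<close>
  define X where "X = (\<Sum>(w, s, u, v, r)\<leftarrow>L. u * w * v)"
  define C where "C = (\<Sum>(w, s, u, v, r)\<leftarrow>L. s * w * r)"
  define E where "E = (\<Sum>(w, s, u, v, r)\<leftarrow>L. s * w * v)"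
  define M where "M = (\<Sum>(w, s, u, v, r)\<leftarrow>L0. N (adj w * w))"
  have "\<rho> X + \<rho> C \<le> N (adj w * w) + M + real (Suc l) * \<rho> E + \<epsilon>" if \<epsilon>: "0 < \<epsilon>" for \<epsilon>
  proof -
    \<comment> \<open>The error \<eta> in E' is multiplied by l; one more comes from the pivot
      inequality and one from C.\<close>
    define \<eta> where "\<eta> = \<epsilon> / (real l + 2)"
    have \<eta>: "0 < \<eta>" using \<epsilon> by (simp add: \<eta>_def)
    define p where "p = s * w"
    obtain H where H: "N (adj (w - w * (H * (adj p * p))) * (w - w * (H * (adj p * p)))) + N (adj p * p) \<le> N (adj w * w) + \<eta>"
      "N (adj (p - p * (H * (adj p * p))) * (p - p * (H * (adj p * p)))) \<le> \<eta>" "H \<in> Mat 1"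
      using pivot[OF w \<eta>, of s] unfolding p_def by blast
    define q where "q = H * (adj p * p)"
    have p: "p * unitm 1 = p" by (simp add: p_def mult.assoc w)
    have q: "q * unitm 1 = q" unfolding q_def by (intro unitm_right Mat_intros H col_Mat p)
    have cols: "(w - w * q) * unitm 1 = w - w * q" "(p - p * q) * unitm 1 = p - p * q"
      by (simp_all add: left_diff_distrib mult.assoc p q w)
    \<comment> \<open>Row operations: the multiples Z and P of the lower block row are subtracted
      from the upper and from the lower one. They clear the pivot column up to w - w q and p - p q,
      and l columns remain.\<close>
    define Z where "Z = u * w * H * adj p"
    define P where "P = p * H * adj p"
    define L' where "L' = map (\<lambda>(w', s', u', v', r'). (w', s' - P * s', u' - Z * s', v', r')) L0"
    have lin: "(\<Sum>(w', s', u', v', r')\<leftarrow>K. (u' - Z * s') * w' * v')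
        = (\<Sum>(w', s', u', v', r')\<leftarrow>K. u' * w' * v') - Z * (\<Sum>(w', s', u', v', r')\<leftarrow>K. s' * w' * v')"
      "(\<Sum>(w', s', u', v', r')\<leftarrow>K. (s' - P * s') * w' * v')
        = (\<Sum>(w', s', u', v', r')\<leftarrow>K. s' * w' * v') - P * (\<Sum>(w', s', u', v', r')\<leftarrow>K. s' * w' * v')"
      "(\<Sum>(w', s', u', v', r')\<leftarrow>K. (s' - P * s') * w' * r')
        = (\<Sum>(w', s', u', v', r')\<leftarrow>K. s' * w' * r') - P * (\<Sum>(w', s', u', v', r')\<leftarrow>K. s' * w' * r')"
      for K :: "('a minf \<times> 'a minf \<times> 'a minf \<times> 'a minf \<times> 'a minf) list"
      by (induction K) (auto simp: algebra_simps)
    define X' where "X' = (\<Sum>(w, s, u, v, r)\<leftarrow>L'. u * w * v)"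
    define C' where "C' = (\<Sum>(w, s, u, v, r)\<leftarrow>L'. s * w * r)"
    define E' where "E' = (\<Sum>(w, s, u, v, r)\<leftarrow>L'. s * w * v)"
    have X0: "X' = (X - u * w * v) - Z * (E - p * v)"
      using lin(1)[of L0] by (simp add: X'_def L'_def X_def E_def L comp_def case_prod_beta' p_def)
    have E0: "E' = (E - p * v) - P * (E - p * v)"
      using lin(2)[of L0] by (simp add: E'_def L'_def E_def L comp_def case_prod_beta' p_def)
    have C0: "C' = (C - p * r) - P * (C - p * r)"
      using lin(3)[of L0] by (simp add: C'_def L'_def C_def L comp_def case_prod_beta' p_def)
    have Pp: "P * (p * z) = p * (q * z)" and Zp: "Z * (p * z) = u * (w * (q * z))" for z
      by (simp_all add: P_def Z_def q_def mult.assoc)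
    have L'l: "length L' = l" "(\<Sum>(w, s, u, v, r)\<leftarrow>L'. N (adj w * w)) = M"
      by (simp_all add: L'_def l M_def comp_def case_prod_beta')
    have "\<forall>(w, s, u, v, r) \<in> set L'. w * unitm 1 = w" using L0 by (auto simp: L'_def)
    then have "\<rho> X' + \<rho> C' \<le> M + real l * \<rho> E'"
      using Suc(1)[OF L'l(1)[symmetric]] unfolding X'_def C'_def E'_def L'l by simp
    moreover have "\<rho> E' \<le> \<rho> E + \<eta>"
    proof -
      obtain n where n: "E \<in> Mat n" using ex_Mat by blast
      have "E' = (unitm n - P) * E + (p - p * q) * (- v)"
        unfolding E0 by (simp add: left_diff_distrib right_diff_distrib mult.assoc Pp unitm_left[OF n])
      then have "\<rho> E' \<le> \<rho> ((unitm n - P) * E) + \<rho> ((p - p * q) * (- v))"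
        using rho_add[of "(unitm n - P) * E" "(p - p * q) * (- v)"] by simp
      also have "\<dots> \<le> \<rho> E + \<eta>"
        using rho_col[OF cols(2), of "- v"] H(2) by (intro add_mono rho_left) (simp add: q_def)
      finally show ?thesis .
    qed
    moreover have "\<rho> C \<le> \<rho> C' + N (adj p * p) + \<eta>"
    proof -
      have "C = (C' + p * (H * adj p * C)) + (p - p * q) * r"
        unfolding C0 by (simp add: left_diff_distrib right_diff_distrib mult.assoc Pp) (simp add: P_def mult.assoc)
      then have "\<rho> C \<le> (\<rho> C' + \<rho> (p * (H * adj p * C))) + \<rho> ((p - p * q) * r)"
        using rho_add[of "C' + p * (H * adj p * C)" "(p - p * q) * r"] rho_add[of C' "p * (H * adj p * C)"] by simp
      also have "\<dots> \<le> (\<rho> C' + N (adj p * p)) + \<eta>"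
        using rho_col[OF cols(2), of r] H(2) by (intro add_mono rho_col p order_refl) (simp add: q_def)
      finally show ?thesis .
    qed
    moreover have "\<rho> X \<le> \<rho> X' + \<rho> E + N (adj (w - w * q) * (w - w * q))"
    proof -
      have "X = (X' + Z * E) + u * ((w - w * q) * v)"
        unfolding X0 by (simp add: left_diff_distrib right_diff_distrib mult.assoc Zp)
      then have "\<rho> X \<le> (\<rho> X' + \<rho> (Z * E)) + \<rho> (u * ((w - w * q) * v))"
        using rho_add[of "X' + Z * E" "u * ((w - w * q) * v)"] rho_add[of X' "Z * E"] by simp
      also have "\<dots> \<le> (\<rho> X' + \<rho> E) + N (adj (w - w * q) * (w - w * q))"
        by (intro add_mono order_refl rho_left order_trans[OF rho_left rho_col] cols)
      finally show ?thesis .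
    qed
    moreover have "real l * \<rho> E' \<le> real l * (\<rho> E + \<eta>)" using calculation(2) by (intro mult_left_mono) auto
    moreover have "real l * \<eta> + 2 * \<eta> = \<epsilon>"
    proof -
      have "real l * \<eta> + 2 * \<eta> = (real l + 2) * \<eta>" by (simp add: algebra_simps)
      also have "\<dots> = \<epsilon>" unfolding \<eta>_def by (simp add: add_nonneg_eq_0_iff)
      finally show ?thesis .
    qed
    ultimately show ?thesis using H(1) by (simp add: q_def algebra_simps)
  qed
  then have "\<rho> X + \<rho> C \<le> N (adj w * w) + M + real (Suc l) * \<rho> E" by (rule field_le_epsilon)
  then show ?case by (simp add: X_def C_def E_def M_def L l)
qed

lemma rk_list: "rk x r \<Longrightarrow> \<exists>L. (\<forall>(w, v) \<in> set L. w * unitm 1 = w) \<and> x = (\<Sum>(w, v)\<leftarrow>L. w * v) \<and>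
    (\<Sum>(w, v)\<leftarrow>L. N (adj w * w)) \<le> r"
proof (induction rule: rk.induct)
  case rk_0
  show ?case by (rule exI[of _ "[]"]) simp
next
  case (rk_step x r w t v)
  then obtain L where "\<forall>(w, v) \<in> set L. w * unitm 1 = w" "x = (\<Sum>(w, v)\<leftarrow>L. w * v)"
    "(\<Sum>(w, v)\<leftarrow>L. N (adj w * w)) \<le> r" by blast
  then show ?case using rk_step by (intro exI[of _ "(w, v) # L"]) auto
qed

text \<open>Take the lower row and the right column from a, the others from b: the lower left corner
  a (a + b) b vanishes. Compression from both sides leaves cubes on the diagonal, which are absorbed
  once cut-offs are taken.\<close>

lemma rho_orth:
  assumes ab: "a * b = 0"
  shows "\<rho> (a * a * a) + \<rho> (b * b * b) \<le> \<rho> (a + b)"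
proof (rule rho_greatest)
  fix r assume "rk (a + b) r"
  then obtain L where L: "\<forall>(w, v) \<in> set L. w * unitm 1 = w" "a + b = (\<Sum>(w, v)\<leftarrow>L. w * v)"
    "(\<Sum>(w, v)\<leftarrow>L. N (adj w * w)) \<le> r" using rk_list by blast
  define L' where "L' = map (\<lambda>(w, v). (w, a, b, v * b, v * a)) L"
  have lin: "(\<Sum>(w, v)\<leftarrow>K. s * w * (v * t)) = s * (\<Sum>(w, v)\<leftarrow>K. w * v) * t" for s t and K :: "('a minf \<times> 'a minf) list"
    by (induction K) (auto simp: algebra_simps)
  have "(\<Sum>(w, s, u, v, r)\<leftarrow>L'. u * w * v) = b * (a + b) * b"
    "(\<Sum>(w, s, u, v, r)\<leftarrow>L'. s * w * r) = a * (a + b) * a"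
    "(\<Sum>(w, s, u, v, r)\<leftarrow>L'. s * w * v) = a * (a + b) * b"
    using lin[of b b L] lin[of a a L] lin[of a b L] L(2)
    by (simp_all add: L'_def comp_def case_prod_beta')
  moreover have "b * (a + b) * b = b * b * b" "a * (a + b) * a = a * a * a" "a * (a + b) * b = 0"
    using ab by (simp_all add: distrib_left distrib_right mult.assoc)
  moreover have "\<rho> 0 = 0" using rho_le[OF rk_0] rho_nonneg[of 0] by simp
  moreover have "(\<Sum>(w, s, u, v, r)\<leftarrow>L'. N (adj w * w)) \<le> r"
    using L(3) by (simp add: L'_def comp_def case_prod_beta')
  moreover have "\<forall>(w, s, u, v, r) \<in> set L'. w * unitm 1 = w" using L(1) by (auto simp: L'_def)
  ultimately show "\<rho> (a * a * a) + \<rho> (b * b * b) \<le> r" using rho_triangular[of L'] by simp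
qed

end

section \<open>The lower semicontinuous extension of a dimension function on the corner\<close>

context corner_dimfun
begin

lemma rho_cf_le:
  assumes a: "a \<in> minf_pos" and C: "C0 f" "C0 m" "C0 g" and eq: "\<And>s. 0 \<le> s \<Longrightarrow> f s = m s * g s"
  shows "\<rho> (cf f a) \<le> \<rho> (cf m a)"
proof -
  note cp = psd_cpos[OF a]
  have "cf f a = cf (\<lambda>s. m s * g s) a" by (rule cf_cong[OF cp C(1) C0_mult[OF C(2,3)] eq])
  also have "\<dots> = cf m a * cf g a" by (rule cf_mult[OF cp C(2,3)])
  finally show ?thesis by (simp add: rho_right)
qed

lemma rho_cf_excess_le:
  assumes a: "a \<in> minf_pos" and f: "C0 f" "\<And>s. 0 \<le> s \<Longrightarrow> s \<le> \<epsilon> \<Longrightarrow> f s = 0" and \<epsilon>: "0 \<le> \<delta>" "\<delta> < \<epsilon>"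
  shows "\<rho> (cf f a) \<le> \<rho> (cf (excess \<delta>) a)"
proof (rule rho_cf_le[OF a f(1) C0_cut[OF \<epsilon>(1)], where g = "\<lambda>s. f s / max (excess \<delta> s) (\<epsilon> - \<delta>)"])
  have "max (excess \<delta> s) (\<epsilon> - \<delta>) \<noteq> 0" for s using \<epsilon> by (auto simp: max_def)
  then show "C0 (\<lambda>s. f s / max (excess \<delta> s) (\<epsilon> - \<delta>))"
    using f(1) C0_cut[OF \<epsilon>(1)] by (auto simp: C0_def intro!: continuous_intros)
  show "f s = excess \<delta> s * (f s / max (excess \<delta> s) (\<epsilon> - \<delta>))" if "0 \<le> s" for s
    using f(2)[OF that] \<epsilon> by (cases "s \<le> \<epsilon>") (auto simp: excess_def max_def)
qed

lemma rho_excess_antimono: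
  assumes "a \<in> minf_pos" "0 \<le> \<delta>" "\<delta> \<le> \<epsilon>"
  shows "\<rho> (cf (excess \<epsilon>) a) \<le> \<rho> (cf (excess \<delta>) a)"
proof (cases "\<delta> = \<epsilon>")
  case False
  then show ?thesis
    using assms by (intro rho_cf_excess_le[where \<epsilon> = \<epsilon>] C0_cut) (auto simp: excess_def)
qed simp

text \<open>A comparison a \<lesssim> b factors only the cuts of a through b
  (\<open>cuntz_factor\<close>), so \<rho> is replaced by its supremum over cuts. This gives
  monotonicity and lower semicontinuity at once.\<close>

definition ext :: "'a minf \<Rightarrow> real" where
  "ext a = (SUP k. \<rho> (cf (excess (1 / real (Suc k))) a))"

lemma ext_upper:
  assumes a: "a \<in> minf_pos" and \<epsilon>: "0 < \<epsilon>" shows "\<rho> (cf (excess \<epsilon>) a) \<le> ext a"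
proof -
  obtain k where k: "1 / real (Suc k) < \<epsilon>" using \<epsilon> nat_approx_posE by blast
  have "bdd_above (range (\<lambda>k. \<rho> (cf (excess (1 / real (Suc k))) a)))"
    using rho_excess_antimono[OF a, of 0] by (intro bdd_aboveI[of _ "\<rho> (cf (excess 0) a)"]) auto
  then have "\<rho> (cf (excess (1 / real (Suc k))) a) \<le> ext a" unfolding ext_def by (intro cSUP_upper) auto
  moreover have "\<rho> (cf (excess \<epsilon>) a) \<le> \<rho> (cf (excess (1 / real (Suc k))) a)"
    using k by (intro rho_excess_antimono a) auto
  ultimately show ?thesis by simp
qed

lemma ext_least: "(\<And>\<epsilon>. 0 < \<epsilon> \<Longrightarrow> \<rho> (cf (excess \<epsilon>) a) \<le> c) \<Longrightarrow> ext a \<le> c"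
  unfolding ext_def by (rule cSUP_least) auto

lemma ext_mono:
  assumes a: "a \<in> minf_pos" and b: "b \<in> minf_pos" and ab: "a \<lesssim> b"
  shows "ext a \<le> ext b"
proof (rule ext_least)
  fix \<epsilon> :: real assume \<epsilon>: "0 < \<epsilon>"
  obtain x \<gamma> where x: "0 < \<gamma>" "cf (excess \<epsilon>) a = x * adj x" "x * cf (ramp \<gamma>) b = x"
    using cuntz_factor[OF a b ab \<epsilon>] by metis
  have "cf (excess \<epsilon>) a = x * cf (ramp \<gamma>) b * adj x" unfolding x(2,3) ..
  then have "\<rho> (cf (excess \<epsilon>) a) \<le> \<rho> (cf (ramp \<gamma>) b)" by (simp add: rho_mult)
  also have "\<dots> \<le> \<rho> (cf (excess (\<gamma>/2)) b)"
    using x(1) by (intro rho_cf_excess_le[where \<epsilon> = \<gamma>] b C0_ramp) (auto simp: ramp_eq_0)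
  also have "\<dots> \<le> ext b" using x(1) by (intro ext_upper b) simp
  finally show "\<rho> (cf (excess \<epsilon>) a) \<le> ext b" .
qed

lemma ext_orth:
  assumes a: "a \<in> minf_pos" and b: "b \<in> minf_pos" and ab: "a * b = 0"
  shows "ext (a + b) = ext a + ext b"
proof (rule antisym)
  show "ext (a + b) \<le> ext a + ext b"
  proof (rule ext_least)
    fix \<epsilon> :: real assume \<epsilon>: "0 < \<epsilon>"
    have "cf (excess \<epsilon>) (a + b) = cf (excess \<epsilon>) a + cf (excess \<epsilon>) b"
      using \<epsilon> by (intro cf_add_orth a b ab C0_cut) simp
    then have "\<rho> (cf (excess \<epsilon>) (a + b)) \<le> \<rho> (cf (excess \<epsilon>) a) + \<rho> (cf (excess \<epsilon>) b)" by (simp add: rho_add)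
    also have "\<dots> \<le> ext a + ext b" by (intro add_mono ext_upper a b \<epsilon>)
    finally show "\<rho> (cf (excess \<epsilon>) (a + b)) \<le> ext a + ext b" .
  qed
  have le: "\<rho> (cf (excess \<epsilon>) a) + \<rho> (cf (excess \<epsilon>) b) \<le> ext (a + b)" if \<epsilon>: "0 < \<epsilon>" for \<epsilon>
  proof -
    define f where "f = ramp (\<epsilon>/2)"
    have f: "C0 f" unfolding f_def using \<epsilon> by (intro C0_ramp) simp
    \<comment> \<open>f is 1 where the cut lives, so the cut is divisible by f^3; this absorbs the
      cubes of \<open>rho_orth\<close>.\<close>
    have cube: "\<rho> (cf (excess \<epsilon>) c) \<le> \<rho> (cf f c * cf f c * cf f c)" if c: "c \<in> minf_pos" for c
    proof -
      note cp = psd_cpos[OF c]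
      have "\<rho> (cf (excess \<epsilon>) c) \<le> \<rho> (cf (\<lambda>s. f s * f s * f s) c)"
      proof (rule rho_cf_le[OF c _ C0_mult[OF C0_mult[OF f f] f]])
        show "excess \<epsilon> s = f s * f s * f s * excess \<epsilon> s" for s
          using \<epsilon> by (cases "s \<le> \<epsilon>") (simp_all add: excess_def f_def ramp_eq_1)
      qed (use \<epsilon> in \<open>auto intro: C0_cut\<close>)
      then show ?thesis by (simp add: cf_mult[OF cp C0_mult[OF f f] f] cf_mult[OF cp f f])
    qed
    have "cf f b * a = 0" by (rule cf_mult_zero[OF b f orth_sym[OF a b ab]])
    then have "a * cf f b = 0"
      using psd_adj[OF a] cf_adj[OF psd_cpos[OF b] f] by (metis adj_mult adj_zero)
    then have "cf f a * cf f b = 0" by (rule cf_mult_zero[OF a f])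
    then have "\<rho> (cf (excess \<epsilon>) a) + \<rho> (cf (excess \<epsilon>) b) \<le> \<rho> (cf f a + cf f b)"
      using rho_orth[of "cf f a" "cf f b"] cube[OF a] cube[OF b] by simp
    also have "\<dots> = \<rho> (cf f (a + b))" by (simp add: cf_add_orth[OF a b ab f])
    also have "\<dots> \<le> \<rho> (cf (excess (\<epsilon>/4)) (a + b))"
      using \<epsilon> by (intro rho_cf_excess_le[where \<epsilon> = "\<epsilon>/2"] psd_add a b f) (auto simp: f_def ramp_eq_0)
    also have "\<dots> \<le> ext (a + b)" using \<epsilon> by (intro ext_upper psd_add a b) simp
    finally show ?thesis .
  qed
  \<comment> \<open>The two suprema are independent; both cuts are compared with the cut at the
    smaller parameter.\<close>
  have "ext a \<le> ext (a + b) - ext b"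
  proof (rule ext_least)
    fix \<epsilon> :: real assume \<epsilon>: "0 < \<epsilon>"
    have "ext b \<le> ext (a + b) - \<rho> (cf (excess \<epsilon>) a)"
    proof (rule ext_least)
      fix \<delta> :: real assume \<delta>: "0 < \<delta>"
      have "\<rho> (cf (excess \<epsilon>) a) \<le> \<rho> (cf (excess (min \<epsilon> \<delta>)) a)" "\<rho> (cf (excess \<delta>) b) \<le> \<rho> (cf (excess (min \<epsilon> \<delta>)) b)"
        using \<epsilon> \<delta> by (intro rho_excess_antimono a b; simp)+
      then show "\<rho> (cf (excess \<delta>) b) \<le> ext (a + b) - \<rho> (cf (excess \<epsilon>) a)"
        using le[of "min \<epsilon> \<delta>"] \<epsilon> \<delta> by simp
    qed
    then show "\<rho> (cf (excess \<epsilon>) a) \<le> ext (a + b) - ext b" by simp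
  qed
  then show "ext a + ext b \<le> ext (a + b)" by simp
qed

lemma ext_corner:
  assumes a: "a \<in> Mat 1" "a \<in> minf_pos" shows "ext a = N a"
proof (rule antisym)
  have e: "\<rho> (cf (excess \<epsilon>) a) = N (cf (excess \<epsilon>) a)" if "0 < \<epsilon>" for \<epsilon>
    using that by (intro rho_corner cf_Mat psd_cut C0_cut a) auto
  show "N a \<le> ext a"
    using ext_upper[OF a(2)] e by (intro D_lsc[OF a]) simp
  show "ext a \<le> N a"
    using e by (intro ext_least) (simp add: D_mono S_cf C0_cut psd_cut a cuntz_cut)
qed

lemma ext_lsc: "lsc_dimfun UNIV ext"
proof -
  have nn: "0 \<le> ext a" if "a \<in> minf_pos" for a
    using ext_upper[OF that, of 1] rho_nonneg[of "cf (excess 1) a"] by simp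
  interpret E: dimfun UNIV ext by (rule dimfun_UNIV_I[OF nn ext_mono ext_orth])
  show ?thesis
  proof
    fix a :: "'a minf" and c assume a: "a \<in> minf_pos" and c: "\<And>\<epsilon>. 0 < \<epsilon> \<Longrightarrow> ext (cf (excess \<epsilon>) a) \<le> c"
    show "ext a \<le> c"
    proof (rule ext_least)
      fix \<epsilon> :: real assume \<epsilon>: "0 < \<epsilon>"
      have "\<rho> (cf (excess \<epsilon>) a) = \<rho> (cf (excess (\<epsilon>/2)) (cf (excess (\<epsilon>/2)) a))"
        using \<epsilon> by (simp add: cut_cut[OF a])
      also have "\<dots> \<le> ext (cf (excess (\<epsilon>/2)) a)" using \<epsilon> by (intro ext_upper psd_cut a) auto
      also have "\<dots> \<le> c" using \<epsilon> by (intro c) simp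
      finally show "\<rho> (cf (excess \<epsilon>) a) \<le> c" .
    qed
  qed
qed

text \<open>Only \<open>D' \<le> ext\<close> is immediate from the definition; the converse is obtained by passing to
  complements in \<open>M\<^sub>n(A)\<close>, where both functions agree on the unit.\<close>

lemma ext_unique:
  assumes D': "lsc_dimfun UNIV D'" and N: "\<And>c. c \<in> Mat 1 \<Longrightarrow> c \<in> minf_pos \<Longrightarrow> D' c = N c"
    and a: "a \<in> minf_pos"
  shows "D' a = ext a"
proof -
  interpret A: lsc_dimfun UNIV D' by (rule D')
  interpret E: lsc_dimfun UNIV ext by (rule ext_lsc)
  have rk: "rk x r \<Longrightarrow> D' (adj x * x) \<le> r" for x r
  proof (induction rule: rk.induct)
    case rk_0
    have "D' 0 = 0" using A.D_orth[of 0 0] by simp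
    then show ?case by (simp add: adj_zero)
  next
    case (rk_step x r w t v)
    have "D' (adj (x + w * v) * (x + w * v)) \<le> D' (adj x * x) + D' (adj (w * v) * (w * v))"
      by (rule A.D_gram_add) auto
    also have "D' (adj (w * v) * (w * v)) \<le> D' (adj w * w)"
    proof (intro A.D_mono psd_square UNIV_I)
      have "adj (w * v) * (w * v) = adj v * (adj w * w) * adj (adj v)" by (simp add: adj_mult adj_adj mult.assoc)
      then show "adj (w * v) * (w * v) \<lesssim> adj w * w" using cuntz_conj by metis
    qed
    also have "D' (adj w * w) = N (adj w * w)" by (intro N col_Mat psd_square rk_step)
    finally show ?case using rk_step by simp
  qed
  have D'_rho: "D' c \<le> \<rho> c" if c: "c \<in> minf_pos" for c
  proof (rule rho_greatest)
    fix r assume "rk c r"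
    have "D' c \<le> D' (adj c * c)"
      unfolding psd_adj[OF c] by (intro A.D_mono UNIV_I c psd_square' psd_adj cuntz_square)
    then show "D' c \<le> r" using rk[OF \<open>rk c r\<close>] by simp
  qed
  have le: "D' a \<le> ext a" if a: "a \<in> minf_pos" for a
  proof (rule A.D_lsc[OF UNIV_I a])
    fix \<epsilon> :: real assume \<epsilon>: "0 < \<epsilon>"
    have "D' (cf (excess \<epsilon>) a) \<le> \<rho> (cf (excess \<epsilon>) a)" using \<epsilon> by (intro D'_rho psd_cut a) simp
    also have "\<dots> \<le> ext a" by (rule ext_upper[OF a \<epsilon>])
    finally show "D' (cf (excess \<epsilon>) a) \<le> ext a" .
  qed
  \<comment> \<open>The unit of \<open>Mat n\<close> is a sum of n orthogonal copies of
    \<open>unitm 1\<close>, on which both functions have the value of N.\<close>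
  have unit: "D' (unitm n) = ext (unitm n)" for n
  proof (induction n)
    case 0
    show ?case using A.D_orth[of 0 0] E.D_orth[of 0 0] by (simp add: unitm_0)
  next
    case (Suc n)
    let ?s = "shiftm n 1 :: 'a minf"
    have o: "unitm n * (?s * adj ?s) = 0" by (simp add: mult.assoc[symmetric] unitm_shiftm)
    have t: "D' (?s * adj ?s) = ext (?s * adj ?s)"
      using A.D_trace[of ?s] E.D_trace[of ?s] N[OF unitm_Mat psd_unitm] ext_corner[OF unitm_Mat psd_unitm]
      by (simp add: adj_shiftm_shiftm)
    show ?case
      unfolding unitm_Suc using Suc t
      by (simp add: A.D_orth[OF UNIV_I UNIV_I psd_unitm psd_square(2) o] E.D_orth[OF UNIV_I UNIV_I psd_unitm psd_square(2) o])
  qed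
  have "ext a \<le> D' a"
  proof (rule E.D_lsc[OF UNIV_I a])
    fix \<epsilon> :: real assume \<epsilon>: "0 < \<epsilon>"
    obtain n where n: "a \<in> Mat n" using ex_Mat by blast
    define \<delta> where "\<delta> = \<epsilon> / 4"
    have \<delta>: "0 < \<delta>" "\<epsilon> = 2 * (2 * \<delta>)" "0 < 2 * \<delta>" using \<epsilon> by (simp_all add: \<delta>_def)
    define k k2 where "k = cf (ramp \<delta>) a" and "k2 = cf (ramp (2 * \<delta>)) a"
    note cp = psd_cpos[OF a]
    have k: "k \<in> minf_pos" "k2 \<in> minf_pos" "k \<in> Mat n" "k2 \<in> Mat n"
      unfolding k_def k2_def by (intro psd_ramp cf_Mat C0_ramp a n \<delta>)+
    have "norm k \<le> 1" unfolding k_def by (rule norm_ramp[OF a \<delta>(1)])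
    then have c: "unitm n - k \<in> minf_pos" using psd_unit_diff[OF k(3) psd_adj[OF k(1)], of 1] by simp
    have "k2 * k = cf (\<lambda>s. ramp (2 * \<delta>) s * ramp \<delta> s) a"
      unfolding k_def k2_def by (rule cf_mult[OF cp C0_ramp[OF \<delta>(3)] C0_ramp[OF \<delta>(1)], symmetric])
    also have "(\<lambda>s. ramp (2 * \<delta>) s * ramp \<delta> s) = ramp (2 * \<delta>)"
    proof
      fix s show "ramp (2 * \<delta>) s * ramp \<delta> s = ramp (2 * \<delta>) s"
        using \<delta> by (cases "2 * \<delta> \<le> s") (simp_all add: ramp_eq_0 ramp_eq_1)
    qed
    finally have "k2 * k = k2" by (simp add: k2_def)
    then have o: "k2 * (unitm n - k) = 0" by (simp add: right_diff_distrib unitm_right[OF k(4)])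
    have "unitm n - (k2 + (unitm n - k)) = k - k2" by simp
    also have "k - k2 \<in> minf_pos"
      unfolding k_def k2_def
    proof (intro psd_cf_diff a C0_ramp \<delta>)
      fix s :: real assume "0 \<le> s"
      show "ramp (2 * \<delta>) s \<le> ramp \<delta> s"
        using \<delta> ramp_le_1[of "2 * \<delta>" s] by (cases "2 * \<delta> \<le> s") (simp_all add: ramp_eq_0 ramp_eq_1 ramp_nonneg)
    qed
    finally have "k2 + (unitm n - k) \<lesssim> unitm n" by (intro le_cuntz psd_add k c)
    \<comment> \<open>Complementation: ext k2 + ext (1 - k) \<le> ext 1 = D' 1 \<le> D' k + D' (1 -
      k) \<le> D' k + ext (1 - k), and the last term cancels because the values are finite.\<close>
    then have "ext k2 + ext (unitm n - k) \<le> ext (unitm n)"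
      unfolding E.D_orth[OF UNIV_I UNIV_I k(2) c o, symmetric] by (intro E.D_mono UNIV_I psd_add k c psd_unitm)
    also have "\<dots> = D' (k + (unitm n - k))" by (simp add: unit)
    also have "\<dots> \<le> D' k + D' (unitm n - k)" by (intro A.D_add UNIV_I k c)
    also have "\<dots> \<le> D' k + ext (unitm n - k)" by (intro add_left_mono le c)
    finally have "ext k2 \<le> D' k" by simp
    also have "\<dots> \<le> D' a"
      using cuntz_trans[OF cuntz_ramp[OF a \<delta>(1)] cuntz_cut[OF a]] \<delta>
      by (intro A.D_mono UNIV_I k a) (simp add: k_def)
    finally have "ext k2 \<le> D' a" .
    moreover have "ext (cf (excess \<epsilon>) a) \<le> ext k2"
      unfolding \<delta>(2) k2_def using \<epsilon> \<delta>
      by (intro E.D_mono UNIV_I psd_cut psd_ramp a cuntz_cut_ramp) auto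
    ultimately show "ext (cf (excess \<epsilon>) a) \<le> D' a" by simp
  qed
  then show ?thesis using le[OF a] by simp
qed

end

section \<open>Existence and uniqueness of the extended quasitrace\<close>

lemma lsc_dimfun_UNIV:
  assumes "\<And>m. lsc_dimfun (Mat m) D" shows "lsc_dimfun UNIV D"
proof
  fix a :: "'a minf" assume a: "a \<in> minf_pos"
  obtain n where n: "a \<in> Mat n" using ex_Mat by blast
  interpret lsc_dimfun "Mat n" D by (rule assms)
  show "0 \<le> D a" using a n by (rule D_nonneg[rotated])
  show "D a \<le> c" if "\<And>\<epsilon>. 0 < \<epsilon> \<Longrightarrow> D (cf (excess \<epsilon>) a) \<le> c" for c
    by (rule D_lsc[OF n a that])
next
  fix a b :: "'a minf" assume ab: "a \<in> minf_pos" "b \<in> minf_pos"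
  obtain n where n: "a \<in> Mat n" "b \<in> Mat n" using ex_Mat2 by blast
  interpret lsc_dimfun "Mat n" D by (rule assms)
  show "D (a + b) \<le> D a + D b" by (rule D_add[OF n ab])
  show "D a \<le> D b" if "a \<lesssim> b" by (rule D_mono[OF n ab that])
  show "D (a + b) = D a + D b" if "a * b = 0" by (rule D_orth[OF n ab that])
qed simp

text \<open>A commutative subalgebra of \<open>Mat m\<close> has to be one of \<open>Mat n\<close>;
  only its closedness needs an argument, namely that \<open>Mat m\<close> is closed.\<close>

lemma quasitr_sub:
  assumes T: "quasitr n T" and mn: "m \<le> n" shows "quasitr m T"
proof
  interpret quasitr n T by (rule T)
  have sub: "Mat m \<subseteq> (Mat n :: 'a minf set)" by (rule Mat_mono[OF mn])
  have "cstar_subalgebra (Mat n) mat_norm B" if B: "cstar_subalgebra (Mat m) mat_norm B" for B :: "'a minf set"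
    unfolding cstar_subalgebra_def norm_closed_in_def
  proof (intro conjI allI impI)
    fix x :: "nat \<Rightarrow> 'a minf" and l
    assume x: "(\<forall>k. x k \<in> B) \<and> l \<in> Mat n \<and> (\<lambda>k. mat_norm (x k - l)) \<longlonglongrightarrow> 0"
    have "x k \<in> Mat m" for k using x B by (auto simp: cstar_subalgebra_def)
    moreover have "x \<longlonglongrightarrow> l" using x by (subst tendsto_dist_iff) (simp add: dist_norm norm_minf_def)
    ultimately have "l \<in> Mat m" using complete_imp_closed[OF complete_Mat] closed_sequentially by metis
    then show "l \<in> B" using x B by (auto simp: cstar_subalgebra_def norm_closed_in_def)
  qed (use B sub in \<open>auto simp: cstar_subalgebra_def\<close>)
  then show "quasitrace_on (Mat m) mat_norm T"
    using qt sub unfolding quasitrace_on_def by (auto; blast)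
qed

lemma dim_cong:
  assumes T: "quasitr n T" and T': "quasitr n' T'" and eq: "\<And>x. x \<in> Mat m \<Longrightarrow> T x = T' x"
    and a: "a \<in> Mat m" "a \<in> minf_pos"
  shows "quasitr.dim T a = quasitr.dim T' a"
  using a eq[OF cf_Mat[OF a(2,1) C0_ramp]]
  by (simp add: quasitr.dim_def[OF T] quasitr.dim_def[OF T'] quasitr.tr_def[OF T] quasitr.tr_def[OF T'])

text \<open>The extension is \<open>TD\<close> for \<open>ext\<close>. As \<open>ext\<close> is
  lower semicontinuous, it is exactly the dimension function of \<open>TD\<close>; any other
  extension has a dimension function that \<open>ext_unique\<close> identifies with it, and
  \<open>quasitr_determined\<close> does the rest.\<close>

lemma quasitrace_extension:
  fixes \<tau> :: "'a :: unital_cstar_algebra minf \<Rightarrow> complex"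
  assumes \<tau>: "quasitrace_on (Mat 2) mat_norm \<tau>"
  shows "\<exists>!T. (\<forall>n. quasitrace_on (Mat n) mat_norm T) \<and> (\<forall>x \<in> Mat 1. T x = \<tau> x)"
proof -
  interpret Q: quasitr 2 \<tau> by standard (rule \<tau>)
  have q1: "quasitr 1 \<tau>" by (rule quasitr_sub[OF Q.quasitr_axioms]) simp
  interpret N: lsc_dimfun "Mat 1" Q.dim by (rule Q.lsc_dimfun_dim) simp
  interpret corner_dimfun Q.dim ..
  interpret E: lsc_dimfun UNIV ext by (rule ext_lsc)
  interpret F: fin_dimfun ext ..
  have dimT: "quasitr.dim F.TD a = ext a" if a: "a \<in> minf_pos" for a
  proof -
    obtain n where n: "a \<in> Mat n" using ex_Mat by blast
    show ?thesis
      using F.dim_TD_le[OF n a] E.D_lsc[OF UNIV_I a F.dim_TD_ge[OF n a]] by simp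
  qed
  have "F.TD x = \<tau> x" if "x \<in> Mat 1" for x
    using dimT ext_corner that by (intro quasitr_determined[OF F.quasitr_TD q1]) auto
  moreover have "T = F.TD" if T: "\<forall>n. quasitrace_on (Mat n) mat_norm T" "\<forall>x \<in> Mat 1. T x = \<tau> x" for T
  proof
    fix x :: "'a minf"
    have q: "quasitr n T" for n using T by (simp add: quasitr_def)
    have l: "lsc_dimfun UNIV (quasitr.dim T)"
      by (rule lsc_dimfun_UNIV, rule quasitr.lsc_dimfun_dim[OF q order_refl])
    have "quasitr.dim T a = ext a" if "a \<in> minf_pos" for a
      using T(2) by (intro ext_unique[OF l _ that] dim_cong[OF q q1]) auto
    moreover obtain n where "x \<in> Mat n" using ex_Mat by blast
    ultimately show "T x = F.TD x" using dimT by (intro quasitr_determined[OF q F.quasitr_TD]) auto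
  qed
  ultimately show ?thesis using F.quasitrace_TD by blast
qed

section \<open>Quasitraces on the algebra and \<open>d\<^sub>\<tau>\<close>\<close>

lemma pow_Suc_cf:
  assumes b: "b \<in> minf_pos" and f: "C0 f"
  shows "C0 (\<lambda>s. f s ^ Suc n) \<and> pow_Suc (cf f b) n = cf (\<lambda>s. f s ^ Suc n) b"
proof (induction n)
  case (Suc n)
  then show ?case
    using C0_mult[of "\<lambda>s. f s ^ Suc n" f] f cf_mult[OF psd_cpos[OF b], of "\<lambda>s. f s ^ Suc n" f]
    by (simp add: mult.commute mult.left_commute)
qed (simp add: f)

lemma C0_root: "C0 (root (Suc k))"
  by (auto simp: C0_def intro!: continuous_intros)

lemma root_Suc_cf:
  fixes a :: "'a :: unital_cstar_algebra minf"
  assumes a: "a \<in> minf_pos" shows "root_Suc n a = cf (root (Suc n)) a"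
  unfolding root_Suc_def
proof (rule the_equality)
  have "pow_Suc (cf (root (Suc n)) a) n = cf (\<lambda>s. root (Suc n) s ^ Suc n) a"
    using pow_Suc_cf[OF a C0_root] by simp
  also have "\<dots> = cf (\<lambda>s. s) a"
    using pow_Suc_cf[OF a C0_root, of n n] real_root_pow_pos2[of "Suc n"]
    by (intro cf_cong psd_cpos a C0_simps) (simp_all del: power_Suc)
  also have "\<dots> = a" by (rule cf_id[OF psd_cpos[OF a]])
  finally show "cf (root (Suc n)) a \<in> minf_pos \<and> pow_Suc (cf (root (Suc n)) a) n = a"
    using psd_cf[OF a C0_root] by simp
  fix b :: "'a minf" assume b: "b \<in> minf_pos \<and> pow_Suc b n = a"
  then have cp: "cpos b" by (intro psd_cpos) simp
  have p: "C0 (\<lambda>s :: real. s ^ Suc n)" and ab: "a = cf (\<lambda>s. s ^ Suc n) b"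
    using pow_Suc_cf[OF _ C0_simps(1), of b n] b by (simp_all add: cf_id[OF cp])
  have "cf (root (Suc n)) a = cf (\<lambda>s. root (Suc n) (s ^ Suc n)) b"
    unfolding ab by (rule cf_comp[OF cp p _ C0_root]) simp
  also have "\<dots> = cf (\<lambda>s. s) b"
    by (rule cf_cong[OF cp C0_comp[OF p C0_root] C0_simps(1)]) (auto simp del: power_Suc intro: real_root_power_cancel)
  also have "\<dots> = b" by (rule cf_id[OF cp])
  finally show "b = cf (root (Suc n)) a" ..
qed

section \<open>Traces of roots and d_\<tau>\<close>

context quasitr
begin

lemma tr_cf_scale:
  assumes a: "a \<in> Mat n" "a \<in> minf_pos" and f: "C0 f"
  shows "tr (cf (\<lambda>s. c * f s) a) = c * tr (cf f a)"
  using tr_scaleR[OF cf_Mat[OF a(2,1) f] cf_adj[OF psd_cpos[OF a(2)] f]] cf_scale[OF psd_cpos[OF a(2)] f] by simp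

text \<open>f need not vanish near 0, as \<open>dim_upper\<close> requires. Write f = K g + \<eta> h
  with g = (f - \<eta>)_+ / K, which does vanish there, and h a contraction; the second term costs
  at most \<eta> times the trace of the unit.\<close>

lemma tr_cf_le_dim:
  assumes a: "a \<in> Mat n" "a \<in> minf_pos" and f: "C0 f" "\<And>s. 0 \<le> s \<Longrightarrow> 0 \<le> f s" "\<And>s. 0 \<le> s \<Longrightarrow> f s \<le> K" and K: "0 < K"
  shows "tr (cf f a) \<le> K * dim a"
proof -
  note cp = psd_cpos[OF a(2)]
  define C where "C = tr (unitm n)"
  have C: "0 \<le> C" unfolding C_def by (intro tr_nonneg unitm_Mat psd_unitm)
  have eta: "tr (cf f a) \<le> K * dim a + \<eta> * C" if \<eta>: "0 < \<eta>" for \<eta>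
  proof -
    define g h where "g = (\<lambda>s. max 0 (f s - \<eta>) / K)" and "h = (\<lambda>s. min (f s) \<eta> / \<eta>)"
    have gh: "C0 g" "C0 h" using f(1) \<eta> K by (auto simp: C0_def g_def h_def intro!: continuous_intros)
    obtain \<delta> where \<delta>: "0 < \<delta>" "\<And>s. 0 \<le> s \<Longrightarrow> s < \<delta> \<Longrightarrow> f s < \<eta>"
    proof -
      have "continuous_on {0..} f" "f 0 = 0" using f(1) by (auto simp: C0_def)
      then have "\<exists>\<delta>>0. \<forall>s\<in>{0..}. dist s 0 < \<delta> \<longrightarrow> dist (f s) (f 0) < \<eta>"
        using \<eta> unfolding continuous_on_iff by (metis atLeast_iff order_refl)
      then obtain \<delta> where "0 < \<delta>" "\<forall>s\<in>{0..}. dist s 0 < \<delta> \<longrightarrow> dist (f s) (f 0) < \<eta>" by blast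
      then show ?thesis using that[of \<delta>] \<open>f 0 = 0\<close> f(2) by (auto simp: dist_real_def)
    qed
    have g: "tr (cf g a) \<le> dim a"
    proof (rule dim_upper[OF a gh(1), where \<delta> = "\<delta> / 2"])
      show "g s \<le> 1" if "0 \<le> s" for s using f(3)[OF that] K \<eta> by (simp add: g_def)
      show "g s \<le> 0" if "0 \<le> s" "s \<le> \<delta> / 2" for s using \<delta>(2)[of s] \<delta>(1) that by (simp add: g_def)
    qed (use \<delta> in simp)
    have "norm (cf h a) \<le> 1"
      using f(2) \<eta> by (intro cf_norm cp gh) (auto simp: h_def abs_le_iff min_def)
    then have h: "tr (cf h a) \<le> C"
      unfolding C_def using f(2) \<eta> gh
      by (intro tr_le_unit cf_Mat psd_cf a unitm_Mat psd_unitm unitm_right[OF cf_Mat]) (auto simp: h_def)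
    define w where "w = (\<lambda>i :: bool. \<lambda>s. if i then K * g s else \<eta> * h s)"
    have w: "C0 (w i)" for i using gh by (cases i) (simp_all add: w_def C0_simps(4))
    have "cf f a = cf (\<lambda>s. \<Sum>i\<in>UNIV. w i s) a"
    proof (rule cf_cong[OF cp f(1)])
      show "C0 (\<lambda>s. \<Sum>i\<in>UNIV. w i s)" using tr_cf_sum[OF a, of UNIV w] w by auto
      show "f s = (\<Sum>i\<in>UNIV. w i s)" for s using K \<eta> by (auto simp: UNIV_bool w_def g_def h_def)
    qed
    then have "tr (cf f a) = (\<Sum>i\<in>UNIV. tr (cf (w i) a))" using tr_cf_sum[OF a, of UNIV w] w by auto
    also have "\<dots> = K * tr (cf g a) + \<eta> * tr (cf h a)"
      by (simp add: UNIV_bool w_def tr_cf_scale[OF a gh(1)] tr_cf_scale[OF a gh(2)])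
    also have "\<dots> \<le> K * dim a + \<eta> * C" using g h K \<eta> by (intro add_mono mult_left_mono) auto
    finally show ?thesis .
  qed
  show ?thesis
  proof (rule field_le_epsilon)
    fix \<epsilon> :: real assume \<epsilon>: "0 < \<epsilon>"
    have "\<epsilon> / (C + 1) * C \<le> \<epsilon>" using C \<epsilon> by (simp add: field_simps)
    then show "tr (cf f a) \<le> K * dim a + \<epsilon>" using eta[of "\<epsilon> / (C + 1)"] C \<epsilon> by simp
  qed
qed

text \<open>On the spectrum the root is at most the same root of M, and it is at least the ramp at
  \<delta> divided by the same root of 1/\<delta>. Both constants tend to 1 with growing
  order.\<close>

lemma tr_root_LIMSEQ:
  assumes a: "a \<in> Mat n" "a \<in> minf_pos"
  shows "(\<lambda>k. tr (cf (root (Suc k)) a)) \<longlonglongrightarrow> dim a"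
proof (rule order_tendstoI)
  note cp = psd_cpos[OF a(2)]
  define M where "M = max 1 (norm a)"
  have M: "0 < M" by (simp add: M_def)
  have up: "tr (cf (root (Suc k)) a) \<le> root (Suc k) M * dim a" for k
  proof -
    define f where "f = (\<lambda>s. min (root (Suc k) s) (root (Suc k) M))"
    have f: "C0 f" using M by (auto simp: C0_def f_def intro!: continuous_intros)
    have "cf (root (Suc k)) a = cf f a"
      by (rule cf_cong[OF cp C0_root f]) (auto simp: f_def min_def M_def)
    then show ?thesis
      using M by (simp only:) (intro tr_cf_le_dim a f, auto simp: f_def)
  qed
  have Mlim: "(\<lambda>k. root (Suc k) c) \<longlonglongrightarrow> 1" if "0 < c" for c :: real
    using LIMSEQ_Suc[OF LIMSEQ_root_const[OF that]] .
  {
    fix c assume c: "dim a < c"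
    have "(\<lambda>k. root (Suc k) M * dim a) \<longlonglongrightarrow> 1 * dim a" by (intro tendsto_mult Mlim M tendsto_const)
    then have "\<forall>\<^sub>F k in sequentially. root (Suc k) M * dim a < c" using c by (intro order_tendstoD(2)) auto
    then show "\<forall>\<^sub>F k in sequentially. tr (cf (root (Suc k)) a) < c"
      by (rule eventually_mono) (rule le_less_trans[OF up])
  }
  fix c assume "c < dim a"
  then obtain \<delta> where \<delta>: "0 < \<delta>" "c < tr (cf (ramp \<delta>) a)" using dim_least[of a c] by (meson not_le)
  have low: "tr (cf (ramp \<delta>) a) / root (Suc k) (1 / \<delta>) \<le> tr (cf (root (Suc k)) a)" for k
  proof -
    have "tr (cf (ramp \<delta>) a) \<le> tr (cf (\<lambda>s. root (Suc k) (1 / \<delta>) * root (Suc k) s) a)"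
    proof (rule tr_cf_mono[OF a C0_ramp[OF \<delta>(1)] C0_simps(4)[OF C0_root]])
      fix s :: real assume s: "0 \<le> s"
      show "ramp \<delta> s \<le> root (Suc k) (1 / \<delta>) * root (Suc k) s"
      proof (cases "s \<le> \<delta>")
        case False
        then have "1 \<le> root (Suc k) (s / \<delta>)" using \<delta> by simp
        moreover have "root (Suc k) (s / \<delta>) = root (Suc k) (1 / \<delta>) * root (Suc k) s"
          by (simp add: real_root_mult[symmetric])
        ultimately show ?thesis using ramp_le_1[of \<delta> s] by simp
      qed (use \<delta> s in \<open>simp add: ramp_eq_0\<close>)
    qed
    then have "tr (cf (ramp \<delta>) a) \<le> tr (cf (root (Suc k)) a) * root (Suc k) (1 / \<delta>)"
      unfolding tr_cf_scale[OF a C0_root] by (simp only: mult.commute)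
    then show ?thesis using \<delta>(1) by (simp add: divide_le_eq)
  qed
  have "(\<lambda>k. tr (cf (ramp \<delta>) a) / root (Suc k) (1 / \<delta>)) \<longlonglongrightarrow> tr (cf (ramp \<delta>) a) / 1"
    using \<delta> by (intro tendsto_divide Mlim tendsto_const) auto
  then have "\<forall>\<^sub>F k in sequentially. c < tr (cf (ramp \<delta>) a) / root (Suc k) (1 / \<delta>)"
    using \<delta>(2) by (intro order_tendstoD(1)) auto
  then show "\<forall>\<^sub>F k in sequentially. c < tr (cf (root (Suc k)) a)"
    by (rule eventually_mono) (rule less_le_trans[OF _ low])
qed

end

lemma entry_corner: "entry (corner x) i j = (if i = 0 \<and> j = 0 then x else 0)"
  by (simp add: corner.rep_eq)

lemma corner_Mat: "corner x \<in> Mat 1"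
  by (auto simp: Mat_def entry_corner)

lemma corner_entry: "a \<in> Mat 1 \<Longrightarrow> corner (entry a 0 0) = a"
  by (rule minf_eqI) (auto simp: Mat_def entry_corner One_nat_def Suc_le_eq)

lemma corner_hom:
  fixes x y :: "'a :: unital_cstar_algebra"
  shows "corner (x + y) = corner x + corner y" "corner (x * y) = corner x * corner y"
    "corner (c *\<^sub>C x) = c *\<^sub>C corner x" "corner (adj x) = adj (corner x)" "corner (x - y) = corner x - corner y"
    "corner 0 = (0 :: 'a minf)" "corner 1 = (unitm 1 :: 'a minf)"
  by (rule minf_eqI; auto simp: entry_corner plus_minf.rep_eq minus_minf.rep_eq entry_times[OF corner_Mat]
    scaleC_minf.rep_eq scaleC_zero_right adj_minf.rep_eq adj_zero zero_minf.rep_eq unitm.rep_eq One_nat_def)+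

lemma norm_corner: "mat_norm (corner x) = norm (x :: 'a :: unital_cstar_algebra)"
  using entry_le_mat_norm[of "corner x" 0 0] mat_norm_crude[OF corner_Mat[of x]]
  by (simp add: entry_corner One_nat_def)

lemma quasitrace_corner:
  fixes T :: "'a :: unital_cstar_algebra minf \<Rightarrow> complex"
  assumes T: "quasitrace_on (Mat 1) mat_norm T"
  shows "quasitrace_on UNIV norm (\<lambda>x. T (corner x))"
  unfolding quasitrace_on_def
proof (intro conjI ballI allI impI)
  fix x :: 'a
  show "T (corner (adj x * x)) = T (corner (x * adj x))" "T (corner (adj x * x)) \<in> \<real>\<^sub>\<ge>\<^sub>0"
    using T corner_Mat[of x] by (auto simp: quasitrace_on_def corner_hom)
next
  fix a b :: 'a assume "adj a = a \<and> adj b = b"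
  then have "adj (corner a) = corner a" "adj (corner b) = corner b" by (simp_all add: corner_hom(4)[symmetric])
  then show "T (corner (a + \<i> *\<^sub>C b)) = T (corner a) + \<i> * T (corner b)"
    using T corner_Mat[of a] corner_Mat[of b] by (simp add: quasitrace_on_def corner_hom)
next
  fix B :: "'a set" and c x y
  assume B: "cstar_subalgebra UNIV norm B \<and> (\<forall>x\<in>B. \<forall>y\<in>B. x * y = y * x)" and xy: "x \<in> B" "y \<in> B"
  have "cstar_subalgebra (Mat 1) mat_norm (corner ` B)"
    unfolding cstar_subalgebra_def norm_closed_in_def
  proof (intro conjI allI impI)
    fix z :: "nat \<Rightarrow> 'a minf" and l
    assume "(\<forall>k. z k \<in> corner ` B) \<and> l \<in> Mat 1 \<and> (\<lambda>k. mat_norm (z k - l)) \<longlonglongrightarrow> 0"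
    then have z: "\<forall>k. z k \<in> corner ` B" and l: "l \<in> Mat 1" "(\<lambda>k. mat_norm (z k - l)) \<longlonglongrightarrow> 0" by auto
    from z have "\<forall>k. \<exists>u. u \<in> B \<and> z k = corner u" by blast
    from choice[OF this] obtain u where u: "\<And>k. u k \<in> B" "\<And>k. z k = corner (u k)" by blast
    have "z k - l = corner (u k - entry l 0 0)" for k
      by (simp add: u corner_hom corner_entry[OF l(1)])
    then have "(\<lambda>k. norm (u k - entry l 0 0)) \<longlonglongrightarrow> 0" using l(2) by (simp add: norm_corner)
    moreover have "norm_closed_in UNIV norm B" using B by (simp add: cstar_subalgebra_def)
    ultimately have "entry l 0 0 \<in> B" using u(1) unfolding norm_closed_in_def by blast
    from imageI[OF this, of corner] show "l \<in> corner ` B" unfolding corner_entry[OF l(1)] .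
  next
    show "0 \<in> corner ` B" using B corner_hom(6) by (auto simp: cstar_subalgebra_def image_iff)
  next
    show "\<forall>x\<in>corner ` B. \<forall>y\<in>corner ` B. x + y \<in> corner ` B \<and> x * y \<in> corner ` B"
      using B by (auto simp: cstar_subalgebra_def corner_hom(1,2)[symmetric])
    show "\<forall>x\<in>corner ` B. c *\<^sub>C x \<in> corner ` B" for c
      using B by (auto simp: cstar_subalgebra_def corner_hom(3)[symmetric])
    show "\<forall>x\<in>corner ` B. adj x \<in> corner ` B"
      using B by (auto simp: cstar_subalgebra_def corner_hom(4)[symmetric])
  qed (use corner_Mat in auto)
  moreover have "\<forall>x\<in>corner ` B. \<forall>y\<in>corner ` B. x * y = y * x"
    using B by (auto simp: corner_hom(2)[symmetric])
  ultimately have "T (c *\<^sub>C corner x + corner y) = c * T (corner x) + T (corner y)"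
    using T xy unfolding quasitrace_on_def by blast
  then show "T (corner (c *\<^sub>C x + y)) = c * T (corner x) + T (corner y)"
    by (simp add: corner_hom)
qed

lemma qt_extension_eqI:
  fixes \<tau> :: "'a :: unital_cstar_algebra \<Rightarrow> complex"
  assumes "\<And>n. quasitrace_on (Mat n) mat_norm T" and "\<And>x. T (corner x) = \<tau> x"
  shows "qt_extension \<tau> = T"
  unfolding qt_extension_def
proof (rule the1_equality)
  have "(\<forall>x. T' (corner x) = \<tau> x) \<longleftrightarrow> (\<forall>x\<in>Mat 1. T' x = T x)" for T'
    using assms(2) corner_Mat corner_entry by metis
  then show "\<exists>!T. (\<forall>n. quasitrace_on (Mat n) mat_norm T) \<and> (\<forall>x. T (corner x) = \<tau> x)"
    using quasitrace_extension[OF assms(1)] by simp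
qed (use assms in auto)

lemma QT_extension:
  assumes "\<tau> \<in> QT"
  shows "quasitrace_on (Mat n) mat_norm (qt_extension \<tau>)" "qt_extension \<tau> (corner x) = \<tau> x"
proof -
  obtain \<tau>2 where \<tau>2: "quasitrace_on (Mat 2) mat_norm \<tau>2" "\<And>x. \<tau>2 (corner x) = \<tau> x"
    using assms unfolding QT_def by blast
  obtain T where T: "\<And>n. quasitrace_on (Mat n) mat_norm T" "\<And>x. x \<in> Mat 1 \<Longrightarrow> T x = \<tau>2 x"
    using quasitrace_extension[OF \<tau>2(1)] by blast
  then have "T (corner x) = \<tau> x" for x using \<tau>2(2) corner_Mat by metis
  then show "quasitrace_on (Mat n) mat_norm (qt_extension \<tau>)" "qt_extension \<tau> (corner x) = \<tau> x"
    using qt_extension_eqI[OF T(1)] T(1) by simp_all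
qed

lemma d_tau_dim:
  assumes T: "\<And>n. quasitr n (qt_extension \<tau>)" and a: "a \<in> minf_pos"
  shows "d_tau \<tau> a = quasitr.dim (qt_extension \<tau>) a"
proof -
  obtain n where n: "a \<in> Mat n" using ex_Mat by blast
  interpret quasitr n "qt_extension \<tau>" by (rule T)
  show ?thesis
    unfolding d_tau_def root_Suc_cf[OF a] using tr_root_LIMSEQ[OF n a] by (intro limI) (simp add: tr_def)
qed

section \<open>The Cuntz semigroup\<close>

text \<open>\<open>cuntz_factor\<close> gives x and y supported on a' and b', which are orthogonal;
  hence \<open>x * adj y = 0\<close>, the cut of a + b is \<open>(x + y) * adj (x + y)\<close>, and
  a ramp of a' + b' is a right unit of x + y.\<close>

lemma cuntz_orth_add:
  fixes a b :: "'a :: unital_cstar_algebra minf"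
  assumes psd: "a \<in> minf_pos" "b \<in> minf_pos" "a' \<in> minf_pos" "b' \<in> minf_pos"
    and ab: "a * b = 0" "a' * b' = 0" and le: "a \<lesssim> a'" "b \<lesssim> b'"
  shows "a + b \<lesssim> a' + b'"
proof (rule cuntz_from_cut[OF psd_add[OF psd(1,2)]])
  fix \<epsilon> :: real assume \<epsilon>: "0 < \<epsilon>"
  obtain x \<gamma> where x: "0 < \<gamma>" "cf (excess \<epsilon>) a = x * adj x" "x * cf (ramp \<gamma>) a' = x"
    using cuntz_factor[OF psd(1,3) le(1) \<epsilon>] by metis
  obtain y \<delta> where y: "0 < \<delta>" "cf (excess \<epsilon>) b = y * adj y" "y * cf (ramp \<delta>) b' = y"
    using cuntz_factor[OF psd(2,4) le(2) \<epsilon>] by metis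
  \<comment> \<open>Half the smaller level, so that \<open>ramp \<eta>\<close> is 1 wherever
    \<open>ramp \<gamma>\<close> or \<open>ramp \<delta>\<close> does not vanish.\<close>
  define \<eta> where "\<eta> = min \<gamma> \<delta> / 2"
  have \<eta>: "0 < \<eta>" using x y by (simp add: \<eta>_def)
  have C: "C0 (ramp \<eta>)" by (rule C0_ramp[OF \<eta>])
  have unit: "z * cf (ramp \<eta>) c = z" if "z * cf (ramp \<theta>) c = z" "c \<in> minf_pos" "0 < \<theta>" "2 * \<eta> \<le> \<theta>" for z c :: "'a minf" and \<theta>
  proof -
    note cp = psd_cpos[OF that(2)]
    have rr: "(\<lambda>s. ramp \<theta> s * ramp \<eta> s) = ramp \<theta>"
    proof
      show "ramp \<theta> s * ramp \<eta> s = ramp \<theta> s" for s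
        using that \<eta> by (cases "s \<le> \<theta>") (simp_all add: ramp_eq_0 ramp_eq_1)
    qed
    have "cf (ramp \<theta>) c * cf (ramp \<eta>) c = cf (ramp \<theta>) c"
      using cf_mult[OF cp C0_ramp[OF that(3)] C] unfolding rr ..
    then show ?thesis using that(1) by (metis mult.assoc)
  qed
  have xy: "x * cf (ramp \<eta>) a' = x" "y * cf (ramp \<eta>) b' = y"
    using unit[OF x(3) psd(3) x(1)] unit[OF y(3) psd(4) y(1)] by (simp_all add: \<eta>_def)
  let ?k = "cf (ramp \<eta>) a'" and ?l = "cf (ramp \<eta>) b'"
  have lk: "?l * ?k = 0" "?k * ?l = 0"
  proof -
    have "?l * a' = 0" by (rule cf_mult_zero[OF psd(4) C orth_sym[OF psd(3,4) ab(2)]])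
    then have "a' * ?l = 0" using psd_adj[OF psd(3)] cf_adj[OF psd_cpos[OF psd(4)] C] by (metis adj_mult adj_zero)
    then show *: "?k * ?l = 0" by (rule cf_mult_zero[OF psd(3) C])
    show "?l * ?k = 0" by (rule orth_sym[OF _ _ *]) (intro psd_ramp psd \<eta>)+
  qed
  have xl: "x * ?l = 0" using xy(1) lk(2) by (metis mult.assoc mult_zero_right)
  have yk: "y * ?k = 0" using xy(2) lk(1) by (metis mult.assoc mult_zero_right)
  have "x * adj y = x * (?l * adj y)"
    using arg_cong[OF xy(2), of adj] cf_adj[OF psd_cpos[OF psd(4)] C] by (simp add: adj_mult)
  then have o: "x * adj y = 0" using xl by (simp add: mult.assoc[symmetric])
  then have o': "y * adj x = 0" by (metis adj_adj adj_mult adj_zero)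
  have "cf (excess \<epsilon>) (a + b) = (x + y) * adj (x + y)"
    using \<epsilon> by (simp add: cf_add_orth[OF psd(1,2) ab(1)] C0_cut x(2) y(2) adj_add distrib_left distrib_right o o')
  also have "\<dots> = (x + y) * cf (ramp \<eta>) (a' + b') * adj (x + y)"
    by (simp add: cf_add_orth[OF psd(3,4) ab(2) C] distrib_left distrib_right xy xl yk)
  also have "\<dots> \<lesssim> cf (ramp \<eta>) (a' + b')" by (rule cuntz_conj)
  also have "\<dots> \<lesssim> a' + b'"
    using \<eta> by (intro cuntz_trans[OF cuntz_ramp cuntz_cut] psd_add psd) auto
  finally show "cf (excess \<epsilon>) (a + b) \<lesssim> a' + b'" .
qed

lemma dsum_props:
  fixes a b :: "'a :: unital_cstar_algebra minf"
  assumes a: "a \<in> Mat m" "a \<in> minf_pos" and b: "b \<in> minf_pos"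
  obtains c where "dsum m a b = a + c" "c \<in> minf_pos" "a * c = 0" "c \<lesssim> b" "b \<lesssim> c"
proof -
  obtain k where k: "b \<in> Mat k" using ex_Mat by blast
  show ?thesis
    by (rule that[of "shiftm m k * b * adj (shiftm m k)"])
      (use dsum_shiftm[OF a(1) k] psd_conj[OF b] shiftm_orth[OF a(1)] shiftm_cuntz[OF k] in
        \<open>auto simp: mult.assoc[symmetric]\<close>)
qed

lemma mem_cuntz_class: "c \<in> cuntz_class a \<longleftrightarrow> a \<in> minf_pos \<and> c \<in> minf_pos \<and> a \<lesssim> c \<and> c \<lesssim> a"
  by (simp add: cuntz_class_def cuntz_rel_def)

lemma cuntz_class_eqI:
  assumes "a \<in> minf_pos" "b \<in> minf_pos" "a \<lesssim> b" "b \<lesssim> a" shows "cuntz_class a = cuntz_class b"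
  using assms by (auto simp: mem_cuntz_class intro: cuntz_trans)

lemma cuntz_W: "X \<in> cuntz_W \<longleftrightarrow> (\<exists>a\<in>minf_pos. X = cuntz_class a)"
  by (auto simp: cuntz_W_def cuntz_class_def quotient_def)

text \<open>Up to Cuntz equivalence a direct sum is an orthogonal sum, so all representatives lead
  to one class and the union in \<open>W_add\<close> has a single member. Addition may then be
  computed on any orthogonal representatives.\<close>

lemma W_add_class:
  fixes a b :: "'a :: unital_cstar_algebra minf"
  assumes a: "a \<in> minf_pos" and b: "b \<in> minf_pos" and ab: "a * b = 0"
  shows "W_add (cuntz_class a) (cuntz_class b) = cuntz_class (a + b)"
proof -
  have eq: "cuntz_class (dsum m a' b') = cuntz_class (a + b)"
    if cl: "a' \<in> cuntz_class a" "b' \<in> cuntz_class b" and m: "a' \<in> Mat m" for m and a' b' :: "'a minf"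
  proof -
    have ab': "a' \<in> minf_pos" "b' \<in> minf_pos" "a \<lesssim> a'" "a' \<lesssim> a" "b \<lesssim> b'" "b' \<lesssim> b"
      using cl by (simp_all add: mem_cuntz_class)
    obtain c where c: "dsum m a' b' = a' + c" "c \<in> minf_pos" "a' * c = 0" "c \<lesssim> b'" "b' \<lesssim> c"
      by (rule dsum_props[OF m ab'(1,2)])
    have "c \<lesssim> b" "b \<lesssim> c" using c ab' cuntz_trans by blast+
    then show ?thesis
      unfolding c(1) using c ab' a b ab by (intro cuntz_class_eqI psd_add cuntz_orth_add)
  qed
  obtain m where "a \<in> Mat m" using ex_Mat by blast
  moreover have "a \<in> cuntz_class a" "b \<in> cuntz_class b" using a b by (simp_all add: mem_cuntz_class cuntz_refl)
  ultimately have "{cuntz_class (dsum m a' b') | m a' b'. a' \<in> cuntz_class a \<and> b' \<in> cuntz_class b \<and> a' \<in> Mat m}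
      = {cuntz_class (a + b)}"
    using eq by (intro equalityI subsetI) (auto, metis)
  then show ?thesis by (simp add: W_add_def)
qed

lemma W_le_class:
  "a \<in> minf_pos \<Longrightarrow> b \<in> minf_pos \<Longrightarrow> W_le (cuntz_class a) (cuntz_class b) \<longleftrightarrow> a \<lesssim> b"
  unfolding W_le_def Bex_def mem_cuntz_class by (meson cuntz_trans cuntz_refl)

lemma dimension_function_dimfun:
  fixes d :: "'a :: unital_cstar_algebra minf set \<Rightarrow> ennreal"
  assumes d: "dimension_function d"
  shows "dimfun UNIV (\<lambda>a. d (cuntz_class a))"
proof (rule dimfun_UNIV_I)
  fix a b :: "'a minf" assume ab: "a \<in> minf_pos" "b \<in> minf_pos"
  then have W: "cuntz_class a \<in> cuntz_W" "cuntz_class b \<in> cuntz_W" by (auto simp: cuntz_W)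
  show "d (cuntz_class a) \<le> d (cuntz_class b)" if "a \<lesssim> b"
    using d W W_le_class[OF ab] that by (auto simp: dimension_function_def)
  show "d (cuntz_class (a + b)) = d (cuntz_class a) + d (cuntz_class b)" if "a * b = 0"
    using d W by (simp add: dimension_function_def flip: W_add_class[OF ab that])
qed simp

lemma dimfun_dimension_function:
  fixes D :: "'a :: unital_cstar_algebra minf \<Rightarrow> ennreal"
  assumes D: "dimfun UNIV D"
  obtains d where "dimension_function d" "\<And>a. a \<in> minf_pos \<Longrightarrow> d (cuntz_class a) = D a"
proof -
  interpret dimfun UNIV D by (rule D)
  define d where "d X = D (SOME a. a \<in> X)" for X
  have d: "d (cuntz_class a) = D a" if a: "a \<in> minf_pos" for a
  proof -
    have "(SOME c. c \<in> cuntz_class a) \<in> cuntz_class a"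
      by (rule someI[of _ a]) (simp add: mem_cuntz_class a cuntz_refl)
    then show ?thesis unfolding d_def by (intro D_eq) (auto simp: mem_cuntz_class)
  qed
  have "dimension_function d"
    unfolding dimension_function_def
  proof (intro conjI ballI impI)
    fix X Y assume "X \<in> (cuntz_W :: 'a minf set set)" "Y \<in> (cuntz_W :: 'a minf set set)"
    then obtain a b :: "'a minf" where ab: "a \<in> minf_pos" "X = cuntz_class a" "b \<in> minf_pos" "Y = cuntz_class b"
      by (auto simp: cuntz_W)
    show "W_le X Y \<Longrightarrow> d X \<le> d Y"
      using ab by (simp add: d W_le_class D_mono)
    obtain m where m: "a \<in> Mat m" using ex_Mat by blast
    obtain c where c: "c \<in> minf_pos" "a * c = 0" "c \<lesssim> b" "b \<lesssim> c"
      using dsum_props[OF m ab(1,3)] by metis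
    have "Y = cuntz_class c" unfolding ab(4) using ab c by (intro cuntz_class_eqI)
    then show "d (W_add X Y) = d X + d Y"
      using c ab by (simp add: W_add_class d psd_add D_orth)
  qed
  then show ?thesis using that d by blast
qed

section \<open>Simplicity\<close>

lemma corner_compress: "corner (entry b i j) = adj (shiftm i 1) * b * (shiftm j 1 :: 'a :: unital_cstar_algebra minf)"
proof (rule minf_eqI)
  fix k l
  obtain n where n: "b \<in> Mat n" using ex_Mat by blast
  have e: "entry (adj (shiftm i 1) * c) k l = (if k = 0 then entry c i l else 0)" for c :: "'a minf" and i k l
  proof -
    have "entry (adj (shiftm i 1) * c) k l = (\<Sum>h<i+1. if h = i then (if k = 0 then entry c i l else 0) else 0)"
      unfolding entry_times[OF M_adj_mem[OF shiftm_Mat]]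
      by (intro sum.cong) (auto simp: adj_minf.rep_eq shiftm.rep_eq adj_zero adj_one)
    then show ?thesis by simp
  qed
  have "entry (adj (adj (shiftm j 1) * adj b)) k l = adj (entry (adj (shiftm j 1) * adj b) l k)"
    for k l by (simp add: adj_minf.rep_eq)
  then have "entry (b * shiftm j 1) k l = (if l = 0 then entry b k j else 0)" for k l
    by (simp add: adj_mult adj_adj e adj_minf.rep_eq adj_zero)
  then show "entry (corner (entry b i j)) k l = entry (adj (shiftm i 1) * b * shiftm j 1) k l"
    by (simp add: mult.assoc e entry_corner)
qed

text \<open>The corner of a closed ideal of \<open>Mat n\<close> is a closed ideal of A, and it
  contains a nonzero entry of b. By simplicity it contains the unit, which the shifts carry to all
  diagonal places. So the ideal hypothesis of weak comparison is automatic for b \<noteq> 0.\<close>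

lemma closed_ideal_Mat:
  fixes a b :: "'a :: unital_cstar_algebra minf"
  assumes simple: "simple_cstar TYPE('a)" and b: "b \<in> Mat n" "b \<noteq> 0" and a: "a \<in> Mat n"
  shows "a \<in> closed_ideal_generated (Mat n) mat_norm b"
  unfolding closed_ideal_generated_def
proof (intro InterI)
  fix I assume "I \<in> {I. closed_ideal (Mat n) mat_norm I \<and> b \<in> I}"
  then have I: "closed_ideal (Mat n) mat_norm I" and bI: "b \<in> I" by auto
  have mult: "s * x \<in> I" "x * s \<in> I" if "s \<in> Mat n" "x \<in> I" for s x
    using I that by (auto simp: closed_ideal_def)
  obtain i j where ij: "entry b i j \<noteq> 0" using b(2) by (metis minf_eqI zero_minf.rep_eq)
  then have lt: "i < n" "j < n" using b(1) by (auto simp: Mat_def not_le[symmetric])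
  have s: "shiftm i 1 \<in> (Mat n :: 'a minf set)" if "i < n" for i
    using Mat_sub[OF shiftm_Mat, of i 1 n] that by simp
  have corn: "corner x \<in> Mat n" for x :: 'a
    using Mat_sub[OF corner_Mat, of n] lt by (simp add: Suc_le_eq One_nat_def)
  define J where "J = {x :: 'a. corner x \<in> I}"
  have "closed_ideal UNIV norm J"
    unfolding closed_ideal_def norm_closed_in_def
  proof (intro conjI allI impI ballI)
    fix x :: "nat \<Rightarrow> 'a" and l assume x: "(\<forall>k. x k \<in> J) \<and> l \<in> UNIV \<and> (\<lambda>k. norm (x k - l)) \<longlonglongrightarrow> 0"
    then have "(\<lambda>k. mat_norm (corner (x k) - corner l)) \<longlonglongrightarrow> 0"
      by (simp add: corner_hom(5)[symmetric] norm_corner)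
    moreover have "norm_closed_in (Mat n) mat_norm I" using I by (simp add: closed_ideal_def)
    ultimately have "corner l \<in> I"
      using x corn[of l] norm_closed_in_def[THEN iffD1, THEN spec[of _ "\<lambda>k. corner (x k)"], THEN spec[of _ "corner l"], THEN mp]
      by (simp add: J_def)
    then show "l \<in> J" by (simp add: J_def)
  qed (use I mult corn in \<open>auto simp: J_def corner_hom closed_ideal_def\<close>)
  moreover have "entry b i j \<in> J"
    unfolding J_def corner_compress mem_Collect_eq by (intro mult mult(1)[OF M_adj_mem] s lt bI)
  ultimately have "J = UNIV" using simple ij unfolding simple_cstar_def by blast
  then have "1 \<in> J" by simp
  then have 1: "unitm 1 \<in> I" by (simp add: J_def corner_hom)
  have "unitm k \<in> I" if "k \<le> n" for k
    using that
  proof (induction k)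
    case (Suc k)
    have "shiftm k 1 * unitm 1 * adj (shiftm k 1) \<in> I"
      using Suc by (intro mult(2)[OF M_adj_mem] mult(1) s 1) auto
    then show ?case using Suc I by (auto simp: unitm_Suc shiftm_unitm closed_ideal_def)
  qed (use I in \<open>simp add: unitm_0 closed_ideal_def\<close>)
  from mult(1)[OF a this[OF order_refl]] show "a \<in> I" by (simp add: unitm_right[OF a])
qed

lemma closed_ideal_generated_zero:
  assumes "a \<in> closed_ideal_generated (Mat n) mat_norm (0 :: 'a :: unital_cstar_algebra minf)"
  shows "a = 0"
proof -
  have "closed_ideal (Mat n) mat_norm {0 :: 'a minf}"
    unfolding closed_ideal_def norm_closed_in_def
    by (auto simp: Mat_def zero_minf.rep_eq scaleC_zero_right)
      (metis LIMSEQ_unique diff_0 mat_norm_eq_0 neg_equal_0_iff_equal tendsto_const)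
  then show ?thesis using assms unfolding closed_ideal_generated_def by blast
qed


text \<open>For a projection u, (u - 1/2)_+ \<ge> u/2. So the cut in \<open>cut_cuntz_near\<close>
  does no harm at the unit, and every positive element at distance less than 1/2 from the unit
  dominates it.\<close>

lemma excess_projection_cuntz: "unitm n \<lesssim> cf (excess (1/2)) (unitm n :: 'a :: unital_cstar_algebra minf)"
proof -
  let ?u = "unitm n :: 'a minf"
  note u = psd_unitm[of n]
  have "(1/2) *\<^sub>R ?u + cf (excess (1/2)) ?u - ?u \<in> minf_pos" by (intro excess_le u unitm_Mat) simp
  also have "(1/2) *\<^sub>R ?u + cf (excess (1/2)) ?u - ?u = cf (excess (1/2)) ?u - (1/2) *\<^sub>R ?u"
    by (simp add: algebra_simps scaleR_left_diff_distrib[symmetric] flip: scaleR_2)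
  finally have "(1/2) *\<^sub>R ?u \<lesssim> cf (excess (1/2)) ?u" by (intro le_cuntz psd_scale u) auto
  moreover have "?u \<lesssim> (1/2) *\<^sub>R ?u" using cuntz_scale[of 2 "(1/2) *\<^sub>R ?u"] by simp
  ultimately show ?thesis using cuntz_trans by blast
qed

text \<open>The elements \<open>x\<close> with \<open>D (x\<^sup>* x) \<in> K\<close> form an algebraic two-sided ideal. If it is not zero, it
  is dense by simplicity, so that it contains an element close to the unit.\<close>

lemma (in dimfun) simple_ideal:
  assumes simple: "simple_cstar TYPE('a)" and S: "S = UNIV"
    and K: "0 \<in> K" "\<And>s t. s \<in> K \<Longrightarrow> t \<in> K \<Longrightarrow> s + t \<in> K" "\<And>s t. 0 \<le> s \<Longrightarrow> s \<le> t \<Longrightarrow> t \<in> K \<Longrightarrow> s \<in> K"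
    and b: "b \<in> minf_pos" "b \<noteq> 0" "D b \<in> K" and a: "a \<in> minf_pos"
  shows "D a \<in> K"
proof -
  have mem: "x \<in> S" for x using S by simp
  have down: "D x \<in> K" if "x \<in> minf_pos" "y \<in> minf_pos" "x \<lesssim> y" "D y \<in> K" for x y
    using K(3)[OF D_nonneg[OF mem that(1)] D_mono[OF mem mem that(1-3)] that(4)] .
  define J where "J = {x. D (corner (adj x * x)) \<in> K}"
  have J: "x \<in> J \<longleftrightarrow> D (adj (corner x) * corner x) \<in> K" for x by (simp add: J_def corner_hom)
  have D0: "D 0 \<in> K" using down[OF psd_0 b(1) _ b(3)] le_cuntz[OF psd_0, of b] b(1) by simp
  have J0: "0 \<in> J" unfolding J using D0 K(1) by (auto simp: corner_hom)
  have J_add: "x + y \<in> J" if "x \<in> J" "y \<in> J" for x y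
    using K(2)[OF that[unfolded J]] D_gram_add[OF mem mem mem, of "corner x" "corner y"]
      K(3)[OF D_nonneg[OF mem psd_square(1)]] by (auto simp: J corner_hom)
  have J_left: "u * x \<in> J" if "x \<in> J" for u x
  proof -
    have "adj (corner (u * x)) * corner (u * x) = adj (corner x) * (adj (corner u) * corner u) * corner x"
      by (simp add: corner_hom adj_mult mult.assoc)
    also have "\<dots> \<lesssim> adj (corner x) * corner x" by (rule cuntz_compress[OF psd_square(1)])
    finally show ?thesis using down[OF psd_square(1) psd_square(1)] that by (simp add: J)
  qed
  have J_right: "x * u \<in> J" if "x \<in> J" for u x
  proof -
    have "adj (corner (x * u)) * corner (x * u) = adj (corner u) * (adj (corner x) * corner x) * adj (adj (corner u))"
      by (simp add: corner_hom adj_mult adj_adj mult.assoc)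
    then have "adj (corner (x * u)) * corner (x * u) \<lesssim> adj (corner x) * corner x" using cuntz_conj by metis
    then show ?thesis using down[OF psd_square(1) psd_square(1)] that by (simp add: J)
  qed
  have J_scale: "c *\<^sub>C x \<in> J" if "x \<in> J" for c x
    using J_left[OF that, of "c *\<^sub>C 1"] by (simp add: mult_scaleC_left)
  obtain i j where ij: "entry b i j \<noteq> 0" using b(2) by (metis minf_eqI zero_minf.rep_eq)
  have "entry b i j \<in> J"
  proof -
    let ?p = "adj (shiftm i 1) :: 'a minf" and ?q = "shiftm j 1 :: 'a minf"
    have "adj (?p * b * ?q) * (?p * b * ?q) = adj ?q * (adj (?p * b) * (?p * b)) * adj (adj ?q)"
      by (simp add: adj_mult adj_adj mult.assoc)
    then have "adj (?p * b * ?q) * (?p * b * ?q) \<lesssim> adj (?p * b) * (?p * b)" using cuntz_conj by metis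
    also have "adj (?p * b) * (?p * b) = adj b * (adj ?p * ?p) * b" by (simp add: adj_mult mult.assoc)
    also have "\<dots> \<lesssim> adj b * b" by (rule cuntz_compress[OF psd_square(1)])
    also have "adj b * b = cf sqrt b * b * adj (cf sqrt b)"
      using cf_sqrt[OF b(1)] psd_adj[OF b(1)] by (metis mult.assoc psd_adj)
    also have "\<dots> \<lesssim> b" by (rule cuntz_conj)
    finally show ?thesis using down[OF psd_square(1) b(1) _ b(3)] by (simp add: J corner_compress)
  qed
  define I where "I = closure J"
  have "closed_ideal UNIV norm I"
    unfolding closed_ideal_def norm_closed_in_def
  proof (intro conjI allI impI ballI)
    show "0 \<in> I" unfolding I_def using J0 closure_subset by blast
  next
    fix x y :: 'a assume "x \<in> I" "y \<in> I"
    then obtain f g where "\<And>n. f n \<in> J" "f \<longlonglongrightarrow> x" "\<And>n. g n \<in> J" "g \<longlonglongrightarrow> y"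
      unfolding I_def closure_sequential by blast
    then show "x + y \<in> I"
      unfolding I_def closure_sequential using J_add tendsto_add by (intro exI[of _ "\<lambda>n. f n + g n"]) auto
  next
    fix x :: 'a and c assume "x \<in> I"
    then obtain f where "\<And>n. f n \<in> J" "f \<longlonglongrightarrow> x" unfolding I_def closure_sequential by blast
    then have "(\<lambda>n. c *\<^sub>C 1 * f n) \<longlonglongrightarrow> c *\<^sub>C 1 * x" "\<And>n. c *\<^sub>C 1 * f n \<in> J"
      using J_left by (auto intro!: tendsto_intros)
    then show "c *\<^sub>C x \<in> I"
      unfolding I_def closure_sequential by (intro exI[of _ "\<lambda>n. c *\<^sub>C 1 * f n"]) (auto simp: mult_scaleC_left)
  next
    fix x u :: 'a assume "x \<in> I"
    then obtain f where "\<And>n. f n \<in> J" "f \<longlonglongrightarrow> x" unfolding I_def closure_sequential by blast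
    then have "(\<lambda>n. u * f n) \<longlonglongrightarrow> u * x" "(\<lambda>n. f n * u) \<longlonglongrightarrow> x * u" "\<And>n. u * f n \<in> J" "\<And>n. f n * u \<in> J"
      using J_left J_right by (auto intro!: tendsto_intros)
    then have "u * x \<in> I \<and> x * u \<in> I"
      unfolding I_def closure_sequential
      by (intro conjI exI[of _ "\<lambda>n. u * f n"] exI[of _ "\<lambda>n. f n * u"]) auto
    then show "u * x \<in> I" "x * u \<in> I" by auto
  next
    fix x :: "nat \<Rightarrow> 'a" and l assume x: "(\<forall>k. x k \<in> I) \<and> l \<in> UNIV \<and> (\<lambda>k. norm (x k - l)) \<longlonglongrightarrow> 0"
    then have lim: "x \<longlonglongrightarrow> l" by (subst tendsto_dist_iff) (simp add: dist_norm)
    show "l \<in> I" using x by (intro closed_sequentially[OF _ _ lim]) (auto simp: I_def)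
  qed simp
  moreover have "entry b i j \<in> I" using \<open>entry b i j \<in> J\<close> closure_subset unfolding I_def by blast
  ultimately have "I = UNIV" using simple ij unfolding simple_cstar_def by blast
  \<comment> \<open>With 1/8 the norm of \<open>1 - adj x * x\<close> is at most three times 1/8,
    below the 1/2 that \<open>excess_projection_cuntz\<close> tolerates.\<close>
  then obtain x where x: "x \<in> J" "dist x 1 < 1/8"
    unfolding I_def using closure_approachable[of 1 J] by (metis UNIV_I zero_less_divide_iff zero_less_one zero_less_numeral)
  have "norm (1 - adj x * x) < 1/2"
  proof -
    define y where "y = 1 - x"
    have y: "norm y < 1/8" using x(2) by (simp add: y_def dist_norm norm_minus_commute)
    have "1 - adj x * x = y + adj y - adj y * y"
      by (simp add: y_def adj_diff adj_one left_diff_distrib right_diff_distrib)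
    also have "norm \<dots> \<le> norm y + norm y + norm y * norm y"
      using norm_triangle_ineq4[of "y + adj y" "adj y * y"] norm_triangle_ineq[of y "adj y"]
        norm_mult_ineq[of "adj y" y] by (simp add: norm_adj)
    also have "norm y * norm y \<le> norm y * 1" using y by (intro mult_left_mono) auto
    finally show ?thesis using y by simp
  qed
  then have "norm (unitm 1 - corner (adj x * x)) < 1/2"
    by (simp add: corner_hom(7)[symmetric] corner_hom(5)[symmetric] norm_minf_def norm_corner)
  then have near: "norm (unitm 1 - adj (corner x) * corner x) < 1/2" by (simp add: corner_hom)
  have "unitm 1 \<lesssim> adj (corner x) * corner x"
    using cuntz_trans[OF excess_projection_cuntz cut_cuntz_near[OF psd_unitm psd_square(1) near]] .
  then have u: "D (unitm 1) \<in> K" using down[OF psd_unitm psd_square(1)] x(1) by (simp add: J)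
  have un: "D (unitm n) \<in> K" for n
  proof (induction n)
    case 0
    show ?case using D0 K(1) by (auto simp: unitm_0)
  next
    case (Suc n)
    let ?s = "shiftm n 1 :: 'a minf"
    have "D (?s * adj ?s) \<in> K"
      using D_trace[OF mem mem, of ?s] u by (simp add: adj_shiftm_shiftm)
    then have "D (unitm n) + D (?s * adj ?s) \<in> K" using Suc K(2) by simp
    then show ?case
      unfolding unitm_Suc
      by (rule K(3)[rotated 2]) (intro D_nonneg D_add mem psd_add psd_unitm psd_square)+
  qed
  obtain n where n: "a \<in> Mat n" using ex_Mat by blast
  have "a = cf sqrt a * unitm n * adj (cf sqrt a)"
    using cf_sqrt[OF a] cf_Mat[OF a n C0_sqrt[OF C0_simps(1)]] by (simp add: unitm_right psd_adj)
  then have "a \<lesssim> unitm n" using cuntz_conj by metis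
  then show ?thesis using down[OF a psd_unitm _ un] by blast
qed

section \<open>Comparison\<close>

text \<open>As \<tau>(1) = 1, \<open>tr_cf_le_dim\<close> for min(s, 1), which is the identity on
  the spectrum of the unit, gives dimension at least 1.\<close>

lemma dim_unit_pos:
  assumes "\<tau> \<in> (QT :: ('a :: unital_cstar_algebra \<Rightarrow> complex) set)"
  shows "0 < quasitr.dim (qt_extension \<tau>) (unitm 1)"
proof -
  interpret quasitr 1 "qt_extension \<tau>" by standard (rule QT_extension[OF assms])
  have "qt_extension \<tau> (unitm 1) = 1"
    using QT_extension(2)[OF assms, of 1] assms by (simp add: corner_hom QT_def)
  then have 1: "tr (unitm 1) = 1" by (simp add: tr_def)
  have n: "norm (unitm 1 :: 'a minf) = 1" by (simp add: norm_minf_def corner_hom(7)[symmetric] norm_corner)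
  have f: "C0 (\<lambda>s :: real. min s 1)" by (auto simp: C0_def intro!: continuous_intros)
  have "cf (\<lambda>s. min s 1) (unitm 1) = cf (\<lambda>s. s) (unitm 1 :: 'a minf)"
    using n by (intro cf_cong psd_cpos psd_unitm f C0_simps) simp
  also have "\<dots> = unitm 1" by (rule cf_id[OF psd_cpos[OF psd_unitm]])
  finally show ?thesis using tr_cf_le_dim[OF unitm_Mat psd_unitm f, of 1] 1 by simp
qed

lemma QT_dimfun:
  assumes "\<tau> \<in> (QT :: ('a :: unital_cstar_algebra \<Rightarrow> complex) set)"
  shows "\<exists>D. lsc_dimfun UNIV D \<and> (\<forall>a\<in>minf_pos. d_tau \<tau> a = D a) \<and> 0 < D (unitm 1)"
proof -
  have q: "quasitr n (qt_extension \<tau>)" for n by standard (rule QT_extension[OF assms])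
  have "lsc_dimfun UNIV (quasitr.dim (qt_extension \<tau>))"
    by (rule lsc_dimfun_UNIV) (rule quasitr.lsc_dimfun_dim[OF q order_refl])
  then show ?thesis using d_tau_dim[OF q] dim_unit_pos[OF assms] by blast
qed

lemma strict_imp_weak:
  assumes simple: "simple_cstar TYPE('a :: unital_cstar_algebra)"
    and strict: "strict_comparison TYPE('a)"
  shows "weak_strict_comparison TYPE('a)"
  unfolding weak_strict_comparison_def
proof (intro ballI impI, elim conjE exE)
  fix a b :: "'a minf" and n
  assume a: "a \<in> minf_pos" and b: "b \<in> minf_pos" and "a \<in> closed_ideal_generated (Mat n) mat_norm b"
    and d: "\<forall>d. dimension_function d \<and> d (cuntz_class b) = 1 \<longrightarrow> d (cuntz_class a) < d (cuntz_class b)"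
  show "a \<lesssim> b"
  proof (cases "b = 0")
    \<comment> \<open>No dimension function has the value 1 at 0, so here the ideal hypothesis has
      to do the work: it gives a = 0.\<close>
    case True
    then show ?thesis
      using closed_ideal_generated_zero \<open>a \<in> closed_ideal_generated (Mat n) mat_norm b\<close> cuntz_refl by metis
  next
    case False
    have "d_tau \<tau> a < d_tau \<tau> b" if \<tau>: "\<tau> \<in> QT" for \<tau>
    proof -
      obtain D where D: "lsc_dimfun UNIV D \<and> (\<forall>a\<in>minf_pos. d_tau \<tau> a = D a) \<and> 0 < D (unitm 1)"
        using QT_dimfun[OF \<tau>] ..
      interpret lsc_dimfun UNIV D using D by blast
      note nn = D_nonneg[OF UNIV_I]
      have "D b \<noteq> 0"
      proof
        assume "D b = 0"
        \<comment> \<open>With K = {0}: if D vanished at b \<noteq> 0, it would vanish everywhere,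
          against D(1) > 0.\<close>
        have "D (unitm 1) \<in> {0}"
          by (rule simple_ideal[OF simple refl _ _ _ b False _ psd_unitm]) (use nn \<open>D b = 0\<close> in auto)
        then show False using D by simp
      qed
      then have pos: "0 < D b" using nn[OF b] by simp
      \<comment> \<open>Scaled to have the value 1 at b, since weak comparison tests only such
        functions.\<close>
      have "dimfun UNIV (\<lambda>x. ennreal (D x / D b))"
      proof (rule dimfun_UNIV_I)
        fix x y :: "'a minf" assume xy: "x \<in> minf_pos" "y \<in> minf_pos"
        show "ennreal (D x / D b) \<le> ennreal (D y / D b)" if "x \<lesssim> y"
          using pos by (intro ennreal_leI divide_right_mono D_mono xy that) auto
        have "D (x + y) = D x + D y" if "x * y = 0" by (rule D_orth[OF UNIV_I UNIV_I xy that])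
        then show "ennreal (D (x + y) / D b) = ennreal (D x / D b) + ennreal (D y / D b)" if "x * y = 0"
          using that pos nn[OF xy(1)] nn[OF xy(2)] by (simp add: add_divide_distrib)
      qed simp
      then obtain d' where "dimension_function d'" "\<And>x. x \<in> minf_pos \<Longrightarrow> d' (cuntz_class x) = ennreal (D x / D b)"
        using dimfun_dimension_function by blast
      then have "ennreal (D a / D b) < ennreal (D b / D b)" using d a b pos by force
      then have "D a < D b" using pos nn[OF a] by (simp add: ennreal_less_iff divide_less_cancel)
      then show ?thesis by (simp add: D a b)
    qed
    then show ?thesis using strict a b unfolding strict_comparison_def by blast
  qed
qed

lemma weak_imp_strict:
  assumes simple: "simple_cstar TYPE('a :: unital_cstar_algebra)"
    and QT: "(QT :: ('a \<Rightarrow> complex) set) \<noteq> {}"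
    and weak: "weak_strict_comparison TYPE('a)"
  shows "strict_comparison TYPE('a)"
  unfolding strict_comparison_def
proof (intro ballI impI)
  fix a b :: "'a minf"
  assume a: "a \<in> minf_pos" and b: "b \<in> minf_pos" and lt: "\<forall>\<tau>\<in>QT. d_tau \<tau> a < d_tau \<tau> b"
  \<comment> \<open>This is where a quasitrace must exist: without one the hypothesis on a and b
    would be vacuous, and b = 0 could not be excluded.\<close>
  have b0: "b \<noteq> 0"
  proof
    assume b0: "b = 0"
    obtain \<tau> :: "'a \<Rightarrow> complex" where \<tau>: "\<tau> \<in> QT" using QT by blast
    obtain D where D: "lsc_dimfun UNIV D \<and> (\<forall>a\<in>minf_pos. d_tau \<tau> a = D a) \<and> 0 < D (unitm 1)"
      using QT_dimfun[OF \<tau>] ..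
    interpret lsc_dimfun UNIV D using D by blast
    have "D a < D 0" using lt \<tau> a b b0 D by auto
    moreover have "D 0 \<le> D a" using a by (intro D_mono le_cuntz) auto
    ultimately show False by simp
  qed
  show "a \<lesssim> b"
  proof (rule cuntz_from_cut[OF a])
    fix \<epsilon> :: real assume \<epsilon>: "0 < \<epsilon>"
    let ?a = "cf (excess \<epsilon>) a"
    have ap: "?a \<in> minf_pos" using \<epsilon> by (intro psd_cut a) simp
    obtain n where n: "?a \<in> Mat n" "b \<in> Mat n" using ex_Mat2 by blast
    have "d (cuntz_class ?a) < d (cuntz_class b)" if d: "dimension_function d" "d (cuntz_class b) = 1" for d
    proof -
      define E where "E x = d (cuntz_class x)" for x :: "'a minf"
      interpret E: dimfun UNIV E unfolding E_def by (rule dimension_function_dimfun[OF d(1)])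
      let ?u = "unitm 1 :: 'a minf"
      have fin: "E x < top" if "x \<in> minf_pos" for x
      proof -
        \<comment> \<open>Now K is the set of finite values: the single finite value d(b) = 1 makes
          d finite everywhere.\<close>
        have "E x \<in> {t. t < top}"
          by (rule E.simple_ideal[OF simple refl _ _ _ b b0 _ that]) (use d(2) in \<open>auto simp: E_def intro: le_less_trans\<close>)
        then show ?thesis by simp
      qed
      have "E ?u \<noteq> 0"
      proof
        assume "E ?u = 0"
        have "norm ?u = 1" by (simp add: norm_minf_def corner_hom(7)[symmetric] norm_corner)
        then have "?u \<noteq> 0" by auto
        have "E b \<in> {0}"
          by (rule E.simple_ideal[OF simple refl _ _ _ psd_unitm \<open>?u \<noteq> 0\<close> _ b]) (use \<open>E ?u = 0\<close> in auto)
        then show False using d(2) by (simp add: E_def)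
      qed
      \<comment> \<open>Normalisation at the unit, so that the quasitrace obtained satisfies
        \<tau>(1) = 1.\<close>
      define c where "c = enn2real (E ?u)"
      have c: "0 < c" unfolding c_def using \<open>E ?u \<noteq> 0\<close> fin[OF psd_unitm] by (simp add: enn2real_positive_iff zero_less_iff_neq_zero)
      define D where "D x = enn2real (E x) / c" for x
      interpret dimfun UNIV D
      proof (rule dimfun_UNIV_I)
        fix x y :: "'a minf" assume xy: "x \<in> minf_pos" "y \<in> minf_pos"
        show "D x \<le> D y" if "x \<lesssim> y"
          unfolding D_def using c fin[OF xy(2)] that xy by (intro divide_right_mono enn2real_mono E.D_mono) auto
        show "D (x + y) = D x + D y" if "x * y = 0"
          using fin xy that by (simp add: D_def E.D_orth enn2real_plus add_divide_distrib)
      qed (use c in \<open>simp add: D_def\<close>)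
      interpret fin_dimfun D ..
      define \<tau> where "\<tau> x = TD (corner x)" for x
      have "tD ?u = 1"
      proof (rule antisym)
        have "norm ?u \<le> 1" by (simp add: norm_minf_def corner_hom(7)[symmetric] norm_corner)
        then have "norm ?u * D ?u \<le> 1 * 1"
          using c by (intro mult_mono) (auto simp: D_def c_def)
        then show "tD ?u \<le> 1" using tD_le[OF psd_unitm, of 1] by simp
        \<comment> \<open>D need not be lower semicontinuous, but cutting a projection at 1/2 does
          not change its class, so nothing is lost at the unit.\<close>
        have "1 = D ?u" using c by (simp add: D_def c_def)
        also have "\<dots> \<le> D (cf (excess (1/2)) ?u)" by (intro mono psd_cut psd_unitm excess_projection_cuntz) simp
        also have "\<dots> \<le> quasitr.dim TD ?u" by (rule dim_TD_ge[OF unitm_Mat psd_unitm]) simp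
        also have "\<dots> \<le> quasitr.tr TD ?u"
        proof (rule quasitr.dim_least[OF quasitr_TD])
          show "quasitr.tr TD (cf (ramp \<delta>) ?u) \<le> quasitr.tr TD ?u" if "0 < \<delta>" for \<delta>
            by (rule quasitr.tr_ramp_bound[OF quasitr_TD unitm_Mat psd_unitm that])
        qed
        also have "\<dots> = tD ?u" by (simp add: quasitr.tr_def[OF quasitr_TD] TD_psd psd_unitm)
        finally show "1 \<le> tD ?u" .
      qed
      then have "\<tau> 1 = 1" by (simp add: \<tau>_def corner_hom TD_psd psd_unitm)
      then have \<tau>: "\<tau> \<in> QT"
        unfolding QT_def using quasitrace_corner[OF quasitrace_TD] quasitrace_TD by (auto simp: \<tau>_def[abs_def])
      have T: "qt_extension \<tau> = TD" by (rule qt_extension_eqI[OF quasitrace_TD]) (simp add: \<tau>_def)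
      have dim: "d_tau \<tau> x = quasitr.dim TD x" if "x \<in> minf_pos" for x
        using d_tau_dim[of \<tau> x] that quasitr_TD by (simp add: T)
      obtain m where m: "a \<in> Mat m" "b \<in> Mat m" using ex_Mat2 by blast
      \<comment> \<open>The cut on a pays for the missing semicontinuity of D on the left; on the
        right b needs no cut.\<close>
      have "D ?a \<le> quasitr.dim TD a" by (rule dim_TD_ge[OF m(1) a \<epsilon>])
      also have "\<dots> < quasitr.dim TD b" using lt \<tau> dim a b by auto
      also have "\<dots> \<le> D b" by (rule dim_TD_le[OF m(2) b])
      finally have "enn2real (E ?a) < enn2real (E b)" using c by (simp add: D_def divide_less_cancel)
      then show ?thesis using fin[OF ap] fin[OF b] unfolding E_def[symmetric]
        by (metis enn2real_mono leD leI)
    qed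
    moreover have "?a \<in> closed_ideal_generated (Mat n) mat_norm b"
      by (rule closed_ideal_Mat[OF simple n(2) b0 n(1)])
    ultimately show "?a \<lesssim> b" using weak ap b n unfolding weak_strict_comparison_def by blast
  qed
qed

theorem proposition6p9:
  assumes "simple_cstar TYPE('a :: unital_cstar_algebra)"
    and "(QT :: ('a \<Rightarrow> complex) set) \<noteq> {}"
  shows "strict_comparison TYPE('a) \<longleftrightarrow> weak_strict_comparison TYPE('a)"
  using strict_imp_weak weak_imp_strict assms by blast

end
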